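(* Let $D,E,x>1$ be real numbers and $\epsilon>0$. Let $k,l,h$ be integers with $1\le l<k$ and $h\neq 0$. Put $$U=\frac{x^{1/l}}{D^{k/l}},\qquad V=\frac{x^{1/l}}{E^{k/l}},$$ and let $\mathcal N(x;D,E)$ be the number of elements of the set $$\{(d,e,u,v)\in\mathbb N^4:\ d\sim D,\ e\sim E,\ u\sim U,\ v\sim V,\ e^kv^l-d^ku^l=h\}.$$ Let $M>1$ be defined by $$\log M=\frac98\,\frac{\log(DE)\log(UV)}{\log x},$$ and suppose that the following two conditions are satisfied: (1) $\log(DE)\asymp\log(UV)\asymp\log x$; (2) $l\ge 2$, or $DE\gg_{k,l,h}x^{1/k}$. Then, if $x$ is large enough in terms of $\epsilon$, $$\mathcal N(x;D,E)\ll_{\epsilon,k,l,h}x^{\epsilon}\min\{(DEM)^{1/2}+D+E,\ (UVM)^{1/2}+U+V\}.$$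
   Context: $\mathbb N$ denotes the positive integers. The notation $y\sim Y$ means $Y<y<2Y$. The notation $y\asymp Y$ means that there are positive constants $A,B$, independent of $Y$, with $AY\le |y|\le BY$. $\ll$ and $\gg$ are Vinogradov notation, with subscripts indicating the parameters on which the implied constant may depend. The constants implicit in hypotheses (1) and (2) are regarded as fixed once and for all (i.e. $c_1\log x\le\log(DE),\log(UV)\le c_2\log x$, and in the case $l=1$, $DE\ge c_3x^{1/k}$, for fixed positive $c_1,c_2,c_3$); the implied constant in the conclusion and the meaning of "large enough" may also depend on them. *)

theory Defs
  imports Complex_Main
begin

definition dyadic :: "nat \<Rightarrow> real \<Rightarrow> bool" where
  "dyadic y Y \<longleftrightarrow> Y < real y \<and> real y < 2 * Y"

(* In the paper U = cofactor_size k l x D and V = cofactor_size k l x E. *)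
definition cofactor_size :: "nat \<Rightarrow> nat \<Rightarrow> real \<Rightarrow> real \<Rightarrow> real" where
  "cofactor_size k l x D = x powr (1 / real l) / D powr (real k / real l)"

definition solution_set ::
    "nat \<Rightarrow> nat \<Rightarrow> int \<Rightarrow> real \<Rightarrow> real \<Rightarrow> real \<Rightarrow> (nat \<times> nat \<times> nat \<times> nat) set" where
  "solution_set k l h x D E =
     {(d, e, u, v). d \<ge> 1 \<and> e \<ge> 1 \<and> u \<ge> 1 \<and> v \<ge> 1 \<and>
        dyadic d D \<and> dyadic e E \<and>
        dyadic u (cofactor_size k l x D) \<and> dyadic v (cofactor_size k l x E) \<and>
        int e ^ k * int v ^ l - int d ^ k * int u ^ l = h}"

(* The set is finite because of the dyadic ranges, so card is its true cardinality. *)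
definition solution_count ::
    "nat \<Rightarrow> nat \<Rightarrow> int \<Rightarrow> real \<Rightarrow> real \<Rightarrow> real \<Rightarrow> nat" where
  "solution_count k l h x D E = card (solution_set k l h x D E)"

end

(* Approximate determinant method. A solution has d/e = s and v/u = t with t^l = s^k (1 + O(1/x)), so (s, t)
   lies very close to the curve t^l = s^k. Cut the range of s into about M x^\<delta> short intervals. Expanding
   bihomogeneous monomials of bidegree (a, b) around one point of the curve shows that every
   monomial determinant at the solutions of one interval has absolute value below 1, hence is 0; so
   these solutions lie on a form of bounded bidegree.

   A solution set lying on such a form and in a thin strip |d - s0 e| <= X0, e <= Y0 has size
   O(x^\<delta> (sqrt (X0 Y0) + 1 + 1/\<rho>)), where \<rho> measures a short integer vector of the strip. For forms of degree
   at least 2 in (u, v) this follows from a p-adic determinant method with p about sqrt (X0 Y0); forms linear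
   in (u, v) express u and v through d and e up to few divisors of a resultant, and the points then lie
   on few curves H(d, e) = const, which meet a line in the direction of the short vector in O(1) points
   unless they contain it.

   Taking the short vectors from Dirichlet's theorem, the sum of 1/\<rho> over all strips is O(x^\<delta> (sqrt (D E M) + D + E)).
   The second bound follows by exchanging (d, e, k) and (u, v, l). *)
theory Submission
  imports Defs "HOL-Analysis.Analysis" "Subresultants.Subresultant_Gcd"
    "HOL-Number_Theory.Number_Theory" "HOL-Real_Asymp.Real_Asymp"
begin

hide_const (open) up_ring.coeff up_ring.monom module.smult

section \<open>Determinants whose entries are sums\<close>

text \<open>The p-adic step compares p^(n (n - 1) / 2), where n = (A + 1) b, with (X0 Y0)^(A n / 2).
  For b >= 2 a prime slightly above sqrt (X0 Y0) wins once A is large, and a prime p leaves at most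
  p b residue classes. For b = 1 the same comparison needs p near X0 Y0, which is no better than
  counting lattice points; hence forms linear in (u, v) get an argument of their own. Only there
  does 1 / \<rho> arise: a line along the short vector may lie inside a curve H(d, e) = const, and
  it carries about 1 / \<rho> points of the strip.

  Strips with X0 = D \<eta>, Y0 = 2 E and \<eta> about 1 / M turn M copies of sqrt (X0 Y0) into sqrt
  (D E M). For M >= D E the trivial count of pairs (d, e) is enough.

  Condition (2) enters through U V = O(x) alone. This bounds the number of solutions over one ratio
  d / e, on which every passage from few ratios to few points depends. For the exchanged problem the
  analogue D E <= x holds because k >= 2.\<close>

lemma det_expand_columns:
  fixes Z :: "nat \<Rightarrow> 'j \<Rightarrow> 'a :: idom"
  assumes "finite J"
  shows "det (mat n n (\<lambda>(r, c). \<Sum>m\<in>J. Z r m * B m c)) =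
    (\<Sum>f | f \<in> PiE {0..<n} (\<lambda>_. J) \<and> inj_on f {0..<n}.
       (\<Prod>c=0..<n. B (f c) c) * det (mat n n (\<lambda>(r, c). Z r (f c))))"
proof -
  let ?P = "{p. p permutes {0..<n}}"
  let ?F = "PiE {0..<n} (\<lambda>_. J)"
  have "det (mat n n (\<lambda>(r, c). \<Sum>m\<in>J. Z r m * B m c)) =
      (\<Sum>p\<in>?P. signof p * (\<Prod>c=0..<n. \<Sum>m\<in>J. Z (p c) m * B m c))"
    by (subst mat_det_left_def[of _ n]) (auto simp: permutes_in_image intro!: sum.cong prod.cong)
  also have "\<dots> = (\<Sum>p\<in>?P. signof p * (\<Sum>f\<in>?F. \<Prod>c=0..<n. Z (p c) (f c) * B (f c) c))"
    using assms by (subst prod_sum_PiE) auto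
  also have "\<dots> = (\<Sum>f\<in>?F. \<Sum>p\<in>?P. signof p * (\<Prod>c=0..<n. Z (p c) (f c) * B (f c) c))"
    by (subst sum_distrib_left, rule sum.swap)
  also have "\<dots> = (\<Sum>f\<in>?F. (\<Prod>c=0..<n. B (f c) c) * det (mat n n (\<lambda>(r, c). Z r (f c))))"
    by (intro sum.cong refl, subst mat_det_left_def[of _ n])
       (auto simp: permutes_in_image prod.distrib sum_distrib_left mult_ac intro!: sum.cong prod.cong)
  also have "\<dots> = (\<Sum>f | f \<in> ?F \<and> inj_on f {0..<n}.
       (\<Prod>c=0..<n. B (f c) c) * det (mat n n (\<lambda>(r, c). Z r (f c))))"
  \<comment> \<open>A non-injective choice repeats a column, so its determinant vanishes. All gains
    below rest on this: the chosen indices are n distinct ones.\<close>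
  proof (rule sum.mono_neutral_right)
    show "finite ?F" using assms by (intro finite_PiE) auto
    show "\<forall>f\<in>?F - {f. f \<in> ?F \<and> inj_on f {0..<n}}.
        (\<Prod>c=0..<n. B (f c) c) * det (mat n n (\<lambda>(r, c). Z r (f c))) = 0"
    proof
      fix f assume "f \<in> ?F - {f. f \<in> ?F \<and> inj_on f {0..<n}}"
      then obtain i j where ij: "i < n" "j < n" "i \<noteq> j" "f i = f j" by (auto simp: inj_on_def)
      have "det (mat n n (\<lambda>(r, c). Z r (f c))) = 0"
        by (rule det_identical_columns[of _ n i j]) (use ij in \<open>auto simp: col_def\<close>)
      thus "(\<Prod>c=0..<n. B (f c) c) * det (mat n n (\<lambda>(r, c). Z r (f c))) = 0" by simp
    qed
  qed auto
  finally show ?thesis .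
qed

lemma abs_det_le_column_bound:
  fixes A :: "'a :: linordered_idom mat"
  assumes "A \<in> carrier_mat n n" "\<And>r c. r < n \<Longrightarrow> c < n \<Longrightarrow> \<bar>A $$ (r, c)\<bar> \<le> z c"
  shows "\<bar>det A\<bar> \<le> fact n * (\<Prod>c=0..<n. z c)"
proof -
  let ?P = "{p. p permutes {0..<n}}"
  have "\<bar>det A\<bar> = \<bar>\<Sum>p\<in>?P. signof p * (\<Prod>c=0..<n. A $$ (p c, c))\<bar>"
    using assms(1) by (subst mat_det_left_def[OF assms(1)]) auto
  also have "\<dots> \<le> (\<Sum>p\<in>?P. \<bar>signof p * (\<Prod>c=0..<n. A $$ (p c, c))\<bar>)" by (rule sum_abs)
  also have "\<dots> \<le> (\<Sum>p\<in>?P. \<Prod>c=0..<n. z c)"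
  proof (rule sum_mono)
    fix p assume p: "p \<in> ?P"
    have "\<bar>signof p * (\<Prod>c=0..<n. A $$ (p c, c))\<bar> = (\<Prod>c=0..<n. \<bar>A $$ (p c, c)\<bar>)"
      by (simp add: abs_mult abs_prod sign_def)
    also have "\<dots> \<le> (\<Prod>c=0..<n. z c)"
      using p assms(2) by (intro prod_mono) (auto simp: permutes_in_image)
    finally show "\<bar>signof p * (\<Prod>c=0..<n. A $$ (p c, c))\<bar> \<le> (\<Prod>c=0..<n. z c)" .
  qed
  also have "\<dots> = fact n * (\<Prod>c=0..<n. z c)"
    by (simp add: card_permutations)
  finally show ?thesis .
qed

lemma det_dvd_columns:
  fixes A :: "'a :: comm_ring_1 mat"
  assumes "A \<in> carrier_mat n n" "\<And>r c. r < n \<Longrightarrow> c < n \<Longrightarrow> z c dvd A $$ (r, c)"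
  shows "(\<Prod>c=0..<n. z c) dvd det A"
  using assms(1) by (subst mat_det_left_def[OF assms(1)])
     (auto intro!: dvd_sum dvd_mult prod_dvd_prod assms(2) simp: permutes_in_image)

text \<open>Each surviving term costs at most \<open>fact n * G\<close>, where G only has to bound
  products of column weights over n distinct indices. With weights given by monomials in small
  quantities, distinct exponents make G much smaller than the n-th power of the largest
  weight.\<close>

lemma abs_det_expand_le:
  fixes Z :: "nat \<Rightarrow> 'j \<Rightarrow> real"
  assumes "finite J"
    and "\<And>r m. r < n \<Longrightarrow> m \<in> J \<Longrightarrow> \<bar>Z r m\<bar> \<le> z m"
    and "\<And>f. f \<in> {0..<n} \<rightarrow> J \<Longrightarrow> inj_on f {0..<n} \<Longrightarrow> 
           (\<Prod>c=0..<n. \<bar>B (f c) c\<bar> * z (f c)) \<le> G"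
    and "G \<ge> 0"
  shows "\<bar>det (mat n n (\<lambda>(r, c). \<Sum>m\<in>J. Z r m * B m c))\<bar> \<le> real (card J) ^ n * fact n * G"
proof -
  let ?F = "{f. f \<in> PiE {0..<n} (\<lambda>_. J) \<and> inj_on f {0..<n}}"
  have fin: "finite (PiE {0..<n} (\<lambda>_. J))" using assms(1) by (intro finite_PiE) auto
  have "\<bar>det (mat n n (\<lambda>(r, c). \<Sum>m\<in>J. Z r m * B m c))\<bar> \<le>
     (\<Sum>f\<in>?F. \<bar>(\<Prod>c=0..<n. B (f c) c) * det (mat n n (\<lambda>(r, c). Z r (f c)))\<bar>)"
    unfolding det_expand_columns[OF assms(1)] by (rule sum_abs)
  also have "\<dots> \<le> (\<Sum>f\<in>?F. fact n * G)"
  proof (rule sum_mono)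
    fix f assume f: "f \<in> ?F"
    have "\<bar>det (mat n n (\<lambda>(r, c). Z r (f c)))\<bar> \<le> fact n * (\<Prod>c=0..<n. z (f c))"
      using f by (intro abs_det_le_column_bound) (auto intro!: assms(2))
    hence "\<bar>(\<Prod>c=0..<n. B (f c) c) * det (mat n n (\<lambda>(r, c). Z r (f c)))\<bar> \<le>
       (\<Prod>c=0..<n. \<bar>B (f c) c\<bar>) * (fact n * (\<Prod>c=0..<n. z (f c)))"
      unfolding abs_mult abs_prod by (intro mult_left_mono) (auto intro!: prod_nonneg)
    also have "\<dots> = fact n * (\<Prod>c=0..<n. \<bar>B (f c) c\<bar> * z (f c))" by (simp add: prod.distrib)
    also have "\<dots> \<le> fact n * G" using f by (intro mult_left_mono assms(3)) auto
    finally show "\<bar>(\<Prod>c=0..<n. B (f c) c) * det (mat n n (\<lambda>(r, c). Z r (f c)))\<bar> \<le> fact n * G" .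
  qed
  also have "\<dots> = real (card ?F) * (fact n * G)" by simp
  also have "\<dots> \<le> real (card J ^ n) * (fact n * G)"
  proof (intro mult_right_mono)
    have "card ?F \<le> card (PiE {0..<n} (\<lambda>_. J))" by (intro card_mono fin) auto
    also have "\<dots> = card J ^ n" by (subst card_PiE) auto
    finally show "real (card ?F) \<le> real (card J ^ n)" using of_nat_mono by blast
  qed (use assms(4) in auto)
  finally show ?thesis by (simp add: mult.assoc)
qed

text \<open>The p-adic counterpart of \<open>abs_det_expand_le\<close>: the least possible total
  weight of n distinct indices becomes a power of p dividing the determinant.\<close>

lemma det_expand_dvd:
  fixes Z :: "nat \<Rightarrow> 'j \<Rightarrow> int"
  assumes "finite J"
    and "\<And>r m. r < n \<Longrightarrow> m \<in> J \<Longrightarrow> p ^ w m dvd Z r m"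
    and "\<And>f. f \<in> {0..<n} \<rightarrow> J \<Longrightarrow> inj_on f {0..<n} \<Longrightarrow> N \<le> (\<Sum>c=0..<n. w (f c))"
  shows "p ^ N dvd det (mat n n (\<lambda>(r, c). \<Sum>m\<in>J. Z r m * B m c))"
  unfolding det_expand_columns[OF assms(1)]
proof (intro dvd_sum dvd_mult)
  fix f assume f: "f \<in> {f \<in> {0..<n} \<rightarrow>\<^sub>E J. inj_on f {0..<n}}"
  have "p ^ N dvd p ^ (\<Sum>c=0..<n. w (f c))" using f by (intro le_imp_power_dvd assms(3)) auto
  also have "\<dots> = (\<Prod>c=0..<n. p ^ w (f c))" by (simp add: power_sum)
  also have "\<dots> dvd det (mat n n (\<lambda>(r, c). Z r (f c)))"
    using f by (intro det_dvd_columns) (auto intro!: assms(2))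
  finally show "p ^ N dvd det (mat n n (\<lambda>(r, c). Z r (f c)))" .
qed

lemma det_cong_int:
  assumes "\<And>r c. r < n \<Longrightarrow> c < n \<Longrightarrow> [A r c = B r c] (mod (m::int))"
  shows "[det (mat n n (\<lambda>(r, c). A r c)) = det (mat n n (\<lambda>(r, c). B r c))] (mod m)"
  by (subst (1 2) mat_det_left_def[of _ n])
     (auto intro!: cong_sum cong_mult cong_prod assms simp: permutes_in_image)

text \<open>A nonvanishing minor that cannot be enlarged is bordered by a row P and one further
  column. Expanding the bordered minor along row P gives a linear relation among the columns whose
  coefficients are cofactors independent of P. Up to sign they are minors of the original matrix,
  hence polynomially bounded in B.\<close>

lemma kernel_vector_of_vanishing_dets:
  fixes V :: "'p \<Rightarrow> 'j \<Rightarrow> int"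
  assumes J: "finite J" "bij_betw \<phi> {0..<n} J"
    and V: "\<And>P j. P \<in> S \<Longrightarrow> j \<in> J \<Longrightarrow> \<bar>V P j\<bar> \<le> B" and B: "B \<ge> 1"
    and 0: "\<And>\<rho>. \<rho> \<in> {0..<n} \<rightarrow> S \<Longrightarrow> det (mat n n (\<lambda>(r, c). V (\<rho> r) (\<phi> c))) = 0"
  shows "\<exists>c. (\<exists>j\<in>J. c j \<noteq> 0) \<and> (\<forall>j. \<bar>c j\<bar> \<le> fact n * B ^ n) \<and> (\<forall>P\<in>S. (\<Sum>j\<in>J. c j * V P j) = 0)"
proof -
  define good where "good r \<longleftrightarrow> (\<exists>\<rho> \<kappa>. \<rho> \<in> {0..<r} \<rightarrow> S \<and> \<kappa> \<in> {0..<r} \<rightarrow> J \<and> inj_on \<kappa> {0..<r} \<and>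
     det (mat r r (\<lambda>(i, c). V (\<rho> i) (\<kappa> c))) \<noteq> 0)" for r
  have cardJ: "card J = n" using J(2) bij_betw_same_card by fastforce
  have good0: "good 0" unfolding good_def by auto
  \<comment> \<open>An n by n minor with distinct columns uses all of J, so it is a column
    permutation of one of the determinants assumed to vanish.\<close>
  have good_n: "\<not> good n"
  proof
    assume "good n"
    then obtain \<rho> \<kappa> where *: "\<rho> \<in> {0..<n} \<rightarrow> S" "\<kappa> \<in> {0..<n} \<rightarrow> J" "inj_on \<kappa> {0..<n}"
      "det (mat n n (\<lambda>(i, c). V (\<rho> i) (\<kappa> c))) \<noteq> 0" unfolding good_def by blast
    define p where "p i = (if i < n then inv_into {0..<n} \<phi> (\<kappa> i) else i)" for i
    have im: "\<kappa> ` {0..<n} = J"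
      using *(2,3) J(1) cardJ by (intro card_subset_eq) (auto simp: card_image)
    have "bij_betw (inv_into {0..<n} \<phi> \<circ> \<kappa>) {0..<n} {0..<n}"
      by (rule bij_betw_trans[where B = J]) (use *(3) im bij_betw_inv_into[OF J(2)] in \<open>auto simp: bij_betw_def\<close>)
    hence "bij_betw p {0..<n} {0..<n}"
      by (rule bij_betw_cong[THEN iffD1, rotated]) (auto simp: p_def)
    hence p: "p permutes {0..<n}"
      by (rule bij_imp_permutes) (auto simp: p_def)
    have ph: "\<phi> (p i) = \<kappa> i" if "i < n" for i
      using that im J(2) f_inv_into_f[of "\<kappa> i" \<phi> "{0..<n}"] by (auto simp: bij_betw_def p_def)
    have pn: "p i < n" if "i < n" for i using p that by (simp add: permutes_in_image)
    define A where "A = mat n n (\<lambda>(r, c). V (\<rho> r) (\<phi> c))"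
    have A: "A \<in> carrier_mat n n" by (simp add: A_def)
    have "mat n n (\<lambda>(i, c). V (\<rho> i) (\<kappa> c)) = (mat n n (\<lambda>(i, j). A\<^sup>T $$ (p i, j)))\<^sup>T"
      using ph pn by (intro eq_matI) (auto simp: A_def)
    hence "det (mat n n (\<lambda>(i, c). V (\<rho> i) (\<kappa> c))) = det (mat n n (\<lambda>(i, j). A\<^sup>T $$ (p i, j)))"
      by (simp add: det_transpose[of _ n])
    also have "\<dots> = signof p * det (A\<^sup>T)"
      using A by (intro det_permute_rows[OF _ p]) auto
    also have "\<dots> = 0" using 0[OF *(1)] det_transpose[OF A] by (simp add: A_def)
    finally show False using *(4) by simp
  qed
  \<comment> \<open>The first size at which enlargement fails: \<open>good r\<close> holds and
    \<open>good (Suc r)\<close> does not, so every bordered minor vanishes.\<close>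
  define r where "r = (LEAST r. \<not> good (Suc r))"
  obtain n' where n': "n = Suc n'" using good0 good_n by (cases n) auto
  have ex: "\<exists>r. \<not> good (Suc r)" using good_n n' by auto
  have r1: "\<not> good (Suc r)" unfolding r_def using ex by (rule LeastI_ex)
  have r2: "good r" 
  proof (cases r)
    case (Suc r')
    thus ?thesis using not_less_Least[of r' "\<lambda>r. \<not> good (Suc r)"] r_def by auto
  qed (use good0 in auto)
  have rn: "r < n" using Least_le[of "\<lambda>r. \<not> good (Suc r)" n'] good_n n' unfolding r_def by auto
  from r2 obtain \<rho> \<kappa> where *: "\<rho> \<in> {0..<r} \<rightarrow> S" "\<kappa> \<in> {0..<r} \<rightarrow> J" "inj_on \<kappa> {0..<r}"
      "det (mat r r (\<lambda>(i, c). V (\<rho> i) (\<kappa> c))) \<noteq> 0" unfolding good_def by blast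
  have "card (\<kappa> ` {0..<r}) = r" using *(3) by (simp add: card_image)
  hence "\<kappa> ` {0..<r} \<noteq> J" using cardJ rn by auto
  moreover have "\<kappa> ` {0..<r} \<subseteq> J" using *(2) by auto
  ultimately obtain j0 where j0: "j0 \<in> J" "j0 \<notin> \<kappa> ` {0..<r}" by blast
  define \<kappa>' where "\<kappa>' = \<kappa>(r := j0)"
  have set_Suc: "{0..<Suc r} = insert r {0..<r}" by auto
  have \<kappa>'_image: "\<kappa>' ` {0..<r} = \<kappa> ` {0..<r}" by (auto simp: \<kappa>'_def)
  have k': "\<kappa>' \<in> {0..<Suc r} \<rightarrow> J"
    using *(2) j0 by (auto simp: \<kappa>'_def)
  have inj': "inj_on \<kappa>' {0..<Suc r}"
    unfolding set_Suc inj_on_insert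
  proof
    show "inj_on \<kappa>' {0..<r}" using *(3) by (subst inj_on_cong[of _ _ \<kappa>]) (auto simp: \<kappa>'_def)
    show "\<kappa>' r \<notin> \<kappa>' ` ({0..<r} - {r})" using j0(2) \<kappa>'_image by (simp add: \<kappa>'_def)
  qed
  note k' = k' inj'
  define M where "M P = mat (Suc r) (Suc r) (\<lambda>(i, c). V ((\<rho>(r := P)) i) (\<kappa>' c))" for P
  \<comment> \<open>Cofactors of the last row of \<open>M P\<close>. Only that row depends on P, so
    the same \<open>m\<close> serves all points. The entry \<open>m r\<close> is the nonvanishing
    minor, which makes the coefficient of \<open>j0\<close> nonzero.\<close>
  define m where "m c = (-1) ^ (r + c) * det (mat r r (\<lambda>(i, j). V (\<rho> i) (\<kappa>' (insert_index c j))))" for c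
  have cof: "cofactor (M P) r c = m c" if "c < Suc r" for P c
  proof -
    have "mat_delete (M P) r c = mat r r (\<lambda>(i, j). V (\<rho> i) (\<kappa>' (insert_index c j)))"
      using that by (intro eq_matI) (auto simp: mat_delete_def M_def insert_index_def)
    thus ?thesis unfolding cofactor_def m_def by simp
  qed
  have van: "(\<Sum>c<Suc r. V P (\<kappa>' c) * m c) = 0" if "P \<in> S" for P
  proof -
    have "det (M P) = 0"
    proof (rule ccontr)
      assume "det (M P) \<noteq> 0"
      moreover have "\<rho>(r := P) \<in> {0..<Suc r} \<rightarrow> S" using *(1) that by auto
      ultimately have "good (Suc r)" unfolding good_def M_def using k'
        by (intro exI[of _ "\<rho>(r := P)"] exI[of _ \<kappa>'] conjI)
      thus False using r1 by blast
    qed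
    moreover have "det (M P) = (\<Sum>c<Suc r. M P $$ (r, c) * cofactor (M P) r c)"
      by (rule laplace_expansion_row) (auto simp: M_def)
    also have "\<dots> = (\<Sum>c<Suc r. V P (\<kappa>' c) * m c)"
      by (intro sum.cong refl arg_cong2[where f="(*)"] cof) (auto simp: M_def)
    finally show ?thesis using \<open>det (M P) = 0\<close> by simp
  qed
  define c where "c j = (if j \<in> \<kappa>' ` {0..<Suc r} then m (inv_into {0..<Suc r} \<kappa>' j) else 0)" for j
  have cm: "c (\<kappa>' i) = m i" if "i < Suc r" for i using that k'(2) by (auto simp: c_def inv_into_f_f)
  have "insert_index r j = j" if "j < r" for j using that by (simp add: insert_index_def)
  hence "mat r r (\<lambda>(i, j). V (\<rho> i) (\<kappa>' (insert_index r j))) = mat r r (\<lambda>(i, c). V (\<rho> i) (\<kappa> c))"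
    by (intro cong_mat) (auto simp: \<kappa>'_def)
  hence "m r = det (mat r r (\<lambda>(i, c). V (\<rho> i) (\<kappa> c)))"
    unfolding m_def by (simp add: power_add[symmetric])
  hence "m r \<noteq> 0" using *(4) by simp
  hence "c j0 \<noteq> 0" using cm[of r] by (simp add: \<kappa>'_def)
  moreover have "(\<Sum>j\<in>J. c j * V P j) = 0" if "P \<in> S" for P
  proof -
    have "(\<Sum>j\<in>J. c j * V P j) = (\<Sum>j\<in>\<kappa>' ` {0..<Suc r}. c j * V P j)"
      using k'(1) J(1) by (intro sum.mono_neutral_right) (auto simp: c_def)
    also have "\<dots> = (\<Sum>i\<in>{0..<Suc r}. c (\<kappa>' i) * V P (\<kappa>' i))"
      by (subst sum.reindex[OF k'(2)]) simp
    also have "\<dots> = (\<Sum>i<Suc r. V P (\<kappa>' i) * m i)"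
      by (intro sum.cong) (simp_all only: cm atLeast0LessThan lessThan_iff mult.commute)
    also have "\<dots> = 0" by (rule van[OF that])
    finally show ?thesis .
  qed
  moreover have mb: "\<bar>m i\<bar> \<le> fact n * B ^ n" if "i < Suc r" for i
  proof -
    have "\<bar>m i\<bar> = \<bar>det (mat r r (\<lambda>(i', j). V (\<rho> i') (\<kappa>' (insert_index i j))))\<bar>"
      unfolding m_def by (simp add: abs_mult power_abs)
    also have "\<dots> \<le> fact r * (\<Prod>c=0..<r. B)"
    proof (rule abs_det_le_column_bound)
      fix r' c assume rc: "r' < r" "c < r"
      have "insert_index i c < Suc r" using rc that by (auto simp: insert_index_def)
      hence "\<kappa>' (insert_index i c) \<in> J" using k'(1) by auto
      thus "\<bar>mat r r (\<lambda>(i', j). V (\<rho> i') (\<kappa>' (insert_index i j))) $$ (r', c)\<bar> \<le> B"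
        using rc *(1) by (auto intro!: V)
    qed auto
    also have "\<dots> = fact r * B ^ r" by simp
    also have "\<dots> \<le> fact n * B ^ n"
      using rn B by (intro mult_mono fact_mono power_increasing) auto
    finally show ?thesis .
  qed
  have "\<bar>c j\<bar> \<le> fact n * B ^ n" for j
  proof (cases "j \<in> \<kappa>' ` {0..<Suc r}")
    case True
    then obtain i where "i < Suc r" "j = \<kappa>' i" by auto
    thus ?thesis using cm[of i] mb[of i] by simp
  qed (use B in \<open>auto simp: c_def\<close>)
  ultimately show ?thesis using j0(1) by blast
qed

section \<open>Bihomogeneous forms in (d, e) and (u, v), and the points on them\<close>

definition form :: "nat \<Rightarrow> nat \<Rightarrow> (nat \<Rightarrow> nat \<Rightarrow> int) \<Rightarrow> int \<Rightarrow> int \<Rightarrow> int \<Rightarrow> int \<Rightarrow> int" where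
  "form a b c d e u v = (\<Sum>i\<le>a. \<Sum>j\<le>b. c i j * (d ^ i * e ^ (a - i) * v ^ j * u ^ (b - j)))"

text \<open>No size of the coefficients is recorded: \<open>on_form_small_coeffs\<close> replaces
  any vanishing form by one with coefficients polynomial in the height.\<close>

definition on_form :: "nat \<Rightarrow> nat \<Rightarrow> 'p set \<Rightarrow> ('p \<Rightarrow> int) \<Rightarrow> ('p \<Rightarrow> int) \<Rightarrow> ('p \<Rightarrow> int) \<Rightarrow> ('p \<Rightarrow> int) \<Rightarrow> bool" where
  "on_form a b S d e u v \<longleftrightarrow>
     (\<exists>c. (\<exists>i\<le>a. \<exists>j\<le>b. c i j \<noteq> 0) \<and> (\<forall>P\<in>S. form a b c (d P) (e P) (u P) (v P) = 0))"

text \<open>Ratios d / e are compared by cross multiplication. The bound K converts a bound on the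
  number of ratios, such as the degree of a polynomial vanishing at them, into a bound on the number
  of points.\<close>

definition fibres_le :: "nat \<Rightarrow> 'p set \<Rightarrow> ('p \<Rightarrow> int) \<Rightarrow> ('p \<Rightarrow> int) \<Rightarrow> bool" where
  "fibres_le K S d e \<longleftrightarrow> finite S \<and> (\<forall>P\<in>S. e P > 0) \<and>
     (\<forall>P0\<in>S. card {P\<in>S. d P * e P0 = d P0 * e P} \<le> K)"

lemma fibres_le_subset:
  assumes "fibres_le K S d e" "T \<subseteq> S"
  shows "fibres_le K T d e"
  unfolding fibres_le_def
proof (intro conjI ballI)
  show "finite T" using assms finite_subset by (auto simp: fibres_le_def)
  fix P0 assume P0: "P0 \<in> T"
  have "card {P\<in>T. d P * e P0 = d P0 * e P} \<le> card {P\<in>S. d P * e P0 = d P0 * e P}"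
    using assms by (intro card_mono) (auto simp: fibres_le_def)
  thus "card {P\<in>T. d P * e P0 = d P0 * e P} \<le> K"
    using assms P0 by (force simp: fibres_le_def)
qed (use assms in \<open>auto simp: fibres_le_def\<close>)

lemma card_le_roots:
  fixes R :: "real poly"
  assumes "fibres_le K S d e" "R \<noteq> 0" "\<And>P. P \<in> S \<Longrightarrow> poly R (of_int (d P) / of_int (e P)) = 0"
  shows "card S \<le> degree R * K"
proof -
  let ?s = "\<lambda>P. of_int (d P) / of_int (e P) :: real"
  let ?Z = "{s. poly R s = 0}"
  have fin: "finite ?Z" using assms(2) by (rule poly_roots_finite)
  have "S \<subseteq> (\<Union>s\<in>?Z. {P\<in>S. ?s P = s})" using assms(3) by auto
  hence "card S \<le> card (\<Union>s\<in>?Z. {P\<in>S. ?s P = s})"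
    using assms(1) fin by (intro card_mono) (auto simp: fibres_le_def)
  also have "\<dots> \<le> (\<Sum>s\<in>?Z. card {P\<in>S. ?s P = s})" using fin by (rule card_UN_le)
  also have "\<dots> \<le> (\<Sum>s\<in>?Z. K)"
  proof (rule sum_mono)
    fix s assume "s \<in> ?Z"
    show "card {P\<in>S. ?s P = s} \<le> K"
    proof (cases "{P\<in>S. ?s P = s} = {}")
      case False
      then obtain P0 where P0: "P0 \<in> S" "?s P0 = s" by auto
      have "{P\<in>S. ?s P = s} = {P\<in>S. d P * e P0 = d P0 * e P}"
      proof (intro Collect_cong conj_cong refl)
        fix P assume "P \<in> S"
        hence "e P > 0" "e P0 > 0" using P0(1) assms(1) by (auto simp: fibres_le_def)
        hence "?s P = s \<longleftrightarrow> real_of_int (d P * e P0) = real_of_int (d P0 * e P)"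
          unfolding P0(2)[symmetric] by (simp add: field_simps)
        thus "?s P = s \<longleftrightarrow> d P * e P0 = d P0 * e P" unfolding of_int_eq_iff .
      qed
      thus ?thesis using P0(1) assms(1) by (auto simp: fibres_le_def)
    next
      case True
      thus ?thesis by (simp only: True card.empty)
    qed
  qed
  also have "\<dots> \<le> degree R * K" using card_poly_roots_bound[OF assms(2)] by simp
  finally show ?thesis .
qed

lemma poly_eq_sum_le:
  fixes p :: "'a :: comm_semiring_1 poly"
  assumes "degree p \<le> n"
  shows "poly p x = (\<Sum>i\<le>n. coeff p i * x ^ i)"
  unfolding poly_altdef
  by (rule sum.mono_neutral_left) (use assms in \<open>auto simp: coeff_eq_0\<close>)

text \<open>The outer variable stands for t = v / u and the coefficients are polynomials in s = d /
  e, so \<open>resultant\<close> eliminates t and leaves a polynomial in s alone. In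
  \<open>form\<close> the exponent j accordingly belongs to v and i to d.\<close>

definition ev2 :: "int poly poly \<Rightarrow> real \<Rightarrow> real \<Rightarrow> real" where
  "ev2 F s t = poly (map_poly (\<lambda>c. poly (of_int_poly c) s) F) t"

lemma comm_ring_hom_eval: "comm_ring_hom (\<lambda>c. poly (of_int_poly c) (s :: real))"
  by unfold_locales (auto simp: hom_distribs)

lemma ev2_mult: "ev2 (F * G) s t = ev2 F s t * ev2 G s t"
proof -
  interpret comm_ring_hom "\<lambda>c. poly (of_int_poly c) s" by (rule comm_ring_hom_eval)
  interpret h: map_poly_comm_ring_hom "\<lambda>c. poly (of_int_poly c) s" ..
  show ?thesis unfolding ev2_def h.hom_mult by simp
qed

definition poly_of_coeffs :: "nat \<Rightarrow> nat \<Rightarrow> (nat \<Rightarrow> nat \<Rightarrow> int) \<Rightarrow> int poly poly" where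
  "poly_of_coeffs a b c = (\<Sum>j\<le>b. monom (\<Sum>i\<le>a. monom (c i j) i) j)"

lemma coeff_poly_of_coeffs:
  "coeff (coeff (poly_of_coeffs a b c) j) i = (if i \<le> a \<and> j \<le> b then c i j else 0)"
proof -
  have 1: "coeff (poly_of_coeffs a b c) j = (if j \<le> b then (\<Sum>i\<le>a. monom (c i j) i) else 0)"
    by (auto simp: poly_of_coeffs_def coeff_sum)
  show ?thesis unfolding 1 by (auto simp: coeff_sum)
qed

lemma degree_poly_of_coeffs: "degree (poly_of_coeffs a b c) \<le> b" "degree (coeff (poly_of_coeffs a b c) j) \<le> a"
proof -
  show "degree (poly_of_coeffs a b c) \<le> b"
    by (rule degree_le) (auto intro!: poly_eqI simp: coeff_poly_of_coeffs)
  show "degree (coeff (poly_of_coeffs a b c) j) \<le> a"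
    by (rule degree_le) (auto simp: coeff_poly_of_coeffs)
qed

lemma ev2_altdef:
  assumes "degree F \<le> b" "\<And>j. degree (coeff F j) \<le> a"
  shows "ev2 F s t = (\<Sum>i\<le>a. \<Sum>j\<le>b. of_int (coeff (coeff F j) i) * s ^ i * t ^ j)"
proof -
  have "degree (map_poly (\<lambda>c. poly (of_int_poly c) s) F) \<le> b"
    using assms(1) map_poly_degree_leq[of "\<lambda>c. poly (of_int_poly c) s" F] by simp
  hence "ev2 F s t = (\<Sum>j\<le>b. poly (of_int_poly (coeff F j)) s * t ^ j)"
    unfolding ev2_def by (subst poly_eq_sum_le) (auto simp: coeff_map_poly)
  also have "\<dots> = (\<Sum>j\<le>b. (\<Sum>i\<le>a. of_int (coeff (coeff F j) i) * s ^ i) * t ^ j)"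
    using assms(2) by (intro sum.cong refl, subst poly_eq_sum_le[where n = a]) auto
  also have "\<dots> = (\<Sum>i\<le>a. \<Sum>j\<le>b. of_int (coeff (coeff F j) i) * s ^ i * t ^ j)"
    unfolding sum_distrib_right by (rule sum.swap)
  finally show ?thesis .
qed

lemma form_eq_ev2:
  assumes "e \<noteq> 0" "u \<noteq> 0" "degree F \<le> b" "\<And>j. degree (coeff F j) \<le> a"
  shows "real_of_int (form a b (\<lambda>i j. coeff (coeff F j) i) d e u v) =
           of_int e ^ a * of_int u ^ b * ev2 F (of_int d / of_int e) (of_int v / of_int u)"
  unfolding ev2_altdef[OF assms(3,4)] form_def of_int_sum sum_distrib_left
proof (intro sum.cong refl)
  fix i j assume ij: "i \<in> {..a}" "j \<in> {..b}"
  have 1: "real_of_int e ^ a = of_int e ^ i * of_int e ^ (a - i)" 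
          "real_of_int u ^ b = of_int u ^ j * of_int u ^ (b - j)"
    using ij by (auto simp: power_add[symmetric])
  show "real_of_int (coeff (coeff F j) i * (d ^ i * e ^ (a - i) * v ^ j * u ^ (b - j))) =
      of_int e ^ a * of_int u ^ b * (of_int (coeff (coeff F j) i) * (of_int d / of_int e) ^ i * (of_int v / of_int u) ^ j)"
    unfolding 1 using assms(1,2) by (simp add: power_divide)
qed

lemma form_poly_of_coeffs:
  "form a b (\<lambda>i j. coeff (coeff (poly_of_coeffs a b c) j) i) d e u v = form a b c d e u v"
  unfolding form_def by (intro sum.cong refl) (simp add: coeff_poly_of_coeffs)

lemma on_formI:
  assumes "F \<noteq> 0" "degree F \<le> b" "\<And>j. degree (coeff F j) \<le> a"
    and "\<And>P. P \<in> S \<Longrightarrow> e P \<noteq> 0 \<and> u P \<noteq> 0 \<and> ev2 F (of_int (d P) / of_int (e P)) (of_int (v P) / of_int (u P)) = 0"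
  shows "on_form a b S d e u v"
  unfolding on_form_def
proof (intro exI[of _ "\<lambda>i j. coeff (coeff F j) i"] conjI ballI)
  have "coeff (coeff F (degree F)) (degree (coeff F (degree F))) \<noteq> 0" using assms(1) by simp
  thus "\<exists>i\<le>a. \<exists>j\<le>b. coeff (coeff F j) i \<noteq> 0" using assms(2,3) by blast
  fix P assume "P \<in> S"
  thus "form a b (\<lambda>i j. coeff (coeff F j) i) (d P) (e P) (u P) (v P) = 0"
    using form_eq_ev2[of "e P" "u P" F b a "d P" "v P"] assms by simp
qed

lemma ev2_eq_0_of_form:
  assumes "form a b c d e u v = 0" "e \<noteq> 0" "u \<noteq> 0"
  shows "ev2 (poly_of_coeffs a b c) (of_int d / of_int e) (of_int v / of_int u) = 0"
  using form_eq_ev2[OF assms(2,3) degree_poly_of_coeffs, of a b c d v] assms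
  unfolding form_poly_of_coeffs by simp

section \<open>Resultants and factorisation\<close>

text \<open>Each row of the Sylvester matrix is a shifted list of the coefficients of p or q, so
  pairing it with the monomials of degree m + n - 1 gives a monomial times the homogenised
  polynomial. The sizes m, n only bound the degrees and both variables x, y are kept, so the
  identity serves specialised polynomials, whose degree may drop, as well as binary forms.\<close>

lemma sylvester_row_sum:
  fixes p q :: "'a :: comm_ring_1 poly"
  assumes i: "i < m + n" and p: "degree p \<le> m" "degree q \<le> n"
  shows "(\<Sum>j<m+n. sylvester_mat_sub m n p q $$ (i, j) * (x ^ (m + n - 1 - j) * y ^ j)) =
     (if i < n then x ^ (n - 1 - i) * y ^ i * (\<Sum>k\<le>m. coeff p k * x ^ k * y ^ (m - k))
      else x ^ (m + n - 1 - i) * y ^ (i - n) * (\<Sum>k\<le>n. coeff q k * x ^ k * y ^ (n - k)))"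
proof (cases "i < n")
  case True
  have "(\<Sum>j<m+n. sylvester_mat_sub m n p q $$ (i, j) * (x ^ (m + n - 1 - j) * y ^ j)) =
     (\<Sum>j\<in>{i..i+m}. coeff p (m + i - j) * (x ^ (m + n - 1 - j) * y ^ j))"
    using True by (intro sum.mono_neutral_cong_right) (auto simp: sylvester_mat_sub_index)
  also have "\<dots> = (\<Sum>k\<le>m. coeff p k * (x ^ (n - 1 - i + k) * y ^ (i + (m - k))))"
  proof (rule sum.reindex_bij_witness[of _ "\<lambda>k. i + (m - k)" "\<lambda>j. m + i - j"])
    fix j assume j: "j \<in> {i..i+m}"
    have eq: "n - 1 - i + (m + i - j) = m + n - 1 - j" "i + (m - (m + i - j)) = j" using j True by auto
    show "coeff p (m + i - j) * (x ^ (n - 1 - i + (m + i - j)) * y ^ (i + (m - (m + i - j)))) =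
         coeff p (m + i - j) * (x ^ (m + n - 1 - j) * y ^ j)" unfolding eq ..
  qed auto
  also have "\<dots> = x ^ (n - 1 - i) * y ^ i * (\<Sum>k\<le>m. coeff p k * x ^ k * y ^ (m - k))"
    unfolding sum_distrib_left power_add by (simp only: mult_ac)
  finally show ?thesis using True by simp
next
  case False
  have "(\<Sum>j<m+n. sylvester_mat_sub m n p q $$ (i, j) * (x ^ (m + n - 1 - j) * y ^ j)) =
     (\<Sum>j\<in>{i-n..i}. coeff q (i - j) * (x ^ (m + n - 1 - j) * y ^ j))"
    using False i by (intro sum.mono_neutral_cong_right) (auto simp: sylvester_mat_sub_index)
  also have "\<dots> = (\<Sum>k\<le>n. coeff q k * (x ^ (m + n - 1 - i + k) * y ^ (i - n + (n - k))))"
  proof (rule sum.reindex_bij_witness[of _ "\<lambda>k. i - k" "\<lambda>j. i - j"])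
    fix j assume j: "j \<in> {i-n..i}"
    have eq: "m + n - 1 - i + (i - j) = m + n - 1 - j" "i - n + (n - (i - j)) = j" using j i False by auto
    show "coeff q (i - j) * (x ^ (m + n - 1 - i + (i - j)) * y ^ (i - n + (n - (i - j)))) =
         coeff q (i - j) * (x ^ (m + n - 1 - j) * y ^ j)" unfolding eq ..
  qed (use False i in auto)
  also have "\<dots> = x ^ (m + n - 1 - i) * y ^ (i - n) * (\<Sum>k\<le>n. coeff q k * x ^ k * y ^ (n - k))"
    unfolding sum_distrib_left power_add by (simp only: mult_ac)
  finally show ?thesis using False by simp
qed

text \<open>A common root x puts the vector of powers of x into the kernel. This works for formal
  degrees m, n that may exceed the true ones.\<close>

lemma sylvester_det_eq_0:
  fixes p q :: "real poly"
  assumes "degree p \<le> m" "degree q \<le> n" "m + n > 0" "poly p x = 0" "poly q x = 0"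
  shows "det (sylvester_mat_sub m n p q) = 0"
proof (subst det_0_iff_vec_prod_zero[OF sylvester_mat_sub_carrier], intro exI conjI)
  let ?w = "vec (m + n) (\<lambda>j. x ^ (m + n - 1 - j))"
  show "?w \<in> carrier_vec (m + n)" by simp
  \<comment> \<open>The last entry is x^0 = 1, so the vector is nonzero even for x = 0.\<close>
  have "?w $ (m + n - 1) = 1" using assms(3) by simp
  thus "?w \<noteq> 0\<^sub>v (m + n)" using assms(3) by (metis diff_less index_zero_vec(1) less_numeral_extra(1) zero_neq_one)
  show "sylvester_mat_sub m n p q *\<^sub>v ?w = 0\<^sub>v (m + n)"
  proof (rule eq_vecI)
    fix i assume "i < dim_vec (0\<^sub>v (m + n))"
    hence i: "i < m + n" by simp
    have "(sylvester_mat_sub m n p q *\<^sub>v ?w) $ i =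
        (\<Sum>j<m+n. sylvester_mat_sub m n p q $$ (i, j) * (x ^ (m + n - 1 - j) * 1 ^ j))"
      using i by (simp add: scalar_prod_def atLeast0LessThan)
    also have "\<dots> = 0" using assms
      by (subst sylvester_row_sum[OF i assms(1,2)]) (auto simp: poly_eq_sum_le[symmetric])
    finally show "(sylvester_mat_sub m n p q *\<^sub>v ?w) $ i = 0\<^sub>v (m + n) $ i" using i by simp
  qed simp
qed

text \<open>Every ratio s = d / e of a point is a root of the resultant, because the specialisations
  of F and G at s share the root t. As a polynomial in s the resultant has degree at most a (degree
  F + degree G).\<close>

lemma card_le_resultant:
  fixes F G :: "int poly poly"
  assumes fib: "fibres_le K S d e" and res: "resultant F G \<noteq> 0" and deg: "degree F > 0"
    and a: "\<And>j. degree (coeff F j) \<le> a" "\<And>j. degree (coeff G j) \<le> a"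
    and F: "\<And>P. P \<in> S \<Longrightarrow> ev2 F (of_int (d P) / of_int (e P)) (t P) = 0"
    and G: "\<And>P. P \<in> S \<Longrightarrow> ev2 G (of_int (d P) / of_int (e P)) (t P) = 0"
  shows "card S \<le> a * (degree F + degree G) * K"
proof -
  let ?m = "degree F" and ?n = "degree G"
  define R where "R = resultant F G"
  have "degree R \<le> a * (?m + ?n)"
    unfolding R_def resultant_def
    by (rule degree_det_le) (auto simp: sylvester_index_mat a)
  moreover have "card S \<le> degree (map_poly real_of_int R) * K"
  proof (rule card_le_roots[OF fib])
    show "map_poly real_of_int R \<noteq> 0" using res R_def by simp
    fix P assume P: "P \<in> S"
    define s where "s = real_of_int (d P) / of_int (e P)"
    interpret comm_ring_hom "\<lambda>c. poly (of_int_poly c) s" by (rule comm_ring_hom_eval)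
    \<comment> \<open>Specialising s commutes with the determinant but may lower the degrees in t;
      the Sylvester matrix therefore keeps the sizes \<open>?m\<close> and \<open>?n\<close>, as
      \<open>sylvester_det_eq_0\<close> allows.\<close>
    have "poly (map_poly real_of_int R) s = 
       det (sylvester_mat_sub ?m ?n (map_poly (\<lambda>c. poly (of_int_poly c) s) F) (map_poly (\<lambda>c. poly (of_int_poly c) s) G))"
      unfolding R_def resultant_def sylvester_mat_def hom_det[symmetric]
      by (subst sylvester_mat_sub_map) auto
    also have "\<dots> = 0"
      by (rule sylvester_det_eq_0[where x = "t P"])
         (use F[OF P] G[OF P] deg in \<open>auto simp: ev2_def s_def map_poly_degree_leq\<close>)
    finally show "poly (map_poly real_of_int R) (of_int (d P) / of_int (e P)) = 0" unfolding s_def .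
  qed
  moreover have "degree (map_poly real_of_int R) \<le> degree R" by (rule map_poly_degree_leq)
  ultimately show ?thesis using mult_le_mono1 order_trans by meson
qed

text \<open>The degree in s is additive on products. \<open>ma\<close> is that degree and
  \<open>mj\<close> the largest exponent of t at which it is attained. In the coefficient of t^(mj F
  + mj G) only the product of these two extreme terms reaches degree \<open>ma F + ma G\<close>, so
  it cannot cancel.\<close>

lemma degree_coeff_factor_le:
  fixes F G :: "int poly poly"
  assumes F: "F \<noteq> 0" and G: "G \<noteq> 0" and a: "\<And>j. degree (coeff (F * G) j) \<le> a"
  shows "degree (coeff F j) \<le> a"
proof -
  define ma where "ma = (\<lambda>F :: int poly poly. Max ((\<lambda>j. degree (coeff F j)) ` {j. j \<le> degree F \<and> coeff F j \<noteq> 0}))"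
  define mj where "mj = (\<lambda>F :: int poly poly. Max {j. j \<le> degree F \<and> coeff F j \<noteq> 0 \<and> degree (coeff F j) = ma F})"
  have 1: "degree (coeff F j) \<le> ma F" if "coeff F j \<noteq> 0" for F j
    unfolding ma_def using that by (intro Max_ge) (auto simp: le_degree)
  have 2: "coeff F (mj F) \<noteq> 0 \<and> degree (coeff F (mj F)) = ma F \<and> 
       (\<forall>j>mj F. coeff F j = 0 \<or> degree (coeff F j) < ma F)" if "F \<noteq> 0" for F
  proof -
    have "{j. j \<le> degree F \<and> coeff F j \<noteq> 0} \<noteq> {}" using that by (auto intro!: exI[of _ "degree F"])
    hence "ma F \<in> (\<lambda>j. degree (coeff F j)) ` {j. j \<le> degree F \<and> coeff F j \<noteq> 0}"
      unfolding ma_def by (intro Max_in) auto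
    hence "{j. j \<le> degree F \<and> coeff F j \<noteq> 0 \<and> degree (coeff F j) = ma F} \<noteq> {}" by auto
    hence "mj F \<in> {j. j \<le> degree F \<and> coeff F j \<noteq> 0 \<and> degree (coeff F j) = ma F}"
      unfolding mj_def by (intro Max_in) auto
    moreover have "coeff F j = 0 \<or> degree (coeff F j) < ma F" if "j > mj F" for j
    proof (rule ccontr)
      assume *: "\<not> ?thesis"
      hence "degree (coeff F j) = ma F" using 1[of F j] by auto
      hence "j \<le> mj F" unfolding mj_def using * by (intro Max_ge) (auto simp: le_degree)
      thus False using that by simp
    qed
    ultimately show ?thesis by auto
  qed
  let ?N = "ma F + ma G"
  have "coeff (coeff (F * G) (mj F + mj G)) ?N =
      (\<Sum>i\<le>mj F + mj G. coeff (coeff F i * coeff G (mj F + mj G - i)) ?N)"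
    unfolding coeff_mult[of F G] coeff_sum ..
  also have "\<dots> = (\<Sum>i\<in>{mj F}. coeff (coeff F i * coeff G (mj F + mj G - i)) ?N)"
  proof (rule sum.mono_neutral_right)
    show "\<forall>i\<in>{..mj F + mj G} - {mj F}. coeff (coeff F i * coeff G (mj F + mj G - i)) ?N = 0"
    proof
      fix i assume i: "i \<in> {..mj F + mj G} - {mj F}"
      show "coeff (coeff F i * coeff G (mj F + mj G - i)) ?N = 0"
      proof (cases "coeff F i = 0 \<or> coeff G (mj F + mj G - i) = 0")
        case False
        have "degree (coeff F i) + degree (coeff G (mj F + mj G - i)) < ?N"
        proof (cases "i > mj F")
          case True
          thus ?thesis using 2[OF F] 1[of G "mj F + mj G - i"] False by (auto intro!: add_less_le_mono)
        next
          case F': False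
          hence "mj F + mj G - i > mj G" using i by auto
          thus ?thesis using 2[OF G] 1[of F i] False by (auto intro!: add_le_less_mono)
        qed
        hence "degree (coeff F i * coeff G (mj F + mj G - i)) < ?N"
          using degree_mult_le[of "coeff F i" "coeff G (mj F + mj G - i)"] by linarith
        thus ?thesis by (rule coeff_eq_0)
      qed auto
    qed
  qed auto
  also have "\<dots> \<noteq> 0"
  proof -
    have "coeff (coeff F (mj F)) (ma F) \<noteq> 0" "coeff (coeff G (mj G)) (ma G) \<noteq> 0"
      using 2[OF F] 2[OF G] leading_coeff_neq_0 by metis+
    thus ?thesis
      using 2[OF F] 2[OF G] coeff_mult_degree_sum[of "coeff F (mj F)" "coeff G (mj G)"] by simp
  qed
  finally have "?N \<le> degree (coeff (F * G) (mj F + mj G))" by (rule le_degree)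
  also have "\<dots> \<le> a" by (rule a)
  finally have "ma F \<le> a" by simp
  thus ?thesis using 1[of F j] by (cases "coeff F j = 0") auto
qed

text \<open>A zero resultant makes the gcd of F and G nonconstant in t. Its degree is at most that
  of G, hence below that of F, so it splits F into two factors of smaller degree.\<close>

lemma factorise_of_resultant_eq_0:
  fixes F G :: "int poly poly"
  assumes "resultant F G = 0" "G \<noteq> 0" "degree G < degree F" and a: "\<And>j. degree (coeff F j) \<le> a"
  obtains F1 F2 where "F = F1 * F2" "degree F1 < degree F" "degree F2 < degree F"
    "\<And>j. degree (coeff F1 j) \<le> a" "\<And>j. degree (coeff F2 j) \<le> a"
proof -
  define F1 where "F1 = gcd F G"
  have "F1 dvd F" unfolding F1_def by simp
  then obtain F2 where F2: "F = F1 * F2" by (auto simp: dvd_def)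
  have F0: "F \<noteq> 0" using assms(3) by auto
  hence nz: "F1 \<noteq> 0" "F2 \<noteq> 0" using F2 by auto
  have "degree F1 \<noteq> 0" using assms(1) resultant_0_gcd[of F G] by (simp add: F1_def)
  moreover have "degree F1 \<le> degree G" using assms(2) by (intro dvd_imp_degree_le) (auto simp: F1_def)
  moreover have "degree F = degree F1 + degree F2" unfolding F2 using nz by (rule degree_mult_eq)
  moreover have "degree (coeff F1 j) \<le> a" for j
    using degree_coeff_factor_le[OF nz] a unfolding F2 by blast
  moreover have "degree (coeff F2 j) \<le> a" for j
    using degree_coeff_factor_le[OF nz(2,1)] a unfolding F2 mult.commute[of F1 F2] by blast
  ultimately show ?thesis using assms(3) F2 by (intro that[of F1 F2]) auto
qed

section \<open>Forms with small coefficients\<close>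

lemma form_pair_sum:
  "form a b (\<lambda>i j. c (i, j)) d e u v = 
     (\<Sum>p\<in>{..a}\<times>{..b}. c p * (d ^ fst p * e ^ (a - fst p) * v ^ snd p * u ^ (b - snd p)))"
  unfolding form_def sum.cartesian_product by (intro sum.cong) auto

lemma on_form_of_vanishing_dets:
  fixes \<phi> :: "nat \<Rightarrow> nat \<times> nat"
  assumes \<phi>: "bij_betw \<phi> {0..<n} ({..a} \<times> {..b})" and H: "H \<ge> 1"
    and bd: "\<And>P. P \<in> S \<Longrightarrow> 0 \<le> d P \<and> d P \<le> H \<and> 0 \<le> e P \<and> e P \<le> H \<and> 0 \<le> u P \<and> u P \<le> H \<and> 0 \<le> v P \<and> v P \<le> H"
    and 0: "\<And>\<rho>. \<rho> \<in> {0..<n} \<rightarrow> S \<Longrightarrow> det (mat n n (\<lambda>(r, c). d (\<rho> r) ^ fst (\<phi> c) * e (\<rho> r) ^ (a - fst (\<phi> c))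
             * v (\<rho> r) ^ snd (\<phi> c) * u (\<rho> r) ^ (b - snd (\<phi> c)))) = (0 :: int)"
  obtains c where "\<exists>i\<le>a. \<exists>j\<le>b. c i j \<noteq> 0" "\<And>i j. \<bar>c i j\<bar> \<le> fact n * (H ^ (a + b)) ^ n"
    "\<And>P. P \<in> S \<Longrightarrow> form a b c (d P) (e P) (u P) (v P) = 0"
proof -
  let ?V = "\<lambda>P p. d P ^ fst p * e P ^ (a - fst p) * v P ^ snd p * u P ^ (b - snd p)"
  have "\<exists>c. (\<exists>j\<in>{..a}\<times>{..b}. c j \<noteq> 0) \<and> (\<forall>j. \<bar>c j\<bar> \<le> fact n * (H ^ (a + b)) ^ n) \<and>
      (\<forall>P\<in>S. (\<Sum>j\<in>{..a}\<times>{..b}. c j * ?V P j) = 0)"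
  proof (rule kernel_vector_of_vanishing_dets[OF _ \<phi>])
    fix P j assume P: "P \<in> S" "j \<in> {..a} \<times> {..b}"
    have "\<bar>?V P j\<bar> \<le> H ^ fst j * H ^ (a - fst j) * H ^ snd j * H ^ (b - snd j)"
      using bd[OF P(1)] H unfolding abs_mult power_abs by (intro mult_mono power_mono) auto
    also have "\<dots> = H ^ (a + b)" using P(2) by (auto simp: power_add[symmetric])
    finally show "\<bar>?V P j\<bar> \<le> H ^ (a + b)" .
  qed (use H 0 in auto)
  then obtain c where c: "\<exists>j\<in>{..a}\<times>{..b}. c j \<noteq> 0" "\<forall>j. \<bar>c j\<bar> \<le> fact n * (H ^ (a + b)) ^ n"
    "\<forall>P\<in>S. (\<Sum>j\<in>{..a}\<times>{..b}. c j * ?V P j) = 0" by blast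
  show ?thesis
    by (rule that[of "\<lambda>i j. c (i, j)"]) (use c in \<open>auto simp: form_pair_sum\<close>)
qed

lemma ex_bij_pairs: "\<exists>\<phi>. bij_betw \<phi> {0..<(a + 1) * (b + 1)} ({..a :: nat} \<times> {..b :: nat})"
  using ex_bij_betw_nat_finite[of "{..a} \<times> {..b}"] by (simp add: card_cartesian_product)

text \<open>A vanishing form is a kernel vector, so all monomial determinants at points of S are
  zero; solving the linear system again by minors yields coefficients bounded by a power of H. This
  polynomial bound is what the divisor bound and the search for primes avoiding given numbers rely
  on.\<close>

lemma on_form_small_coeffs:
  assumes on: "on_form a b S d e u v" and H: "H \<ge> 1"
    and bd: "\<And>P. P \<in> S \<Longrightarrow> 0 \<le> d P \<and> d P \<le> H \<and> 0 \<le> e P \<and> e P \<le> H \<and> 0 \<le> u P \<and> u P \<le> H \<and> 0 \<le> v P \<and> v P \<le> H"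
  obtains c where "\<exists>i\<le>a. \<exists>j\<le>b. c i j \<noteq> 0"
    "\<And>i j. \<bar>c i j\<bar> \<le> fact ((a + 1) * (b + 1)) * (H ^ (a + b)) ^ ((a + 1) * (b + 1))"
    "\<And>P. P \<in> S \<Longrightarrow> form a b c (d P) (e P) (u P) (v P) = 0"
proof -
  let ?n = "(a + 1) * (b + 1)"
  from ex_bij_pairs obtain \<phi> where \<phi>: "bij_betw \<phi> {0..<?n} ({..a} \<times> {..b})" by blast
  show ?thesis
  proof (rule on_form_of_vanishing_dets[OF \<phi> H bd])
    fix \<rho> assume \<rho>: "\<rho> \<in> {0..<?n} \<rightarrow> S"
    from on obtain c where c: "\<exists>i\<le>a. \<exists>j\<le>b. c i j \<noteq> 0" "\<forall>P\<in>S. form a b c (d P) (e P) (u P) (v P) = 0"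
      unfolding on_form_def by blast
    define w where "w = vec ?n (\<lambda>i. c (fst (\<phi> i)) (snd (\<phi> i)))"
    let ?V = "\<lambda>P p. d P ^ fst p * e P ^ (a - fst p) * v P ^ snd p * u P ^ (b - snd p)"
    let ?M = "mat ?n ?n (\<lambda>(r, c). ?V (\<rho> r) (\<phi> c))"
    show "det ?M = 0"
    proof (subst det_0_iff_vec_prod_zero[of _ ?n], simp, intro exI conjI)
      show "w \<in> carrier_vec ?n" by (simp add: w_def)
      from c(1) obtain i j where ij: "i \<le> a" "j \<le> b" "c i j \<noteq> 0" by blast
      hence "(i, j) \<in> \<phi> ` {0..<?n}" using \<phi> by (auto simp: bij_betw_def)
      then obtain q where q: "q < ?n" "\<phi> q = (i, j)" by auto
      hence "w $ q \<noteq> 0" using ij by (simp add: w_def)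
      thus "w \<noteq> 0\<^sub>v ?n" using q by auto
      show "?M *\<^sub>v w = 0\<^sub>v ?n"
      proof (rule eq_vecI)
        fix r assume "r < dim_vec (0\<^sub>v ?n)"
        hence r: "r < ?n" by simp
        have "(?M *\<^sub>v w) $ r = (\<Sum>q\<in>{0..<?n}. ?V (\<rho> r) (\<phi> q) * c (fst (\<phi> q)) (snd (\<phi> q)))"
          using r by (simp add: scalar_prod_def w_def)
        also have "\<dots> = (\<Sum>p\<in>{..a}\<times>{..b}. ?V (\<rho> r) p * c (fst p) (snd p))"
          by (rule sum.reindex_bij_betw[OF \<phi>])
        also have "\<dots> = form a b c (d (\<rho> r)) (e (\<rho> r)) (u (\<rho> r)) (v (\<rho> r))"
          unfolding form_def sum.cartesian_product by (intro sum.cong) (auto simp: mult_ac)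
        also have "\<dots> = 0" using c(2) \<rho> r by auto
        finally show "(?M *\<^sub>v w) $ r = 0\<^sub>v ?n $ r" using r by simp
      qed simp
    qed
  qed (use that in blast)+
qed

section \<open>The divisor bound\<close>

lemma Suc_le_powr_divisor:
  fixes \<delta> :: real
  assumes "\<delta> > 0"
  shows "real (n + 1) \<le> (1 / min 1 (\<delta> * ln 2)) * 2 powr (\<delta> * n)"
proof -
  define m where "m = min 1 (\<delta> * ln 2)"
  have m: "m > 0" "m \<le> 1" "m \<le> \<delta> * ln 2" using assms by (auto simp: m_def)
  have "m * (n + 1) \<le> 1 + \<delta> * ln 2 * n"
    using m(2) mult_right_mono[OF m(3), of "real n"] by (simp add: algebra_simps)
  also have "\<dots> \<le> exp (\<delta> * ln 2 * n)" using exp_ge_add_one_self[of "\<delta> * ln 2 * n"] by simp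
  also have "\<dots> = 2 powr (\<delta> * n)" by (simp add: powr_def mult_ac)
  finally show ?thesis using m(1) by (simp add: m_def[symmetric] field_simps)
qed

text \<open>A prime p with exponent \<alpha> contributes the factor (\<alpha> + 1) / p^(\<delta>
  \<alpha>). If p >= 2^(1 / \<delta>) this is at most 1, since \<alpha> + 1 <= 2^\<alpha>; for
  smaller primes it is at most K, and there are boundedly many of those.\<close>

lemma card_divisors_le:
  fixes \<delta> :: real
  assumes "\<delta> > 0"
  obtains C where "C > 0" "\<And>n. n > 0 \<Longrightarrow> real (card {r :: nat. r dvd n}) \<le> C * real n powr \<delta>"
proof -
  define K where "K = 1 / min 1 (\<delta> * ln 2)"
  define B where "B = 2 powr (1 / \<delta>)"
  have K: "K \<ge> 1" using assms by (auto simp: K_def min_def)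
  let ?P = "\<lambda>n. {p. prime p \<and> p dvd n \<and> real p < B}"
  have fin: "finite (?P n)" for n
    by (rule finite_subset[of _ "{..nat \<lceil>B\<rceil>}"]) (auto, linarith)
  \<comment> \<open>Induction on n, splitting off one prime with its full multiplicity; the exponent
    of K counts the small primes dividing n.\<close>
  have main: "real (card {r. r dvd n}) \<le> K ^ card (?P n) * real n powr \<delta>" if "n > 0" for n :: nat
    using that
  proof (induction n rule: less_induct)
    case (less n)
    show ?case
    proof (cases "n = 1")
      case False
      then obtain p where p: "prime p" "p dvd n" using prime_factor_nat by blast
      define \<alpha> where "\<alpha> = multiplicity p n"
      have nz: "n \<noteq> 0" and nu: "\<not> is_unit p" using less.prems p not_prime_unit by auto
      obtain m where m: "n = p ^ \<alpha> * m" "\<not> p dvd m"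
        unfolding \<alpha>_def by (rule multiplicity_decompose'[OF nz nu])
      have \<alpha>: "\<alpha> > 0" using p less.prems by (simp add: \<alpha>_def prime_multiplicity_gt_zero_iff)
      have p1: "p > 1" using p(1) by (rule prime_gt_1_nat)
      have m0: "m > 0" using m(2) by (cases m) auto
      have "1 < p ^ \<alpha>" using p1 \<alpha> by (rule one_less_power)
      hence mn: "m < n" using m0 m(1) by simp
      have qdvd: "q dvd n \<longleftrightarrow> q = p \<or> q dvd m" if "prime q" for q
        unfolding m(1) using that p(1) \<alpha> by (auto simp: prime_dvd_mult_iff prime_dvd_power_iff primes_dvd_imp_eq)
      have "{r. r dvd n} \<subseteq> (\<lambda>(i, r). p ^ i * r) ` ({..\<alpha>} \<times> {r. r dvd m})"
      proof
        fix r assume "r \<in> {r. r dvd n}"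
        hence "r dvd p ^ \<alpha> * m" using m(1) by simp
        then obtain x y where xy: "r = x * y" "x dvd p ^ \<alpha>" "y dvd m" by (meson division_decomp)
        then obtain i where "i \<le> \<alpha>" "x = p ^ i" using p(1) by (auto simp: divides_primepow_nat)
        thus "r \<in> (\<lambda>(i, r). p ^ i * r) ` ({..\<alpha>} \<times> {r. r dvd m})" using xy by auto
      qed
      hence "card {r. r dvd n} \<le> card ((\<lambda>(i, r). p ^ i * r) ` ({..\<alpha>} \<times> {r. r dvd m}))"
        using m0 by (intro card_mono) auto
      also have "\<dots> \<le> card ({..\<alpha>} \<times> {r. r dvd m})" using m0 by (intro card_image_le) auto
      also have "\<dots> = (\<alpha> + 1) * card {r. r dvd m}" by (simp add: card_cartesian_product)
      finally have "real (card {r. r dvd n}) \<le> real (\<alpha> + 1) * real (card {r. r dvd m})"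
        by (metis of_nat_le_iff of_nat_mult)
      also have "\<dots> \<le> real (\<alpha> + 1) * (K ^ card (?P m) * real m powr \<delta>)"
        using less.IH[OF mn m0] by (intro mult_left_mono) auto
      also have "\<dots> \<le> ((if real p < B then K else 1) * real (p ^ \<alpha>) powr \<delta>) * (K ^ card (?P m) * real m powr \<delta>)"
      proof (rule mult_right_mono)
        have eq: "real (p ^ \<alpha>) powr \<delta> = real p powr (\<delta> * \<alpha>)"
          using p1 by (simp add: powr_realpow[symmetric] powr_powr mult_ac)
        show "real (\<alpha> + 1) \<le> (if real p < B then K else 1) * real (p ^ \<alpha>) powr \<delta>"
        proof (cases "real p < B")
          case True
          have "real (\<alpha> + 1) \<le> K * 2 powr (\<delta> * \<alpha>)" unfolding K_def by (rule Suc_le_powr_divisor[OF assms])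
          also have "\<dots> \<le> K * real p powr (\<delta> * \<alpha>)"
            using p1 K assms by (intro mult_left_mono powr_mono2) auto
          finally show ?thesis using True eq by simp
        next
          case False
          have "real (\<alpha> + 1) \<le> 2 ^ \<alpha>" using less_exp[of \<alpha>] by (metis Suc_eq_plus1 Suc_leI of_nat_le_iff of_nat_numeral of_nat_power)
          also have "\<dots> = B powr (\<delta> * \<alpha>)" using assms by (simp add: B_def powr_powr powr_realpow)
          also have "\<dots> \<le> real p powr (\<delta> * \<alpha>)" using False assms by (intro powr_mono2) (auto simp: B_def)
          finally show ?thesis using False eq by simp
        qed
      qed (use K in auto)
      also have "\<dots> = ((if real p < B then K else 1) * K ^ card (?P m)) * real n powr \<delta>"
        unfolding m(1) of_nat_mult by (subst powr_mult) (auto simp: mult_ac)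
      also have "(if real p < B then K else 1) * K ^ card (?P m) = K ^ card (?P n)"
      proof (cases "real p < B")
        case True
        have "?P n = insert p (?P m)" using p(1) True qdvd by auto
        moreover have "p \<notin> ?P m" using m(2) by auto
        ultimately show ?thesis using True fin[of m] by simp
      next
        case False
        have "?P n = ?P m" using p(1) False qdvd by auto
        thus ?thesis using False by simp
      qed
      finally show ?thesis .
    qed (use K in auto)
  qed
  have "card (?P n) \<le> nat \<lceil>B\<rceil> + 1" for n
  proof -
    have "card (?P n) \<le> card {..nat \<lceil>B\<rceil>}" by (intro card_mono) (auto, linarith)
    thus ?thesis by simp
  qed
  hence "K ^ card (?P n) \<le> K ^ (nat \<lceil>B\<rceil> + 1)" for n using K by (intro power_increasing) auto
  hence "real (card {r :: nat. r dvd n}) \<le> K ^ (nat \<lceil>B\<rceil> + 1) * real n powr \<delta>" if "n > 0" for n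
    using main[OF that] mult_right_mono[of "K ^ card (?P n)" "K ^ (nat \<lceil>B\<rceil> + 1)" "real n powr \<delta>"] by force
  moreover have "K ^ (nat \<lceil>B\<rceil> + 1) > 0" using K by (intro zero_less_power) simp
  ultimately show ?thesis using that by blast
qed

lemma card_int_divisors_le:
  assumes "n \<noteq> (0 :: int)"
  shows "finite {r. r dvd n}" "card {r. r dvd n} \<le> 2 * card {r :: nat. r dvd nat \<bar>n\<bar>}"
proof -
  show "finite {r. r dvd n}" using assms by simp
  have fin: "finite {r :: nat. r dvd nat \<bar>n\<bar>}" using assms by (intro finite_divisors_nat) simp
  have "{r. r dvd n} \<subseteq> (\<lambda>(s, m). s * int m) ` ({1, -1} \<times> {r. r dvd nat \<bar>n\<bar>})"
  proof
    fix r assume "r \<in> {r. r dvd n}"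
    hence "nat \<bar>r\<bar> dvd nat \<bar>n\<bar>" by (simp add: nat_dvd_iff)
    moreover have "r = (if r < 0 then -1 else 1) * int (nat \<bar>r\<bar>)" by simp
    ultimately show "r \<in> (\<lambda>(s, m). s * int m) ` ({1, -1} \<times> {r. r dvd nat \<bar>n\<bar>})"
      by (intro image_eqI[of _ _ "(if r < 0 then -1 else 1, nat \<bar>r\<bar>)"]) auto
  qed
  hence "card {r. r dvd n} \<le> card ((\<lambda>(s, m). s * int m) ` ({1, -1 :: int} \<times> {r. r dvd nat \<bar>n\<bar>}))"
    by (intro card_mono finite_imageI finite_cartesian_product fin) simp
  also have "\<dots> \<le> card ({1, -1 :: int} \<times> {r. r dvd nat \<bar>n\<bar>})"
    by (intro card_image_le finite_cartesian_product fin) simp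
  also have "\<dots> = 2 * card {r. r dvd nat \<bar>n\<bar>}" by (simp add: card_cartesian_product)
  finally show "card {r. r dvd n} \<le> 2 * card {r :: nat. r dvd nat \<bar>n\<bar>}" .
qed

section \<open>Homogeneous curves in a thin strip\<close>

lemma card_int_interval_le:
  fixes A :: "int set" and R :: real
  assumes "\<And>z. z \<in> A \<Longrightarrow> \<bar>real_of_int z\<bar> \<le> R" "R \<ge> 0"
  shows "finite A" "real (card A) \<le> 2 * R + 1"
proof -
  have sub: "A \<subseteq> {- \<lfloor>R\<rfloor>..\<lfloor>R\<rfloor>}"
  proof
    fix z assume "z \<in> A"
    hence "\<bar>real_of_int z\<bar> \<le> R" by (rule assms)
    hence "z \<le> \<lfloor>R\<rfloor>" "- z \<le> \<lfloor>R\<rfloor>" by (simp_all add: le_floor_iff abs_le_iff)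
    thus "z \<in> {- \<lfloor>R\<rfloor>..\<lfloor>R\<rfloor>}" by simp
  qed
  thus "finite A" by (rule finite_subset) simp
  have "card A \<le> card {- \<lfloor>R\<rfloor>..\<lfloor>R\<rfloor>}" using sub by (intro card_mono) auto
  also have "\<dots> = nat (2 * \<lfloor>R\<rfloor> + 1)" by simp
  finally have "real (card A) \<le> real (nat (2 * \<lfloor>R\<rfloor> + 1))" by simp
  also have "\<dots> = 2 * real_of_int \<lfloor>R\<rfloor> + 1" using assms(2) by (simp add: of_nat_nat)
  also have "\<dots> \<le> 2 * R + 1" by simp
  finally show "real (card A) \<le> 2 * R + 1" .
qed

text \<open>The points are sorted by the parallel lines in the direction (g1, g2), on which
  \<open>lam\<close> is constant; \<open>lam\<close> takes O(\<rho> X0 Y0 + 1) values. A line not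
  contained in the curve meets it in at most m points. A line contained in it has at most 4 / \<rho>
  + 1 points in the strip, and there are at most two such lines: by homogeneity, the real factor
  scaling one to another is an m-th root of unity. As c \<noteq> 0, no such line passes through the
  origin, so the scaling makes sense.\<close>

lemma card_homogeneous_curve_in_strip:
  fixes Hf :: "real \<Rightarrow> real \<Rightarrow> real" and T :: "(int \<times> int) set"
  assumes hom: "\<And>x y \<tau>. Hf (\<tau> * x) (\<tau> * y) = \<tau> ^ m * Hf x y"
    and pol: "\<And>x0 y0 x1 y1. \<exists>q. degree q \<le> m \<and> (\<forall>z. poly q z = Hf (x0 + z * x1) (y0 + z * y1))"
    and m: "m > 0" and c: "c \<noteq> 0" and T: "finite T" "\<And>x y. (x, y) \<in> T \<Longrightarrow> Hf (of_int x) (of_int y) = c"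
    and strip: "\<And>x y. (x, y) \<in> T \<Longrightarrow> \<bar>of_int x - s0 * of_int y\<bar> \<le> X0 \<and> \<bar>of_int y\<bar> \<le> Y0"
    and XY: "X0 > 0" "Y0 > 0" "\<rho> > 0"
    and g: "coprime g1 g2" "\<bar>of_int g1 - s0 * of_int g2\<bar> \<le> \<rho> * X0" "\<bar>of_int g2\<bar> \<le> \<rho> * Y0"
           "\<bar>of_int g1 - s0 * of_int g2\<bar> = \<rho> * X0 \<or> \<bar>of_int g2\<bar> = \<rho> * Y0"
  shows "real (card T) \<le> m * (4 * \<rho> * (X0 * Y0) + 1) + 2 * (4 / \<rho> + 1)"
proof -
  define lam where "lam = (\<lambda>(x, y). g1 * y - g2 * x)"
  \<comment> \<open>The coordinate \<alpha> x + \<beta> y equals 1 at (g1, g2), so it numbers the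
    lattice points of each line consecutively.\<close>
  obtain \<alpha> \<beta> where bez: "\<alpha> * g1 + \<beta> * g2 = 1" using g(1) bezout_int[of g1 g2] by auto
  define L where "L = (\<lambda>t. {P\<in>T. lam P = t})"
  define \<Lambda> where "\<Lambda> = lam ` T"
  define bad where "bad = {t\<in>\<Lambda>. card (L t) > m}"
  have finL: "finite (L t)" for t using T(1) by (simp add: L_def)
  have on_line: "\<exists>z::int. x = x0 + z * g1 \<and> y = y0 + z * g2 \<and> z = \<alpha> * x + \<beta> * y - (\<alpha> * x0 + \<beta> * y0)"
    if "lam (x, y) = lam (x0, y0)" for x y x0 y0
  proof -
    have eq: "g1 * (y - y0) = g2 * (x - x0)" using that by (simp add: lam_def algebra_simps)
    define z where "z = \<alpha> * (x - x0) + \<beta> * (y - y0)"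
    have "z * g1 = \<alpha> * g1 * (x - x0) + \<beta> * (g1 * (y - y0))" by (simp add: z_def algebra_simps)
    also have "\<dots> = (\<alpha> * g1 + \<beta> * g2) * (x - x0)" unfolding eq by (simp add: algebra_simps)
    finally have 1: "x = x0 + z * g1" using bez by simp
    have "z * g2 = \<alpha> * (g2 * (x - x0)) + \<beta> * g2 * (y - y0)" by (simp add: z_def algebra_simps)
    also have "\<dots> = (\<alpha> * g1 + \<beta> * g2) * (y - y0)" unfolding eq[symmetric] by (simp add: algebra_simps)
    finally have 2: "y = y0 + z * g2" using bez by simp
    have "z = \<alpha> * x + \<beta> * y - (\<alpha> * x0 + \<beta> * y0)" by (simp add: z_def algebra_simps)
    thus ?thesis using 1 2 by blast
  qed
  have inj: "inj_on (\<lambda>(x, y). \<alpha> * x + \<beta> * y - w) (L t)" for t w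
  proof (rule inj_onI, clarify)
    fix x y x' y' assume *: "(x, y) \<in> L t" "(x', y') \<in> L t" "\<alpha> * x + \<beta> * y - w = \<alpha> * x' + \<beta> * y' - w"
    hence "lam (x, y) = lam (x', y')" by (simp add: L_def)
    from on_line[OF this] obtain z where z: "x = x' + z * g1" "y = y' + z * g2" 
      "z = \<alpha> * x + \<beta> * y - (\<alpha> * x' + \<beta> * y')" by blast
    have "z = 0" using z(3) *(3) by linarith
    thus "x = x' \<and> y = y'" using z(1,2) by simp
  qed
  have card_line: "real (card (L t)) \<le> 4 / \<rho> + 1" for t
  proof (cases "L t = {}")
    case False
    then obtain x0 y0 where P0: "(x0, y0) \<in> L t" by auto
    have "card (L t) = card ((\<lambda>(x, y). \<alpha> * x + \<beta> * y - (\<alpha> * x0 + \<beta> * y0)) ` L t)"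
      by (rule card_image[OF inj, symmetric])
    also have "real \<dots> \<le> 2 * (2 / \<rho>) + 1"
    proof (rule card_int_interval_le(2))
      fix z assume "z \<in> (\<lambda>(x, y). \<alpha> * x + \<beta> * y - (\<alpha> * x0 + \<beta> * y0)) ` L t"
      then obtain x y where P: "(x, y) \<in> L t" "z = \<alpha> * x + \<beta> * y - (\<alpha> * x0 + \<beta> * y0)" by auto
      have "lam (x, y) = lam (x0, y0)" using P P0 by (simp add: L_def)
      from on_line[OF this] P(2) have xy: "x = x0 + z * g1" "y = y0 + z * g2" by auto
      note st = strip[of x y] strip[of x0 y0]
      have inT: "(x, y) \<in> T" "(x0, y0) \<in> T" using P P0 by (auto simp: L_def)
      have 1: "\<bar>real_of_int z\<bar> * \<bar>of_int g2\<bar> \<le> 2 * Y0"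
      proof -
        have "\<bar>real_of_int z\<bar> * \<bar>of_int g2\<bar> = \<bar>real_of_int y - real_of_int y0\<bar>"
          unfolding xy by (simp add: abs_mult)
        thus ?thesis using st inT by linarith
      qed
      have 2: "\<bar>real_of_int z\<bar> * \<bar>of_int g1 - s0 * of_int g2\<bar> \<le> 2 * X0"
      proof -
        have "\<bar>real_of_int z\<bar> * \<bar>of_int g1 - s0 * of_int g2\<bar> = 
           \<bar>(real_of_int x - s0 * of_int y) - (real_of_int x0 - s0 * of_int y0)\<bar>"
          unfolding xy abs_mult[symmetric] by (simp add: algebra_simps)
        thus ?thesis using st inT by linarith
      qed
      \<comment> \<open>One of the two strip coordinates of (g1, g2) attains the gauge \<rho>, and
        that coordinate limits the number z of steps along the line.\<close>
      have "\<bar>real_of_int z\<bar> * \<rho> \<le> 2"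
        using g(4)
      proof
        assume "\<bar>of_int g1 - s0 * of_int g2\<bar> = \<rho> * X0"
        hence "(\<bar>real_of_int z\<bar> * \<rho>) * X0 \<le> 2 * X0" using 2 by (simp add: mult_ac)
        thus ?thesis using XY(1) by simp
      next
        assume "\<bar>of_int g2\<bar> = \<rho> * Y0"
        hence "(\<bar>real_of_int z\<bar> * \<rho>) * Y0 \<le> 2 * Y0" using 1 by (simp add: mult_ac)
        thus ?thesis using XY(2) by simp
      qed
      thus "\<bar>real_of_int z\<bar> \<le> 2 / \<rho>" using XY(3) by (simp add: field_simps)
    qed (use XY in auto)
    finally show ?thesis by simp
  qed (use XY in auto)
  have bad_line: "\<forall>z. Hf (of_int x0 + z * of_int g1) (of_int y0 + z * of_int g2) = c"
    if "lam (x0, y0) \<in> bad" "(x0, y0) \<in> T" for x0 y0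
  proof -
    obtain q where q: "degree q \<le> m" "\<And>z. poly q z = Hf (of_int x0 + z * of_int g1) (of_int y0 + z * of_int g2)"
      using pol by blast
    let ?q = "q - [:c:]"
    let ?t = "lam (x0, y0)"
    have "?q = 0"
    proof (rule ccontr)
      assume nz: "?q \<noteq> 0"
      let ?f = "real_of_int \<circ> (\<lambda>(x, y). \<alpha> * x + \<beta> * y - (\<alpha> * x0 + \<beta> * y0))"
      have "?f ` L ?t \<subseteq> {z. poly ?q z = 0}"
      proof
        fix w assume "w \<in> ?f ` L ?t"
        then obtain x y where P: "(x, y) \<in> L ?t" 
          and w: "w = real_of_int (\<alpha> * x + \<beta> * y - (\<alpha> * x0 + \<beta> * y0))" by auto
        hence "lam (x, y) = lam (x0, y0)" by (simp add: L_def)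
        from on_line[OF this] obtain z where z: "x = x0 + z * g1" "y = y0 + z * g2" "z = \<alpha> * x + \<beta> * y - (\<alpha> * x0 + \<beta> * y0)"
          by blast
        have "poly q (of_int z) = Hf (of_int x) (of_int y)" unfolding q(2) by (simp add: z(1,2))
        also have "\<dots> = c" by (rule T(2)) (use P in \<open>simp add: L_def\<close>)
        finally show "w \<in> {z. poly ?q z = 0}" unfolding w z(3)[symmetric] by simp
      qed
      hence "card (?f ` L ?t) \<le> card {z. poly ?q z = 0}" using nz by (intro card_mono poly_roots_finite)
      also have "\<dots> \<le> degree ?q" by (rule card_poly_roots_bound[OF nz])
      also have "\<dots> \<le> m" using q(1) by (intro degree_diff_le) auto
      also have "card (?f ` L ?t) = card (L ?t)"
        by (intro card_image comp_inj_on inj) (simp add: inj_on_def)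
      finally show False using that by (simp add: bad_def)
    qed
    hence "q = [:c:]" by simp
    thus ?thesis using q(2) by simp
  qed
  have g_nz: "g1 \<noteq> 0 \<or> g2 \<noteq> 0" using bez by auto
  have kernel: "\<exists>z. x = z * real_of_int g1 \<and> y = z * real_of_int g2" 
    if "real_of_int g1 * y = real_of_int g2 * x" for x y
  proof (cases "g1 = 0")
    case True
    hence "g2 \<noteq> 0" using g_nz by simp
    thus ?thesis using that True by (intro exI[of _ "y / of_int g2"]) auto
  next
    case False
    thus ?thesis using that by (intro exI[of _ "x / of_int g1"]) (auto simp: field_simps)
  qed
  have bad_subset: "bad \<subseteq> {t, - t}" if t: "t \<in> bad" for t
  proof
    fix t' assume t': "t' \<in> bad"
    obtain x0 y0 where P: "(x0, y0) \<in> T" "t = lam (x0, y0)" using t by (auto simp: bad_def \<Lambda>_def)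
    obtain x1 y1 where P': "(x1, y1) \<in> T" "t' = lam (x1, y1)" using t' by (auto simp: bad_def \<Lambda>_def)
    have line: "\<forall>z. Hf (of_int x0 + z * of_int g1) (of_int y0 + z * of_int g2) = c"
      using bad_line P t by blast
    have line': "\<forall>z. Hf (of_int x1 + z * of_int g1) (of_int y1 + z * of_int g2) = c"
      using bad_line P' t' by blast
    have t0: "t \<noteq> 0"
    proof
      assume "t = 0"
      hence "g1 * y0 = g2 * x0" using P(2) by (simp add: lam_def)
      hence "real_of_int g1 * of_int y0 = of_int g2 * of_int x0" by (metis of_int_mult)
      then obtain z where "real_of_int x0 = z * of_int g1" "real_of_int y0 = z * of_int g2" using kernel by blast
      hence "Hf 0 0 = c" using line[rule_format, of "-z"] by simp
      moreover have "Hf 0 0 = 0" using hom[of 0 0 0] m by (simp add: power_0_left)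
      ultimately show False using c by simp
    qed
    \<comment> \<open>Scaling by \<tau> carries the line \<open>lam\<close> = t onto the line
      \<open>lam\<close> = t'. Since \<open>Hf\<close> equals c on both, \<tau>^m = 1.\<close>
    define \<tau> where "\<tau> = real_of_int t' / of_int t"
    have "real_of_int g1 * (\<tau> * of_int y0 - of_int y1) = of_int g2 * (\<tau> * of_int x0 - of_int x1)"
    proof -
      have "\<tau> * (of_int g1 * of_int y0 - of_int g2 * of_int x0) = \<tau> * of_int t"
        unfolding P(2) by (simp add: lam_def)
      also have "\<dots> = of_int g1 * of_int y1 - of_int g2 * of_int x1"
        using t0 unfolding \<tau>_def P'(2) by (simp add: lam_def)
      finally show ?thesis by (simp add: algebra_simps)
    qed
    then obtain z where "\<tau> * of_int x0 - of_int x1 = z * of_int g1" "\<tau> * of_int y0 - of_int y1 = z * of_int g2"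
      using kernel by blast
    hence "\<tau> * of_int x0 = of_int x1 + z * of_int g1" "\<tau> * of_int y0 = of_int y1 + z * of_int g2" by auto
    hence "Hf (\<tau> * of_int x0) (\<tau> * of_int y0) = c" using line' by simp
    moreover have "Hf (of_int x0) (of_int y0) = c" using line[rule_format, of 0] by simp
    ultimately have "\<tau> ^ m = 1" using hom c by simp
    hence "\<bar>\<tau>\<bar> ^ m = 1 ^ m" by (simp add: power_abs[symmetric])
    hence "\<bar>\<tau>\<bar> = 1" using m by (intro power_eq_imp_eq_base[of "\<bar>\<tau>\<bar>" m 1]) auto
    hence "\<bar>t'\<bar> = \<bar>t\<bar>" using t0 unfolding \<tau>_def by (simp add: abs_divide)
    thus "t' \<in> {t, -t}" by auto
  qed
  have card_bad: "card bad \<le> 2"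
  proof (cases "bad = {}")
    case False
    then obtain t where "t \<in> bad" by auto
    hence "card bad \<le> card {t, -t}" by (intro card_mono bad_subset) auto
    also have "\<dots> \<le> 2" by (simp add: card_insert_le_m1)
    finally show ?thesis .
  qed auto
  have fin\<Lambda>: "finite \<Lambda>" using T(1) by (simp add: \<Lambda>_def)
  have card\<Lambda>: "real (card \<Lambda>) \<le> 2 * (2 * \<rho> * (X0 * Y0)) + 1"
  proof (rule card_int_interval_le(2))
    fix t assume "t \<in> \<Lambda>"
    then obtain x y where P: "(x, y) \<in> T" "t = lam (x, y)" by (auto simp: \<Lambda>_def)
    \<comment> \<open>The determinant \<open>lam\<close> is unchanged by the shear (x, y) -> (x - s0
      y, y), which turns the strip into a box.\<close>
    have "real_of_int t = (of_int g1 - s0 * of_int g2) * of_int y - of_int g2 * (of_int x - s0 * of_int y)"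
      unfolding P(2) lam_def by (simp add: algebra_simps)
    also have "\<bar>\<dots>\<bar> \<le> \<bar>of_int g1 - s0 * of_int g2\<bar> * \<bar>of_int y\<bar> + \<bar>of_int g2\<bar> * \<bar>of_int x - s0 * of_int y\<bar>"
      unfolding abs_mult[symmetric] by (rule abs_triangle_ineq4)
    also have "\<dots> \<le> (\<rho> * X0) * Y0 + (\<rho> * Y0) * X0"
      using strip[OF P(1)] g(2,3) XY by (intro add_mono mult_mono) auto
    finally show "\<bar>real_of_int t\<bar> \<le> 2 * \<rho> * (X0 * Y0)" by (simp add: algebra_simps)
  qed (use XY in auto)
  have "T = (\<Union>t\<in>\<Lambda>. L t)" by (auto simp: \<Lambda>_def L_def)
  hence "card T \<le> (\<Sum>t\<in>\<Lambda>. card (L t))" using card_UN_le[OF fin\<Lambda>] by metis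
  hence "real (card T) \<le> (\<Sum>t\<in>\<Lambda>. real (card (L t)))" by (metis of_nat_le_iff of_nat_sum)
  also have "\<dots> \<le> (\<Sum>t\<in>\<Lambda>. real m + (if t \<in> bad then 4 / \<rho> + 1 else 0))"
  proof (rule sum_mono)
    fix t assume "t \<in> \<Lambda>"
    show "real (card (L t)) \<le> real m + (if t \<in> bad then 4 / \<rho> + 1 else 0)"
      using card_line[of t] \<open>t \<in> \<Lambda>\<close> by (cases "t \<in> bad") (auto simp: bad_def)
  qed
  also have "\<dots> = real (card \<Lambda>) * m + real (card bad) * (4 / \<rho> + 1)"
  proof -
    have "bad \<subseteq> \<Lambda>" by (auto simp: bad_def)
    thus ?thesis using fin\<Lambda> by (simp add: sum.distrib sum.If_cases Int_absorb1)
  qed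
  also have "\<dots> \<le> (2 * (2 * \<rho> * (X0 * Y0)) + 1) * m + 2 * (4 / \<rho> + 1)"
    using card\<Lambda> card_bad XY by (intro add_mono mult_right_mono) auto
  finally show ?thesis by (simp add: algebra_simps)
qed

section \<open>Forms that are linear in the second pair of variables\<close>

text \<open>The vector \<open>(g1, g2)\<close> has norm \<open>\<rho>\<close> for the gauge of the strip, so the strip contains about
  \<open>1 / \<rho>\<close> points of any line in that direction, and few such lines meet it.\<close>

definition in_strip where
  "in_strip k l h K0 H s0 X0 Y0 \<rho> S d e u v \<longleftrightarrow>
     fibres_le K0 S d e \<and> (H :: int) \<ge> 1 \<and>
     (\<forall>P\<in>S. 0 < d P \<and> d P \<le> H \<and> 0 < e P \<and> e P \<le> H \<and> 0 < u P \<and> u P \<le> H \<and> 0 < v P \<and> v P \<le> H \<and>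
        e P ^ k * v P ^ l - d P ^ k * u P ^ l = h \<and>
        \<bar>of_int (d P) - s0 * of_int (e P)\<bar> \<le> X0 \<and> of_int (e P) \<le> Y0) \<and>
     0 < X0 \<and> X0 \<le> of_int H \<and> 0 < Y0 \<and> Y0 \<le> of_int H \<and> 0 < \<rho> \<and> \<rho> * sqrt (X0 * Y0) \<le> 2 \<and>
     (\<exists>g1 g2. coprime g1 g2 \<and> \<bar>of_int g1 - s0 * of_int g2\<bar> \<le> \<rho> * X0 \<and> \<bar>of_int g2\<bar> \<le> \<rho> * (Y0 :: real) \<and>
        (\<bar>of_int g1 - s0 * of_int g2\<bar> = \<rho> * X0 \<or> \<bar>of_int g2\<bar> = \<rho> * Y0))"

lemma in_strip_subset:
  "in_strip k l h K0 H s0 X0 Y0 \<rho> S d e u v \<Longrightarrow> T \<subseteq> S \<Longrightarrow> in_strip k l h K0 H s0 X0 Y0 \<rho> T d e u v"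
  unfolding in_strip_def by (auto intro: fibres_le_subset)

lemma card_le_homogeneous_roots:
  assumes "fibres_le K S d e" "\<exists>i\<le>a. c i \<noteq> 0"
    and 0: "\<And>P. P \<in> S \<Longrightarrow> (\<Sum>i\<le>a. c i * d P ^ i * e P ^ (a - i)) = 0"
  shows "card S \<le> a * K"
proof -
  define R where "R = (\<Sum>i\<le>a. monom (real_of_int (c i)) i)"
  have coeffR: "coeff R i = (if i \<le> a then of_int (c i) else 0)" for i
    unfolding R_def by (simp add: coeff_sum)
  have "card S \<le> degree R * K"
  proof (rule card_le_roots[OF assms(1)])
    show "R \<noteq> 0" using assms(2) coeffR by (metis coeff_0 of_int_eq_0_iff)
    fix P assume P: "P \<in> S"
    hence e: "e P > 0" using assms(1) by (auto simp: fibres_le_def)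
    have "of_int (e P) ^ a * poly R (of_int (d P) / of_int (e P)) =
       (\<Sum>i\<le>a. real_of_int (c i * d P ^ i * e P ^ (a - i)))"
      unfolding R_def poly_sum poly_monom sum_distrib_left
    proof (intro sum.cong refl)
      fix i assume "i \<in> {..a}"
      hence "real_of_int (e P) ^ a = of_int (e P) ^ i * of_int (e P) ^ (a - i)" by (simp add: power_add[symmetric])
      thus "real_of_int (e P) ^ a * (real_of_int (c i) * (real_of_int (d P) / real_of_int (e P)) ^ i) =
         real_of_int (c i * d P ^ i * e P ^ (a - i))" using e by (simp add: power_divide)
    qed
    also have "\<dots> = real_of_int (\<Sum>i\<le>a. c i * d P ^ i * e P ^ (a - i))" by simp
    also have "\<dots> = 0" unfolding 0[OF P] by simp
    finally show "poly R (of_int (d P) / of_int (e P)) = 0" using e by simp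
  qed
  also have "degree R \<le> a" by (rule degree_le) (simp add: coeffR)
  finally show ?thesis by simp
qed

lemma card_le_form_0:
  assumes "fibres_le K S d e" "on_form a 0 S d e u v"
  shows "card S \<le> a * K"
proof -
  from assms(2) obtain c where c: "\<exists>i\<le>a. c i 0 \<noteq> 0" "\<And>P. P \<in> S \<Longrightarrow> form a 0 c (d P) (e P) (u P) (v P) = 0"
    unfolding on_form_def by auto
  show ?thesis
    by (rule card_le_homogeneous_roots[OF assms(1) c(1)]) (use c(2) in \<open>simp add: form_def mult.assoc\<close>)
qed

text \<open>A copy of \<open>hform\<close> with real arguments, since the scaling factor and the
  parameter on a line are real.\<close>

definition hsum :: "nat \<Rightarrow> (nat \<Rightarrow> int) \<Rightarrow> real \<Rightarrow> real \<Rightarrow> real" where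
  "hsum a c x y = (\<Sum>i\<le>a. of_int (c i) * x ^ i * y ^ (a - i))"

lemma hsum_scale: "hsum a c (\<tau> * x) (\<tau> * y) = \<tau> ^ a * hsum a c x y"
  unfolding hsum_def sum_distrib_left
proof (intro sum.cong refl)
  fix i assume "i \<in> {..a}"
  hence "\<tau> ^ a = \<tau> ^ i * \<tau> ^ (a - i)" by (simp add: power_add[symmetric])
  thus "of_int (c i) * (\<tau> * x) ^ i * (\<tau> * y) ^ (a - i) = \<tau> ^ a * (of_int (c i) * x ^ i * y ^ (a - i))"
    by (simp add: power_mult_distrib mult_ac)
qed

lemma hsum_line_poly: "\<exists>q. degree q \<le> a \<and> (\<forall>z. poly q z = hsum a c (x0 + z * x1) (y0 + z * y1))"
proof (intro exI conjI allI)
  let ?q = "\<Sum>i\<le>a. smult (of_int (c i)) ([:x0, x1:] ^ i * [:y0, y1:] ^ (a - i))"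
  show "degree ?q \<le> a"
  proof (intro degree_sum_le)
    fix i assume "i \<in> {..a}"
    have "degree ([:x0, x1:] ^ i * [:y0, y1:] ^ (a - i)) \<le> degree [:x0, x1:] * i + degree [:y0, y1:] * (a - i)"
      by (rule order.trans[OF degree_mult_le]) (intro add_mono degree_power_le)
    also have "\<dots> \<le> 1 * i + 1 * (a - i)" by (intro add_mono mult_right_mono) auto
    finally show "degree (smult (of_int (c i)) ([:x0, x1:] ^ i * [:y0, y1:] ^ (a - i))) \<le> a"
      using \<open>i \<in> {..a}\<close> by (intro order.trans[OF degree_smult_le]) auto
  qed auto
  show "poly ?q z = hsum a c (x0 + z * x1) (y0 + z * y1)" for z
    by (simp add: hsum_def poly_sum mult.assoc)
qed

lemma card_le_mult_card_image:
  assumes "finite S" "\<And>y. y \<in> f ` S \<Longrightarrow> card {P\<in>S. f P = y} \<le> K"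
  shows "card S \<le> K * card (f ` S)"
proof -
  have "S = (\<Union>y\<in>f ` S. {P\<in>S. f P = y})" by auto
  hence "card S \<le> (\<Sum>y\<in>f ` S. card {P\<in>S. f P = y})"
    using card_UN_le[of "f ` S" "\<lambda>y. {P\<in>S. f P = y}"] assms(1) by simp
  also have "\<dots> \<le> (\<Sum>y\<in>f ` S. K)" using assms(2) by (rule sum_mono)
  finally show ?thesis by (simp add: mult.commute)
qed

definition hform :: "nat \<Rightarrow> (nat \<Rightarrow> int) \<Rightarrow> int \<Rightarrow> int \<Rightarrow> int" where
  "hform a c x y = (\<Sum>i\<le>a. c i * x ^ i * y ^ (a - i))"

lemma hsum_of_int: "hsum a c (of_int x) (of_int y) = of_int (hform a c x y)"
  by (simp add: hsum_def hform_def)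

lemma form_1_eq: "form a 1 c d e u v = hform a (\<lambda>i. c i 0) d e * u + hform a (\<lambda>i. c i 1) d e * v"
  unfolding form_def hform_def sum_distrib_right sum.distrib[symmetric]
  by (intro sum.cong refl) (simp add: algebra_simps)

text \<open>Let A1, A2 be the two coefficient forms and u = g u', v = g v' with u', v' coprime. From
  A1 u + A2 v = 0 follow A2 = r u' and A1 = - r v' for some r, and multiplying the equation of the
  solutions by (r / g)^l gives e^k (- A1)^l - d^k A2^l = (r / g)^l h. Here r divides A1 and A2,
  hence N0, and g divides h. So the points (d, e) lie on few level sets of one homogeneous
  polynomial \<open>Hf\<close> of degree k + l a.\<close>

lemma card_linear_form_divisors:
  fixes h :: int
  assumes k: "k > 0" and l: "l > 0" and h: "h \<noteq> 0"
    and st: "in_strip k l h K0 H s0 X0 Y0 \<rho> S d e u v"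
    and 0: "\<And>P. P \<in> S \<Longrightarrow> form a 1 c (d P) (e P) (u P) (v P) = 0"
    and N0: "N0 \<noteq> 0"
    and dvd: "\<And>P r. P \<in> S \<Longrightarrow> r dvd hform a (\<lambda>i. c i 0) (d P) (e P) \<Longrightarrow> r dvd hform a (\<lambda>i. c i 1) (d P) (e P) \<Longrightarrow> r dvd N0"
  shows "real (card S) \<le> real (card {r. r dvd N0} * card {g. g dvd h} * K0 * (8 * (k + l * a) + 8)) *
           (sqrt (X0 * Y0) + 1 + 1 / \<rho>)"
proof -
  let ?A1 = "\<lambda>P. hform a (\<lambda>i. c i 0) (d P) (e P)" and ?A2 = "\<lambda>P. hform a (\<lambda>i. c i 1) (d P) (e P)"
  define m where "m = k + l * a"
  define Hf where "Hf x y = y ^ k * (- hsum a (\<lambda>i. c i 0) x y) ^ l - x ^ k * hsum a (\<lambda>i. c i 1) x y ^ l" for x y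
  define R where "R = {r. r dvd N0}"
  define G where "G = {g. g dvd h}"
  define val where "val = (\<lambda>(r, g). real_of_int (r ^ l * h) / of_int (g ^ l))"
  define T where "T p = {P\<in>S. Hf (of_int (d P)) (of_int (e P)) = val p}" for p
  define B where "B = sqrt (X0 * Y0) + 1 + 1 / \<rho>"
  have fib: "fibres_le K0 S d e" and XY: "X0 > 0" "Y0 > 0" "\<rho> > 0" "\<rho> * sqrt (X0 * Y0) \<le> 2"
    using st by (auto simp: in_strip_def)
  have finS: "finite S" using fib by (simp add: fibres_le_def)
  have B: "B \<ge> 1" using XY by (simp add: B_def)
  have finRG: "finite R" "finite G" using N0 h by (simp_all add: R_def G_def)
  have cover: "S \<subseteq> (\<Union>p\<in>R \<times> G. T p)"
  proof
    fix P assume P: "P \<in> S"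
    have pos: "u P > 0" "v P > 0" and eq: "e P ^ k * v P ^ l - d P ^ k * u P ^ l = h"
      using st P by (auto simp: in_strip_def)
    have lin: "?A1 P * u P + ?A2 P * v P = 0" using 0[OF P] unfolding form_1_eq .
    define g where "g = gcd (u P) (v P)"
    have g: "g > 0" using pos by (simp add: g_def)
    have "gcd (u P) (v P) \<noteq> 0" using pos by simp
    from gcd_coprime_exists[OF this] obtain u' v' where uv: "u P = u' * g" "v P = v' * g" "coprime u' v'"
      unfolding g_def by blast
    have u': "u' \<noteq> 0" using uv pos by auto
    have "g * (?A1 P * u' + ?A2 P * v') = 0" using lin uv by (simp add: algebra_simps)
    hence lin': "?A1 P * u' + ?A2 P * v' = 0" using g by simp
    hence "?A2 P * v' = u' * (- ?A1 P)" by (simp add: algebra_simps)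
    hence "u' dvd ?A2 P * v'" by (metis dvd_triv_left)
    hence "u' dvd ?A2 P" using uv(3) coprime_dvd_mult_left_iff by blast
    then obtain r where r2: "?A2 P = u' * r" by (auto simp: dvd_def)
    have "u' * (?A1 P + r * v') = 0" using lin' unfolding r2 by (simp add: algebra_simps)
    hence r1: "?A1 P = - (r * v')" using u' by simp
    have rR: "r \<in> R" unfolding R_def using dvd[OF P, of r] r1 r2 by simp
    have "g ^ l * (e P ^ k * v' ^ l - d P ^ k * u' ^ l) = h"
      using eq unfolding uv by (simp add: power_mult_distrib algebra_simps)
    hence "g ^ l dvd h" by (metis dvd_triv_left)
    hence gG: "g \<in> G" using l unfolding G_def by (metis dvd_power dvd_trans mem_Collect_eq)
    have "(e P ^ k * (r * v') ^ l - d P ^ k * (u' * r) ^ l) * g ^ l = r ^ l * h"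
      unfolding eq[symmetric] uv by (simp add: power_mult_distrib algebra_simps)
    hence "real_of_int ((e P ^ k * (r * v') ^ l - d P ^ k * (u' * r) ^ l) * g ^ l) = of_int (r ^ l * h)"
      by (simp only:)
    hence "real_of_int (e P ^ k * (r * v') ^ l - d P ^ k * (u' * r) ^ l) = val (r, g)"
      using g unfolding val_def by (simp add: field_simps)
    hence "Hf (of_int (d P)) (of_int (e P)) = val (r, g)"
      unfolding Hf_def hsum_of_int r1 r2 by simp
    thus "P \<in> (\<Union>p\<in>R \<times> G. T p)" using P rR gG by (auto simp: T_def)
  qed
  have piece: "real (card (T p)) \<le> K0 * ((8 * m + 8) * B)" if p: "p \<in> R \<times> G" for p
  proof -
    let ?f = "\<lambda>P. (d P, e P)"
    have "card (T p) \<le> K0 * card (?f ` T p)"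
    proof (rule card_le_mult_card_image)
      show "finite (T p)" using finS by (simp add: T_def)
      fix y assume "y \<in> ?f ` T p"
      then obtain P0 where P0: "P0 \<in> S" "y = ?f P0" by (auto simp: T_def)
      have "card {P \<in> T p. ?f P = y} \<le> card {P\<in>S. d P * e P0 = d P0 * e P}"
        using finS P0 by (intro card_mono) (auto simp: T_def)
      also have "\<dots> \<le> K0" using fib P0(1) by (auto simp: fibres_le_def)
      finally show "card {P \<in> T p. ?f P = y} \<le> K0" .
    qed
    moreover have "real (card (?f ` T p)) \<le> m * (4 * \<rho> * (X0 * Y0) + 1) + 2 * (4 / \<rho> + 1)"
    proof -
      obtain g1 g2 where g: "coprime g1 g2" "\<bar>of_int g1 - s0 * of_int g2\<bar> \<le> \<rho> * X0" "\<bar>of_int g2\<bar> \<le> \<rho> * Y0"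
         "\<bar>of_int g1 - s0 * of_int g2\<bar> = \<rho> * X0 \<or> \<bar>of_int g2\<bar> = \<rho> * Y0"
        using st unfolding in_strip_def by blast
      show ?thesis
      proof (rule card_homogeneous_curve_in_strip[where Hf = Hf and c = "val p", OF _ _ _ _ _ _ _ XY(1-3) g])
        show "Hf (\<tau> * x) (\<tau> * y) = \<tau> ^ m * Hf x y" for x y \<tau>
        proof -
          have eq: "\<tau> ^ m = \<tau> ^ k * (\<tau> ^ a) ^ l"
            by (simp add: m_def power_add power_mult[symmetric] mult.commute)
          have neg: "- (\<tau> ^ a * t) = \<tau> ^ a * (- t)" for t by simp
          show ?thesis unfolding Hf_def hsum_scale neg power_mult_distrib eq right_diff_distrib
            by (simp only: mult_ac)
        qed
        show "\<exists>q. degree q \<le> m \<and> (\<forall>z. poly q z = Hf (x0 + z * x1) (y0 + z * y1))" for x0 y0 x1 y1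
        proof -
          obtain q1 where q1: "degree q1 \<le> a" "\<And>z. poly q1 z = hsum a (\<lambda>i. c i 0) (x0 + z * x1) (y0 + z * y1)"
            using hsum_line_poly by blast
          obtain q2 where q2: "degree q2 \<le> a" "\<And>z. poly q2 z = hsum a (\<lambda>i. c i 1) (x0 + z * x1) (y0 + z * y1)"
            using hsum_line_poly by blast
          have lin: "degree [:x, y:] \<le> 1" for x y :: real by simp
          have deg: "degree ([:x, y:] ^ k * q ^ l) \<le> m" if "degree q \<le> a" for x y :: real and q
          proof -
            have "degree ([:x, y:] ^ k * q ^ l) \<le> degree [:x, y:] * k + degree q * l"
              by (rule order.trans[OF degree_mult_le]) (intro add_mono degree_power_le)
            also have "\<dots> \<le> 1 * k + a * l" using that lin[of x y] by (intro add_mono mult_right_mono) auto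
            finally show ?thesis by (simp add: m_def mult.commute)
          qed
          let ?q = "[:y0, y1:] ^ k * (- q1) ^ l - [:x0, x1:] ^ k * q2 ^ l"
          have "degree ?q \<le> m" using q1 q2 by (intro degree_diff_le deg) auto
          moreover have "poly ?q z = Hf (x0 + z * x1) (y0 + z * y1)" for z
            unfolding Hf_def q1(2)[symmetric] q2(2)[symmetric] by simp
          ultimately show ?thesis by blast
        qed
        show "m > 0" using k by (simp add: m_def)
        have "fst p \<noteq> 0" "snd p \<noteq> 0" using p N0 h by (auto simp: R_def G_def)
        thus "val p \<noteq> 0" using h by (auto simp: val_def split: prod.splits)
        show "finite (?f ` T p)" using finS by (simp add: T_def)
        show "Hf (of_int x) (of_int y) = val p" if "(x, y) \<in> ?f ` T p" for x y
          using that by (auto simp: T_def)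
        show "\<bar>of_int x - s0 * of_int y\<bar> \<le> X0 \<and> \<bar>of_int y\<bar> \<le> Y0" if xy: "(x, y) \<in> ?f ` T p" for x y
        proof -
          obtain P where "P \<in> S" "x = d P" "y = e P" using xy by (auto simp: T_def)
          thus ?thesis using st by (auto simp: in_strip_def)
        qed
      qed
    qed
    \<comment> \<open>The normalisation \<rho> sqrt (X0 Y0) <= 2 in \<open>in_strip\<close> makes
      \<rho> X0 Y0 at most of the order sqrt (X0 Y0).\<close>
    moreover have "m * (4 * \<rho> * (X0 * Y0) + 1) + 2 * (4 / \<rho> + 1) \<le> (8 * m + 8) * B"
    proof -
      have "\<rho> * (X0 * Y0) = (\<rho> * sqrt (X0 * Y0)) * sqrt (X0 * Y0)"
        using XY by simp
      also have "\<dots> \<le> 2 * sqrt (X0 * Y0)" using XY by (intro mult_right_mono) auto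
      finally have "4 * (\<rho> * (X0 * Y0)) \<le> 8 * sqrt (X0 * Y0)" by linarith
      hence 1: "4 * \<rho> * (X0 * Y0) \<le> 8 * sqrt (X0 * Y0)" by (subst mult.assoc)
      have "1 / \<rho> > 0" using XY by simp
      moreover have "x + 1 \<le> 8 * (y + 1 + z)" if "x \<le> 8 * y" "z > 0" for x y z :: real
        using that by argo
      ultimately have "4 * \<rho> * (X0 * Y0) + 1 \<le> 8 * B" unfolding B_def using 1 by blast
      hence "m * (4 * \<rho> * (X0 * Y0) + 1) \<le> m * (8 * B)" by (intro mult_left_mono) auto
      moreover have "2 * (4 / \<rho> + 1) \<le> 8 * B" using XY by (simp add: B_def)
      ultimately show ?thesis by (simp add: algebra_simps)
    qed
    ultimately have T: "card (T p) \<le> K0 * card (?f ` T p)" "real (card (?f ` T p)) \<le> (8 * m + 8) * B"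
      by linarith+
    have "real (card (T p)) \<le> real (K0 * card (?f ` T p))" using T(1) by (simp only: of_nat_le_iff)
    also have "\<dots> \<le> K0 * ((8 * m + 8) * B)" using T(2) by (simp add: mult_left_mono)
    finally show ?thesis .
  qed
  have "card S \<le> card (\<Union>p\<in>R \<times> G. T p)"
    using cover finS finRG by (intro card_mono) (auto simp: T_def)
  also have "\<dots> \<le> (\<Sum>p\<in>R \<times> G. card (T p))" using finRG by (intro card_UN_le) auto
  finally have "real (card S) \<le> real (\<Sum>p\<in>R \<times> G. card (T p))" by (simp only: of_nat_le_iff)
  also have "\<dots> = (\<Sum>p\<in>R \<times> G. real (card (T p)))" by (rule of_nat_sum)
  also have "\<dots> \<le> (\<Sum>p\<in>R \<times> G. K0 * ((8 * m + 8) * B))" by (rule sum_mono[OF piece])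
  also have "\<dots> = real (card R * card G * K0 * (8 * m + 8)) * B" by (simp add: card_cartesian_product)
  finally show ?thesis unfolding R_def G_def m_def B_def .
qed

text \<open>N0 is at most a constant times a power of H, so it has O(H^\<delta>) divisors when the
  divisor bound is applied with exponent \<delta> / (C2 + 1). The resulting constant depends on C1
  and C2 but not on N0 or on the coefficients of the form.\<close>

lemma card_linear_form_nonsingular:
  fixes h :: int and \<delta> :: real and C1 :: int
  assumes k: "k > 0" and l: "l > 0" and h: "h \<noteq> 0" and \<delta>: "\<delta> > 0" and C1: "C1 > 0"
  shows "\<exists>K\<ge>0. \<forall>(S :: 'p set) d e u v H s0 X0 Y0 \<rho> c N0.
     in_strip k l h K0 H s0 X0 Y0 \<rho> S d e u v \<and> (\<forall>P\<in>S. form a 1 c (d P) (e P) (u P) (v P) = 0) \<and>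
     N0 \<noteq> 0 \<and> \<bar>N0\<bar> \<le> C1 * H ^ C2 \<and>
     (\<forall>P\<in>S. \<forall>r. r dvd hform a (\<lambda>i. c i 0) (d P) (e P) \<and> r dvd hform a (\<lambda>i. c i 1) (d P) (e P) \<longrightarrow> r dvd N0) \<longrightarrow>
     real (card S) \<le> K * of_int H powr \<delta> * (sqrt (X0 * Y0) + 1 + 1 / \<rho>)"
proof -
  define \<delta>' where "\<delta>' = \<delta> / (C2 + 1)"
  have \<delta>': "\<delta>' > 0" "C2 * \<delta>' \<le> \<delta>" using \<delta> by (auto simp: \<delta>'_def field_simps)
  obtain C where C: "C > 0" "\<And>n. n > 0 \<Longrightarrow> real (card {r :: nat. r dvd n}) \<le> C * real n powr \<delta>'"
    using card_divisors_le[OF \<delta>'(1)] by blast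
  define Q where "Q = real (card {g. g dvd h} * K0 * (8 * (k + l * a) + 8))"
  define K where "K = 2 * C * of_int C1 powr \<delta>' * Q"
  show ?thesis
  proof (intro exI[of _ K] conjI allI impI, goal_cases)
    case 1
    show ?case using C(1) by (simp add: K_def Q_def)
  next
    case (2 S d e u v H s0 X0 Y0 \<rho> c N0)
    hence st: "in_strip k l h K0 H s0 X0 Y0 \<rho> S d e u v" and N0: "N0 \<noteq> 0" "\<bar>N0\<bar> \<le> C1 * H ^ C2" by auto
    have H: "H \<ge> 1" using st by (simp add: in_strip_def)
    have \<rho>: "\<rho> > 0" "X0 > 0" "Y0 > 0" using st by (auto simp: in_strip_def)
    have "real (card S) \<le> real (card {r. r dvd N0} * card {g. g dvd h} * K0 * (8 * (k + l * a) + 8)) *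
           (sqrt (X0 * Y0) + 1 + 1 / \<rho>)"
      by (rule card_linear_form_divisors[OF k l h st]) (use 2 in auto)
    also have "\<dots> = real (card {r. r dvd N0}) * (Q * (sqrt (X0 * Y0) + 1 + 1 / \<rho>))" by (simp add: Q_def mult_ac)
    also have "\<dots> \<le> (2 * C * of_int C1 powr \<delta>' * of_int H powr \<delta>) * (Q * (sqrt (X0 * Y0) + 1 + 1 / \<rho>))"
    proof (rule mult_right_mono)
      have "real (card {r. r dvd N0}) \<le> 2 * real (card {r :: nat. r dvd nat \<bar>N0\<bar>})"
        using card_int_divisors_le(2)[OF N0(1)] by linarith
      also have "\<dots> \<le> 2 * (C * real (nat \<bar>N0\<bar>) powr \<delta>')" using C(2)[of "nat \<bar>N0\<bar>"] N0(1) by simp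
      also have "\<dots> \<le> 2 * (C * (of_int C1 * of_int H ^ C2) powr \<delta>')"
      proof -
        have "real (nat \<bar>N0\<bar>) = of_int \<bar>N0\<bar>" by simp
        also have "\<dots> \<le> of_int (C1 * H ^ C2)" using N0(2) by (simp only: of_int_le_iff)
        finally have "real (nat \<bar>N0\<bar>) \<le> of_int C1 * of_int H ^ C2" by simp
        thus ?thesis using C(1) \<delta>'(1) by (intro mult_left_mono powr_mono2) auto
      qed
      also have "(of_int C1 * of_int H ^ C2 :: real) powr \<delta>' = of_int C1 powr \<delta>' * of_int H powr (C2 * \<delta>')"
        using H C1 by (simp add: powr_mult powr_powr powr_realpow[symmetric])
      also have "\<dots> \<le> of_int C1 powr \<delta>' * of_int H powr \<delta>"
        using H \<delta>' by (intro mult_left_mono powr_mono) auto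
      finally show "real (card {r. r dvd N0}) \<le> 2 * C * of_int C1 powr \<delta>' * of_int H powr \<delta>"
        using C(1) by (simp add: mult_ac)
    qed (use \<rho> in \<open>auto simp: Q_def intro!: mult_nonneg_nonneg add_nonneg_nonneg\<close>)
    finally show ?case by (simp add: K_def mult_ac)
  qed
qed

lemma sylvester_apply:
  fixes c :: "nat \<Rightarrow> nat \<Rightarrow> int"
  assumes n: "n > 0"
  defines "M \<equiv> sylvester_mat_sub n n (\<Sum>i\<le>n. monom (c i 0) i) (\<Sum>i\<le>n. monom (c i 1) i)"
  shows "\<And>i. i < n + n \<Longrightarrow> (\<Sum>j<n+n. M $$ (i, j) * (x ^ (n + n - 1 - j) * y ^ j)) =
     (if i < n then x ^ (n - 1 - i) * y ^ i * hform n (\<lambda>i. c i 0) x y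
      else x ^ (n + n - 1 - i) * y ^ (i - n) * hform n (\<lambda>i. c i 1) x y)"
    and "\<And>B i j. (\<And>i j. \<bar>c i j\<bar> \<le> B) \<Longrightarrow> i < n + n \<Longrightarrow> j < n + n \<Longrightarrow> \<bar>M $$ (i, j)\<bar> \<le> B"
proof -
  have coeff_c: "coeff (\<Sum>i\<le>n. monom (c i t) i) k = (if k \<le> n then c k t else 0)" for t k
    by (simp add: coeff_sum)
  have deg: "degree (\<Sum>i\<le>n. monom (c i t) i) \<le> n" for t
    by (rule degree_le) (simp add: coeff_c)
  show "(\<Sum>j<n+n. M $$ (i, j) * (x ^ (n + n - 1 - j) * y ^ j)) =
     (if i < n then x ^ (n - 1 - i) * y ^ i * hform n (\<lambda>i. c i 0) x y
      else x ^ (n + n - 1 - i) * y ^ (i - n) * hform n (\<lambda>i. c i 1) x y)" if "i < n + n" for i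
    unfolding M_def by (subst sylvester_row_sum[OF that deg deg]) (simp add: coeff_c hform_def)
  show "\<bar>M $$ (i, j)\<bar> \<le> B" if "\<And>i j. \<bar>c i j\<bar> \<le> B" "i < n + n" "j < n + n" for B i j
  proof -
    have "B \<ge> 0" using that(1)[of 0 0] by linarith
    thus ?thesis unfolding M_def by (subst sylvester_mat_sub_index[OF that(2,3)]) (auto simp: coeff_c that(1))
  qed
qed

text \<open>Induction on the degree in (d, e) through the Sylvester matrix M of the coefficient
  forms A1, A2 of degree n. If det M \<noteq> 0, a common divisor r of A1 and A2 divides det M
  d^(2n-1) and det M e^(2n-1), hence det M h^(2n-1), because gcd (d, e) divides h; this is a
  suitable N0. If det M = 0, a left kernel vector gives forms X, Y of degree n - 1 with X A1 + Y A2
  = 0, and then Y u - X v = 0 wherever A2 \<noteq> 0, which is a linear form of smaller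
  degree.\<close>

lemma card_linear_form:
  fixes h :: int and \<delta> :: real
  assumes k: "k > 0" and l: "l > 0" and h: "h \<noteq> 0" and \<delta>: "\<delta> > 0"
  shows "\<exists>K\<ge>0. \<forall>(S :: 'p set) d e u v H s0 X0 Y0 \<rho>.
     in_strip k l h K0 H s0 X0 Y0 \<rho> S d e u v \<and> on_form a 1 S d e u v \<longrightarrow>
     real (card S) \<le> K * of_int H powr \<delta> * (sqrt (X0 * Y0) + 1 + 1 / \<rho>)"
proof (induction a)
  case IH: 0
  obtain K where K: "K \<ge> 0" "\<forall>(S :: 'p set) d e u v H s0 X0 Y0 \<rho> c N0.
     in_strip k l h K0 H s0 X0 Y0 \<rho> S d e u v \<and> (\<forall>P\<in>S. form 0 1 c (d P) (e P) (u P) (v P) = 0) \<and>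
     N0 \<noteq> 0 \<and> \<bar>N0\<bar> \<le> fact 2 * H ^ 2 \<and>
     (\<forall>P\<in>S. \<forall>r. r dvd hform 0 (\<lambda>i. c i 0) (d P) (e P) \<and> r dvd hform 0 (\<lambda>i. c i 1) (d P) (e P) \<longrightarrow> r dvd N0) \<longrightarrow>
     real (card S) \<le> K * of_int H powr \<delta> * (sqrt (X0 * Y0) + 1 + 1 / \<rho>)"
    using card_linear_form_nonsingular[OF k l h \<delta>, of "fact 2" K0 0 2] by auto
  show ?case
  proof (intro exI[of _ K] conjI allI impI K(1), elim conjE)
    fix S :: "'p set" and d e u v H s0 X0 Y0 \<rho>
    assume st: "in_strip k l h K0 H s0 X0 Y0 \<rho> S d e u v" and on: "on_form 0 1 S d e u v"
    have H: "H \<ge> 1" and \<rho>: "\<rho> > 0" and XY: "X0 > 0" "Y0 > 0" using st by (auto simp: in_strip_def)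
    show "real (card S) \<le> K * of_int H powr \<delta> * (sqrt (X0 * Y0) + 1 + 1 / \<rho>)"
    proof (cases "S = {}")
      case True
      thus ?thesis using K(1) \<rho> XY by simp
    next
      case False
      obtain c where c: "\<exists>i\<le>0. \<exists>j\<le>1. c i j \<noteq> 0"
        "\<And>i j. \<bar>c i j\<bar> \<le> fact ((0 + 1) * (1 + 1)) * (H ^ (0 + 1)) ^ ((0 + 1) * (1 + 1))"
        "\<And>P. P \<in> S \<Longrightarrow> form 0 1 c (d P) (e P) (u P) (v P) = 0"
        by (rule on_form_small_coeffs[OF on H]) (use st in \<open>auto simp: in_strip_def\<close>)
      have lin: "c 0 0 * u P + c 0 1 * v P = 0" if "P \<in> S" for P
        using c(3)[OF that] unfolding form_1_eq by (simp add: hform_def)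
      \<comment> \<open>In degree 0 both coefficients are constants, and \<open>c 0 1\<close> itself
        serves as N0.\<close>
      have "c 0 1 \<noteq> 0"
      proof
        assume 0: "c 0 1 = 0"
        obtain P where P: "P \<in> S" using False by auto
        have "u P > 0" using st P by (auto simp: in_strip_def)
        hence "c 0 0 = 0" using lin[OF P] 0 by auto
        thus False using c(1) 0 by (auto simp: le_Suc_eq)
      qed
      moreover have "\<bar>c 0 1\<bar> \<le> fact 2 * H ^ 2" using c(2)[of 0 1] by (simp add: numeral_2_eq_2)
      moreover have "\<forall>P\<in>S. \<forall>r. r dvd hform 0 (\<lambda>i. c i 0) (d P) (e P) \<and> r dvd hform 0 (\<lambda>i. c i 1) (d P) (e P) \<longrightarrow> r dvd c 0 1"
        by (simp add: hform_def)
      ultimately show ?thesis using K(2) st c(3) by blast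
    qed
  qed
next
  case (Suc a)
  define n where "n = Suc a"
  have n: "n > 0" by (simp add: n_def)
  define N where "N = (n + 1) * 2"
  define C1 :: int where "C1 = fact (n + n) * fact N ^ (n + n) * \<bar>h\<bar> ^ (n + n - 1)"
  define C2 where "C2 = (n + 1) * N * (n + n)"
  have C1: "C1 > 0" using h by (simp add: C1_def)
  obtain K1 where K1: "K1 \<ge> 0" "\<forall>(S :: 'p set) d e u v H s0 X0 Y0 \<rho>.
     in_strip k l h K0 H s0 X0 Y0 \<rho> S d e u v \<and> on_form a 1 S d e u v \<longrightarrow>
     real (card S) \<le> K1 * of_int H powr \<delta> * (sqrt (X0 * Y0) + 1 + 1 / \<rho>)"
    using Suc.IH by blast
  obtain K2 where K2: "K2 \<ge> 0" "\<forall>(S :: 'p set) d e u v H s0 X0 Y0 \<rho> c N0.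
     in_strip k l h K0 H s0 X0 Y0 \<rho> S d e u v \<and> (\<forall>P\<in>S. form n 1 c (d P) (e P) (u P) (v P) = 0) \<and>
     N0 \<noteq> 0 \<and> \<bar>N0\<bar> \<le> C1 * H ^ C2 \<and>
     (\<forall>P\<in>S. \<forall>r. r dvd hform n (\<lambda>i. c i 0) (d P) (e P) \<and> r dvd hform n (\<lambda>i. c i 1) (d P) (e P) \<longrightarrow> r dvd N0) \<longrightarrow>
     real (card S) \<le> K2 * of_int H powr \<delta> * (sqrt (X0 * Y0) + 1 + 1 / \<rho>)"
    using card_linear_form_nonsingular[OF k l h \<delta> C1, of K0 n C2] by blast
  define K where "K = K1 + K2 + n * K0"
  show ?case unfolding n_def[symmetric]
  proof (intro exI[of _ K] conjI allI impI, goal_cases)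
    case 1
    show ?case using K1(1) K2(1) by (simp add: K_def)
  next
    case (2 S d e u v H s0 X0 Y0 \<rho>)
    hence st: "in_strip k l h K0 H s0 X0 Y0 \<rho> S d e u v" and on: "on_form n 1 S d e u v" by auto
    have H: "H \<ge> 1" and \<rho>: "\<rho> > 0" and XY: "X0 > 0" "Y0 > 0" and fib: "fibres_le K0 S d e"
      using st by (auto simp: in_strip_def)
    have finS: "finite S" using fib by (simp add: fibres_le_def)
    define B where "B = of_int H powr \<delta> * (sqrt (X0 * Y0) + 1 + 1 / \<rho>)"
    have B: "B \<ge> 1" 
    proof -
      have "1 * 1 \<le> B" unfolding B_def using H \<delta> XY \<rho> by (intro mult_mono ge_one_powr_ge_zero) auto
      thus ?thesis by simp
    qed
    obtain c where c: "\<exists>i\<le>n. \<exists>j\<le>1. c i j \<noteq> 0"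
      "\<And>i j. \<bar>c i j\<bar> \<le> fact ((n + 1) * (1 + 1)) * (H ^ (n + 1)) ^ ((n + 1) * (1 + 1))"
      "\<And>P. P \<in> S \<Longrightarrow> form n 1 c (d P) (e P) (u P) (v P) = 0"
      by (rule on_form_small_coeffs[OF on H]) (use st in \<open>auto simp: in_strip_def\<close>)
    note c_le = c(2)[unfolded one_add_one, folded N_def]
    define A1 where "A1 P = hform n (\<lambda>i. c i 0) (d P) (e P)" for P
    define A2 where "A2 P = hform n (\<lambda>i. c i 1) (d P) (e P)" for P
    define M where "M = sylvester_mat_sub n n (\<Sum>i\<le>n. monom (c i 0) i) (\<Sum>i\<le>n. monom (c i 1) i)"
    have M: "M \<in> carrier_mat (n + n) (n + n)" unfolding M_def by (rule sylvester_mat_sub_carrier)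
    note M_row = sylvester_apply(1)[OF n, of _ c, folded M_def]
    have lin: "A1 P * u P + A2 P * v P = 0" if "P \<in> S" for P
      using c(3)[OF that] unfolding form_1_eq A1_def A2_def .
    define z where "z P = vec (n + n) (\<lambda>j. d P ^ (n + n - 1 - j) * e P ^ j)" for P
    have Mz: "(M *\<^sub>v z P) $ i = (if i < n then d P ^ (n - 1 - i) * e P ^ i * A1 P
      else d P ^ (n + n - 1 - i) * e P ^ (i - n) * A2 P)" if "i < n + n" for i P
      using that M M_row[OF that, of "d P" "e P"]
      by (simp add: scalar_prod_def atLeast0LessThan z_def A1_def A2_def)
    have "real (card S) \<le> K * B"
    proof (cases "det M = 0")
      case False
      define N0 where "N0 = det M * h ^ (n + n - 1)"
      have "N0 \<noteq> 0" using False h by (simp add: N0_def)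
      moreover have "\<bar>N0\<bar> \<le> C1 * H ^ C2"
      proof -
        let ?b = "fact N * (H ^ (n + 1)) ^ N :: int"
        have "\<bar>det M\<bar> \<le> fact (n + n) * (\<Prod>i=0..<n+n. ?b)"
        proof (rule abs_det_le_column_bound[OF M])
          fix i j assume "i < n + n" "j < n + n"
          thus "\<bar>M $$ (i, j)\<bar> \<le> ?b" unfolding M_def by (intro sylvester_apply(2)[OF n] c_le)
        qed
        also have "\<dots> = fact (n + n) * fact N ^ (n + n) * H ^ C2"
          by (simp only: C2_def power_mult_distrib power_mult prod_constant card_atLeastLessThan diff_zero mult.assoc)
        finally have "\<bar>det M\<bar> * \<bar>h\<bar> ^ (n + n - 1) \<le> (fact (n + n) * fact N ^ (n + n) * H ^ C2) * \<bar>h\<bar> ^ (n + n - 1)"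
          by (intro mult_right_mono) auto
        thus ?thesis unfolding N0_def C1_def abs_mult power_abs by (simp add: mult_ac)
      qed
      moreover have "r dvd N0" if P: "P \<in> S" and r: "r dvd A1 P" "r dvd A2 P" for P r
      proof -
        \<comment> \<open>Multiplying M z by the adjugate of M gives det M times z, while every
          entry of M z is a multiple of A1 or of A2.\<close>
        have "r dvd det M * z P $ j" if j: "j < n + n" for j
        proof -
          have zc: "z P \<in> carrier_vec (n + n)" by (simp add: z_def)
          note adj = adj_mat[OF M]
          have "adj_mat M *\<^sub>v (M *\<^sub>v z P) = (det M \<cdot>\<^sub>m 1\<^sub>m (n + n)) *\<^sub>v z P"
            using assoc_mult_mat_vec[OF adj(1) M zc] adj(3) by simp
          also have "\<dots> = det M \<cdot>\<^sub>v z P"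
            using zc by (intro eq_vecI) (auto simp: scalar_prod_def if_distrib if_distribR cong: if_cong)
          finally have "det M * z P $ j = (adj_mat M *\<^sub>v (M *\<^sub>v z P)) $ j" using j zc by simp
          also have "\<dots> = (\<Sum>i<n+n. adj_mat M $$ (j, i) * (M *\<^sub>v z P) $ i)"
            using j adj(1) M by (simp add: scalar_prod_def atLeast0LessThan)
          also have "r dvd \<dots>"
          proof (intro dvd_sum dvd_mult)
            fix i assume "i \<in> {..<n+n}"
            thus "r dvd (M *\<^sub>v z P) $ i" using r by (subst Mz) auto
          qed
          finally show ?thesis .
        qed
        from this[of 0] this[of "n + n - 1"] have rde: "r dvd det M * d P ^ (n + n - 1)" "r dvd det M * e P ^ (n + n - 1)"
          using n by (simp_all add: z_def)
        have "gcd (d P) (e P) dvd h"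
        proof -
          have "e P ^ k * v P ^ l - d P ^ k * u P ^ l = h" using st P by (auto simp: in_strip_def)
          moreover have "gcd (d P) (e P) dvd e P ^ k" "gcd (d P) (e P) dvd d P ^ k"
            using k by (auto intro: dvd_trans[OF _ dvd_power])
          ultimately show ?thesis by (metis dvd_diff dvd_mult2)
        qed
        have "r dvd gcd (det M * d P ^ (n + n - 1)) (det M * e P ^ (n + n - 1))" using rde by simp
        also have "\<dots> dvd det M * gcd (d P) (e P) ^ (n + n - 1)"
          by (simp add: gcd_mult_left gcd_exp)
        also have "\<dots> dvd N0" unfolding N0_def using \<open>gcd (d P) (e P) dvd h\<close>
          by (intro mult_dvd_mono dvd_power_same) auto
        finally show ?thesis .
      qed
      ultimately have "real (card S) \<le> K2 * of_int H powr \<delta> * (sqrt (X0 * Y0) + 1 + 1 / \<rho>)"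
        using K2(2) st c(3) unfolding A1_def A2_def by blast
      also have "\<dots> = K2 * B" by (simp add: B_def)
      also have "\<dots> \<le> K * B" using B K1(1) K2(1) by (intro mult_right_mono) (auto simp: K_def)
      finally show ?thesis .
    next
      case True
      hence "det (M\<^sup>T) = 0" using det_transpose[OF M] by simp
      then obtain w where w: "w \<in> carrier_vec (n + n)" "w \<noteq> 0\<^sub>v (n + n)" "M\<^sup>T *\<^sub>v w = 0\<^sub>v (n + n)"
        using det_0_iff_vec_prod_zero[of "M\<^sup>T" "n + n"] M by auto
      define X where "X P = (\<Sum>i\<le>a. w $ (a - i) * d P ^ i * e P ^ (a - i))" for P
      define Y where "Y P = (\<Sum>i\<le>a. w $ (n + (a - i)) * d P ^ i * e P ^ (a - i))" for P
      have XA: "X P * A1 P + Y P * A2 P = 0" for P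
      proof -
        have "0 = (\<Sum>j<n+n. (M\<^sup>T *\<^sub>v w) $ j * z P $ j)" unfolding w(3) by simp
        also have "\<dots> = (\<Sum>j<n+n. \<Sum>i<n+n. w $ i * (M $$ (i, j) * z P $ j))"
          using w(1) M by (intro sum.cong refl) (simp add: scalar_prod_def atLeast0LessThan sum_distrib_left mult_ac)
        also have "\<dots> = (\<Sum>i<n+n. w $ i * (\<Sum>j<n+n. M $$ (i, j) * z P $ j))"
          unfolding sum_distrib_left by (rule sum.swap)
        also have "\<dots> = (\<Sum>i<n+n. w $ i * (M *\<^sub>v z P) $ i)"
          using M by (intro sum.cong refl) (simp add: scalar_prod_def atLeast0LessThan z_def)
        also have "\<dots> = (\<Sum>i<n. w $ i * (M *\<^sub>v z P) $ i) + (\<Sum>i=n..<n+n. w $ i * (M *\<^sub>v z P) $ i)"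
          by (subst sum.atLeastLessThan_concat[of 0 n "n + n", symmetric, unfolded atLeast0LessThan]) auto
        also have "(\<Sum>i<n. w $ i * (M *\<^sub>v z P) $ i) = X P * A1 P"
          unfolding X_def sum_distrib_right
          by (rule sum.reindex_bij_witness[of _ "\<lambda>i. a - i" "\<lambda>i. a - i"]) (auto simp: n_def Mz[unfolded n_def])
        also have "(\<Sum>i=n..<n+n. w $ i * (M *\<^sub>v z P) $ i) = Y P * A2 P"
          unfolding Y_def sum_distrib_right
          by (rule sum.reindex_bij_witness[of _ "\<lambda>i. n + (a - i)" "\<lambda>i. n + a - i"]) (auto simp: n_def Mz[unfolded n_def])
        finally show ?thesis by simp
      qed
      \<comment> \<open>Where A2 = 0 also A1 = 0, since u > 0. At least one of the two forms is not
        identically zero, and it has at most n roots d / e.\<close>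
      define S1 where "S1 = {P\<in>S. A2 P = 0}"
      define S2 where "S2 = {P\<in>S. A2 P \<noteq> 0}"
      have "card S1 \<le> n * K0"
      proof (cases "\<exists>i\<le>n. c i 1 \<noteq> 0")
        case True
        show ?thesis
          by (rule card_le_homogeneous_roots[of _ _ d e n "\<lambda>i. c i 1"])
             (use True fibres_le_subset[OF fib, of S1] in \<open>auto simp: S1_def A2_def hform_def\<close>)
      next
        case False
        hence "\<exists>i\<le>n. c i 0 \<noteq> 0" using c(1) by (auto simp: le_Suc_eq)
        moreover have "A1 P = 0" if "P \<in> S1" for P
        proof -
          have "u P > 0" using that st by (auto simp: S1_def in_strip_def)
          thus ?thesis using lin[of P] that by (auto simp: S1_def)
        qed
        ultimately show ?thesis
          by (intro card_le_homogeneous_roots[of _ _ d e n "\<lambda>i. c i 0"])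
             (use fibres_le_subset[OF fib, of S1] in \<open>auto simp: S1_def A1_def hform_def\<close>)
      qed
      moreover have "real (card S2) \<le> K1 * B"
      proof -
        define c' where "c' i j = (if j = 0 then w $ (n + (a - i)) else - w $ (a - i))" for i j :: nat
        have "on_form a 1 S2 d e u v"
          unfolding on_form_def
        proof (intro exI[of _ c'] conjI ballI)
          have "\<exists>q<n+n. w $ q \<noteq> 0"
          proof (rule ccontr)
            assume "\<not> ?thesis"
            hence "w = 0\<^sub>v (n + n)" using w(1) by (intro eq_vecI) auto
            thus False using w(2) by simp
          qed
          then obtain q where q: "q < n + n" "w $ q \<noteq> 0" by blast
          show "\<exists>i\<le>a. \<exists>j\<le>1. c' i j \<noteq> 0"
          proof (cases "q < n")
            case True
            thus ?thesis using q by (intro exI[of _ "a - q"] conjI exI[of _ "1 :: nat"]) (auto simp: c'_def n_def)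
          next
            case False
            hence "n + (a - (n + a - q)) = q" using q by (auto simp: n_def)
            thus ?thesis using q False
              by (intro exI[of _ "n + a - q"] conjI exI[of _ "0 :: nat"]) (auto simp: c'_def)
          qed
          fix P assume P: "P \<in> S2"
          \<comment> \<open>Combining the two relations with weights u and X eliminates A1 and
            leaves a factor A2, which is nonzero on \<open>S2\<close>.\<close>
          have "A2 P * (Y P * u P - X P * v P) = (X P * A1 P + Y P * A2 P) * u P - X P * (A1 P * u P + A2 P * v P)"
            by (simp add: algebra_simps)
          also have "\<dots> = 0" using XA lin P by (simp add: S2_def)
          finally have "Y P * u P - X P * v P = 0" using P by (simp add: S2_def)
          moreover have "form a 1 c' (d P) (e P) (u P) (v P) = Y P * u P - X P * v P"
            unfolding form_1_eq hform_def X_def Y_def c'_def by (simp add: sum_negf)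
          ultimately show "form a 1 c' (d P) (e P) (u P) (v P) = 0" by simp
        qed
        moreover have "in_strip k l h K0 H s0 X0 Y0 \<rho> S2 d e u v"
          by (rule in_strip_subset[OF st]) (auto simp: S2_def)
        ultimately show ?thesis using K1(2) by (simp add: B_def mult.assoc)
      qed
      moreover have "card S = card S1 + card S2"
        using finS by (subst card_Un_disjoint[symmetric]) (auto simp: S1_def S2_def intro!: arg_cong[where f=card])
      ultimately have "real (card S) \<le> real (n * K0) + K1 * B"
        using of_nat_mono[of "card S1" "n * K0", where 'a = real] by linarith
      also have "\<dots> \<le> (n * K0) * B + K1 * B + K2 * B"
      proof -
        have "0 \<le> K2 * B" using K2(1) B by simp
        thus ?thesis using mult_left_mono[OF B, of "real (n * K0)"] by simp
      qed
      finally show ?thesis by (simp add: K_def algebra_simps)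
    qed
    thus ?case by (simp add: B_def mult.assoc)
  qed
qed

section \<open>Many primes in a short multiplicative range\<close>

lemma Lcm_atMost_pos: "Lcm {1..n :: nat} > 0"
  by (simp add: Lcm_0_iff_nat zero_less_iff_neq_zero)

lemma inverse_difference_aux:
  fixes x y :: real
  assumes "x > 0" "y > 0" "M > 0" "N > 0" "(N - M) * y = N * x"
  shows "1 / (M * x) - 1 / (M * y) = 1 / (N * x)"
proof -
  have "N * (y - x) = M * y" using assms(5) by (simp add: algebra_simps)
  hence yx: "y - x = M * y / N" using assms by (simp add: field_simps)
  have "1 / (M * x) - 1 / (M * y) = (y - x) / (M * x * y)" using assms by (simp add: field_simps)
  thus ?thesis unfolding yx using assms by simp
qed

(* Telescoping in the Leibniz triangle: 1/((m+1) C(n,m+1)) = 1/(m C(n-1,m)) - 1/(m C(n,m)). *)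
lemma mult_binomial_dvd_Lcm:
  assumes "1 \<le> m" "m \<le> n"
  shows "m * (n choose m) dvd Lcm {1..n}"
proof -
  have "real (Lcm {1..n}) / (real m * real (n choose m)) \<in> \<int>"
    using assms
  proof (induction m arbitrary: n rule: nat_induct_at_least)
    case base
    hence "n dvd Lcm {1..n}" by (intro dvd_Lcm) auto
    then obtain q where "Lcm {1..n} = n * q" by (auto simp: dvd_def)
    thus ?case using base by simp
  next
    case (Suc m n)
    then obtain n' where n: "n = Suc n'" "m \<le> n'" by (cases n) auto
    have "real (Lcm {1..n'}) / (real m * real (n' choose m)) \<in> \<int>" using Suc n by auto
    moreover have "Lcm {1..n'} dvd Lcm {1..n}" by (rule Lcm_subset) (auto simp: n)
    ultimately obtain q where "Lcm {1..n} = Lcm {1..n'} * q" by (auto simp: dvd_def)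
    hence "real (Lcm {1..n}) / (real m * real (n' choose m)) = 
        real q * (real (Lcm {1..n'}) / (real m * real (n' choose m)))" by simp
    also have "\<dots> \<in> \<int>"
      by (intro Ints_mult Ints_of_nat) fact
    finally have 1: "real (Lcm {1..n}) / (real m * real (n' choose m)) \<in> \<int>" .
    have 2: "real (Lcm {1..n}) / (real m * real (n choose m)) \<in> \<int>" using Suc.IH[of n] n by auto
    have "n' choose m > 0" "n choose m > 0" "m > 0" "n choose Suc m > 0"
      using n Suc.hyps Suc.prems by (auto simp: zero_less_binomial_iff simp del: binomial_Suc_Suc)
    hence pos: "real (n' choose m) > 0" "real (n choose m) > 0" "real m > 0" "real (n choose Suc m) > 0"
      by (simp_all only: of_nat_0_less_iff)
    have e1: "real (Suc m) * real (n choose Suc m) = real n * real (n' choose m)"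
      unfolding n(1) of_nat_mult[symmetric] Suc_times_binomial_eq by (simp only: mult.commute)
    have e2: "real (n - m) * real (n choose m) = real n * real (n' choose m)"
      unfolding of_nat_mult[symmetric] binomial_absorb_comp by (simp add: n)
    have "n - m > 0" using n by simp
    have "1 / (real m * real (n' choose m)) - 1 / (real m * real (n choose m)) = 1 / (real (Suc m) * real (n choose Suc m))"
      unfolding e1 by (rule inverse_difference_aux) (use pos n e2 in \<open>auto simp: of_nat_diff\<close>)
    hence "real (Lcm {1..n}) * (1 / (real m * real (n' choose m)) - 1 / (real m * real (n choose m))) =
      real (Lcm {1..n}) * (1 / (real (Suc m) * real (n choose Suc m)))" by (simp only:)
    hence "real (Lcm {1..n}) / (real (Suc m) * real (n choose Suc m)) =
      real (Lcm {1..n}) / (real m * real (n' choose m)) - real (Lcm {1..n}) / (real m * real (n choose m))"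
      unfolding right_diff_distrib by (simp only: times_divide_eq_right mult_1_right)
    thus ?case using 1 2 by simp
  qed
  then obtain z where z: "real (Lcm {1..n}) / (real m * real (n choose m)) = of_int z" by (auto elim: Ints_cases)
  have "m * (n choose m) > 0" using assms by simp
  hence "real (m * (n choose m)) * of_int z = real (Lcm {1..n})" using z assms by (simp add: field_simps)
  hence "of_int (int (m * (n choose m)) * z) = (of_int (int (Lcm {1..n})) :: real)" by simp
  hence "int (m * (n choose m)) * z = int (Lcm {1..n})" unfolding of_int_eq_iff .
  thus ?thesis by (metis dvd_triv_left int_dvd_int_iff)
qed

text \<open>Each prime p <= n contributes to the lcm its largest power not exceeding n, hence a
  factor at most n.\<close>

lemma Lcm_le_power_card_primes:
  fixes n :: nat
  assumes "n \<ge> 1"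
  shows "Lcm {1..n} \<le> n ^ card {p. prime p \<and> p \<le> n}"
proof -
  let ?P = "{p. prime p \<and> p \<le> n}"
  \<comment> \<open>The exponent of p in the lcm. The condition k <= n makes the set finite without
    excluding anything, since k < 2^k <= p^k for a prime p.\<close>
  define kk where "kk p = Max {k. k \<le> n \<and> p ^ k \<le> n}" for p
  have fin: "finite ?P" by (rule finite_subset[of _ "{..n}"]) auto
  have kk: "p ^ kk p \<le> n" "\<And>j. p ^ j \<le> n \<Longrightarrow> j \<le> kk p" if "prime p" for p
  proof -
    have "{k. k \<le> n \<and> p ^ k \<le> n} \<noteq> {}" using assms by (auto intro!: exI[of _ 0])
    hence "kk p \<in> {k. k \<le> n \<and> p ^ k \<le> n}" unfolding kk_def by (intro Max_in) auto
    thus "p ^ kk p \<le> n" by simp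
    fix j assume j: "p ^ j \<le> n"
    have "j < 2 ^ j" by (rule less_exp)
    also have "\<dots> \<le> p ^ j" using that prime_ge_2_nat by (intro power_mono) auto
    finally show "j \<le> kk p" using j unfolding kk_def by (intro Max_ge) auto
  qed
  have "Lcm {1..n} dvd (\<Prod>p\<in>?P. p ^ kk p)"
  proof (rule Lcm_least)
    fix m assume m: "m \<in> {1..n}"
    have "m = (\<Prod>p\<in>prime_factors m. p ^ multiplicity p m)" using m by (intro prime_factorization_nat) auto
    also have "\<dots> dvd (\<Prod>p\<in>prime_factors m. p ^ kk p)"
    proof (intro prod_dvd_prod le_imp_power_dvd)
      fix p assume p: "p \<in> prime_factors m"
      have "p ^ multiplicity p m \<le> m" using m by (intro dvd_imp_le multiplicity_dvd) auto
      thus "multiplicity p m \<le> kk p" using p m by (intro kk(2)) (auto simp: in_prime_factors_iff)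
    qed
    also have "\<dots> dvd (\<Prod>p\<in>?P. p ^ kk p)"
    proof (intro prod_dvd_prod_subset fin subsetI)
      fix p assume p: "p \<in> prime_factors m"
      hence "p \<le> m" using m by (intro dvd_imp_le) auto
      thus "p \<in> ?P" using p m by auto
    qed
    finally show "m dvd (\<Prod>p\<in>?P. p ^ kk p)" .
  qed
  moreover have "(\<Prod>p\<in>?P. p ^ kk p) > 0" by (intro prod_pos) (auto simp: prime_gt_0_nat)
  ultimately have "Lcm {1..n} \<le> (\<Prod>p\<in>?P. p ^ kk p)" by (rule dvd_imp_le)
  also have "\<dots> \<le> (\<Prod>p\<in>?P. n)" using kk by (intro prod_mono) auto
  finally show ?thesis by simp
qed

text \<open>Chebyshev's argument: 4^N / (2 N) is at most the central binomial coefficient, which is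
  at most the lcm of 1, ..., 2 N, and this in turn is at most 2 N raised to the number of primes up
  to 2 N.\<close>

lemma card_primes_ge:
  assumes "N \<ge> 1"
  shows "real N * ln 4 \<le> (real (card {p. prime p \<and> p \<le> 2 * N}) + 1) * ln (2 * real N)"
proof -
  let ?c = "card {p. prime p \<and> p \<le> 2 * N}"
  have "(2 * N choose N) \<le> N * (2 * N choose N)" using assms by simp
  also have "\<dots> \<le> Lcm {1..2 * N}"
    using assms by (intro dvd_imp_le mult_binomial_dvd_Lcm Lcm_atMost_pos) auto
  also have "\<dots> \<le> (2 * N) ^ ?c" using assms by (intro Lcm_le_power_card_primes) auto
  finally have le: "real (2 * N choose N) \<le> real ((2 * N) ^ ?c)" by (simp only: of_nat_le_iff)
  have "4 ^ N \<le> 2 * real N * real (2 * N choose N)"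
    using central_binomial_lower_bound[of N] assms by (simp add: field_simps)
  also have "\<dots> \<le> 2 * real N * real ((2 * N) ^ ?c)" using le by (intro mult_left_mono) auto
  also have "\<dots> = (2 * real N) ^ (?c + 1)" by simp
  finally have "ln (4 ^ N) \<le> ln ((2 * real N) ^ (?c + 1))" using assms by (subst ln_le_cancel_iff) auto
  moreover have "ln (4 ^ N :: real) = real N * ln 4" by (rule ln_realpow)
  moreover have "ln ((2 * real N) ^ (?c + 1)) = real (?c + 1) * ln (2 * real N)"
    by (rule ln_realpow)
  ultimately show ?thesis by (simp add: add.commute)
qed

text \<open>Chebyshev's bound gives at least Q (K + 2) - 1 primes up to Q H^\<delta> for large H,
  because H^\<delta> outgrows the logarithm; at most Q of them are at most Q. The condition Q <= H^3
  keeps that logarithm of order ln H.\<close>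

lemma ex_primes_between:
  fixes \<delta> :: real and K :: nat
  assumes "\<delta> > 0"
  obtains H0 where "H0 \<ge> 1" "\<And>H Q. H \<ge> H0 \<Longrightarrow> 1 \<le> Q \<Longrightarrow> Q \<le> H ^ 3 \<Longrightarrow>
     \<exists>\<P>. finite \<P> \<and> card \<P> = K \<and> (\<forall>p\<in>\<P>. prime p \<and> Q < real p \<and> real p \<le> Q * H powr \<delta>)"
proof -
  have "eventually (\<lambda>H::real. H powr \<delta> * ln 4 \<ge> 4 * (3 + \<delta>) * ln H * (real K + 2) \<and> H powr \<delta> \<ge> 4 \<and> H > 1) at_top"
    using assms by (intro eventually_conj eventually_gt_at_top; real_asymp)
  then obtain H1 where H1: "\<And>H::real. H \<ge> H1 \<Longrightarrow> H powr \<delta> * ln 4 \<ge> 4 * (3 + \<delta>) * ln H * (real K + 2) \<and> H powr \<delta> \<ge> 4 \<and> H > 1"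
    by (auto simp: eventually_at_top_linorder)
  show ?thesis
  proof (rule that[of "max 1 H1"])
    fix H Q :: real assume H: "H \<ge> max 1 H1" and Q: "1 \<le> Q" "Q \<le> H ^ 3"
    have H': "H powr \<delta> * ln 4 \<ge> 4 * (3 + \<delta>) * ln H * (real K + 2)" "H powr \<delta> \<ge> 4" "H > 1" using H1[of H] H by auto
    define y where "y = Q * H powr \<delta>"
    have y4: "y \<ge> 4" using mult_mono[of 1 Q 4 "H powr \<delta>"] Q H' by (simp add: y_def)
    define N where "N = nat \<lfloor>y / 2\<rfloor>"
    have Nr: "real N = of_int \<lfloor>y / 2\<rfloor>" using y4 by (simp add: N_def)
    have N: "real N \<ge> y / 4" "2 * real N \<le> y"
    proof -
      show "2 * real N \<le> y" unfolding Nr by linarith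
      have "real N \<ge> y / 2 - 1" unfolding Nr by linarith
      thus "real N \<ge> y / 4" using y4 by linarith
    qed
    have N1: "N \<ge> 1" using N(1) y4 by linarith
    let ?c = "card {p. prime p \<and> p \<le> 2 * N}"
    have lny: "ln y \<le> (3 + \<delta>) * ln H"
    proof -
      have "ln y = ln Q + \<delta> * ln H" unfolding y_def using Q H' by (simp add: ln_mult ln_powr)
      also have "ln Q \<le> ln (H ^ 3)" using Q H' by (subst ln_le_cancel_iff) auto
      also have "\<dots> = 3 * ln H" using H' by (simp add: ln_realpow)
      finally show ?thesis by (simp add: algebra_simps)
    qed
    have lnH: "ln H > 0" using H' by simp
    have "y / 4 * ln 4 \<le> real N * ln 4" using N(1) by (intro mult_right_mono) auto
    also have "\<dots> \<le> (real ?c + 1) * ln (2 * real N)" by (rule card_primes_ge[OF N1])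
    also have "\<dots> \<le> (real ?c + 1) * ((3 + \<delta>) * ln H)"
      using N(2) N1 lny y4 by (intro mult_left_mono order.trans[OF _ lny]) auto
    finally have 1: "y / 4 * ln 4 \<le> (real ?c + 1) * ((3 + \<delta>) * ln H)" .
    have "Q * (4 * (3 + \<delta>) * ln H * (real K + 2)) \<le> Q * (H powr \<delta> * ln 4)"
      using Q H'(1) by (intro mult_left_mono) auto
    hence "(Q * (real K + 2)) * ((3 + \<delta>) * ln H) \<le> y / 4 * ln 4" unfolding y_def by (simp add: algebra_simps)
    hence "(Q * (real K + 2)) * ((3 + \<delta>) * ln H) \<le> (real ?c + 1) * ((3 + \<delta>) * ln H)" using 1 by linarith
    hence c: "Q * (real K + 2) \<le> real ?c + 1" using lnH assms by (subst (asm) mult_le_cancel_right_pos) auto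
    have "Q * (real K + 1) \<ge> real K + 1" using Q mult_right_mono[of 1 Q "real K + 1"] by simp
    hence c2: "real ?c \<ge> Q + real K" using c by (simp add: algebra_simps)
    let ?A = "{p. prime p \<and> p \<le> 2 * N}" and ?B = "{p. prime p \<and> real p \<le> Q}"
    have B: "?B \<subseteq> {1..nat \<lfloor>Q\<rfloor>}" by (auto simp: le_nat_floor dest: prime_gt_0_nat)
    hence "card ?B \<le> card {1..nat \<lfloor>Q\<rfloor>}" by (intro card_mono) auto
    also have "real \<dots> \<le> Q" using Q by simp
    finally have "real (card ?B) \<le> Q" by simp
    moreover have "card ?A \<le> card (?A - ?B) + card ?B"
    proof -
      have "finite ?B" using B finite_subset by blast
      thus ?thesis using card_Un_le[of "?A - ?B" ?B] card_mono[of "(?A - ?B) \<union> ?B" ?A] by fastforce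
    qed
    ultimately have "real K \<le> real (card (?A - ?B))" using c2 by linarith
    then obtain \<P> where P: "\<P> \<subseteq> ?A - ?B" "card \<P> = K" "finite \<P>"
      using obtain_subset_with_card_n[of K "?A - ?B"] by auto
    have "prime p \<and> Q < real p \<and> real p \<le> Q * H powr \<delta>" if "p \<in> \<P>" for p
    proof -
      have p: "prime p" "p \<le> 2 * N" "\<not> real p \<le> Q" using P(1) that by auto
      have "real p \<le> 2 * real N" using of_nat_mono[OF p(2), where 'a = real] by simp
      thus ?thesis using p N(2) unfolding y_def by auto
    qed
    thus "\<exists>\<P>. finite \<P> \<and> card \<P> = K \<and> (\<forall>p\<in>\<P>. prime p \<and> Q < real p \<and> real p \<le> Q * H powr \<delta>)" using P by blast
  qed simp
qed

section \<open>The p-adic determinant method\<close>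

definition iform :: "nat \<Rightarrow> nat \<Rightarrow> (nat \<Rightarrow> nat \<Rightarrow> int) \<Rightarrow> int \<Rightarrow> int \<Rightarrow> int" where
  "iform a b c s t = (\<Sum>i\<le>a. \<Sum>j\<le>b. c i j * s ^ i * t ^ j)"

text \<open>The formal derivative in t. At j = 0 the truncated exponent \<open>j - 1\<close> is
  harmless, as the factor j vanishes.\<close>

definition iform_dt :: "nat \<Rightarrow> nat \<Rightarrow> (nat \<Rightarrow> nat \<Rightarrow> int) \<Rightarrow> int \<Rightarrow> int \<Rightarrow> int" where
  "iform_dt a b c s t = (\<Sum>i\<le>a. \<Sum>j\<le>b. c i j * s ^ i * (int j * t ^ (j - 1)))"

lemma power_add_cong_square:
  fixes t x :: int
  shows "x ^ 2 dvd (t + x) ^ j - t ^ j - x * (int j * t ^ (j - 1))"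
proof (induction j)
  case (Suc j)
  have "(t + x) ^ Suc j - t ^ Suc j - x * (int (Suc j) * t ^ (Suc j - 1)) =
     (t + x) * ((t + x) ^ j - t ^ j - x * (int j * t ^ (j - 1))) + x ^ 2 * (int j * t ^ (j - 1))"
  proof (cases j)
    case (Suc i)
    thus ?thesis by (simp add: algebra_simps power2_eq_square)
  qed simp
  thus ?case using Suc.IH by (simp only:) (intro dvd_add dvd_mult dvd_mult2, auto)
qed simp

lemma iform_add_cong_square:
  "x ^ 2 dvd iform a b c s (t + x) - iform a b c s t - x * iform_dt a b c s t"
proof -
  have "iform a b c s (t + x) - iform a b c s t - x * iform_dt a b c s t =
     (\<Sum>i\<le>a. \<Sum>j\<le>b. c i j * s ^ i * ((t + x) ^ j - t ^ j - x * (int j * t ^ (j - 1))))"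
    unfolding iform_def iform_dt_def sum_distrib_left sum_subtractf[symmetric]
    by (intro sum.cong refl) (simp add: algebra_simps)
  also have "x ^ 2 dvd \<dots>" by (intro dvd_sum dvd_mult power_add_cong_square)
  finally show ?thesis .
qed

lemma iform_dt_cong:
  assumes "[s = s'] (mod m)" "[t = t'] (mod m)"
  shows "[iform_dt a b c s t = iform_dt a b c s' t'] (mod m)"
  unfolding iform_dt_def using assms by (intro cong_sum cong_mult cong_pow cong_refl)

(* Newton iteration, carried out on polynomials but checked only at the given points. *)
lemma hensel_polynomial:
  fixes s t :: "'p \<Rightarrow> int"
  assumes st: "\<And>P. P \<in> S \<Longrightarrow> [s P = s0] (mod p)" "\<And>P. P \<in> S \<Longrightarrow> [t P = t0] (mod p)"
    and F: "\<And>P. P \<in> S \<Longrightarrow> p ^ m dvd iform a b c (s P) (t P)"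
    and w: "[w * iform_dt a b c s0 t0 = 1] (mod p)"
    and r: "1 \<le> r" "r \<le> m"
  shows "\<exists>f :: int poly. \<forall>P\<in>S. p ^ r dvd t P - poly f (s P - s0)"
  using r
proof (induction r rule: nat_induct_at_least)
  case base
  show ?case using st(2) by (intro exI[of _ "[:t0:]"]) (auto simp: cong_iff_dvd_diff)
next
  case (Suc r)
  then obtain f where f: "\<And>P. P \<in> S \<Longrightarrow> p ^ r dvd t P - poly f (s P - s0)" by auto
  \<comment> \<open>The form along the approximate branch t = f(s - s0). The correction uses the
    constant w, an inverse of the t-derivative modulo p only, so each round gains one power of p
    instead of doubling the precision.\<close>
  define \<Psi> where "\<Psi> = (\<Sum>i\<le>a. \<Sum>j\<le>b. [:c i j:] * [:s0, 1:] ^ i * f ^ j)"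
  have \<Psi>: "poly \<Psi> (s P - s0) = iform a b c (s P) (poly f (s P - s0))" for P
    by (simp add: \<Psi>_def iform_def poly_sum mult.assoc)
  show ?case
  proof (intro exI[of _ "f - [:w:] * \<Psi>"] ballI)
    fix P assume P: "P \<in> S"
    define y where "y = poly f (s P - s0)"
    obtain z where z: "t P - y = p ^ r * z" using f[OF P] by (auto simp: dvd_def y_def)
    define x where "x = y - t P"
    have x: "x = - (p ^ r * z)" using z by (simp add: x_def)
    have pr: "p ^ Suc r dvd x ^ 2"
    proof -
      have "x ^ 2 = p ^ (r + r) * z ^ 2" unfolding x by (simp add: power2_eq_square power_add mult_ac)
      moreover have "p ^ Suc r dvd p ^ (r + r)" using Suc.hyps by (intro le_imp_power_dvd) auto
      ultimately show ?thesis by simp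
    qed
    have 1: "p ^ Suc r dvd iform a b c (s P) (t P + x) - iform a b c (s P) (t P) - x * iform_dt a b c (s P) (t P)"
      using dvd_trans[OF pr iform_add_cong_square] .
    have 2: "p ^ Suc r dvd iform a b c (s P) (t P)"
      using F[OF P] Suc.prems by (meson dvd_trans le_imp_power_dvd)
    have 3: "p ^ Suc r dvd w * (x * iform_dt a b c (s P) (t P)) - x"
    proof -
      have "[w * iform_dt a b c (s P) (t P) = w * iform_dt a b c s0 t0] (mod p)"
        using st P by (intro cong_mult cong_refl iform_dt_cong)
      hence "[w * iform_dt a b c (s P) (t P) = 1] (mod p)" using w cong_trans by blast
      hence "p dvd w * iform_dt a b c (s P) (t P) - 1" by (simp add: cong_iff_dvd_diff)
      hence "p ^ r * p dvd x * (w * iform_dt a b c (s P) (t P) - 1)"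
        unfolding x by (intro mult_dvd_mono) auto
      thus ?thesis by (simp add: algebra_simps)
    qed
    have "t P - poly (f - [:w:] * \<Psi>) (s P - s0) = 
       w * (iform a b c (s P) (t P + x) - iform a b c (s P) (t P) - x * iform_dt a b c (s P) (t P))
       + w * iform a b c (s P) (t P) + (w * (x * iform_dt a b c (s P) (t P)) - x)"
      by (simp add: \<Psi> x_def y_def[symmetric] algebra_simps)
    also have "p ^ Suc r dvd \<dots>" using 1 2 3 by (intro dvd_add dvd_mult) 
    finally show "p ^ Suc r dvd t P - poly (f - [:w:] * \<Psi>) (s P - s0)" .
  qed
qed

lemma sum_distinct_nats_ge:
  fixes A :: "nat set"
  assumes "finite A"
  shows "(\<Sum>i<card A. i) \<le> \<Sum>A"
  using assms
proof (induction "card A" arbitrary: A)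
  case (Suc k)
  hence A: "A \<noteq> {}" "finite A" by auto
  let ?x = "Max A"
  have "A \<subseteq> {..?x}" using A by auto
  hence "card A \<le> card {..?x}" by (intro card_mono) auto
  hence k: "k \<le> ?x" using Suc.hyps(2) by simp
  have c: "card (A - {?x}) = k" using A Suc.hyps(2) by simp
  have "(\<Sum>i<card A. i) = (\<Sum>i<k. i) + k" unfolding Suc.hyps(2)[symmetric] by simp
  also have "\<dots> \<le> \<Sum>(A - {?x}) + ?x" using Suc.hyps(1)[of "A - {?x}"] c A k by (intro add_mono) auto
  also have "\<dots> = \<Sum>A" using A by (subst sum.remove[of A ?x]) auto
  finally show ?case .
qed auto

text \<open>In one residue class t = f(s - s0) modulo p^N, so each monomial is e^A u^B times a
  polynomial in s - s0. The columns are thus combinations of powers (s - s0)^q, divisible by p^q,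
  and n distinct exponents add up to at least 0 + ... + (n - 1) = N.\<close>

lemma padic_det_dvd:
  fixes d e u v s t :: "nat \<Rightarrow> int" and \<phi> :: "nat \<Rightarrow> nat \<times> nat" and n :: nat
  defines "N \<equiv> (\<Sum>i<n. i)"
  assumes \<phi>: "\<And>x. x < n \<Longrightarrow> fst (\<phi> x) \<le> A \<and> snd (\<phi> x) \<le> B"
    and d: "\<And>r. r < n \<Longrightarrow> [d r = s r * e r] (mod p ^ N)" "\<And>r. r < n \<Longrightarrow> [v r = t r * u r] (mod p ^ N)"
    and s: "\<And>r. r < n \<Longrightarrow> p dvd s r - s0"
    and f: "\<And>r. r < n \<Longrightarrow> p ^ N dvd t r - poly f (s r - s0)"
  shows "p ^ N dvd det (mat n n (\<lambda>(r, x). d r ^ fst (\<phi> x) * e r ^ (A - fst (\<phi> x)) * v r ^ snd (\<phi> x) * u r ^ (B - snd (\<phi> x))))"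
proof -
  define g where "g x = [:s0, 1:] ^ fst (\<phi> x) * f ^ snd (\<phi> x)" for x
  define D where "D = Max (insert 0 ((\<lambda>x. degree (g x)) ` {..<n}))"
  have D: "degree (g x) \<le> D" if "x < n" for x unfolding D_def using that by (intro Max_ge) auto
  define Z where "Z r q = (e r ^ A * u r ^ B) * (s r - s0) ^ q" for r q
  have "[det (mat n n (\<lambda>(r, x). d r ^ fst (\<phi> x) * e r ^ (A - fst (\<phi> x)) * v r ^ snd (\<phi> x) * u r ^ (B - snd (\<phi> x)))) =
      det (mat n n (\<lambda>(r, x). \<Sum>q\<in>{..D}. Z r q * coeff (g x) q))] (mod p ^ N)"
  proof (rule det_cong_int)
    fix r x assume r: "r < n" and x: "x < n"
    let ?i = "fst (\<phi> x)" and ?j = "snd (\<phi> x)"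
    have "[t r = poly f (s r - s0)] (mod p ^ N)" using f[OF r] by (simp add: cong_iff_dvd_diff)
    hence "[v r = poly f (s r - s0) * u r] (mod p ^ N)"
      using d(2)[OF r] by (meson cong_refl cong_mult cong_trans)
    hence "[d r ^ ?i * e r ^ (A - ?i) * v r ^ ?j * u r ^ (B - ?j) =
       (s r * e r) ^ ?i * e r ^ (A - ?i) * (poly f (s r - s0) * u r) ^ ?j * u r ^ (B - ?j)] (mod p ^ N)"
      using d(1)[OF r] by (intro cong_mult cong_pow cong_refl)
    also have "(s r * e r) ^ ?i * e r ^ (A - ?i) * (poly f (s r - s0) * u r) ^ ?j * u r ^ (B - ?j) =
       (e r ^ ?i * e r ^ (A - ?i)) * (u r ^ ?j * u r ^ (B - ?j)) * poly (g x) (s r - s0)"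
      by (simp add: g_def power_mult_distrib mult_ac)
    also have "e r ^ ?i * e r ^ (A - ?i) = e r ^ A" using \<phi>[OF x] by (simp flip: power_add)
    also have "u r ^ ?j * u r ^ (B - ?j) = u r ^ B" using \<phi>[OF x] by (simp flip: power_add)
    also have "e r ^ A * u r ^ B * poly (g x) (s r - s0) = (\<Sum>q\<in>{..D}. Z r q * coeff (g x) q)"
      unfolding poly_eq_sum_le[OF D[OF x]] Z_def sum_distrib_left by (intro sum.cong refl) (simp only: mult_ac)
    finally show "[d r ^ ?i * e r ^ (A - ?i) * v r ^ ?j * u r ^ (B - ?j) = (\<Sum>q\<in>{..D}. Z r q * coeff (g x) q)] (mod p ^ N)" .
  qed
  moreover have "p ^ N dvd det (mat n n (\<lambda>(r, x). \<Sum>q\<in>{..D}. Z r q * coeff (g x) q))"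
  proof (rule det_expand_dvd[where w = "\<lambda>q. q"])
    show "p ^ q dvd Z r q" if "r < n" for r q
      unfolding Z_def using s[OF that] by (intro dvd_mult dvd_power_same)
    fix h assume "h \<in> {0..<n} \<rightarrow> {..D}" and inj: "inj_on h {0..<n}"
    have "N \<le> \<Sum>(h ` {0..<n})"
      using sum_distinct_nats_ge[of "h ` {0..<n}"] inj by (simp add: card_image N_def)
    thus "N \<le> (\<Sum>c=0..<n. h c)" using inj by (simp add: sum.reindex)
  qed simp
  ultimately show ?thesis by (simp add: cong_dvd_iff)
qed

text \<open>Substituting d = y + s0 e with |y| <= X0 changes the monomials d^i e^(A-i) into y^q
  e^(A-q), q <= i, by a unipotent triangular matrix. Hence the powers of s0 drop out of the
  estimate, and only the area X0 Y0 of the strip remains.\<close>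

lemma strip_det_bound:
  fixes d e u v :: "nat \<Rightarrow> int" and \<phi> :: "nat \<Rightarrow> nat \<times> nat" and s0 X0 Y0 H :: real
  assumes \<phi>: "bij_betw \<phi> {0..<n} ({..A} \<times> {..B})"
    and bd: "\<And>r. r < n \<Longrightarrow> \<bar>of_int (d r) - s0 * of_int (e r)\<bar> \<le> X0 \<and> \<bar>of_int (e r)\<bar> \<le> Y0 \<and>
        \<bar>of_int (u r)\<bar> \<le> H \<and> \<bar>of_int (v r)\<bar> \<le> H"
    and pos: "X0 \<ge> 0" "Y0 \<ge> 0" "H \<ge> 0"
  shows "(real_of_int (det (mat n n (\<lambda>(r, x). d r ^ fst (\<phi> x) * e r ^ (A - fst (\<phi> x)) * v r ^ snd (\<phi> x) * u r ^ (B - snd (\<phi> x)))))) ^ 2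
     \<le> (real (n ^ n * fact n)) ^ 2 * ((X0 * Y0) ^ A * (H ^ B) ^ 2) ^ n"
proof -
  let ?J = "{..A} \<times> {..B}"
  let ?E = "\<lambda>r x. d r ^ fst (\<phi> x) * e r ^ (A - fst (\<phi> x)) * v r ^ snd (\<phi> x) * u r ^ (B - snd (\<phi> x))"
  define y where "y r = real_of_int (d r) - s0 * of_int (e r)" for r
  define Z where "Z r = (\<lambda>(q, j). y r ^ q * of_int (e r) ^ (A - q) * of_int (v r) ^ j * of_int (u r) ^ (B - j))" for r
  define BB where "BB = (\<lambda>(q, j) x. if j = snd (\<phi> x) \<and> q \<le> fst (\<phi> x) then of_nat (fst (\<phi> x) choose q) * s0 ^ (fst (\<phi> x) - q) else 0)"
  define z where "z = (\<lambda>(q, j :: nat). X0 ^ q * Y0 ^ (A - q) * H ^ B)"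
  define G where "G = (\<Prod>p\<in>?J. z p)"
  have card: "card ?J = n" using bij_betw_same_card[OF \<phi>] by simp
  have \<phi>in: "fst (\<phi> x) \<le> A \<and> snd (\<phi> x) \<le> B" if "x < n" for x
    using bij_betwE[OF \<phi>] that by (auto simp: mem_Times_iff)
  have E: "real_of_int (?E r x) = (\<Sum>m\<in>?J. Z r m * BB m x)" if x: "x < n" for r x
  proof -
    let ?i = "fst (\<phi> x)" and ?j = "snd (\<phi> x)"
    have "(\<Sum>m\<in>?J. Z r m * BB m x) = (\<Sum>q\<le>A. \<Sum>j\<le>B. Z r (q, j) * BB (q, j) x)"
      by (simp add: sum.cartesian_product)
    also have "\<dots> = (\<Sum>q\<le>A. \<Sum>j\<le>B. if j = ?j then Z r (q, ?j) * BB (q, ?j) x else 0)"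
      by (intro sum.cong refl) (auto simp: BB_def)
    also have "\<dots> = (\<Sum>q\<le>A. Z r (q, ?j) * BB (q, ?j) x)" using \<phi>in[OF x] by simp
    also have "\<dots> = (\<Sum>q\<le>?i. Z r (q, ?j) * BB (q, ?j) x)"
      using \<phi>in[OF x] by (intro sum.mono_neutral_right) (auto simp: BB_def)
    also have "\<dots> = (\<Sum>q\<le>?i. of_nat (?i choose q) * y r ^ q * (s0 * of_int (e r)) ^ (?i - q)) * 
        (of_int (e r) ^ (A - ?i) * of_int (v r) ^ ?j * of_int (u r) ^ (B - ?j))"
      unfolding sum_distrib_right
    proof (intro sum.cong refl)
      fix q assume q: "q \<in> {..?i}"
      have "A - q = (?i - q) + (A - ?i)" using q \<phi>in[OF x] by auto
      hence "real_of_int (e r) ^ (A - q) = of_int (e r) ^ (?i - q) * of_int (e r) ^ (A - ?i)" by (simp add: power_add)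
      thus "Z r (q, ?j) * BB (q, ?j) x = of_nat (?i choose q) * y r ^ q * (s0 * of_int (e r)) ^ (?i - q) * 
        (of_int (e r) ^ (A - ?i) * of_int (v r) ^ ?j * of_int (u r) ^ (B - ?j))"
        using q by (simp add: Z_def BB_def power_mult_distrib mult_ac)
    qed
    also have "(\<Sum>q\<le>?i. of_nat (?i choose q) * y r ^ q * (s0 * of_int (e r)) ^ (?i - q)) = (y r + s0 * of_int (e r)) ^ ?i"
      by (rule binomial_ring[symmetric])
    also have "y r + s0 * of_int (e r) = of_int (d r)" by (simp add: y_def)
    finally show ?thesis by (simp add: mult_ac)
  qed
  have G0: "G \<ge> 0" unfolding G_def z_def using pos by (intro prod_nonneg) auto
  have "\<bar>det (mat n n (\<lambda>(r, x). \<Sum>m\<in>?J. Z r m * BB m x))\<bar> \<le> real (card ?J) ^ n * fact n * G"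
  proof (rule abs_det_expand_le[where z = z])
    show "\<bar>Z r m\<bar> \<le> z m" if r: "r < n" and mJ: "m \<in> ?J" for r m
    proof -
      obtain q j where m: "m = (q, j)" "q \<le> A" "j \<le> B" using mJ by auto
      have "\<bar>Z r m\<bar> \<le> X0 ^ q * Y0 ^ (A - q) * H ^ j * H ^ (B - j)"
        unfolding m(1) Z_def prod.case abs_mult power_abs
        using bd[OF r] pos by (intro mult_mono power_mono) (auto simp: y_def)
      also have "\<dots> = z m" using m by (simp add: z_def mult.assoc flip: power_add)
      finally show ?thesis .
    qed
    fix f assume f: "f \<in> {0..<n} \<rightarrow> ?J" "inj_on f {0..<n}"
    show "(\<Prod>c=0..<n. \<bar>BB (f c) c\<bar> * z (f c)) \<le> G"
    proof (cases "\<forall>c<n. BB (f c) c \<noteq> 0")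
      case False
      then obtain c where "c < n" "BB (f c) c = 0" by blast
      hence "(\<Prod>c=0..<n. \<bar>BB (f c) c\<bar> * z (f c)) = 0" by (intro prod_zero) auto
      thus ?thesis using G0 by linarith
    next
      case True
      have "f ` {0..<n} = ?J"
      proof (rule card_subset_eq)
        show "f ` {0..<n} \<subseteq> ?J" using f(1) by blast
        show "card (f ` {0..<n}) = card ?J" unfolding card card_image[OF f(2)] by simp
      qed simp
      hence bf: "bij_betw f {0..<n} ?J" using f(2) by (simp add: bij_betw_def)
      \<comment> \<open>Only exponents q <= i have a nonzero coefficient. Both f and \<phi> run
        through all pairs, so their first coordinates have the same sum; hence q = i throughout, and
        the coefficient is 1.\<close>
      have le: "fst (f c) \<le> fst (\<phi> c)" if "c < n" for c
        using True[rule_format, OF that] by (cases "f c") (auto simp: BB_def split: if_splits)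
      have "(\<Sum>c=0..<n. fst (f c)) = (\<Sum>c=0..<n. fst (\<phi> c))"
        using sum.reindex_bij_betw[OF bf, of fst] sum.reindex_bij_betw[OF \<phi>, of fst] by simp
      have eq: "fst (f c) = fst (\<phi> c)" if c: "c < n" for c
      proof (rule ccontr)
        assume "fst (f c) \<noteq> fst (\<phi> c)"
        hence "(\<Sum>c=0..<n. fst (f c)) < (\<Sum>c=0..<n. fst (\<phi> c))"
          using le c by (intro sum_strict_mono_ex1) (auto intro!: bexI[of _ c] simp: le_neq_implies_less)
        thus False using \<open>(\<Sum>c=0..<n. fst (f c)) = (\<Sum>c=0..<n. fst (\<phi> c))\<close> by simp
      qed
      have "BB (f c) c = 1" if "c < n" for c
        using True[rule_format, OF that] eq[OF that] by (cases "f c") (auto simp: BB_def split: if_splits)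
      hence "(\<Prod>c=0..<n. \<bar>BB (f c) c\<bar> * z (f c)) = (\<Prod>c=0..<n. z (f c))" by (intro prod.cong) auto
      also have "\<dots> = G" unfolding G_def by (rule prod.reindex_bij_betw[OF bf])
      finally show ?thesis by simp
    qed
  qed (use G0 in auto)
  also have "mat n n (\<lambda>(r, x). \<Sum>m\<in>?J. Z r m * BB m x) = map_mat real_of_int (mat n n (\<lambda>(r, x). ?E r x))"
    by (intro eq_matI) (auto simp: E simp del: of_int_mult of_int_power)
  also have "det \<dots> = real_of_int (det (mat n n (\<lambda>(r, x). ?E r x)))" by (rule of_int_hom.hom_det)
  finally have "\<bar>real_of_int (det (mat n n (\<lambda>(r, x). ?E r x)))\<bar> ^ 2 \<le> (real (card ?J) ^ n * fact n * G) ^ 2"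
    by (intro power_mono) auto
  also have "\<dots> = (real (n ^ n * fact n)) ^ 2 * G ^ 2" unfolding card by (simp add: power_mult_distrib)
  also have "G ^ 2 = ((X0 * Y0) ^ A * (H ^ B) ^ 2) ^ n"
  proof -
    \<comment> \<open>Reflecting q to A - q exchanges X0 and Y0, and the product of both expressions
      depends on X0 Y0 only. This is why the bound is stated for the square.\<close>
    have "G = (\<Prod>p\<in>?J. X0 ^ (A - fst p) * Y0 ^ fst p * H ^ B)"
      unfolding G_def z_def
      by (rule prod.reindex_bij_witness[of _ "\<lambda>(q, j). (A - q, j)" "\<lambda>(q, j). (A - q, j)"]) auto
    hence "G ^ 2 = (\<Prod>p\<in>?J. z p) * (\<Prod>p\<in>?J. X0 ^ (A - fst p) * Y0 ^ fst p * H ^ B)"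
      unfolding power2_eq_square by (simp add: G_def)
    also have "\<dots> = (\<Prod>p\<in>?J. (X0 * Y0) ^ A * (H ^ B) ^ 2)"
      unfolding prod.distrib[symmetric]
    proof (intro prod.cong refl)
      fix p assume p: "p \<in> ?J"
      have "z p * (X0 ^ (A - fst p) * Y0 ^ fst p * H ^ B) =
         (X0 ^ fst p * X0 ^ (A - fst p)) * (Y0 ^ fst p * Y0 ^ (A - fst p)) * (H ^ B) ^ 2"
        by (simp add: z_def power2_eq_square mult_ac split: prod.splits)
      moreover have "fst p + (A - fst p) = A" using p by auto
      hence "X0 ^ fst p * X0 ^ (A - fst p) = X0 ^ A" "Y0 ^ fst p * Y0 ^ (A - fst p) = Y0 ^ A"
        by (simp_all flip: power_add)
      ultimately show "z p * (X0 ^ (A - fst p) * Y0 ^ fst p * H ^ B) = (X0 * Y0) ^ A * (H ^ B) ^ 2"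
        by (simp add: power_mult_distrib)
    qed
    finally show ?thesis using card by simp
  qed
  finally show ?thesis by simp
qed

text \<open>The root bound over the field with p elements, with divisibility by the constant
  polynomial \<open>[:p:]\<close> in place of reduction modulo p. Synthetic division at one root r
  lowers the degree, and the other roots r' survive because p does not divide r' - r.\<close>

lemma poly_mod_prime_zero:
  fixes f :: "int poly"
  assumes "prime p" "degree f \<le> b" "R \<subseteq> {0..<p}" "card R > b" "\<And>r. r \<in> R \<Longrightarrow> p dvd poly f r"
  shows "[:p:] dvd f"
  using assms(2-)
proof (induction b arbitrary: f R)
  case 0
  then obtain r where r: "r \<in> R" by (metis card.empty ex_in_conv less_irrefl)
  obtain x where "f = [:x:]" using 0(1) by (meson degree_eq_zeroE le_zero_eq)
  thus ?case using 0(4)[OF r] by (auto simp: const_poly_dvd_iff coeff_pCons split: nat.splits)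
next
  case (Suc b)
  then obtain r where r: "r \<in> R" by (metis card.empty ex_in_conv not_less_zero)
  have finR: "finite R" using Suc.prems(2) finite_subset by blast
  define q where "q = synthetic_div f r"
  have fq: "f = [:- r, 1:] * q + [:poly f r:]" unfolding q_def by (rule synthetic_div_correct'[symmetric])
  have "[:p:] dvd q"
  proof (rule Suc.IH)
    show "degree q \<le> b" using Suc.prems(1) by (simp add: q_def degree_synthetic_div)
    show "R - {r} \<subseteq> {0..<p}" using Suc.prems(2) by auto
    show "card (R - {r}) > b" using Suc.prems(3) r finR by simp
    fix r' assume r': "r' \<in> R - {r}"
    have "poly f r' = poly ([:- r, 1:] * q + [:poly f r:]) r'" by (simp only: fq[symmetric])
    hence "poly f r' - poly f r = (r' - r) * poly q r'" by (simp add: algebra_simps)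
    hence "p dvd (r' - r) * poly q r'" using Suc.prems(4) r r' by (metis DiffD1 dvd_diff)
    moreover have "\<not> p dvd r' - r"
    proof
      assume "p dvd r' - r"
      moreover have "r \<in> {0..<p}" "r' \<in> {0..<p}" using r r' Suc.prems(2) by blast+
      hence "\<bar>r' - r\<bar> < p" "r' - r \<noteq> 0" using r' by auto
      ultimately show False using dvd_imp_le_int[of "r' - r" p] by auto
    qed
    ultimately show "p dvd poly q r'" using assms(1) prime_dvd_mult_iff by blast
  qed
  moreover have "[:p:] dvd [:poly f r:]" using Suc.prems(4)[OF r] by simp
  ultimately have "[:p:] dvd [:- r, 1:] * q + [:poly f r:]" by (rule dvd_add[OF dvd_mult])
  thus ?case by (simp only: fq[symmetric])
qed

definition dt_coeffs :: "(nat \<Rightarrow> nat \<Rightarrow> int) \<Rightarrow> nat \<Rightarrow> nat \<Rightarrow> int" where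
  "dt_coeffs c i j = int (Suc j) * c i (Suc j)"

lemma iform_dt_eq: "iform_dt a (Suc b) c s t = iform a b (dt_coeffs c) s t"
  unfolding iform_dt_def iform_def
  by (rule sum.cong[OF refl]) (simp add: sum.atMost_Suc_shift dt_coeffs_def mult_ac del: sum.atMost_Suc)

lemma form_cong_iform:
  assumes "[d = s * e] (mod q)" "[v = t * u] (mod q)"
  shows "[form a b c d e u v = e ^ a * u ^ b * iform a b c s t] (mod q)"
proof -
  have "[form a b c d e u v = form a b c (s * e) e u (t * u)] (mod q)"
    unfolding form_def using assms by (intro cong_sum cong_mult cong_pow cong_refl)
  also have "form a b c (s * e) e u (t * u) = e ^ a * u ^ b * iform a b c s t"
    unfolding form_def iform_def sum_distrib_left
  proof (intro sum.cong refl)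
    fix i j assume ij: "i \<in> {..a}" "j \<in> {..b}"
    have "e ^ a = e ^ i * e ^ (a - i)" "u ^ b = u ^ j * u ^ (b - j)"
      using ij by (auto simp flip: power_add)
    thus "c i j * ((s * e) ^ i * e ^ (a - i) * (t * u) ^ j * u ^ (b - j)) = e ^ a * u ^ b * (c i j * s ^ i * t ^ j)"
      by (simp add: power_mult_distrib mult_ac)
  qed
  finally show ?thesis .
qed

text \<open>For fixed s there are at most b roots t modulo p, unless the polynomial in t vanishes
  identically modulo p; in that case its derivative vanishes too, and no t is counted for this
  s.\<close>

lemma card_simple_root_classes:
  fixes p :: int
  assumes p: "prime p"
  shows "card {(s, t). s \<in> {0..<p} \<and> t \<in> {0..<p} \<and> p dvd iform a b c s t \<and> \<not> p dvd iform_dt a b c s t} \<le> nat p * b"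
proof -
  let ?C = "{(s, t). s \<in> {0..<p} \<and> t \<in> {0..<p} \<and> p dvd iform a b c s t \<and> \<not> p dvd iform_dt a b c s t}"
  have fin: "finite ?C" by (rule finite_subset[of _ "{0..<p} \<times> {0..<p}"]) auto
  have "card ?C \<le> b * card (fst ` ?C)"
  proof (rule card_le_mult_card_image[OF fin])
    fix s assume "s \<in> fst ` ?C"
    define f where "f = (\<Sum>j\<le>b. monom (\<Sum>i\<le>a. c i j * s ^ i) j)"
    have coeff_f: "coeff f j = (if j \<le> b then (\<Sum>i\<le>a. c i j * s ^ i) else 0)" for j
      by (simp add: f_def coeff_sum)
    have ev: "poly f t = iform a b c s t" for t
      unfolding f_def iform_def poly_sum poly_monom sum_distrib_right by (rule sum.swap)
    have ev': "iform_dt a b c s t = (\<Sum>j\<le>b. coeff f j * (int j * t ^ (j - 1)))" for t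
      unfolding iform_dt_def by (subst sum.swap) (auto simp: coeff_f sum_distrib_right intro!: sum.cong)
    define R where "R = snd ` {P\<in>?C. fst P = s}"
    have R: "R \<subseteq> {0..<p}" "\<And>t. t \<in> R \<Longrightarrow> p dvd poly f t" "\<And>t. t \<in> R \<Longrightarrow> \<not> p dvd iform_dt a b c s t"
      unfolding R_def ev by auto
    have "card {P\<in>?C. fst P = s} = card R"
      unfolding R_def by (intro card_image[symmetric] inj_onI) auto
    also have "card R \<le> b"
    proof (rule ccontr)
      assume *: "\<not> card R \<le> b"
      hence "R \<noteq> {}" by auto
      then obtain t where t: "t \<in> R" by blast
      have "degree f \<le> b" by (rule degree_le) (simp add: coeff_f)
      hence "[:p:] dvd f" using poly_mod_prime_zero[OF p _ R(1), of f b] R(2) * by auto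
      hence "p dvd coeff f j" for j by (simp add: const_poly_dvd_iff)
      hence "p dvd iform_dt a b c s t" unfolding ev' by (intro dvd_sum dvd_mult2)
      thus False using R(3)[OF t] by simp
    qed
    finally show "card {P\<in>?C. fst P = s} \<le> b" .
  qed
  also have "card (fst ` ?C) \<le> card {0..<p}" by (intro card_mono) auto
  finally show ?thesis using p by (simp add: mult.commute)
qed

text \<open>There are n = (A + 1) b monomials of bidegree (A, b - 1). Their determinants at points
  of one class are multiples of p^N with N = n (n - 1) / 2 and, by \<open>size\<close>, smaller than
  p^N. Degree b - 1 in (u, v) keeps the new form below the degree of the given one, so that a
  nonzero resultant of the two can be used.\<close>

lemma padic_class_on_form:
  fixes H :: int and p :: int
  assumes p: "prime p" and b: "b > 0"
    and bd: "\<And>P. P \<in> T \<Longrightarrow> 0 < d P \<and> d P \<le> H \<and> 0 < e P \<and> e P \<le> H \<and> 0 < u P \<and> u P \<le> H \<and> 0 < v P \<and> v P \<le> H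
        \<and> \<bar>of_int (d P) - s00 * of_int (e P)\<bar> \<le> X0 \<and> of_int (e P) \<le> Y0"
    and XY: "X0 > 0" "Y0 > 0" and H: "H \<ge> 1"
    and cls: "\<And>P. P \<in> T \<Longrightarrow> [d P = s0 * e P] (mod p) \<and> [v P = t0 * u P] (mod p) \<and> \<not> p dvd e P \<and> \<not> p dvd u P"
    and F: "\<And>P. P \<in> T \<Longrightarrow> form a b c (d P) (e P) (u P) (v P) = 0"
    and dt: "\<not> p dvd iform_dt a b c s0 t0"
    and n: "n = (A + 1) * b"
    and size: "(real (n ^ n * fact n)) ^ 2 * ((X0 * Y0) ^ A * (of_int H ^ (b - 1)) ^ 2) ^ n < of_int p ^ (n * (n - 1))"
  shows "on_form A (b - 1) T d e u v"
proof -
  define N where "N = (\<Sum>i<n. i)"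
  have N2: "2 * N = n * (n - 1)" unfolding N_def
    by (induction n) (auto simp: algebra_simps)
  have p0: "p > 1" using p by (simp add: prime_gt_1_int)
  have n1: "n \<ge> 1" using n b by simp
  obtain \<phi> where "bij_betw \<phi> {0..<(A + 1) * ((b - 1) + 1)} ({..A} \<times> {..b - 1})" using ex_bij_pairs by blast
  hence \<phi>: "bij_betw \<phi> {0..<n} ({..A} \<times> {..b - 1})" using b by (simp add: n)
  obtain w where w: "[w * iform_dt a b c s0 t0 = 1] (mod p)"
  proof -
    have "coprime (iform_dt a b c s0 t0) p" using dt p by (simp add: prime_imp_coprime coprime_commute)
    then obtain x where "[iform_dt a b c s0 t0 * x = 1] (mod p)" using cong_solve_coprime_int by blast
    thus ?thesis using that[of x] by (simp add: mult.commute)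
  qed
  have inv: "\<exists>s. [x = s * y] (mod p ^ N)" if "\<not> p dvd y" for x y
  proof -
    have "coprime y (p ^ N)" using that p by (simp add: prime_imp_coprime coprime_commute)
    then obtain z where "[y * z = 1] (mod p ^ N)" using cong_solve_coprime_int by blast
    hence "[x * (y * z) = x * 1] (mod p ^ N)" by (intro cong_mult cong_refl)
    thus ?thesis by (intro exI[of _ "x * z"]) (simp add: cong_sym mult_ac)
  qed
  have "\<forall>P. \<exists>s. P \<in> T \<longrightarrow> [d P = s * e P] (mod p ^ N)" using inv cls by blast
  then obtain s where s: "\<And>P. P \<in> T \<Longrightarrow> [d P = s P * e P] (mod p ^ N)" by metis
  have "\<forall>P. \<exists>t. P \<in> T \<longrightarrow> [v P = t * u P] (mod p ^ N)" using inv cls by blast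
  then obtain t where t: "\<And>P. P \<in> T \<Longrightarrow> [v P = t P * u P] (mod p ^ N)" by metis
  have vanish: "det (mat n n (\<lambda>(r, x). d (\<rho> r) ^ fst (\<phi> x) * e (\<rho> r) ^ (A - fst (\<phi> x))
             * v (\<rho> r) ^ snd (\<phi> x) * u (\<rho> r) ^ (b - 1 - snd (\<phi> x)))) = 0" (is "?D = 0")
    if \<rho>: "\<rho> \<in> {0..<n} \<rightarrow> T" for \<rho>
  proof (rule ccontr)
    assume nz: "?D \<noteq> 0"
    have \<rho>T: "\<rho> r \<in> T" if "r < n" for r using \<rho> that by auto
    have dvdD: "p ^ N dvd ?D"
    \<comment> \<open>For N = 0 the congruences modulo p^N say nothing modulo p, but the claim is
      then trivial.\<close>
    proof (cases "N = 0")
      case False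
      hence pN: "p dvd p ^ N" by simp
      have s0: "[s P = s0] (mod p)" if "P \<in> T" for P
      proof -
        have "[s P * e P = s0 * e P] (mod p)"
          using cong_dvd_modulus[OF s[OF that] pN] cls[OF that] by (meson cong_sym cong_trans)
        thus ?thesis using cls[OF that] p by (subst (asm) cong_mult_rcancel) (auto simp: prime_imp_coprime coprime_commute)
      qed
      have t0: "[t P = t0] (mod p)" if "P \<in> T" for P
      proof -
        have "[t P * u P = t0 * u P] (mod p)"
          using cong_dvd_modulus[OF t[OF that] pN] cls[OF that] by (meson cong_sym cong_trans)
        thus ?thesis using cls[OF that] p by (subst (asm) cong_mult_rcancel) (auto simp: prime_imp_coprime coprime_commute)
      qed
      have Fp: "p ^ N dvd iform a b c (s P) (t P)" if "P \<in> T" for P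
      proof -
        have "[0 = e P ^ a * u P ^ b * iform a b c (s P) (t P)] (mod p ^ N)"
          using form_cong_iform[OF s[OF that] t[OF that], of a b c] F[OF that] by simp
        hence "p ^ N dvd e P ^ a * u P ^ b * iform a b c (s P) (t P)" by (simp add: cong_iff_dvd_diff)
        moreover have "coprime (p ^ N) (e P ^ a * u P ^ b)"
          using cls[OF that] p by (simp add: prime_imp_coprime)
        ultimately show ?thesis using coprime_dvd_mult_right_iff by blast
      qed
      obtain f where f: "\<And>P. P \<in> T \<Longrightarrow> p ^ N dvd t P - poly f (s P - s0)"
        using hensel_polynomial[where S = T and r = N and m = N and s = s and t = t, OF s0 t0 Fp w] False by auto
      show ?thesis
      proof (rule padic_det_dvd[where n = n and s = "\<lambda>r. s (\<rho> r)" and t = "\<lambda>r. t (\<rho> r)" and f = f and ?s0.0 = s0, folded N_def])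
        show "fst (\<phi> x) \<le> A \<and> snd (\<phi> x) \<le> b - 1" if "x < n" for x
          using bij_betwE[OF \<phi>] that by (auto simp: mem_Times_iff)
        show "p dvd s (\<rho> r) - s0" if "r < n" for r using s0[OF \<rho>T[OF that]] by (simp add: cong_iff_dvd_diff)
        show "[d (\<rho> r) = s (\<rho> r) * e (\<rho> r)] (mod p ^ N)" if "r < n" for r by (rule s[OF \<rho>T[OF that]])
        show "[v (\<rho> r) = t (\<rho> r) * u (\<rho> r)] (mod p ^ N)" if "r < n" for r by (rule t[OF \<rho>T[OF that]])
        show "p ^ N dvd t (\<rho> r) - poly f (s (\<rho> r) - s0)" if "r < n" for r by (rule f[OF \<rho>T[OF that]])
      qed
    qed simp
    have "real_of_int ?D ^ 2 \<le> (real (n ^ n * fact n)) ^ 2 * ((X0 * Y0) ^ A * (of_int H ^ (b - 1)) ^ 2) ^ n"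
    proof (rule strip_det_bound[OF \<phi>, where ?s0.0 = s00])
      fix r assume "r < n"
      from bd[OF \<rho>T[OF this]] show "\<bar>of_int (d (\<rho> r)) - s00 * of_int (e (\<rho> r))\<bar> \<le> X0 \<and> \<bar>of_int (e (\<rho> r))\<bar> \<le> Y0 \<and>
        \<bar>of_int (u (\<rho> r))\<bar> \<le> real_of_int H \<and> \<bar>of_int (v (\<rho> r))\<bar> \<le> real_of_int H" by auto
    qed (use XY H in auto)
    also have "\<dots> < of_int p ^ (n * (n - 1))" by (rule size)
    also have "\<dots> = (of_int p ^ N) ^ 2" by (simp only: N2[symmetric] power_mult[symmetric] mult.commute)
    finally have "real_of_int (?D ^ 2) < real_of_int ((p ^ N) ^ 2)" by (simp only: of_int_power)
    hence "?D ^ 2 < (p ^ N) ^ 2" by (simp only: of_int_less_iff)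
    hence "\<bar>?D\<bar> < p ^ N" using p0 by (intro power2_less_imp_less[of "\<bar>?D\<bar>"]) auto
    moreover have "p ^ N \<le> \<bar>?D\<bar>" using dvd_imp_le_int[OF nz dvdD] p0 by simp
    ultimately show False by simp
  qed
  obtain c' where "\<exists>i\<le>A. \<exists>j\<le>b - 1. c' i j \<noteq> 0" "\<And>P. P \<in> T \<Longrightarrow> form A (b - 1) c' (d P) (e P) (u P) (v P) = 0"
  proof (rule on_form_of_vanishing_dets[OF \<phi> H])
    show "0 \<le> d P \<and> d P \<le> H \<and> 0 \<le> e P \<and> e P \<le> H \<and> 0 \<le> u P \<and> u P \<le> H \<and> 0 \<le> v P \<and> v P \<le> H" if "P \<in> T" for P
      using bd[OF that] by auto
  qed (use vanish in blast)+
  thus ?thesis unfolding on_form_def by blast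
qed

section \<open>Counting points on a form inside a strip\<close>

lemma prod_primes_dvd:
  fixes X :: int
  assumes "finite \<P>" "\<And>p. p \<in> \<P> \<Longrightarrow> prime p \<and> int p dvd X"
  shows "(\<Prod>p\<in>\<P>. int p) dvd X"
  using assms
proof (induction \<P> rule: finite_induct)
  case (insert p \<P>)
  have "coprime (int p) (\<Prod>p\<in>\<P>. int p)"
  proof (rule prod_coprime_right)
    fix q assume "q \<in> \<P>"
    hence "coprime p q" using insert by (intro primes_coprime) auto
    thus "coprime (int p) (int q)" by simp
  qed
  hence "int p * (\<Prod>p\<in>\<P>. int p) dvd X" using insert by (intro divides_mult) auto
  thus ?case using insert by simp
qed simp

text \<open>More than C / \<delta> distinct primes, each at least H^\<delta>, have a product
  exceeding H^C, so they cannot all divide X.\<close>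

lemma ex_prime_not_dvd:
  fixes X :: int and H \<delta> C :: real
  assumes \<P>: "finite \<P>" "\<And>p. p \<in> \<P> \<Longrightarrow> prime p \<and> real p \<ge> H powr \<delta>"
    and X: "X \<noteq> 0" "\<bar>real_of_int X\<bar> \<le> H powr C" and H: "H > 1" and card: "\<delta> * card \<P> > C"
  obtains p where "p \<in> \<P>" "\<not> int p dvd X"
proof -
  have "\<exists>p\<in>\<P>. \<not> int p dvd X"
  proof (rule ccontr)
    assume "\<not> ?thesis"
    hence "(\<Prod>p\<in>\<P>. int p) dvd X" using \<P> by (intro prod_primes_dvd) auto
    hence "\<bar>\<Prod>p\<in>\<P>. int p\<bar> \<le> \<bar>X\<bar>" using X(1) by (intro dvd_imp_le_int)
    hence "real_of_int \<bar>\<Prod>p\<in>\<P>. int p\<bar> \<le> real_of_int \<bar>X\<bar>" by (simp only: of_int_le_iff)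
    hence "(\<Prod>p\<in>\<P>. real p) \<le> H powr C" using X(2) by (simp add: abs_prod)
    moreover have "(\<Prod>p\<in>\<P>. real p) \<ge> (\<Prod>p\<in>\<P>. H powr \<delta>)" using \<P>(2) by (intro prod_mono) auto
    moreover have "(\<Prod>p\<in>\<P>. H powr \<delta>) = H powr (\<delta> * card \<P>)"
      using H by (simp add: powr_powr powr_realpow[symmetric])
    moreover have "H powr (\<delta> * card \<P>) > H powr C" using H card by (intro powr_less_mono)
    ultimately show False by linarith
  qed
  thus ?thesis using that by blast
qed

lemma abs_form_le:
  fixes H :: int
  assumes "\<And>i j. \<bar>c i j\<bar> \<le> Cm" "0 \<le> d" "d \<le> H" "0 \<le> e" "e \<le> H" "0 \<le> u" "u \<le> H" "0 \<le> v" "v \<le> H"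
  shows "\<bar>form a b c d e u v\<bar> \<le> int ((a + 1) * (b + 1)) * (Cm * H ^ (a + b))"
proof -
  have "\<bar>form a b c d e u v\<bar> \<le> (\<Sum>i\<le>a. \<bar>\<Sum>j\<le>b. c i j * (d ^ i * e ^ (a - i) * v ^ j * u ^ (b - j))\<bar>)"
    unfolding form_def by (rule sum_abs)
  also have "\<dots> \<le> (\<Sum>i\<le>a. \<Sum>j\<le>b. Cm * H ^ (a + b))"
  proof (rule sum_mono, rule order.trans[OF sum_abs], rule sum_mono)
    fix i j assume ij: "i \<in> {..a}" "j \<in> {..b}"
    have "\<bar>d ^ i * e ^ (a - i) * v ^ j * u ^ (b - j)\<bar> \<le> H ^ i * H ^ (a - i) * H ^ j * H ^ (b - j)"
      unfolding abs_mult power_abs using assms by (intro mult_mono power_mono) auto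
    also have "\<dots> = H ^ (a + b)" using ij by (simp flip: power_add)
    finally have "\<bar>d ^ i * e ^ (a - i) * v ^ j * u ^ (b - j)\<bar> \<le> H ^ (a + b)" .
    moreover have "Cm \<ge> 0" using assms(1)[of 0 0] by linarith
    ultimately show "\<bar>c i j * (d ^ i * e ^ (a - i) * v ^ j * u ^ (b - j))\<bar> \<le> Cm * H ^ (a + b)"
      unfolding abs_mult[of "c i j"] using assms(1)[of i j] by (intro mult_mono) auto
  qed
  also have "\<dots> = int ((a + 1) * (b + 1)) * (Cm * H ^ (a + b))" by (simp add: algebra_simps)
  finally show ?thesis .
qed

text \<open>The trivial count of pairs (d, e); it disposes of all H below a constant.\<close>

lemma in_strip_card_le:
  assumes "in_strip k l h K0 H s0 X0 Y0 \<rho> S d e u v"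
  shows "real (card S) \<le> real K0 * of_int H ^ 2"
proof -
  have fib: "fibres_le K0 S d e" and H: "H \<ge> 1" using assms by (auto simp: in_strip_def)
  let ?f = "\<lambda>P. (d P, e P)"
  have finS: "finite S" using fib by (simp add: fibres_le_def)
  have "card S \<le> K0 * card (?f ` S)"
  proof (rule card_le_mult_card_image[OF finS])
    fix y assume "y \<in> ?f ` S"
    then obtain P0 where P0: "P0 \<in> S" "y = ?f P0" by auto
    have "card {P \<in> S. ?f P = y} \<le> card {P\<in>S. d P * e P0 = d P0 * e P}"
      using finS P0 by (intro card_mono) auto
    also have "\<dots> \<le> K0" using fib P0(1) by (auto simp: fibres_le_def)
    finally show "card {P \<in> S. ?f P = y} \<le> K0" .
  qed
  also have "card (?f ` S) \<le> card ({1..H} \<times> {1..H})"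
    using assms by (intro card_mono) (auto simp: in_strip_def)
  finally have "card S \<le> K0 * card ({1..H} \<times> {1..H})" by simp
  also have "card ({1..H} \<times> {1..H}) = nat H ^ 2" by (simp add: card_cartesian_product power2_eq_square)
  finally have "real (card S) \<le> real (K0 * nat H ^ 2)" by (simp only: of_nat_le_iff)
  also have "\<dots> = real K0 * of_int H ^ 2" using H by simp
  finally show ?thesis .
qed

text \<open>The hypothesis \<open>res\<close> plays the role of irreducibility. Points where the
  t-derivative W vanishes are few, since W has smaller degree than F. Any other point, for a prime
  not dividing e u W, lies over a simple root (s, t) modulo that prime. Each such class satisfies a
  form of degree at most b - 1 in (u, v), whose resultant with F bounds its number of
  points.\<close>

lemma card_irreducible_form:
  fixes H :: int and \<P> :: "nat set" and a b :: nat and c :: "nat \<Rightarrow> nat \<Rightarrow> int"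
  assumes st: "in_strip k l h K0 H s00 X0 Y0 \<rho> S d e u v" and b: "b \<ge> 2"
  defines "F \<equiv> poly_of_coeffs a b c"
  assumes F: "degree F = b" and res: "\<And>G. G \<noteq> 0 \<Longrightarrow> degree G < b \<Longrightarrow> resultant F G \<noteq> 0"
    and van: "\<And>P. P \<in> S \<Longrightarrow> form a b c (d P) (e P) (u P) (v P) = 0"
    and A: "A \<ge> a" and n: "n = (A + 1) * b"
    and \<P>: "finite \<P>" "\<And>p. p \<in> \<P> \<Longrightarrow> prime p \<and> real p \<le> B \<and>
       (real (n ^ n * fact n)) ^ 2 * ((X0 * Y0) ^ A * (of_int H ^ (b - 1)) ^ 2) ^ n < real p ^ (n * (n - 1))"
    and avoid: "\<And>P. P \<in> S \<Longrightarrow> form a (b - 1) (dt_coeffs c) (d P) (e P) (u P) (v P) \<noteq> 0 \<Longrightarrow>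
       \<exists>p\<in>\<P>. \<not> int p dvd e P * u P * form a (b - 1) (dt_coeffs c) (d P) (e P) (u P) (v P)"
  shows "real (card S) \<le> real (A * (2 * b) * K0) * (1 + real (card \<P>) * (B * b))"
proof -
  have fib: "fibres_le K0 S d e" and H: "H \<ge> 1" and XY: "X0 > 0" "Y0 > 0" using st by (auto simp: in_strip_def)
  have finS: "finite S" using fib by (simp add: fibres_le_def)
  have pos: "e P > 0" "u P > 0" if "P \<in> S" for P using st that by (auto simp: in_strip_def)
  have coeffF: "degree (coeff F j) \<le> A" for j unfolding F_def using A degree_poly_of_coeffs(2) order_trans by blast
  define M where "M = A * (2 * b) * K0"
  have bounded: "card T \<le> M"
    if T: "T \<subseteq> S" and c': "\<exists>i\<le>A. \<exists>j\<le>b - 1. c' i j \<noteq> 0"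
      "\<And>P. P \<in> T \<Longrightarrow> form A (b - 1) c' (d P) (e P) (u P) (v P) = 0" for T c'
  proof -
    define G where "G = poly_of_coeffs A (b - 1) c'"
    have "G \<noteq> 0" using c'(1) coeff_poly_of_coeffs[of A "b - 1" c'] unfolding G_def by (metis coeff_0)
    moreover have dG: "degree G < b" using degree_poly_of_coeffs(1)[of A "b - 1" c'] b by (simp add: G_def)
    ultimately have "resultant F G \<noteq> 0" by (rule res)
    hence "card T \<le> A * (degree F + degree G) * K0"
    proof (rule card_le_resultant[where t = "\<lambda>P. of_int (v P) / of_int (u P)", OF fibres_le_subset[OF fib T]])
      show "0 < degree F" using F b by simp
      show "degree (coeff F j) \<le> A" for j by (rule coeffF)
      show "degree (coeff G j) \<le> A" for j unfolding G_def by (rule degree_poly_of_coeffs(2))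
      fix P assume P: "P \<in> T"
      hence PS: "P \<in> S" using T by blast
      show "ev2 F (of_int (d P) / of_int (e P)) (of_int (v P) / of_int (u P)) = 0"
        unfolding F_def using pos[OF PS] van[OF PS] by (intro ev2_eq_0_of_form) auto
      show "ev2 G (of_int (d P) / of_int (e P)) (of_int (v P) / of_int (u P)) = 0"
        unfolding G_def using pos[OF PS] c'(2)[OF P] by (intro ev2_eq_0_of_form) auto
    qed
    also have "\<dots> \<le> M" unfolding M_def using F dG by (intro mult_right_mono mult_left_mono) auto
    finally show ?thesis .
  qed
  let ?W = "\<lambda>P. form a (b - 1) (dt_coeffs c) (d P) (e P) (u P) (v P)"
  define S1 where "S1 = {P\<in>S. ?W P = 0}"
  \<comment> \<open>The leading coefficient in t is multiplied by b \<noteq> 0 under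
    differentiation, so the derivative is not the zero form.\<close>
  have dt_nz: "\<exists>i\<le>a. dt_coeffs c i (b - 1) \<noteq> 0"
  proof -
    have "coeff F b \<noteq> 0" using F b by (metis degree_0 leading_coeff_0_iff not_numeral_le_zero)
    then obtain i where "coeff (coeff F b) i \<noteq> 0" by (metis leading_coeff_0_iff)
    hence "i \<le> a \<and> c i b \<noteq> 0" unfolding F_def coeff_poly_of_coeffs by (auto split: if_splits)
    thus ?thesis using b by (auto simp: dt_coeffs_def)
  qed
  have S1: "card S1 \<le> M"
  proof -
    define G where "G = poly_of_coeffs a (b - 1) (dt_coeffs c)"
    have "G \<noteq> 0" using dt_nz coeff_poly_of_coeffs[of a "b - 1" "dt_coeffs c"] unfolding G_def by (metis coeff_0 order_refl)
    moreover have dG: "degree G < b" using degree_poly_of_coeffs(1)[of a "b - 1" "dt_coeffs c"] b by (simp add: G_def)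
    ultimately have "resultant F G \<noteq> 0" by (rule res)
    moreover have "S1 \<subseteq> S" by (auto simp: S1_def)
    ultimately have "card S1 \<le> A * (degree F + degree G) * K0"
    proof (intro card_le_resultant[where t = "\<lambda>P. of_int (v P) / of_int (u P)", OF fibres_le_subset[OF fib]])
      show "0 < degree F" using F b by simp
      show "degree (coeff F j) \<le> A" for j by (rule coeffF)
      show "degree (coeff G j) \<le> A" for j unfolding G_def using A degree_poly_of_coeffs(2) order_trans by blast
      fix P assume P: "P \<in> S1"
      hence PS: "P \<in> S" "?W P = 0" by (auto simp: S1_def)
      show "ev2 F (of_int (d P) / of_int (e P)) (of_int (v P) / of_int (u P)) = 0"
        unfolding F_def using pos[OF PS(1)] van[OF PS(1)] by (intro ev2_eq_0_of_form) auto
      show "ev2 G (of_int (d P) / of_int (e P)) (of_int (v P) / of_int (u P)) = 0"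
        unfolding G_def using pos[OF PS(1)] PS(2) by (intro ev2_eq_0_of_form) auto
    qed auto
    also have "\<dots> \<le> M" unfolding M_def using F dG by (intro mult_right_mono mult_left_mono) auto
    finally show ?thesis .
  qed
  \<comment> \<open>The simple roots of the form modulo p. The sets \<open>T p\<close> require e and
    u to be units modulo p, so that d / e and v / u have residues.\<close>
  define Cl where "Cl p = {(s, t). s \<in> {0..<int p} \<and> t \<in> {0..<int p} \<and> int p dvd iform a b c s t \<and> \<not> int p dvd iform_dt a b c s t}" for p
  define T where "T p = (\<lambda>(s, t). {P\<in>S. [d P = s * e P] (mod int p) \<and> [v P = t * u P] (mod int p) \<and> \<not> int p dvd e P \<and> \<not> int p dvd u P})" for p
  have finCl: "finite (Cl p)" for p
    unfolding Cl_def by (rule finite_subset[of _ "{0..<int p} \<times> {0..<int p}"]) auto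
  have cardT: "card (T p st) \<le> M" if p: "p \<in> \<P>" and stC: "st \<in> Cl p" for p st
  proof -
    obtain s t where s_t: "st = (s, t)" by (cases st)
    have pp: "prime (int p)" using \<P>(2)[OF p] by simp
    have "on_form A (b - 1) (T p st) d e u v"
    proof (rule padic_class_on_form[OF pp _ _ XY H _ _ _ n])
      show "b > 0" using b by simp
      show "0 < d P \<and> d P \<le> H \<and> 0 < e P \<and> e P \<le> H \<and> 0 < u P \<and> u P \<le> H \<and> 0 < v P \<and> v P \<le> H
        \<and> \<bar>of_int (d P) - s00 * of_int (e P)\<bar> \<le> X0 \<and> of_int (e P) \<le> Y0" if "P \<in> T p st" for P
        using st that by (auto simp: in_strip_def T_def s_t)
      show "[d P = s * e P] (mod int p) \<and> [v P = t * u P] (mod int p) \<and> \<not> int p dvd e P \<and> \<not> int p dvd u P" if "P \<in> T p st" for P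
        using that by (auto simp: T_def s_t)
      show "form a b c (d P) (e P) (u P) (v P) = 0" if "P \<in> T p st" for P
        using van that by (auto simp: T_def s_t)
      show "\<not> int p dvd iform_dt a b c s t" using stC by (simp add: Cl_def s_t)
      show "(real (n ^ n * fact n)) ^ 2 * ((X0 * Y0) ^ A * (of_int H ^ (b - 1)) ^ 2) ^ n < of_int (int p) ^ (n * (n - 1))"
        using \<P>(2)[OF p] by simp
    qed
    then obtain c' where "\<exists>i\<le>A. \<exists>j\<le>b - 1. c' i j \<noteq> 0" "\<And>P. P \<in> T p st \<Longrightarrow> form A (b - 1) c' (d P) (e P) (u P) (v P) = 0"
      unfolding on_form_def by blast
    moreover have "T p st \<subseteq> S" by (auto simp: T_def s_t)
    ultimately show ?thesis using bounded by blast
  qed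
  have cover: "S \<subseteq> S1 \<union> (\<Union>p\<in>\<P>. \<Union>st\<in>Cl p. T p st)"
  proof
    fix P assume P: "P \<in> S"
    show "P \<in> S1 \<union> (\<Union>p\<in>\<P>. \<Union>st\<in>Cl p. T p st)"
    proof (cases "?W P = 0")
      case False
      obtain p where p: "p \<in> \<P>" "\<not> int p dvd e P * u P * ?W P" using avoid[OF P False] by blast
      have pp: "prime (int p)" using \<P>(2)[OF p(1)] by simp
      have p0: "int p > 0" using pp by (rule prime_gt_0_int)
      have np: "\<not> int p dvd e P" "\<not> int p dvd u P" "\<not> int p dvd ?W P" using p(2) by auto
      have inv: "\<exists>s\<in>{0..<int p}. [x = s * y] (mod int p)" if "\<not> int p dvd y" for x y
      proof -
        have "coprime y (int p)" using prime_imp_coprime[OF pp that] by (simp add: coprime_commute)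
        then obtain z where "[y * z = 1] (mod int p)" using cong_solve_coprime_int by blast
        hence "[x * (y * z) = x * 1] (mod int p)" by (intro cong_mult cong_refl)
        hence "[x = (x * z) * y] (mod int p)" by (simp add: cong_sym mult_ac)
        moreover have "[(x * z) * y = ((x * z) mod int p) * y] (mod int p)"
          by (intro cong_mult cong_refl) (simp add: cong_def)
        ultimately have "[x = ((x * z) mod int p) * y] (mod int p)" by (rule cong_trans)
        thus ?thesis using p0 by (intro bexI[of _ "(x * z) mod int p"]) auto
      qed
      obtain s where s: "s \<in> {0..<int p}" "[d P = s * e P] (mod int p)" using inv[OF np(1)] by blast
      obtain t where t: "t \<in> {0..<int p}" "[v P = t * u P] (mod int p)" using inv[OF np(2)] by blast
      have "int p dvd iform a b c s t"
      proof -
        have "[0 = e P ^ a * u P ^ b * iform a b c s t] (mod int p)"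
          using form_cong_iform[OF s(2) t(2), of a b c] van[OF P] by simp
        hence "int p dvd e P ^ a * u P ^ b * iform a b c s t" by (simp add: cong_iff_dvd_diff)
        moreover have "\<not> int p dvd e P ^ a" "\<not> int p dvd u P ^ b"
          using np prime_dvd_power[OF pp] by blast+
        ultimately show ?thesis unfolding prime_dvd_mult_iff[OF pp] by blast
      qed
      moreover have "\<not> int p dvd iform_dt a b c s t"
      proof
        assume "int p dvd iform_dt a b c s t"
        moreover have "iform_dt a b c s t = iform a (b - 1) (dt_coeffs c) s t"
          using iform_dt_eq[of a "b - 1" c s t] b by simp
        ultimately have "int p dvd e P ^ a * u P ^ (b - 1) * iform a (b - 1) (dt_coeffs c) s t" by simp
        moreover have "[?W P = e P ^ a * u P ^ (b - 1) * iform a (b - 1) (dt_coeffs c) s t] (mod int p)"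
          by (rule form_cong_iform[OF s(2) t(2)])
        ultimately show False using np(3) cong_dvd_iff by blast
      qed
      ultimately have "(s, t) \<in> Cl p" using s t by (simp add: Cl_def)
      moreover have "P \<in> T p (s, t)" using P s t np by (simp add: T_def)
      ultimately show ?thesis by (intro UnI2 UN_I[OF p(1)] UN_I)
    qed (use P in \<open>auto simp: S1_def\<close>)
  qed
  have M0: "real M \<ge> 0" by simp
  have "T p st \<subseteq> S" for p st by (cases st) (auto simp: T_def)
  hence "finite (T p st)" for p st using finS finite_subset by blast
  hence "finite (\<Union>p\<in>\<P>. \<Union>st\<in>Cl p. T p st)"
    by (intro finite_UN_I \<P>(1) finCl)
  hence "card S \<le> card (S1 \<union> (\<Union>p\<in>\<P>. \<Union>st\<in>Cl p. T p st))"
    using cover finS by (intro card_mono) (auto simp: S1_def)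
  also have "\<dots> \<le> card S1 + card (\<Union>p\<in>\<P>. \<Union>st\<in>Cl p. T p st)" by (rule card_Un_le)
  also have "card (\<Union>p\<in>\<P>. \<Union>st\<in>Cl p. T p st) \<le> (\<Sum>p\<in>\<P>. card (\<Union>st\<in>Cl p. T p st))"
    using \<P>(1) by (rule card_UN_le)
  also have "\<dots> \<le> (\<Sum>p\<in>\<P>. \<Sum>st\<in>Cl p. card (T p st))" by (intro sum_mono card_UN_le finCl)
  also have "\<dots> \<le> (\<Sum>p\<in>\<P>. \<Sum>st\<in>Cl p. M)" by (intro sum_mono cardT)
  finally have "card S \<le> M + (\<Sum>p\<in>\<P>. card (Cl p) * M)" using S1 by simp
  hence "real (card S) \<le> real (M + (\<Sum>p\<in>\<P>. card (Cl p) * M))" by (simp only: of_nat_le_iff)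
  also have "\<dots> = real M + (\<Sum>p\<in>\<P>. real (card (Cl p)) * real M)" by simp
  also have "\<dots> \<le> real M + (\<Sum>p\<in>\<P>. (B * b) * real M)"
  proof (intro add_mono order_refl sum_mono mult_right_mono M0)
    fix p assume p: "p \<in> \<P>"
    have "card (Cl p) \<le> p * b"
      using card_simple_root_classes[of "int p" a b c] \<P>(2)[OF p] by (simp add: Cl_def)
    hence "real (card (Cl p)) \<le> real (p * b)" by (simp only: of_nat_le_iff)
    also have "\<dots> \<le> B * b" using \<P>(2)[OF p] by (simp add: mult_right_mono)
    finally show "real (card (Cl p)) \<le> B * b" .
  qed
  also have "\<dots> = real M * (1 + real (card \<P>) * (B * b))" by (simp add: algebra_simps)
  finally show ?thesis unfolding M_def .
qed

text \<open>K is fixed before the points, H and the strip, which makes the bound uniform. The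
  argument of type itself names the type of the points, over which a definition cannot
  quantify.\<close>

definition strip_count where
  "strip_count k l h K0 \<delta> a b K (_ :: 'p itself) \<longleftrightarrow> K \<ge> 0 \<and>
     (\<forall>(S :: 'p set) d e u v H s0 X0 Y0 \<rho>. in_strip k l h K0 H s0 X0 Y0 \<rho> S d e u v \<and> on_form a b S d e u v \<longrightarrow>
       real (card S) \<le> K * of_int H powr \<delta> * (sqrt (X0 * Y0) + 1 + 1 / \<rho>))"

lemma in_strip_bound_ge_1:
  assumes "in_strip k l h K0 H s0 X0 Y0 \<rho> S d e u v" "\<delta> > 0"
  shows "of_int H powr \<delta> * (sqrt (X0 * Y0) + 1 + 1 / \<rho>) \<ge> 1"
proof -
  have "1 * 1 \<le> of_int H powr \<delta> * (sqrt (X0 * Y0) + 1 + 1 / \<rho>)"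
    using assms by (intro mult_mono ge_one_powr_ge_zero) (auto simp: in_strip_def)
  thus ?thesis by simp
qed

text \<open>\<Omega> stands for X0 Y0. The core is \<Omega>^A H^(2b) <= p^(2A): the factor sqrt
  \<Omega> of p handles \<Omega>^A, and its factor H^\<delta> with \<delta> A >= b handles H^(2b).
  The monomials contribute only H^(2(b-1)), and the remaining H^2 pays for the constant n^n
  n!.\<close>

lemma padic_size_bound:
  fixes \<Omega> H \<delta> p :: real
  assumes b: "b \<ge> 2" and n: "n = (A + 1) * b" and H: "H > real (n ^ n * fact n)" "H > 1"
    and \<delta>: "\<delta> > 0" "\<delta> * A \<ge> b" and \<Omega>: "\<Omega> > 0" and p: "p > max (sqrt \<Omega>) 1 * H powr \<delta>"
  shows "(real (n ^ n * fact n)) ^ 2 * (\<Omega> ^ A * (H ^ (b - 1)) ^ 2) ^ n < p ^ (n * (n - 1))"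
proof -
  define q where "q = max (sqrt \<Omega>) 1"
  have "(sqrt \<Omega>) ^ 2 \<le> q ^ 2" using \<Omega> by (intro power_mono) (auto simp: q_def)
  hence q: "q \<ge> 1" "q ^ 2 \<ge> \<Omega>" using \<Omega> by (auto simp: q_def)
  have Hd: "H powr \<delta> \<ge> 1" using H \<delta> by (intro ge_one_powr_ge_zero) auto
  have qH: "q * H powr \<delta> \<ge> 1" using mult_mono[of 1 q 1 "H powr \<delta>"] q Hd by simp
  have p1: "p \<ge> 1" using p qH by (simp add: q_def)
  \<comment> \<open>Here b >= 2 gives n - 1 >= 2 A, which is why a prime of size sqrt \<Omega> is
    enough.\<close>
  have n1: "n \<ge> 1" "n - 1 \<ge> 2 * A" using b mult_mono[of "A + 1" "A + 1" 2 b] by (auto simp: n)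
  have "\<Omega> ^ A * H ^ (2 * b) \<le> (q ^ 2) ^ A * (H powr \<delta>) ^ (2 * A)"
  proof (intro mult_mono power_mono q)
    have "H ^ (2 * b) = H powr real (2 * b)" using H by (intro powr_realpow[symmetric]) auto
    also have "\<dots> \<le> H powr (2 * (\<delta> * A))" using H \<delta> by (intro powr_mono) auto
    also have "\<dots> = (H powr \<delta>) ^ (2 * A)" using H by (subst powr_power) (auto simp: mult_ac)
    finally show "H ^ (2 * b) \<le> (H powr \<delta>) ^ (2 * A)" .
  qed (use \<Omega> H in auto)
  also have "\<dots> = (q * H powr \<delta>) ^ (2 * A)" by (simp add: power_mult_distrib power_mult)
  also have "\<dots> \<le> p ^ (2 * A)" using p qH by (intro power_mono) (auto simp: q_def)
  also have "\<dots> \<le> p ^ (n - 1)" using p1 n1 by (intro power_increasing) auto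
  finally have "(\<Omega> ^ A * H ^ (2 * b)) ^ n \<le> (p ^ (n - 1)) ^ n" using \<Omega> H by (intro power_mono) auto
  also have "\<dots> = p ^ (n * (n - 1))" by (simp add: power_mult[symmetric] mult.commute)
  finally have 1: "(\<Omega> ^ A * H ^ (2 * b)) ^ n \<le> p ^ (n * (n - 1))" .
  have "H ^ (2 * b) = (H ^ (b - 1)) ^ 2 * H ^ 2"
  proof -
    have "2 * b = (b - 1) * 2 + 2" using b by simp
    thus ?thesis by (simp only: power_add power_mult)
  qed
  hence "(\<Omega> ^ A * H ^ (2 * b)) ^ n = (H ^ 2) ^ n * (\<Omega> ^ A * (H ^ (b - 1)) ^ 2) ^ n"
    by (simp add: power_mult_distrib mult_ac)
  moreover have C: "(real (n ^ n * fact n)) ^ 2 < (H ^ 2) ^ n"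
  proof -
    have "(real (n ^ n * fact n)) ^ 2 < H ^ 2" using H(1) by (intro power_strict_mono) auto
    also have "H ^ 2 = (H ^ 2) ^ 1" by simp
    also have "\<dots> \<le> (H ^ 2) ^ n" using n1 H by (intro power_increasing) auto
    finally show ?thesis .
  qed
  moreover have "(\<Omega> ^ A * (H ^ (b - 1)) ^ 2) ^ n > 0" using \<Omega> H by simp
  note mult_strict_right_mono[OF C this]
  ultimately show ?thesis using 1 by linarith
qed

text \<open>Supplies the parameters of \<open>card_irreducible_form\<close>. A is so large that p
  absorbs the powers of H coming from u and v. K primes of size at least H^\<delta>' contain one
  that does not divide e u W, where W is the t-derivative, because |e u W| <= H^(E + 1) and
  \<delta>' K > E + 1. The threshold H0 makes H exceed the constants C2 and n^n n!.\<close>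

lemma strip_count_smooth:
  fixes h :: int and \<delta> :: real
  assumes \<delta>: "\<delta> > 0" and b: "b \<ge> 2"
  obtains K3 H0 :: real where "K3 \<ge> 0" "H0 \<ge> 1"
    "\<And>(S :: 'p set) d e u v H s0 X0 Y0 \<rho> c. in_strip k l h K0 H s0 X0 Y0 \<rho> S d e u v \<Longrightarrow> of_int H \<ge> H0 \<Longrightarrow>
       (\<And>P. P \<in> S \<Longrightarrow> form a b c (d P) (e P) (u P) (v P) = 0) \<Longrightarrow>
       (\<And>i j. \<bar>c i j\<bar> \<le> fact ((a + 1) * (b + 1)) * (H ^ (a + b)) ^ ((a + 1) * (b + 1))) \<Longrightarrow>
       degree (poly_of_coeffs a b c) = b \<Longrightarrow>
       (\<And>G. G \<noteq> 0 \<Longrightarrow> degree G < b \<Longrightarrow> resultant (poly_of_coeffs a b c) G \<noteq> 0) \<Longrightarrow>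
       real (card S) \<le> K3 * (of_int H powr \<delta> * (sqrt (X0 * Y0) + 1 + 1 / \<rho>))"
proof -
  \<comment> \<open>The upper bound for p carries two factors H^\<delta>', one in Q and one from
    \<open>ex_primes_between\<close>, hence the halving; the cap at 1 keeps Q below H^3.\<close>
  define \<delta>' where "\<delta>' = min \<delta> 1 / 2"
  have \<delta>': "\<delta>' > 0" "\<delta>' \<le> 1" "2 * \<delta>' \<le> \<delta>" using \<delta> by (auto simp: \<delta>'_def)
  define A where "A = max a (nat \<lceil>b / \<delta>'\<rceil>)"
  have A: "A \<ge> a" "\<delta>' * A \<ge> b"
  proof -
    show "A \<ge> a" by (simp add: A_def)
    have "b / \<delta>' \<le> real (nat \<lceil>b / \<delta>'\<rceil>)" by linarith
    also have "\<dots> \<le> A" by (simp add: A_def)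
    finally show "\<delta>' * A \<ge> b" using \<delta>' by (simp add: field_simps)
  qed
  define n where "n = (A + 1) * b"
  define N0 where "N0 = (a + 1) * (b + 1)"
  \<comment> \<open>The exponent of H in the bound for e u W: 2 from e u, (a + b) N0 from the
    coefficients and a + (b - 1) from the monomials.\<close>
  define E where "E = 2 + (a + b) * N0 + (a + (b - 1))"
  define C2 where "C2 = real ((a + 1) * (b - 1 + 1) * (b * fact N0))"
  define K where "K = nat \<lfloor>(real E + 1) / \<delta>'\<rfloor> + 1"
  have K: "\<delta>' * K > real E + 1"
  proof -
    have "(real E + 1) / \<delta>' < real K" unfolding K_def by linarith
    thus ?thesis using \<delta>' by (simp add: field_simps)
  qed
  obtain H1 where H1: "H1 \<ge> 1" "\<And>H Q. H \<ge> H1 \<Longrightarrow> 1 \<le> Q \<Longrightarrow> Q \<le> H ^ 3 \<Longrightarrow>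
     \<exists>\<P>. finite \<P> \<and> card \<P> = K \<and> (\<forall>p\<in>\<P>. prime p \<and> Q < real p \<and> real p \<le> Q * H powr \<delta>')"
    using ex_primes_between[OF \<delta>'(1)] by metis
  define H0 where "H0 = max H1 (max C2 (real (n ^ n * fact n))) + 1"
  define K3 where "K3 = real (A * (2 * b) * K0) * (1 + real (K * b))"
  show ?thesis
  proof (rule that[of K3 H0])
    show "K3 \<ge> 0" by (simp add: K3_def)
    show "H0 \<ge> 1" using H1(1) by (simp add: H0_def)
    fix S :: "'p set" and d e u v H s0 X0 Y0 \<rho> c
    assume st: "in_strip k l h K0 H s0 X0 Y0 \<rho> S d e u v" and HH: "of_int H \<ge> H0"
      and van: "\<And>P. P \<in> S \<Longrightarrow> form a b c (d P) (e P) (u P) (v P) = 0"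
      and c: "\<And>i j. \<bar>c i j\<bar> \<le> fact ((a + 1) * (b + 1)) * (H ^ (a + b)) ^ ((a + 1) * (b + 1))"
      and deg: "degree (poly_of_coeffs a b c) = b"
      and res: "\<And>G. G \<noteq> 0 \<Longrightarrow> degree G < b \<Longrightarrow> resultant (poly_of_coeffs a b c) G \<noteq> 0"
    define Hr where "Hr = real_of_int H"
    have Hr: "Hr > 1" "Hr \<ge> H1" "Hr \<ge> C2" "Hr > real (n ^ n * fact n)" using HH H1(1) by (auto simp: Hr_def H0_def)
    have XY: "X0 > 0" "Y0 > 0" "X0 \<le> Hr" "Y0 \<le> Hr" "\<rho> > 0" using st by (auto simp: in_strip_def Hr_def)
    define q where "q = max (sqrt (X0 * Y0)) 1"
    define Q where "Q = q * Hr powr \<delta>'"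
    have Hd: "Hr powr \<delta>' \<ge> 1" using Hr \<delta>' by (intro ge_one_powr_ge_zero) auto
    have q: "q \<ge> 1" "q \<le> Hr"
    proof -
      have "sqrt (X0 * Y0) \<le> sqrt (Hr * Hr)" using XY by (intro real_sqrt_le_mono mult_mono) auto
      thus "q \<le> Hr" using Hr by (simp add: q_def)
    qed (simp add: q_def)
    have QH: "Hr powr \<delta>' \<le> Q" unfolding Q_def using q mult_right_mono[of 1 q "Hr powr \<delta>'"] by simp
    have "Q \<le> Hr ^ 3"
    proof -
      have "Hr powr \<delta>' \<le> Hr powr 1" using Hr \<delta>' by (intro powr_mono) auto
      hence "Q \<le> Hr * Hr" unfolding Q_def using q Hr by (intro mult_mono) auto
      also have "\<dots> \<le> Hr * Hr * Hr" using Hr mult_left_mono[of 1 Hr "Hr * Hr"] by simp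
      finally show ?thesis by (simp add: power3_eq_cube)
    qed
    then obtain \<P> where \<P>: "finite \<P>" "card \<P> = K" "\<forall>p\<in>\<P>. prime p \<and> Q < real p \<and> real p \<le> Q * Hr powr \<delta>'"
      using H1(2)[OF Hr(2), of Q] QH Hd by auto
    have "real (card S) \<le> real (A * (2 * b) * K0) * (1 + real (card \<P>) * ((Q * Hr powr \<delta>') * b))"
    proof (rule card_irreducible_form[OF st b deg res van A(1) n_def \<P>(1)])
      fix p assume p: "p \<in> \<P>"
      have "(real (n ^ n * fact n)) ^ 2 * ((X0 * Y0) ^ A * (Hr ^ (b - 1)) ^ 2) ^ n < real p ^ (n * (n - 1))"
        by (rule padic_size_bound[OF b n_def Hr(4,1) \<delta>'(1) A(2)])
           (use p \<P>(3) XY in \<open>auto simp: Q_def q_def\<close>)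
      thus "prime p \<and> real p \<le> Q * Hr powr \<delta>' \<and>
       (real (n ^ n * fact n)) ^ 2 * ((X0 * Y0) ^ A * (of_int H ^ (b - 1)) ^ 2) ^ n < real p ^ (n * (n - 1))"
        using p \<P>(3) by (simp add: Hr_def)
    next
      fix P assume P: "P \<in> S" and nz: "form a (b - 1) (dt_coeffs c) (d P) (e P) (u P) (v P) \<noteq> 0"
      let ?W = "form a (b - 1) (dt_coeffs c) (d P) (e P) (u P) (v P)"
      have bdP: "0 < d P" "d P \<le> H" "0 < e P" "e P \<le> H" "0 < u P" "u P \<le> H" "0 < v P" "v P \<le> H"
        using st P by (auto simp: in_strip_def)
      \<comment> \<open>\<open>abs_form_le\<close> asks for one bound over all indices, but the
        factor \<open>Suc j\<close> in \<open>dt_coeffs\<close> grows with j. The entries with j >=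
        b lie outside the form and are set to 0.\<close>
      define c2 where "c2 i j = (if j < b then dt_coeffs c i j else 0)" for i j
      have "?W = form a (b - 1) c2 (d P) (e P) (u P) (v P)"
        unfolding form_def using b by (intro sum.cong refl) (auto simp: c2_def)
      moreover have "\<bar>form a (b - 1) c2 (d P) (e P) (u P) (v P)\<bar> \<le> 
          int ((a + 1) * (b - 1 + 1)) * ((int b * (fact N0 * (H ^ (a + b)) ^ N0)) * H ^ (a + (b - 1)))"
      proof (rule abs_form_le)
        fix i j
        show "\<bar>c2 i j\<bar> \<le> int b * (fact N0 * (H ^ (a + b)) ^ N0)"
        proof (cases "j < b")
          case True
          have "\<bar>c2 i j\<bar> = int (Suc j) * \<bar>c i (Suc j)\<bar>" using True by (simp add: c2_def dt_coeffs_def abs_mult)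
          also have "\<dots> \<le> int b * (fact N0 * (H ^ (a + b)) ^ N0)"
            using True c[of i "Suc j"] unfolding N0_def by (intro mult_mono) auto
          finally show ?thesis .
        qed (use bdP in \<open>auto simp: c2_def\<close>)
      qed (use bdP in auto)
      ultimately have W: "\<bar>?W\<bar> \<le> int ((a + 1) * (b - 1 + 1)) * ((int b * (fact N0 * (H ^ (a + b)) ^ N0)) * H ^ (a + (b - 1)))"
        by simp
      have "\<bar>e P * u P * ?W\<bar> \<le> (H * H) * (int ((a + 1) * (b - 1 + 1)) * ((int b * (fact N0 * (H ^ (a + b)) ^ N0)) * H ^ (a + (b - 1))))"
        unfolding abs_mult using W bdP by (intro mult_mono) auto
      also have "\<dots> = int ((a + 1) * (b - 1 + 1) * (b * fact N0)) * H ^ E"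
        unfolding E_def power_add power_mult power2_eq_square by (simp only: of_nat_mult of_nat_fact mult_ac)
      finally have "real_of_int \<bar>e P * u P * ?W\<bar> \<le> real_of_int (int ((a + 1) * (b - 1 + 1) * (b * fact N0)) * H ^ E)"
        by (simp only: of_int_le_iff)
      also have "\<dots> = C2 * Hr ^ E" unfolding C2_def Hr_def by (simp only: of_int_mult of_int_of_nat_eq of_int_power)
      also have "\<dots> \<le> Hr * Hr ^ E" using Hr by (intro mult_right_mono) auto
      also have "\<dots> = Hr powr (real E + 1)" using Hr by (simp add: powr_realpow powr_add)
      finally have bound: "\<bar>real_of_int (e P * u P * ?W)\<bar> \<le> Hr powr (real E + 1)" by (simp only: of_int_abs)
      have nz': "e P * u P * ?W \<noteq> 0" using nz bdP by simp
      show "\<exists>p\<in>\<P>. \<not> int p dvd e P * u P * ?W"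
      proof (rule ex_prime_not_dvd[OF \<P>(1) _ nz' bound Hr(1), of \<delta>'])
        show "prime p \<and> real p \<ge> Hr powr \<delta>'" if "p \<in> \<P>" for p using \<P>(3) that QH by force
        show "\<delta>' * card \<P> > real E + 1" using K \<P>(2) by simp
      qed blast
    qed
    also have "\<dots> \<le> K3 * (q * Hr powr (2 * \<delta>'))"
    proof -
      have "Q * Hr powr \<delta>' = q * Hr powr (2 * \<delta>')" by (simp add: Q_def powr_add[symmetric])
      moreover have "1 * 1 \<le> q * Hr powr (2 * \<delta>')" using q Hr \<delta>' by (intro mult_mono ge_one_powr_ge_zero) auto
      ultimately have "1 + real (card \<P>) * ((Q * Hr powr \<delta>') * b) \<le> (1 + real (K * b)) * (q * Hr powr (2 * \<delta>'))"
        using \<P>(2) by (simp add: algebra_simps)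
      thus ?thesis unfolding K3_def by (simp only: mult.assoc mult_left_mono of_nat_0_le_iff)
    qed
    also have "\<dots> \<le> K3 * (of_int H powr \<delta> * (sqrt (X0 * Y0) + 1 + 1 / \<rho>))"
    proof (rule mult_left_mono)
      have "q * Hr powr (2 * \<delta>') \<le> (sqrt (X0 * Y0) + 1 + 1 / \<rho>) * Hr powr \<delta>"
        using \<delta>' Hr XY by (intro mult_mono powr_mono) (auto simp: q_def)
      thus "q * Hr powr (2 * \<delta>') \<le> of_int H powr \<delta> * (sqrt (X0 * Y0) + 1 + 1 / \<rho>)" by (simp add: Hr_def mult.commute)
    qed (simp add: K3_def)
    finally show "real (card S) \<le> K3 * (of_int H powr \<delta> * (sqrt (X0 * Y0) + 1 + 1 / \<rho>))" .
  qed
qed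

text \<open>Induction on \<open>b\<close>. If some form of degree below \<open>b\<close> in the second pair vanishes on the points, either
  its resultant with the given form is nonzero, leaving few points, or a common factor lowers the degree.
  Otherwise the \<open>p\<close>-adic determinant method, applied to monomials of degree \<open>b - 1\<close>, produces such
  a form on each residue class modulo a suitable prime.\<close>

theorem ex_strip_count:
  fixes h :: int and \<delta> :: real
  assumes k: "k > 0" and l: "l > 0" and h: "h \<noteq> 0" and \<delta>: "\<delta> > 0"
  shows "\<exists>K. strip_count k l h K0 \<delta> a b K TYPE('p)"
proof (induction b arbitrary: a rule: less_induct)
  case (less b)
  consider "b = 0" | "b = 1" | "b \<ge> 2" by linarith
  thus ?case
  proof cases
    case 1
    show ?thesis unfolding strip_count_def
    proof (intro exI[of _ "real (a * K0)"] conjI allI impI of_nat_0_le_iff, elim conjE)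
      fix S :: "'p set" and d e u v H s0 X0 Y0 \<rho>
      assume st: "in_strip k l h K0 H s0 X0 Y0 \<rho> S d e u v" and on: "on_form a b S d e u v"
      have "card S \<le> a * K0" using card_le_form_0[of K0 S d e a u v] st on 1 by (auto simp: in_strip_def)
      hence "real (card S) \<le> real (a * K0)" by (simp only: of_nat_le_iff)
      also have "\<dots> \<le> real (a * K0) * (of_int H powr \<delta> * (sqrt (X0 * Y0) + 1 + 1 / \<rho>))"
        using mult_left_mono[OF in_strip_bound_ge_1[OF st \<delta>], of "real (a * K0)"] by simp
      finally show "real (card S) \<le> real (a * K0) * of_int H powr \<delta> * (sqrt (X0 * Y0) + 1 + 1 / \<rho>)" by (simp add: mult.assoc)
    qed
  next
    case 2
    show ?thesis unfolding strip_count_def 2 using card_linear_form[OF k l h \<delta>, of K0 a] by blast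
  next
    case 3
    have "\<forall>b'. \<exists>K. b' < b \<longrightarrow> strip_count k l h K0 \<delta> a b' K TYPE('p)" using less.IH by blast
    then obtain Kf where Kf: "\<And>b'. b' < b \<Longrightarrow> strip_count k l h K0 \<delta> a b' (Kf b') TYPE('p)" by metis
    have Kf0: "Kf b' \<ge> 0" if "b' < b" for b' using Kf[OF that] by (simp add: strip_count_def)
    obtain K3 H0 :: real where K3: "K3 \<ge> 0" "H0 \<ge> 1" and smooth:
      "\<And>(S :: 'p set) d e u v H s0 X0 Y0 \<rho> c. in_strip k l h K0 H s0 X0 Y0 \<rho> S d e u v \<Longrightarrow> of_int H \<ge> H0 \<Longrightarrow>
       (\<And>P. P \<in> S \<Longrightarrow> form a b c (d P) (e P) (u P) (v P) = 0) \<Longrightarrow>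
       (\<And>i j. \<bar>c i j\<bar> \<le> fact ((a + 1) * (b + 1)) * (H ^ (a + b)) ^ ((a + 1) * (b + 1))) \<Longrightarrow>
       degree (poly_of_coeffs a b c) = b \<Longrightarrow>
       (\<And>G. G \<noteq> 0 \<Longrightarrow> degree G < b \<Longrightarrow> resultant (poly_of_coeffs a b c) G \<noteq> 0) \<Longrightarrow>
       real (card S) \<le> K3 * (of_int H powr \<delta> * (sqrt (X0 * Y0) + 1 + 1 / \<rho>))"
      using strip_count_smooth[OF \<delta> 3, where 'p = 'p and k = k and l = l and h = h and ?K0.0 = K0 and a = a] by metis
    define Ks where "Ks = (\<Sum>b'<b. Kf b')"
    have Ks: "Kf b' \<le> Ks" if "b' < b" for b' unfolding Ks_def using that Kf0 by (intro member_le_sum) auto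
    have Ks0: "Ks \<ge> 0" using Ks[of 0] Kf0[of 0] 3 by simp
    \<comment> \<open>Two factors in the reducible case, the determinant method in the smooth case,
      and the trivial count for H < H0.\<close>
    define K where "K = 2 * Ks + K3 + real K0 * H0 ^ 2"
    show ?thesis unfolding strip_count_def
    proof (intro exI[of _ K] conjI allI impI, goal_cases)
      case 1
      show ?case using Ks0 K3 by (simp add: K_def)
    next
      case (2 S d e u v H s0 X0 Y0 \<rho>)
      hence st: "in_strip k l h K0 H s0 X0 Y0 \<rho> S d e u v" and on: "on_form a b S d e u v" by auto
      have H: "H \<ge> 1" and fib: "fibres_le K0 S d e" using st by (auto simp: in_strip_def)
      have finS: "finite S" using fib by (simp add: fibres_le_def)
      have pos: "e P > 0" "u P > 0" if "P \<in> S" for P using st that by (auto simp: in_strip_def)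
      define B where "B = of_int H powr \<delta> * (sqrt (X0 * Y0) + 1 + 1 / \<rho>)"
      have B: "B \<ge> 1" unfolding B_def by (rule in_strip_bound_ge_1[OF st \<delta>])
      have IH: "real (card T) \<le> Ks * B" if "T \<subseteq> S" "on_form a b' T d e u v" "b' < b" for T b'
      proof -
        have "real (card T) \<le> Kf b' * of_int H powr \<delta> * (sqrt (X0 * Y0) + 1 + 1 / \<rho>)"
          using Kf[OF that(3)] in_strip_subset[OF st that(1)] that(2) unfolding strip_count_def by blast
        also have "\<dots> = Kf b' * B" by (simp add: B_def)
        also have "\<dots> \<le> Ks * B" using Ks[OF that(3)] B by (intro mult_right_mono) auto
        finally show ?thesis .
      qed
      have nn: "Ks * B \<ge> 0" "K3 * B \<ge> 0" "(real K0 * H0 ^ 2) * B \<ge> 0" using Ks0 K3 B by auto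
      have KB: "K * B = 2 * (Ks * B) + K3 * B + (real K0 * H0 ^ 2) * B" by (simp add: K_def algebra_simps)
      have "real (card S) \<le> K * B"
      proof (cases "of_int H \<ge> H0")
        case False
        have "real (card S) \<le> real K0 * of_int H ^ 2" by (rule in_strip_card_le[OF st])
        also have "\<dots> \<le> real K0 * H0 ^ 2" using False H by (intro mult_left_mono power_mono) auto
        also have "\<dots> \<le> (real K0 * H0 ^ 2) * B" using B mult_left_mono[OF B, of "real K0 * H0 ^ 2"] by simp
        finally show ?thesis using nn KB by linarith
      next
        case HH: True
        obtain c where c: "\<exists>i\<le>a. \<exists>j\<le>b. c i j \<noteq> 0"
          "\<And>i j. \<bar>c i j\<bar> \<le> fact ((a + 1) * (b + 1)) * (H ^ (a + b)) ^ ((a + 1) * (b + 1))"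
          "\<And>P. P \<in> S \<Longrightarrow> form a b c (d P) (e P) (u P) (v P) = 0"
          by (rule on_form_small_coeffs[OF on H]) (use st in \<open>auto simp: in_strip_def\<close>)
        define F where "F = poly_of_coeffs a b c"
        have F0: "F \<noteq> 0" using c(1) coeff_poly_of_coeffs[of a b c] unfolding F_def by (metis coeff_0)
        have Fdeg: "degree F \<le> b" "\<And>j. degree (coeff F j) \<le> a" using degree_poly_of_coeffs[of a b c] by (auto simp: F_def)
        have evF: "ev2 F (of_int (d P) / of_int (e P)) (of_int (v P) / of_int (u P)) = 0" if "P \<in> S" for P
          unfolding F_def using c(3)[OF that] pos[OF that] by (intro ev2_eq_0_of_form) auto
        show ?thesis
        proof (cases "degree F < b")
          case True
          have "on_form a (degree F) S d e u v"
            by (rule on_formI[OF F0 order_refl Fdeg(2)]) (use evF pos in force)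
          hence "real (card S) \<le> Ks * B" using IH True by blast
          thus ?thesis using nn KB by linarith
        next
          case False
          hence dF: "degree F = b" using Fdeg by simp
          show ?thesis
          proof (cases "\<exists>G. G \<noteq> 0 \<and> degree G < b \<and> resultant F G = 0")
            case True
            then obtain G where G: "G \<noteq> 0" "degree G < degree F" "resultant F G = 0" using dF by blast
            obtain F1 F2 where F12: "F = F1 * F2" "degree F1 < degree F" "degree F2 < degree F"
               "\<And>j. degree (coeff F1 j) \<le> a" "\<And>j. degree (coeff F2 j) \<le> a"
              by (rule factorise_of_resultant_eq_0[OF G(3,1,2) Fdeg(2)], rule that) assumption+
            have nz: "F1 \<noteq> 0" "F2 \<noteq> 0" using F12(1) F0 by auto
            define S1 where "S1 = {P\<in>S. ev2 F1 (of_int (d P) / of_int (e P)) (of_int (v P) / of_int (u P)) = 0}"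
            define S2 where "S2 = {P\<in>S. ev2 F2 (of_int (d P) / of_int (e P)) (of_int (v P) / of_int (u P)) = 0}"
            have "on_form a (degree F1) S1 d e u v"
              by (rule on_formI[OF nz(1) order_refl F12(4)]) (use pos in \<open>force simp: S1_def\<close>)
            hence 1: "real (card S1) \<le> Ks * B" using IH[of S1 "degree F1"] F12 dF by (auto simp: S1_def)
            have "on_form a (degree F2) S2 d e u v"
              by (rule on_formI[OF nz(2) order_refl F12(5)]) (use pos in \<open>force simp: S2_def\<close>)
            hence 2: "real (card S2) \<le> Ks * B" using IH[of S2 "degree F2"] F12 dF by (auto simp: S2_def)
            have "S \<subseteq> S1 \<union> S2" using evF unfolding F12(1) ev2_mult by (auto simp: S1_def S2_def)
            hence "card S \<le> card (S1 \<union> S2)" using finS by (intro card_mono) (auto simp: S1_def S2_def)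
            also have "\<dots> \<le> card S1 + card S2" by (rule card_Un_le)
            finally have "real (card S) \<le> real (card S1 + card S2)" by (simp only: of_nat_le_iff)
            thus ?thesis using 1 2 nn KB by simp
          next
            case False
            have "real (card S) \<le> K3 * (of_int H powr \<delta> * (sqrt (X0 * Y0) + 1 + 1 / \<rho>))"
              by (rule smooth[OF st HH c(3,2)]) (use False dF in \<open>auto simp: F_def\<close>)
            thus ?thesis using nn KB by (simp add: B_def)
          qed
        qed
      qed
      thus ?case by (simp add: B_def mult.assoc)
    qed
  qed
qed

section \<open>The real determinant method\<close>

text \<open>A right-endpoint Riemann sum of the decreasing function max 0 (W - y)^(m + 1) is at most
  its integral. The cases m = 0 and m = 1 are the two successive integrations over a
  triangle.\<close>

lemma telescoping_pos_part:
  fixes W Y :: real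
  assumes "Y > 0" and m: "m \<le> 1"
  shows "(\<Sum>q\<le>N. Y * max 0 (W - real (Suc q) * Y) ^ Suc m) \<le> max 0 W ^ (m + 2) / (real m + 2)"
proof -
  define g where "g q = max 0 (W - real q * Y) ^ (m + 2) / (real m + 2)" for q
  have step: "Y * max 0 (W - real (Suc q) * Y) ^ Suc m \<le> g q - g (Suc q)" for q
  proof -
    define b where "b = W - real (Suc q) * Y"
    have a: "W - real q * Y = b + Y" by (simp add: b_def algebra_simps)
    show ?thesis
    proof (cases "b \<le> 0")
      case True
      thus ?thesis unfolding g_def a b_def[symmetric] by (simp add: max_def)
    next
      case False
      hence pos: "b > 0" by simp
      consider "m = 0" | "m = 1" using m by linarith
      hence main: "(real m + 2) * (Y * b ^ Suc m) \<le> (b + Y) ^ (m + 2) - b ^ (m + 2)"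
      proof cases
        case 1
        thus ?thesis using assms by (simp add: power2_eq_square algebra_simps)
      next
        case 2
        have "(b + Y) ^ 3 - b ^ 3 = 3 * (Y * b ^ 2) + 3 * b * Y ^ 2 + Y ^ 3"
          by (simp add: power3_eq_cube power2_eq_square algebra_simps)
        moreover have "3 * b * Y ^ 2 + Y ^ 3 \<ge> 0" using pos assms by simp
        ultimately have "3 * (Y * b ^ 2) \<le> (b + Y) ^ 3 - b ^ 3" by linarith
        thus ?thesis using 2 by (simp add: numeral_2_eq_2 numeral_3_eq_3)
      qed
      have "real m + 2 > 0" by simp
      hence "Y * b ^ Suc m \<le> ((b + Y) ^ (m + 2) - b ^ (m + 2)) / (real m + 2)"
        using main by (subst pos_le_divide_eq) (simp_all only: mult.commute)
      moreover have "max 0 b = b" "max 0 (b + Y) = b + Y" using pos assms by auto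
      ultimately show ?thesis unfolding g_def a b_def[symmetric] by (simp only: diff_divide_distrib)
    qed
  qed
  have "(\<Sum>q\<le>N. Y * max 0 (W - real (Suc q) * Y) ^ Suc m) \<le> (\<Sum>q\<le>N. g q - g (Suc q))"
    by (rule sum_mono[OF step])
  also have "\<dots> = g 0 - g (Suc N)" by (rule sum_telescope)
  also have "\<dots> \<le> g 0" by (simp add: g_def)
  finally show ?thesis by (simp add: g_def)
qed

(* Every n distinct lattice points of the quadrant have total weight at least that of the n points
   closest to the origin; the bound comes from comparing with a triangle p X + q Y <= Z - X - Y. *)
lemma sum_weights_ge:
  fixes X Y :: real and P :: "(nat \<times> nat) set"
  assumes XY: "X > 0" "Y > 0" and fin: "finite P"
  shows "(\<Sum>(p, q)\<in>P. real p * X + real q * Y) \<ge> 2 / 3 * real (card P) * sqrt (2 * real (card P) * X * Y) - real (card P) * (X + Y)"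
proof -
  define n where "n = card P"
  \<comment> \<open>With this Z the triangle p X + q Y <= Z has area n, so it holds about as many
    lattice points as P. Summing the positive part of the deficit over the whole quadrant gives at
    most Z^3 / (6 X Y) = n Z / 3.\<close>
  define Z where "Z = sqrt (2 * real n * X * Y)"
  have Z0: "Z \<ge> 0" using XY by (simp add: Z_def)
  have Z2: "Z ^ 2 = 2 * real n * X * Y" using XY by (simp add: Z_def)
  define m where "m = (\<lambda>(p, q). max 0 (Z - real (Suc p) * X - real (Suc q) * Y))"
  obtain N where N: "P \<subseteq> {..N} \<times> {..N}"
  proof -
    have "finite (fst ` P \<union> snd ` P)" using fin by simp
    then obtain N where "fst ` P \<union> snd ` P \<subseteq> {..N}" using finite_nat_iff_bounded_le by blast
    hence "P \<subseteq> {..N} \<times> {..N}" by (force simp: image_subset_iff)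
    thus ?thesis using that by blast
  qed
  have "(\<Sum>pq\<in>P. m pq) \<le> (\<Sum>pq\<in>{..N} \<times> {..N}. m pq)"
    using N by (intro sum_mono2) (auto simp: m_def)
  also have "\<dots> = (\<Sum>p\<le>N. \<Sum>q\<le>N. max 0 ((Z - real (Suc p) * X) - real (Suc q) * Y))"
    by (simp add: m_def sum.cartesian_product)
  also have "\<dots> \<le> (\<Sum>p\<le>N. max 0 (Z - real (Suc p) * X) ^ 2 / 2 / Y)"
  proof (rule sum_mono)
    fix p
    have "Y * (\<Sum>q\<le>N. max 0 ((Z - real (Suc p) * X) - real (Suc q) * Y)) \<le> max 0 (Z - real (Suc p) * X) ^ 2 / 2"
      using telescoping_pos_part[OF XY(2), of 0 "Z - real (Suc p) * X" N]
      by (simp add: sum_distrib_left power2_eq_square)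
    thus "(\<Sum>q\<le>N. max 0 ((Z - real (Suc p) * X) - real (Suc q) * Y)) \<le> max 0 (Z - real (Suc p) * X) ^ 2 / 2 / Y"
      using XY by (subst pos_le_divide_eq) (simp_all only: mult.commute)
  qed
  also have "\<dots> = (\<Sum>p\<le>N. X * max 0 (Z - real (Suc p) * X) ^ Suc 1) / (2 * X * Y)"
    unfolding sum_divide_distrib using XY by (intro sum.cong refl) (simp add: power2_eq_square)
  also have "\<dots> \<le> (max 0 Z ^ (1 + 2) / (real 1 + 2)) / (2 * X * Y)"
    using XY by (intro divide_right_mono telescoping_pos_part) auto
  also have "\<dots> = Z * Z ^ 2 / (6 * X * Y)" using Z0 by (simp add: max_def power3_eq_cube power2_eq_square)
  also have "\<dots> = real n * Z / 3" unfolding Z2 using XY by simp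
  finally have 1: "(\<Sum>pq\<in>P. m pq) \<le> real n * Z / 3" .
  have "(\<Sum>pq\<in>P. Z - X - Y - m pq) \<le> (\<Sum>(p, q)\<in>P. real p * X + real q * Y)"
    by (intro sum_mono) (auto simp: m_def algebra_simps)
  moreover have "(\<Sum>pq\<in>P. Z - X - Y - m pq) = real n * (Z - X - Y) - (\<Sum>pq\<in>P. m pq)"
    by (simp add: sum_subtractf n_def)
  ultimately have "(\<Sum>(p, q)\<in>P. real p * X + real q * Y) \<ge> real n * (Z - X - Y) - real n * Z / 3" using 1 by linarith
  thus ?thesis unfolding n_def[symmetric] Z_def[symmetric] by (simp add: algebra_simps)
qed

text \<open>Transfers a bound on the relative error of an l-th power to the error of the
  base.\<close>

lemma power_root_bounds:
  fixes y :: real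
  assumes "y \<ge> 0" "l \<ge> 1"
  shows "\<bar>y - 1\<bar> \<le> \<bar>y ^ l - 1\<bar>"
proof (cases "y \<ge> 1")
  case True
  hence "y ^ 1 \<le> y ^ l" using assms by (intro power_increasing) auto
  thus ?thesis using True by simp
next
  case False
  hence "y ^ l \<le> y ^ 1" using assms by (intro power_decreasing) auto
  thus ?thesis using False by simp
qed

text \<open>Pairing (i, j) with (a - i, b - j) makes each pair of monomials contribute (D E)^a (U
  V)^b; squaring the product realises this pairing without halves.\<close>

lemma prod_weighted_box:
  fixes D E U V :: real and \<phi> :: "nat \<Rightarrow> nat \<times> nat"
  assumes \<phi>: "bij_betw \<phi> {0..<n} ({..a} \<times> {..b})"
  shows "(\<Prod>c=0..<n. D ^ fst (\<phi> c) * E ^ (a - fst (\<phi> c)) * V ^ snd (\<phi> c) * U ^ (b - snd (\<phi> c))) ^ 2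
     = ((D * E) ^ a * (U * V) ^ b) ^ n"
proof -
  let ?J = "{..a} \<times> {..b}"
  let ?z = "\<lambda>p. D ^ fst p * E ^ (a - fst p) * V ^ snd p * U ^ (b - snd p)"
  let ?z' = "\<lambda>p. D ^ (a - fst p) * E ^ fst p * V ^ (b - snd p) * U ^ snd p"
  have "(\<Prod>c=0..<n. ?z (\<phi> c)) = (\<Prod>p\<in>?J. ?z p)" by (rule prod.reindex_bij_betw[OF \<phi>])
  moreover have "(\<Prod>p\<in>?J. ?z p) = (\<Prod>p\<in>?J. ?z' p)"
    by (rule prod.reindex_bij_witness[of _ "\<lambda>(i, j). (a - i, b - j)" "\<lambda>(i, j). (a - i, b - j)"]) auto
  ultimately have "(\<Prod>c=0..<n. ?z (\<phi> c)) ^ 2 = (\<Prod>p\<in>?J. ?z p * ?z' p)"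
    by (simp add: power2_eq_square prod.distrib)
  also have "\<dots> = (\<Prod>p\<in>?J. (D * E) ^ a * (U * V) ^ b)"
  proof (intro prod.cong refl)
    fix p assume "p \<in> ?J"
    hence eq: "fst p + (a - fst p) = a" "snd p + (b - snd p) = b" by auto
    have pw: "x ^ a = x ^ fst p * x ^ (a - fst p)" "x ^ b = x ^ snd p * x ^ (b - snd p)" for x :: real
      using eq by (simp_all flip: power_add)
    show "?z p * ?z' p = (D * E) ^ a * (U * V) ^ b"
      unfolding power_mult_distrib pw by (simp only: mult_ac)
  qed
  also have "card ?J = n" using bij_betw_same_card[OF \<phi>] by simp
  hence "(\<Prod>p\<in>?J. (D * E) ^ a * (U * V) ^ b) = ((D * E) ^ a * (U * V) ^ b) ^ n" by simp
  finally show ?thesis .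
qed

lemma binomial_le_power_two:
  assumes "M \<le> M'"
  shows "real (M choose p) \<le> 2 ^ M'"
proof -
  have "M choose p \<le> 2 ^ M"
  proof (cases "p \<le> M")
    case True
    hence "M choose p \<le> (\<Sum>i\<le>M. M choose i)" by (intro member_le_sum) auto
    thus ?thesis by (simp add: choose_row_sum)
  qed (simp add: binomial_eq_0)
  hence "real (M choose p) \<le> real (2 ^ M)" by (simp only: of_nat_le_iff)
  also have "\<dots> \<le> 2 ^ M'" using assms by (simp add: power_increasing)
  finally show ?thesis .
qed

text \<open>On the curve t^l = s^k the parametrisation s = \<tau>^l, t = \<tau>^k turns the monomial
  of index (i, j) into e^a u^b \<tau>^(l i + k j). Near the curve \<tau> = \<tau>0 (1 + \<sigma>),
  and t carries a further factor 1 + \<omega>; the binomial expansions make the columns combinations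
  of \<sigma>^p \<omega>^q. By \<open>sum_weights_ge\<close> with weights - ln \<sigma>0 and - ln
  \<omega>0, n distinct pairs (p, q) yield the exponential factor. C collects the binomial
  coefficients, the factors 2 in e <= 2 E and u <= 2 U, and the powers of 2 in the bounds for
  \<tau>0.\<close>

lemma approx_det_bound:
  fixes d e u v :: "nat \<Rightarrow> int" and \<phi> :: "nat \<Rightarrow> nat \<times> nat" and D E U V \<sigma>0 \<omega>0 \<tau>0 :: real
    and \<sigma> \<omega> :: "nat \<Rightarrow> real"
  assumes \<phi>: "bij_betw \<phi> {0..<n} ({..a} \<times> {..b})"
    and pos: "D > 0" "E > 0" "U > 0" "V > 0" "0 < \<sigma>0" "\<sigma>0 < 1" "0 < \<omega>0" "\<omega>0 < 1" "\<tau>0 > 0"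
    and pt: "\<And>r. r < n \<Longrightarrow> 0 < e r \<and> 0 < u r \<and> of_int (e r) \<le> 2 * E \<and> of_int (u r) \<le> 2 * U \<and>
       of_int (d r) = of_int (e r) * (\<tau>0 * (1 + \<sigma> r)) ^ l \<and>
       of_int (v r) = of_int (u r) * ((\<tau>0 * (1 + \<sigma> r)) ^ k * (1 + \<omega> r)) \<and>
       \<bar>\<sigma> r\<bar> \<le> \<sigma>0 \<and> \<bar>\<omega> r\<bar> \<le> \<omega>0"
    and \<tau>: "\<tau>0 ^ l \<le> 2 * D / E" "\<tau>0 ^ k \<le> 2 ^ k * V / U"
  defines "J \<equiv> {..l * a + k * b} \<times> {..b}" and "C \<equiv> (2 :: real) ^ ((l * a + k * b) + b + a + b + a + k * b)"
  shows "(real_of_int (det (mat n n (\<lambda>(r, x). d r ^ fst (\<phi> x) * e r ^ (a - fst (\<phi> x)) * v r ^ snd (\<phi> x) * u r ^ (b - snd (\<phi> x)))))) ^ 2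
    \<le> (real (card J) ^ n * fact n * C ^ n) ^ 2 * ((D * E) ^ a * (U * V) ^ b) ^ n *
       exp (- 2 * (2 / 3 * real n * sqrt (2 * real n * (- ln \<sigma>0) * (- ln \<omega>0)) - real n * (- ln \<sigma>0 - ln \<omega>0)))"
proof -
  let ?E = "\<lambda>r x. d r ^ fst (\<phi> x) * e r ^ (a - fst (\<phi> x)) * v r ^ snd (\<phi> x) * u r ^ (b - snd (\<phi> x))"
  define X where "X = - ln \<sigma>0"
  define Y where "Y = - ln \<omega>0"
  have XY: "X > 0" "Y > 0" using pos by (simp_all add: X_def Y_def)
  define N where "N x = l * fst (\<phi> x) + k * snd (\<phi> x)" for x
  define Z where "Z r = (\<lambda>(p, q). (of_int (e r) ^ a * of_int (u r) ^ b) * (\<sigma> r ^ p * \<omega> r ^ q))" for r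
  define B where "B = (\<lambda>(p, q) x. (of_nat (N x choose p) * of_nat (snd (\<phi> x) choose q)) * \<tau>0 ^ N x :: real)"
  define z where "z = (\<lambda>(p, q). ((2 * E) ^ a * (2 * U) ^ b) * (\<sigma>0 ^ p * \<omega>0 ^ q))"
  define w where "w x = D ^ fst (\<phi> x) * E ^ (a - fst (\<phi> x)) * V ^ snd (\<phi> x) * U ^ (b - snd (\<phi> x))" for x
  define G where "G = C ^ n * (\<Prod>x=0..<n. w x) * exp (- (2 / 3 * real n * sqrt (2 * real n * X * Y) - real n * (X + Y)))"
  have \<phi>in: "fst (\<phi> x) \<le> a \<and> snd (\<phi> x) \<le> b" if "x < n" for x
    using bij_betwE[OF \<phi>] that by (auto simp: mem_Times_iff)
  have N_le: "N x \<le> l * a + k * b" if "x < n" for x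
    unfolding N_def using \<phi>in[OF that] by (intro add_mono mult_left_mono) auto
  have E: "real_of_int (?E r x) = (\<Sum>m\<in>J. Z r m * B m x)" if r: "r < n" and x: "x < n" for r x
  proof -
    let ?i = "fst (\<phi> x)" and ?j = "snd (\<phi> x)"
    have bin: "(1 + y) ^ M = (\<Sum>p\<le>M'. of_nat (M choose p) * y ^ p)" if "M \<le> M'" for y :: real and M M'
    proof -
      have "(1 + y) ^ M = (y + 1) ^ M" by (simp add: add.commute)
      also have "\<dots> = (\<Sum>p\<le>M. of_nat (M choose p) * y ^ p)" unfolding binomial_ring by simp
      also have "\<dots> = (\<Sum>p\<le>M'. of_nat (M choose p) * y ^ p)"
        using that by (intro sum.mono_neutral_left) auto
      finally show ?thesis .
    qed
    have "real_of_int (?E r x) = (of_int (e r) ^ ?i * of_int (e r) ^ (a - ?i)) * (of_int (u r) ^ ?j * of_int (u r) ^ (b - ?j)) *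
        (\<tau>0 ^ N x * (1 + \<sigma> r) ^ N x * (1 + \<omega> r) ^ ?j)"
      using pt[OF r] unfolding of_int_mult of_int_power N_def power_add power_mult
      by (simp only: power_mult_distrib power_mult[symmetric] mult_ac)
    also have "real_of_int (e r) ^ ?i * of_int (e r) ^ (a - ?i) = of_int (e r) ^ a" using \<phi>in[OF x] by (simp flip: power_add)
    also have "real_of_int (u r) ^ ?j * of_int (u r) ^ (b - ?j) = of_int (u r) ^ b" using \<phi>in[OF x] by (simp flip: power_add)
    also have "(1 + \<sigma> r) ^ N x = (\<Sum>p\<le>l * a + k * b. of_nat (N x choose p) * \<sigma> r ^ p)" by (rule bin[OF N_le[OF x]])
    also have "(1 + \<omega> r) ^ ?j = (\<Sum>q\<le>b. of_nat (?j choose q) * \<omega> r ^ q)" using \<phi>in[OF x] by (intro bin) auto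
    also have "of_int (e r) ^ a * of_int (u r) ^ b * (\<tau>0 ^ N x * (\<Sum>p\<le>l * a + k * b. of_nat (N x choose p) * \<sigma> r ^ p) * (\<Sum>q\<le>b. of_nat (?j choose q) * \<omega> r ^ q)) =
       (\<Sum>p\<le>l * a + k * b. \<Sum>q\<le>b. Z r (p, q) * B (p, q) x)"
      by (simp add: Z_def B_def sum_distrib_left sum_distrib_right mult_ac)
    also have "\<dots> = (\<Sum>m\<in>J. Z r m * B m x)" by (simp add: J_def sum.cartesian_product)
    finally show ?thesis .
  qed
  have C_pos: "C > 0" by (simp add: C_def)
  have w_pos: "w x > 0" for x using pos by (simp add: w_def)
  have G0: "G \<ge> 0" unfolding G_def using C_pos w_pos by (intro mult_nonneg_nonneg prod_nonneg) (auto intro: less_imp_le)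
  \<comment> \<open>Up to C, the size of E^a U^b \<tau>0^(N x) is at most that of the monomial with
    exponents \<phi> x, as \<tau>0^l is at most of the order D / E and \<tau>0^k at most of the
    order V / U.\<close>
  have col: "(2 ^ ((l * a + k * b) + b) * \<tau>0 ^ N x) * ((2 * E) ^ a * (2 * U) ^ b) \<le> C * w x" if x: "x < n" for x
  proof -
    let ?i = "fst (\<phi> x)" and ?j = "snd (\<phi> x)"
    have "\<tau>0 ^ N x = (\<tau>0 ^ l) ^ ?i * (\<tau>0 ^ k) ^ ?j" by (simp add: N_def power_add power_mult)
    also have "\<dots> \<le> (2 * D / E) ^ ?i * (2 ^ k * V / U) ^ ?j"
      using \<tau> pos by (intro mult_mono power_mono) auto
    also have "\<dots> \<le> 2 ^ a * 2 ^ (k * b) * ((D / E) ^ ?i * (V / U) ^ ?j)"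
    proof -
      have "(2 :: real) ^ ?i \<le> 2 ^ a" "(2 :: real) ^ (k * ?j) \<le> 2 ^ (k * b)"
        using \<phi>in[OF x] by (auto intro!: power_increasing)
      hence "(2 ^ ?i * 2 ^ (k * ?j)) * ((D / E) ^ ?i * (V / U) ^ ?j) \<le> (2 ^ a * 2 ^ (k * b)) * ((D / E) ^ ?i * (V / U) ^ ?j)"
        using pos by (intro mult_right_mono mult_mono) auto
      thus ?thesis by (simp add: power_mult_distrib power_divide power_mult mult_ac)
    qed
    finally have "(2 ^ ((l * a + k * b) + b) * \<tau>0 ^ N x) * ((2 * E) ^ a * (2 * U) ^ b) \<le>
       (2 ^ ((l * a + k * b) + b) * (2 ^ a * 2 ^ (k * b) * ((D / E) ^ ?i * (V / U) ^ ?j))) * ((2 * E) ^ a * (2 * U) ^ b)"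
      using pos by (intro mult_right_mono mult_left_mono) auto
    also have "\<dots> = C * ((D / E) ^ ?i * (V / U) ^ ?j * E ^ a * U ^ b)"
      by (simp add: C_def power_add power_mult_distrib)
    also have "(D / E) ^ ?i * (V / U) ^ ?j * E ^ a * U ^ b = w x"
    proof -
      have "E ^ a = E ^ ?i * E ^ (a - ?i)" "U ^ b = U ^ ?j * U ^ (b - ?j)"
        using \<phi>in[OF x] by (simp_all flip: power_add)
      thus ?thesis using pos by (simp add: w_def power_divide)
    qed
    finally show ?thesis .
  qed
  have "\<bar>det (mat n n (\<lambda>(r, x). \<Sum>m\<in>J. Z r m * B m x))\<bar> \<le> real (card J) ^ n * fact n * G"
  proof (rule abs_det_expand_le[where z = z])
    show "finite J" by (simp add: J_def)
    show "\<bar>Z r m\<bar> \<le> z m" if r: "r < n" and m: "m \<in> J" for r m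
    proof -
      obtain p q where pq: "m = (p, q)" by (cases m)
      show ?thesis unfolding pq Z_def z_def prod.case abs_mult power_abs
        using pt[OF r] pos by (intro mult_mono power_mono) auto
    qed
    fix f assume f: "f \<in> {0..<n} \<rightarrow> J" "inj_on f {0..<n}"
    have "(\<Prod>c=0..<n. \<bar>B (f c) c\<bar> * z (f c)) \<le> (\<Prod>c=0..<n. (C * w c) * (\<sigma>0 ^ fst (f c) * \<omega>0 ^ snd (f c)))"
    proof (rule prod_mono, rule conjI)
      fix c assume c: "c \<in> {0..<n}"
      obtain p q where pq: "f c = (p, q)" by (cases "f c")
      show "0 \<le> \<bar>B (f c) c\<bar> * z (f c)" using pos by (simp add: z_def pq)
      have "real (N c choose p) \<le> 2 ^ (l * a + k * b)" "real (snd (\<phi> c) choose q) \<le> 2 ^ b"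
        using c N_le[of c] \<phi>in[of c] by (intro binomial_le_power_two; simp)+
      hence "real (N c choose p) * real (snd (\<phi> c) choose q) \<le> 2 ^ (l * a + k * b) * 2 ^ b"
        by (intro mult_mono) auto
      hence "\<bar>B (f c) c\<bar> \<le> (2 ^ (l * a + k * b) * 2 ^ b) * \<tau>0 ^ N c"
        unfolding pq B_def prod.case using pos by (simp add: abs_mult mult_right_mono)
      hence "\<bar>B (f c) c\<bar> * z (f c) \<le> ((2 ^ (l * a + k * b) * 2 ^ b) * \<tau>0 ^ N c) * (((2 * E) ^ a * (2 * U) ^ b) * (\<sigma>0 ^ p * \<omega>0 ^ q))"
        unfolding pq z_def prod.case using pos by (intro mult_right_mono) auto
      also have "\<dots> = ((2 ^ ((l * a + k * b) + b) * \<tau>0 ^ N c) * ((2 * E) ^ a * (2 * U) ^ b)) * (\<sigma>0 ^ p * \<omega>0 ^ q)"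
        by (simp only: power_add mult.assoc)
      also have "\<dots> \<le> (C * w c) * (\<sigma>0 ^ p * \<omega>0 ^ q)" using col[of c] c pos by (intro mult_right_mono) auto
      finally show "\<bar>B (f c) c\<bar> * z (f c) \<le> (C * w c) * (\<sigma>0 ^ fst (f c) * \<omega>0 ^ snd (f c))" by (simp add: pq)
    qed
    also have "\<dots> = (C ^ n * (\<Prod>c=0..<n. w c)) * (\<Prod>c=0..<n. \<sigma>0 ^ fst (f c) * \<omega>0 ^ snd (f c))"
      by (simp add: prod.distrib)
    also have "(\<Prod>c=0..<n. \<sigma>0 ^ fst (f c) * \<omega>0 ^ snd (f c)) = (\<Prod>c=0..<n. exp (- (real (fst (f c)) * X + real (snd (f c)) * Y)))"
    proof (intro prod.cong refl)
      fix c
      have "\<sigma>0 ^ fst (f c) = exp (- (real (fst (f c)) * X))" "\<omega>0 ^ snd (f c) = exp (- (real (snd (f c)) * Y))"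
        using pos by (simp_all add: X_def Y_def exp_of_nat_mult)
      thus "\<sigma>0 ^ fst (f c) * \<omega>0 ^ snd (f c) = exp (- (real (fst (f c)) * X + real (snd (f c)) * Y))"
        by (simp only: minus_add_distrib exp_add)
    qed
    also have "\<dots> = exp (- (\<Sum>c=0..<n. real (fst (f c)) * X + real (snd (f c)) * Y))"
      by (subst exp_sum[symmetric]) (simp_all only: sum_negf finite_atLeastLessThan)
    also have "\<dots> \<le> exp (- (2 / 3 * real n * sqrt (2 * real n * X * Y) - real n * (X + Y)))"
    proof -
      have "card (f ` {0..<n}) = n" using f(2) by (simp add: card_image)
      moreover have "(\<Sum>c=0..<n. real (fst (f c)) * X + real (snd (f c)) * Y) = (\<Sum>(p, q)\<in>f ` {0..<n}. real p * X + real q * Y)"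
        using f(2) by (simp add: sum.reindex case_prod_beta)
      ultimately show ?thesis using sum_weights_ge[OF XY, of "f ` {0..<n}"] by simp
    qed
    finally show "(\<Prod>c=0..<n. \<bar>B (f c) c\<bar> * z (f c)) \<le> G"
      unfolding G_def using C_pos w_pos by (simp add: prod_nonneg less_imp_le mult_left_mono)
  qed (rule G0)
  also have "mat n n (\<lambda>(r, x). \<Sum>m\<in>J. Z r m * B m x) = map_mat real_of_int (mat n n (\<lambda>(r, x). ?E r x))"
    by (intro eq_matI) (auto simp: E simp del: of_int_mult of_int_power)
  also have "det \<dots> = real_of_int (det (mat n n (\<lambda>(r, x). ?E r x)))" by (rule of_int_hom.hom_det)
  finally have "\<bar>real_of_int (det (mat n n (\<lambda>(r, x). ?E r x)))\<bar> ^ 2 \<le> (real (card J) ^ n * fact n * G) ^ 2"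
    by (intro power_mono) auto
  also have "\<dots> = (real (card J) ^ n * fact n * C ^ n) ^ 2 * (\<Prod>x=0..<n. w x) ^ 2 * 
      exp (- (2 / 3 * real n * sqrt (2 * real n * X * Y) - real n * (X + Y))) ^ 2"
    by (simp add: G_def power_mult_distrib mult_ac)
  also have "(\<Prod>x=0..<n. w x) ^ 2 = ((D * E) ^ a * (U * V) ^ b) ^ n" unfolding w_def by (rule prod_weighted_box[OF \<phi>])
  also have "exp (- (2 / 3 * real n * sqrt (2 * real n * X * Y) - real n * (X + Y))) ^ 2 =
      exp (- 2 * (2 / 3 * real n * sqrt (2 * real n * X * Y) - real n * (X + Y)))"
    by (simp add: exp_double[symmetric])
  finally show ?thesis by (simp add: X_def Y_def)
qed

section \<open>Points with a given ratio\<close>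

lemma abs_power_diff_ge:
  fixes x y m :: real
  assumes "x \<ge> m" "y \<ge> m" "m \<ge> 0" "l \<ge> 1"
  shows "\<bar>x - y\<bar> * m ^ (l - 1) \<le> \<bar>x ^ l - y ^ l\<bar>"
proof -
  obtain j where l: "l = Suc j" using assms(4) by (cases l) auto
  have *: "(x - y) * m ^ j \<le> x ^ Suc j - y ^ Suc j" if "x \<ge> y" "y \<ge> m" for x y
  proof -
    have "(x - y) * m ^ j \<le> (x - y) * x ^ j" using that assms by (intro mult_left_mono power_mono) auto
    also have "\<dots> = x ^ Suc j - y * x ^ j" by (simp add: algebra_simps)
    also have "\<dots> \<le> x ^ Suc j - y * y ^ j" using that assms by (intro diff_left_mono mult_left_mono power_mono) auto
    finally show ?thesis by simp
  qed
  show ?thesis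
  proof (cases "x \<ge> y")
    case True
    thus ?thesis using *[of y x] assms unfolding l by simp
  next
    case False
    thus ?thesis using *[of x y] assms unfolding l by simp
  qed
qed

text \<open>The four sizes are independent parameters, so that exchanging (d, e, k) with (u, v, l)
  becomes a symmetry (\<open>card_solutions_swap\<close>).\<close>

definition solutions :: "nat \<Rightarrow> nat \<Rightarrow> int \<Rightarrow> real \<Rightarrow> real \<Rightarrow> real \<Rightarrow> real \<Rightarrow> (nat \<times> nat \<times> nat \<times> nat) set" where
  "solutions k l h D E U V = {(d, e, u, v). D < real d \<and> real d < 2 * D \<and> E < real e \<and> real e < 2 * E \<and>
     U < real u \<and> real u < 2 * U \<and> V < real v \<and> real v < 2 * V \<and> int e ^ k * int v ^ l - int d ^ k * int u ^ l = h}"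

definition dd :: "nat \<times> nat \<times> nat \<times> nat \<Rightarrow> int" where "dd = (\<lambda>(d, e, u, v). int d)"
definition ee :: "nat \<times> nat \<times> nat \<times> nat \<Rightarrow> int" where "ee = (\<lambda>(d, e, u, v). int e)"
definition uu :: "nat \<times> nat \<times> nat \<times> nat \<Rightarrow> int" where "uu = (\<lambda>(d, e, u, v). int u)"
definition vv :: "nat \<times> nat \<times> nat \<times> nat \<Rightarrow> int" where "vv = (\<lambda>(d, e, u, v). int v)"

lemma point_eqI: "dd P = dd Q \<Longrightarrow> ee P = ee Q \<Longrightarrow> uu P = uu Q \<Longrightarrow> vv P = vv Q \<Longrightarrow> P = Q"
  by (auto simp: dd_def ee_def uu_def vv_def split: prod.splits)

lemma solutionsD:
  assumes "P \<in> solutions k l h D E U V" "D > 0" "E > 0" "U > 0" "V > 0"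
  shows "dd P > 0" "ee P > 0" "uu P > 0" "vv P > 0"
    "D < of_int (dd P)" "of_int (dd P) < 2 * D" "E < of_int (ee P)" "of_int (ee P) < 2 * E"
    "U < of_int (uu P)" "of_int (uu P) < 2 * U" "V < of_int (vv P)" "of_int (vv P) < 2 * V"
    "ee P ^ k * vv P ^ l - dd P ^ k * uu P ^ l = h"
  using assms by (auto simp: solutions_def dd_def ee_def uu_def vv_def of_nat_0_less_iff[symmetric, where 'a = real] simp del: of_nat_0_less_iff)

lemma finite_solutions: "finite (solutions k l h D E U V)"
proof (rule finite_subset)
  show "solutions k l h D E U V \<subseteq> {..nat \<lceil>2 * D\<rceil>} \<times> {..nat \<lceil>2 * E\<rceil>} \<times> {..nat \<lceil>2 * U\<rceil>} \<times> {..nat \<lceil>2 * V\<rceil>}"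
    by (auto simp: solutions_def) linarith+
qed auto

text \<open>Two solutions (u, v) and (u1, v1) over the same (d, e) satisfy e^k ((v u1)^l - (v1 u)^l)
  = h (u1^l - u^l), which bounds the integer j = v u1 - v1 u by |h| 2^l U V / x. With j given, (u,
  v) moves along multiples of (u1, v1) / g, where g = gcd (u1, v1). Since g^l divides h, one step
  changes u by at least u1 / |h|, so there are at most 2 |h| + 1 positions.\<close>

lemma card_given_d_e:
  assumes l: "l \<ge> 1" and h: "h \<noteq> 0" and pos: "D > 0" "E > 0" "U > 0" "V > 0"
    and x: "E ^ k * V ^ l = x" and UV: "U * V \<le> c * x" and c: "c > 0"
  shows "real (card {P\<in>solutions k l h D E U V. dd P = d0 \<and> ee P = e0})
    \<le> (2 * (\<bar>of_int h\<bar> * 2 ^ l * c) + 1) * (2 * \<bar>of_int h\<bar> + 1)"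
proof -
  define S where "S = {P\<in>solutions k l h D E U V. dd P = d0 \<and> ee P = e0}"
  define J where "J = \<bar>of_int h\<bar> * 2 ^ l * c"
  have finS: "finite S" unfolding S_def using finite_solutions by simp
  have J0: "J \<ge> 0" using c by (simp add: J_def)
  have x0: "x > 0" using x pos by auto
  show ?thesis
  proof (cases "S = {}")
    case True
    thus ?thesis unfolding S_def[symmetric] J_def[symmetric] using J0 by simp
  next
    case False
    then obtain P1 where P1: "P1 \<in> S" by auto
    define u1 where "u1 = uu P1"
    define v1 where "v1 = vv P1"
    note sol = solutionsD[OF _ pos]
    have S_sol: "P \<in> solutions k l h D E U V" "dd P = d0" "ee P = e0" if "P \<in> S" for P using that by (auto simp: S_def)
    note s1 = sol[OF S_sol(1)[OF P1]]
    define g where "g = gcd u1 v1"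
    have g: "g > 0" using s1 by (simp add: g_def u1_def)
    have "g ^ l dvd h"
    proof -
      have "g ^ l dvd v1 ^ l" "g ^ l dvd u1 ^ l" by (auto simp: g_def intro: dvd_power_same)
      thus ?thesis using s1(13) unfolding u1_def v1_def by (metis dvd_diff dvd_mult)
    qed
    hence "g ^ l \<le> \<bar>h\<bar>" using h by (intro zdvd_imp_le) auto
    moreover have "g ^ 1 \<le> g ^ l" using g l by (intro power_increasing) auto
    ultimately have gh: "g \<le> \<bar>h\<bar>" by simp
    define j where "j P = vv P * u1 - v1 * uu P" for P
    have jb: "\<bar>real_of_int (j P)\<bar> \<le> J" if P: "P \<in> S" for P
    proof -
      note sP = sol[OF S_sol(1)[OF P]]
      define X where "X = real_of_int (vv P * u1)"
      define Y where "Y = real_of_int (v1 * uu P)"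
      have XY: "X \<ge> U * V" "Y \<ge> U * V"
        unfolding X_def Y_def of_int_mult using sP s1 pos u1_def v1_def
        by (auto simp: mult.commute[of U] intro!: mult_mono)
      have e0: "real_of_int e0 > E" "e0 > 0" using sP S_sol(3)[OF P] by auto
      have 1: "e0 ^ k * vv P ^ l = h + d0 ^ k * uu P ^ l" using sP(13) S_sol[OF P] by simp
      have 2: "e0 ^ k * v1 ^ l = h + d0 ^ k * u1 ^ l" using s1(13) S_sol[OF P1] unfolding u1_def v1_def by simp
      have "e0 ^ k * ((vv P * u1) ^ l - (v1 * uu P) ^ l) = (e0 ^ k * vv P ^ l) * u1 ^ l - (e0 ^ k * v1 ^ l) * uu P ^ l"
        by (simp add: power_mult_distrib algebra_simps)
      also have "\<dots> = h * (u1 ^ l - uu P ^ l)" unfolding 1 2 by (simp add: algebra_simps)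
      finally have "real_of_int (e0 ^ k * ((vv P * u1) ^ l - (v1 * uu P) ^ l)) = real_of_int (h * (u1 ^ l - uu P ^ l))" by (simp only:)
      hence eq: "of_int e0 ^ k * (X ^ l - Y ^ l) = of_int h * (of_int u1 ^ l - of_int (uu P) ^ l)"
        by (simp add: X_def Y_def)
      have "\<bar>real_of_int u1 ^ l - of_int (uu P) ^ l\<bar> \<le> (2 * U) ^ l"
      proof -
        have le: "0 \<le> y ^ l \<and> y ^ l \<le> (2 * U) ^ l" if "0 \<le> y" "y \<le> 2 * U" for y :: real
          using that by (intro conjI power_mono zero_le_power)
        have "0 \<le> real_of_int u1 ^ l \<and> real_of_int u1 ^ l \<le> (2 * U) ^ l"
          using s1(3,10) unfolding u1_def by (intro le) linarith+
        moreover have "0 \<le> real_of_int (uu P) ^ l \<and> real_of_int (uu P) ^ l \<le> (2 * U) ^ l"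
          using sP(3,10) by (intro le) linarith+
        ultimately show ?thesis by linarith
      qed
      hence "of_int e0 ^ k * \<bar>X ^ l - Y ^ l\<bar> \<le> \<bar>of_int h\<bar> * (2 * U) ^ l"
        using arg_cong[OF eq, of abs] e0 by (simp add: abs_mult power_abs mult_left_mono)
      moreover have "E ^ k * (\<bar>X - Y\<bar> * (U * V) ^ (l - 1)) \<le> of_int e0 ^ k * \<bar>X ^ l - Y ^ l\<bar>"
        using abs_power_diff_ge[OF XY _ l] e0 pos by (intro mult_mono power_mono) auto
      ultimately have "E ^ k * (\<bar>X - Y\<bar> * (U * V) ^ (l - 1)) \<le> \<bar>of_int h\<bar> * (2 * U) ^ l" by linarith
      hence "(E ^ k * (\<bar>X - Y\<bar> * (U * V) ^ (l - 1))) * V ^ l \<le> (\<bar>of_int h\<bar> * (2 * U) ^ l) * V ^ l"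
        using pos by (intro mult_right_mono) auto
      moreover have "(E ^ k * (\<bar>X - Y\<bar> * (U * V) ^ (l - 1))) * V ^ l = \<bar>X - Y\<bar> * x * (U * V) ^ (l - 1)"
        unfolding x[symmetric] by (simp only: mult_ac)
      moreover have "(\<bar>of_int h\<bar> * (2 * U) ^ l) * V ^ l = \<bar>of_int h\<bar> * 2 ^ l * (U * V) ^ l"
        unfolding power_mult_distrib by (simp only: mult_ac)
      ultimately have "\<bar>X - Y\<bar> * x * (U * V) ^ (l - 1) \<le> \<bar>of_int h\<bar> * 2 ^ l * (U * V) ^ l" by linarith
      also have "(U * V) ^ l = (U * V) * (U * V) ^ (l - 1)" using l by (simp add: power_eq_if)
      finally have "(\<bar>X - Y\<bar> * x) * (U * V) ^ (l - 1) \<le> (\<bar>of_int h\<bar> * 2 ^ l * (U * V)) * (U * V) ^ (l - 1)"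
        by (simp only: mult.assoc)
      hence "\<bar>X - Y\<bar> * x \<le> \<bar>of_int h\<bar> * 2 ^ l * (U * V)"
        using pos by (subst (asm) mult_le_cancel_right_pos) auto
      also have "\<dots> \<le> \<bar>of_int h\<bar> * 2 ^ l * (c * x)" using UV by (intro mult_left_mono) auto
      finally have "\<bar>X - Y\<bar> * x \<le> J * x" by (simp add: J_def)
      hence "\<bar>X - Y\<bar> \<le> J" using x0 by simp
      thus ?thesis by (simp add: j_def X_def Y_def)
    qed
    have card_fibre: "real (card {P\<in>S. j P = j0}) \<le> 2 * \<bar>of_int h\<bar> + 1" for j0
    proof (cases "{P\<in>S. j P = j0} = {}")
      case True
      thus ?thesis by (simp only: True card.empty)
    next
      case False
      then obtain P2 where P2: "P2 \<in> S" "j P2 = j0" by auto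
      obtain u' v' where uv': "u1 = u' * g" "v1 = v' * g" "coprime u' v'"
        using gcd_coprime_exists[of u1 v1] g unfolding g_def by auto
      have u'0: "u' > 0" using uv' g s1(3) unfolding u1_def[symmetric] by (simp add: zero_less_mult_iff)
      have key: "\<exists>z. uu P = uu P2 + z * u' \<and> vv P = vv P2 + z * v'" if P: "P \<in> S" "j P = j0" for P
      proof -
        have "g * (u' * (vv P - vv P2)) = g * (v' * (uu P - uu P2))"
          using P(2) P2(2) unfolding j_def uv' by (simp add: algebra_simps)
        hence eq: "u' * (vv P - vv P2) = v' * (uu P - uu P2)" using g by simp
        hence "u' dvd v' * (uu P - uu P2)" by (metis dvd_triv_left)
        hence "u' dvd uu P - uu P2" using uv'(3) coprime_dvd_mult_right_iff by blast
        then obtain z where z: "uu P - uu P2 = u' * z" by (auto simp: dvd_def)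
        have "u' * (vv P - vv P2) = u' * (v' * z)" using eq z by simp
        hence "vv P - vv P2 = v' * z" using u'0 by simp
        thus ?thesis using z by (intro exI[of _ z]) (simp add: algebra_simps)
      qed
      define \<zeta> where "\<zeta> P = (uu P - uu P2) div u'" for P
      have \<zeta>: "uu P = uu P2 + \<zeta> P * u' \<and> vv P = vv P2 + \<zeta> P * v'" if P: "P \<in> S" "j P = j0" for P
        using key[OF P] u'0 by (auto simp: \<zeta>_def)
      have "inj_on \<zeta> {P\<in>S. j P = j0}"
      proof (rule inj_onI)
        fix P Q assume PQ: "P \<in> {P\<in>S. j P = j0}" "Q \<in> {P\<in>S. j P = j0}" "\<zeta> P = \<zeta> Q"
        have "uu P = uu Q \<and> vv P = vv Q" using \<zeta>[of P] \<zeta>[of Q] PQ by simp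
        moreover have "dd P = dd Q \<and> ee P = ee Q" using S_sol PQ by simp
        ultimately show "P = Q" by (intro point_eqI) auto
      qed
      hence "card {P\<in>S. j P = j0} = card (\<zeta> ` {P\<in>S. j P = j0})" by (simp add: card_image)
      also have "real \<dots> \<le> 2 * \<bar>of_int h\<bar> + 1"
      proof (rule card_int_interval_le(2))
        fix z assume "z \<in> \<zeta> ` {P\<in>S. j P = j0}"
        then obtain P where P: "P \<in> S" "j P = j0" "z = \<zeta> P" by auto
        note sP = sol[OF S_sol(1)[OF P(1)]] and s2 = sol[OF S_sol(1)[OF P2(1)]]
        have "real_of_int (uu P) = real_of_int (uu P2) + of_int z * of_int u'" using \<zeta>[OF P(1,2)] P(3) by simp
        hence "\<bar>real_of_int z * of_int u'\<bar> \<le> U" using sP s2 by linarith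
        also have "U \<le> of_int u1" using s1 by (simp add: u1_def)
        also have "real_of_int u1 = of_int g * of_int u'" unfolding uv' by simp
        also have "\<dots> \<le> of_int \<bar>h\<bar> * of_int u'" using gh u'0 by (intro mult_right_mono) (simp_all only: of_int_le_iff of_int_0_le_iff)
        finally have "\<bar>real_of_int z\<bar> * of_int u' \<le> \<bar>of_int h\<bar> * of_int u'" using u'0 by (simp add: abs_mult)
        thus "\<bar>real_of_int z\<bar> \<le> \<bar>of_int h\<bar>" using u'0 by simp
      qed simp
      finally show ?thesis .
    qed
    have "S = (\<Union>j0\<in>j ` S. {P\<in>S. j P = j0})" by auto
    hence "card S \<le> (\<Sum>j0\<in>j ` S. card {P\<in>S. j P = j0})"
      using card_UN_le[of "j ` S" "\<lambda>j0. {P\<in>S. j P = j0}"] finS by simp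
    hence "real (card S) \<le> real (\<Sum>j0\<in>j ` S. card {P\<in>S. j P = j0})" by (simp only: of_nat_le_iff)
    also have "\<dots> \<le> (\<Sum>j0\<in>j ` S. 2 * \<bar>of_int h\<bar> + 1)" unfolding of_nat_sum by (rule sum_mono[OF card_fibre])
    also have "\<dots> = real (card (j ` S)) * (2 * \<bar>of_int h\<bar> + 1)" by simp
    also have "\<dots> \<le> (2 * J + 1) * (2 * \<bar>of_int h\<bar> + 1)"
      using jb J0 by (intro mult_right_mono card_int_interval_le(2)) auto
    finally show ?thesis by (simp add: S_def J_def)
  qed
qed

text \<open>For a fixed ratio d / e the pair (d, e) is determined by its gcd, which divides h and so
  takes at most |h| values; K bounds the points over one pair.\<close>

lemma fibres_le_solutions:
  assumes k: "k \<ge> 1" and l: "l \<ge> 1" and h: "h \<noteq> 0" and pos: "D > 0" "E > 0" "U > 0" "V > 0"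
    and x: "E ^ k * V ^ l = x" and UV: "U * V \<le> c * x" and c: "c > 0"
  defines "K \<equiv> nat \<lfloor>(2 * (\<bar>of_int h\<bar> * 2 ^ l * c) + 1) * (2 * \<bar>of_int h\<bar> + 1)\<rfloor>"
  shows "fibres_le (K * nat \<bar>h\<bar>) (solutions k l h D E U V) dd ee"
    and "card {P\<in>solutions k l h D E U V. dd P = d0 \<and> ee P = e0} \<le> K"
proof -
  have Kle: "card {P\<in>solutions k l h D E U V. dd P = d0 \<and> ee P = e0} \<le> K" for d0 e0
    unfolding K_def using card_given_d_e[OF l h pos x UV c, of d0 e0] by (simp add: le_nat_floor)
  thus "card {P\<in>solutions k l h D E U V. dd P = d0 \<and> ee P = e0} \<le> K" .
  show "fibres_le (K * nat \<bar>h\<bar>) (solutions k l h D E U V) dd ee"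
    unfolding fibres_le_def
  proof (intro conjI ballI finite_solutions)
    show "ee P > 0" if "P \<in> solutions k l h D E U V" for P using solutionsD[OF that pos] by simp
    fix P0 assume P0: "P0 \<in> solutions k l h D E U V"
    define T where "T = {P\<in>solutions k l h D E U V. dd P * ee P0 = dd P0 * ee P}"
    have finT: "finite T" using finite_solutions by (simp add: T_def)
    define G where "G P = gcd (dd P) (ee P)" for P
    have "G ` T \<subseteq> {1..\<bar>h\<bar>}"
    proof
      fix g assume "g \<in> G ` T"
      then obtain P where P: "P \<in> solutions k l h D E U V" "g = gcd (dd P) (ee P)" by (auto simp: G_def T_def)
      note sP = solutionsD[OF P(1) pos]
      have "g dvd ee P ^ k" "g dvd dd P ^ k" unfolding P(2) using k by (auto intro: dvd_trans[OF _ dvd_power])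
      hence "g dvd h" using sP(13) by (metis dvd_diff dvd_mult2)
      hence "g \<le> \<bar>h\<bar>" using h by (intro zdvd_imp_le) auto
      moreover have "g > 0" unfolding P(2) using sP by simp
      ultimately show "g \<in> {1..\<bar>h\<bar>}" by auto
    qed
    hence "card (G ` T) \<le> card {1..\<bar>h\<bar>}" by (intro card_mono) auto
    hence GT: "card (G ` T) \<le> nat \<bar>h\<bar>" by simp
    have "card T \<le> K * card (G ` T)"
    proof (rule card_le_mult_card_image[OF finT])
      fix g assume "g \<in> G ` T"
      then obtain P1 where P1: "P1 \<in> T" "G P1 = g" by auto
      have "{P\<in>T. G P = g} \<subseteq> {P\<in>solutions k l h D E U V. dd P = dd P1 \<and> ee P = ee P1}"
      proof
        fix P assume P: "P \<in> {P\<in>T. G P = g}"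
        have pp: "dd P > 0" "ee P > 0" "dd P1 > 0" "ee P1 > 0" "dd P0 > 0" "ee P0 > 0"
        proof -
          have "P \<in> solutions k l h D E U V" "P1 \<in> solutions k l h D E U V" using P P1 by (simp_all add: T_def)
          thus "dd P > 0" "ee P > 0" "dd P1 > 0" "ee P1 > 0" "dd P0 > 0" "ee P0 > 0"
            using P0 by (simp_all only: solutionsD(1,2)[OF _ pos])
        qed
        have "dd P * ee P0 = dd P0 * ee P" "dd P1 * ee P0 = dd P0 * ee P1" using P P1 by (auto simp: T_def)
        hence "(dd P * ee P1) * ee P0 = (dd P1 * ee P) * ee P0"
          by (metis mult.assoc mult.commute)
        hence eq: "dd P * ee P1 = dd P1 * ee P" using pp by simp
        have "ee P1 * gcd (dd P) (ee P) = gcd (ee P1 * dd P) (ee P1 * ee P)"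
          using gcd_mult_distrib_int[of "ee P1" "dd P" "ee P"] pp by simp
        also have "\<dots> = gcd (ee P * dd P1) (ee P * ee P1)" using eq by (simp only: mult.commute)
        also have "\<dots> = ee P * gcd (dd P1) (ee P1)"
          using gcd_mult_distrib_int[of "ee P" "dd P1" "ee P1"] pp by simp
        finally have "ee P1 * g = ee P * g" using P P1 by (simp add: G_def)
        moreover have "g > 0" using P1(2) pp by (auto simp: G_def)
        ultimately have "ee P = ee P1" by simp
        thus "P \<in> {P\<in>solutions k l h D E U V. dd P = dd P1 \<and> ee P = ee P1}" using eq pp P by (auto simp: T_def)
      qed
      hence "card {P\<in>T. G P = g} \<le> card {P\<in>solutions k l h D E U V. dd P = dd P1 \<and> ee P = ee P1}"
        using finite_solutions by (intro card_mono) auto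
      also have "\<dots> \<le> K" by (rule Kle)
      finally show "card {P\<in>T. G P = g} \<le> K" .
    qed
    also have "\<dots> \<le> K * nat \<bar>h\<bar>" using GT by (intro mult_left_mono) auto
    finally show "card {P\<in>solutions k l h D E U V. dd P * ee P0 = dd P0 * ee P} \<le> K * nat \<bar>h\<bar>" by (simp add: T_def)
  qed
qed

lemma quotient_minus_one_eq:
  fixes A B C W z y :: real
  assumes "A > 0" "B > 0" "C > 0" "B * W = y + A * C" "A / B * z = W / C"
  shows "z - 1 = y / (A * C)"
proof -
  have "A * z * C = B * W" using assms(1-3,5) by (simp add: field_simps)
  hence "z * (A * C) = y + A * C" using assms(4) by (simp add: mult_ac)
  hence "z = (y + A * C) / (A * C)" using assms(1,3) by (simp add: eq_divide_eq)
  thus ?thesis using assms(1,3) by (simp add: add_divide_distrib)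
qed

text \<open>The points take the shape of \<open>approx_det_bound\<close> with y = (d / e)^(1/l).
  Here \<sigma> measures y against the l-th root of the left end s1 and is at most \<eta>, while
  \<omega> measures v / u against y^k and is at most |h| / x, because (1 + \<omega>)^l - 1 = h /
  (d^k u^l). The hypothesis \<open>small\<close> says that the square of each integer determinant is
  below 1.\<close>

lemma interval_on_form:
  fixes h :: int
  assumes k: "k \<ge> 1" and l: "l \<ge> 1" and pos: "D > 0" "E > 0" "U > 0" "V > 0"
    and x: "D ^ k * U ^ l = x" "E ^ k * V ^ l = x" "x > \<bar>of_int h\<bar>" and h: "h \<noteq> 0"
    and s1: "s1 > 0" "s1 \<le> 2 * D / E" and \<eta>: "0 < \<eta>" "\<eta> < 1"
    and T: "T \<subseteq> solutions k l h D E U V"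
      "\<And>P. P \<in> T \<Longrightarrow> s1 \<le> of_int (dd P) / of_int (ee P) \<and> of_int (dd P) / of_int (ee P) \<le> s1 * (1 + \<eta>)"
    and small: "(real (card ({..l * a + k * b} \<times> {..b})) ^ ((a + 1) * (b + 1)) * fact ((a + 1) * (b + 1)) *
        (2 ^ ((l * a + k * b) + b + a + b + a + k * b)) ^ ((a + 1) * (b + 1))) ^ 2 *
        ((D * E) ^ a * (U * V) ^ b) ^ ((a + 1) * (b + 1)) *
       exp (- 2 * (2 / 3 * real ((a + 1) * (b + 1)) * sqrt (2 * real ((a + 1) * (b + 1)) * (- ln \<eta>) * (- ln (\<bar>of_int h\<bar> / x)))
           - real ((a + 1) * (b + 1)) * (- ln \<eta> - ln (\<bar>of_int h\<bar> / x)))) < 1"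
  shows "on_form a b T dd ee uu vv"
proof -
  define n where "n = (a + 1) * (b + 1)"
  define \<tau>0 where "\<tau>0 = s1 powr (1 / l)"
  have x0: "x > 0" using x(1) pos by auto
  have root: "(y powr (1 / l)) ^ l = y" if "y > 0" for y :: real
    using that l by (simp add: powr_power)
  have \<tau>0: "\<tau>0 > 0" "\<tau>0 ^ l = s1" using s1 root by (auto simp: \<tau>0_def)
  \<comment> \<open>D^k U^l = E^k V^l means that (D / E, V / U) lies on the curve; the factor 2 in
    s1 <= 2 D / E costs at most 2^k.\<close>
  have \<tau>k: "\<tau>0 ^ k \<le> 2 ^ k * V / U"
  proof -
    have "(D / E) ^ k = (V / U) ^ l" using x pos by (simp add: power_divide field_simps)
    have "(\<tau>0 ^ k) ^ l = s1 ^ k" using \<tau>0(2) by (metis mult.commute power_mult)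
    also have "\<dots> \<le> (2 * (D / E)) ^ k" using s1 by (intro power_mono) auto
    also have "\<dots> = 2 ^ k * (V / U) ^ l" using \<open>(D / E) ^ k = (V / U) ^ l\<close> by (simp only: power_mult_distrib)
    also have "\<dots> \<le> (2 ^ k) ^ l * (V / U) ^ l"
    proof (rule mult_right_mono)
      have "((2 :: real) ^ k) ^ 1 \<le> (2 ^ k) ^ l" using l by (intro power_increasing) auto
      thus "(2 :: real) ^ k \<le> (2 ^ k) ^ l" by simp
    qed (use pos in auto)
    also have "\<dots> = (2 ^ k * V / U) ^ l" by (simp only: power_mult_distrib[symmetric] times_divide_eq_right)
    finally show ?thesis using pos l power_le_imp_le_base[of "\<tau>0 ^ k" "l - 1" "2 ^ k * V / U"] by simp
  qed
  have \<omega>0: "0 < \<bar>of_int h\<bar> / x" "\<bar>of_int h\<bar> / x < 1" using h x0 x(3) by auto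
  obtain \<phi> where \<phi>: "bij_betw \<phi> {0..<n} ({..a} \<times> {..b})" using ex_bij_pairs unfolding n_def by blast
  define H where "H = \<lceil>2 * (D + E + U + V)\<rceil> + 1"
  have H1: "H \<ge> 1" using pos by (simp add: H_def)
  note sol = solutionsD[OF subsetD[OF T(1)] pos]
  have bd: "0 \<le> dd P \<and> dd P \<le> H \<and> 0 \<le> ee P \<and> ee P \<le> H \<and> 0 \<le> uu P \<and> uu P \<le> H \<and> 0 \<le> vv P \<and> vv P \<le> H" if P: "P \<in> T" for P
  proof -
    have "y \<le> H" if "real_of_int y \<le> 2 * (D + E + U + V)" for y using that unfolding H_def by linarith
    thus ?thesis using sol[OF P] pos by auto
  qed
  define y where "y P = (of_int (dd P) / of_int (ee P)) powr (1 / l)" for P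
  define \<sigma> where "\<sigma> P = y P / \<tau>0 - 1" for P
  define \<omega> where "\<omega> P = (of_int (vv P) / of_int (uu P)) / y P ^ k - 1" for P
  have pt: "0 < ee P \<and> 0 < uu P \<and> of_int (ee P) \<le> 2 * E \<and> of_int (uu P) \<le> 2 * U \<and>
       of_int (dd P) = of_int (ee P) * (\<tau>0 * (1 + \<sigma> P)) ^ l \<and>
       of_int (vv P) = of_int (uu P) * ((\<tau>0 * (1 + \<sigma> P)) ^ k * (1 + \<omega> P)) \<and>
       \<bar>\<sigma> P\<bar> \<le> \<eta> \<and> \<bar>\<omega> P\<bar> \<le> \<bar>of_int h\<bar> / x" if P: "P \<in> T" for P
  proof -
    note sP = sol[OF P]
    define s where "s = real_of_int (dd P) / of_int (ee P)"
    define t where "t = real_of_int (vv P) / of_int (uu P)"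
    have st: "s > 0" "t > 0" using sP by (auto simp: s_def t_def)
    have yl: "y P ^ l = s" "y P > 0" using root[OF st(1)] st by (auto simp: y_def s_def)
    have ty: "\<tau>0 * (1 + \<sigma> P) = y P" using \<tau>0 by (simp add: \<sigma>_def field_simps)
    have d: "of_int (dd P) = of_int (ee P) * y P ^ l" using sP by (simp add: yl s_def)
    have wt: "y P ^ k * (1 + \<omega> P) = t" using yl by (simp add: \<omega>_def t_def)
    have v: "of_int (vv P) = of_int (uu P) * (y P ^ k * (1 + \<omega> P))" unfolding wt using sP by (simp add: t_def)
    have "\<bar>\<sigma> P\<bar> \<le> \<eta>"
    proof -
      have eq: "1 + \<sigma> P = y P / \<tau>0" by (simp add: \<sigma>_def)
      have "(1 + \<sigma> P) ^ l = s / s1" unfolding eq power_divide yl \<tau>0 ..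
      moreover have "1 \<le> s / s1" "s / s1 \<le> 1 + \<eta>" using T(2)[OF P] s1 by (auto simp: s_def[symmetric] field_simps)
      moreover have "0 \<le> 1 + \<sigma> P" unfolding eq using yl \<tau>0 by simp
      ultimately show ?thesis using power_root_bounds[of "1 + \<sigma> P" l] l by auto
    qed
    moreover have "\<bar>\<omega> P\<bar> \<le> \<bar>of_int h\<bar> / x"
    proof -
      have w0: "0 \<le> 1 + \<omega> P" using wt st yl by (metis less_imp_le zero_less_mult_pos zero_less_power)
      have "(y P ^ k) ^ l = s ^ k" using yl(1) by (metis mult.commute power_mult)
      hence "s ^ k * (1 + \<omega> P) ^ l = t ^ l" using wt by (metis power_mult_distrib)
      moreover have "real_of_int (ee P ^ k * vv P ^ l) = real_of_int (h + dd P ^ k * uu P ^ l)" using sP(13) by (simp add: algebra_simps)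
      hence "of_int (ee P) ^ k * real_of_int (vv P) ^ l = of_int h + of_int (dd P) ^ k * of_int (uu P) ^ l" by simp
      moreover have "s ^ k = of_int (dd P) ^ k / of_int (ee P) ^ k" "t ^ l = of_int (vv P) ^ l / of_int (uu P) ^ l"
        by (simp_all add: s_def t_def power_divide)
      ultimately have "(1 + \<omega> P) ^ l - 1 = of_int h / (of_int (dd P) ^ k * of_int (uu P) ^ l)"
        using sP(1-3) by (intro quotient_minus_one_eq[of _ "of_int (ee P) ^ k" _ "of_int (vv P) ^ l"]) auto
      hence "\<bar>\<omega> P\<bar> \<le> \<bar>of_int h / (of_int (dd P) ^ k * of_int (uu P) ^ l)\<bar>"
        using power_root_bounds[OF w0 l] by simp
      also have "\<dots> = \<bar>of_int h\<bar> / (of_int (dd P) ^ k * of_int (uu P) ^ l)" using sP(1,3) by (simp add: abs_divide abs_mult)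
      also have "\<dots> \<le> \<bar>of_int h\<bar> / x"
      proof (rule divide_left_mono)
        show "x \<le> of_int (dd P) ^ k * of_int (uu P) ^ l"
          unfolding x(1)[symmetric] using sP pos by (intro mult_mono power_mono) auto
      qed (use x0 sP in auto)
      finally show ?thesis .
    qed
    ultimately show ?thesis using sP d v unfolding ty by auto
  qed
  obtain c where "\<exists>i\<le>a. \<exists>j\<le>b. c i j \<noteq> 0" "\<And>P. P \<in> T \<Longrightarrow> form a b c (dd P) (ee P) (uu P) (vv P) = 0"
  proof (rule on_form_of_vanishing_dets[OF \<phi> H1 bd])
    fix \<rho> assume \<rho>: "\<rho> \<in> {0..<n} \<rightarrow> T"
    let ?D = "det (mat n n (\<lambda>(r, x). dd (\<rho> r) ^ fst (\<phi> x) * ee (\<rho> r) ^ (a - fst (\<phi> x)) * vv (\<rho> r) ^ snd (\<phi> x) * uu (\<rho> r) ^ (b - snd (\<phi> x))))"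
    have "real_of_int ?D ^ 2 \<le> (real (card ({..l * a + k * b} \<times> {..b})) ^ n * fact n * 
        (2 ^ ((l * a + k * b) + b + a + b + a + k * b)) ^ n) ^ 2 * ((D * E) ^ a * (U * V) ^ b) ^ n *
       exp (- 2 * (2 / 3 * real n * sqrt (2 * real n * (- ln \<eta>) * (- ln (\<bar>of_int h\<bar> / x))) - real n * (- ln \<eta> - ln (\<bar>of_int h\<bar> / x))))"
    proof (rule approx_det_bound[OF \<phi> pos \<eta> \<omega>0 \<tau>0(1), where \<sigma> = "\<lambda>r. \<sigma> (\<rho> r)" and \<omega> = "\<lambda>r. \<omega> (\<rho> r)"])
      show "\<tau>0 ^ l \<le> 2 * D / E" using \<tau>0 s1 by simp
      show "\<tau>0 ^ k \<le> 2 ^ k * V / U" by (rule \<tau>k)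
      fix r assume "r < n"
      hence "\<rho> r \<in> T" using \<rho> by auto
      from pt[OF this] show "0 < ee (\<rho> r) \<and> 0 < uu (\<rho> r) \<and> of_int (ee (\<rho> r)) \<le> 2 * E \<and> of_int (uu (\<rho> r)) \<le> 2 * U \<and>
       of_int (dd (\<rho> r)) = of_int (ee (\<rho> r)) * (\<tau>0 * (1 + \<sigma> (\<rho> r))) ^ l \<and>
       of_int (vv (\<rho> r)) = of_int (uu (\<rho> r)) * ((\<tau>0 * (1 + \<sigma> (\<rho> r))) ^ k * (1 + \<omega> (\<rho> r))) \<and>
       \<bar>\<sigma> (\<rho> r)\<bar> \<le> \<eta> \<and> \<bar>\<omega> (\<rho> r)\<bar> \<le> \<bar>of_int h\<bar> / x" .
    qed
    also have "\<dots> < 1" using small unfolding n_def .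
    finally have "real_of_int (?D ^ 2) < real_of_int 1" by simp
    hence "?D ^ 2 < 1" by (simp only: of_int_less_iff)
    moreover have "?D ^ 2 \<ge> 1" if "?D \<noteq> 0" using that by (simp add: int_one_le_iff_zero_less)
    ultimately show "?D = 0" by fastforce
  qed blast+
  thus ?thesis unfolding on_form_def by blast
qed

text \<open>With \<open>a / b\<close> close to \<open>\<U> / \<D>\<close> and \<open>n = (a + 1) * (b + 1)\<close> large, the size \<open>a * \<D> + b * \<U>\<close> of the
  determinant and the gain \<open>4 / 3 * sqrt (2 * n * X * L)\<close> agree to leading order exactly when
  \<open>X = 9 / 8 * \<D> * \<U> / L\<close>; this is the source of the constant in the definition of \<open>M\<close>.\<close>

lemma choose_bidegree:
  fixes q :: "nat \<Rightarrow> nat \<Rightarrow> real" and c1 c2 \<delta> lh :: real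
  assumes c: "c1 > 0" "c2 > 0" and \<delta>: "\<delta> > 0" and lh: "lh \<ge> 0" and q: "\<And>a b. q a b \<ge> 1"
  obtains B0 L0 where "L0 > 0" "L0 > lh"
    "\<And>L \<D> \<U>. L \<ge> L0 \<Longrightarrow> c1 * L \<le> \<D> \<Longrightarrow> \<D> \<le> c2 * L \<Longrightarrow> c1 * L \<le> \<U> \<Longrightarrow> \<U> \<le> c2 * L \<Longrightarrow>
      \<exists>a\<le>B0. \<exists>b\<le>B0. 2 * ln (q a b) + real ((a + 1) * (b + 1)) * (a * \<D> + b * \<U>)
        - 2 * (2 / 3 * real ((a + 1) * (b + 1)) * sqrt (2 * real ((a + 1) * (b + 1)) * (9 / 8 * (\<D> * \<U> / L) + \<delta> * L) * (L - lh))
               - real ((a + 1) * (b + 1)) * ((9 / 8 * (\<D> * \<U> / L) + \<delta> * L) + (L - lh))) < 0"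
proof -
  \<comment> \<open>The slack that \<delta> buys. With \<gamma> = \<alpha> \<beta> >= c1^2 >=
    \<kappa> one has (\<gamma> + \<kappa>)^2 <= \<gamma>^2 + 3 \<gamma> \<kappa> <= \<gamma>^2 + 8/9
    \<gamma> \<delta>, so the gain exceeds the main term 2 N \<gamma> L by about 2 N \<kappa>
    L.\<close>
  define \<kappa> where "\<kappa> = min (c1 ^ 2) (8 / 27 * \<delta>)"
  have \<kappa>: "\<kappa> > 0" "\<kappa> \<le> c1 ^ 2" "\<kappa> \<le> 8 / 27 * \<delta>" using c \<delta> by (auto simp: \<kappa>_def)
  \<comment> \<open>The lower-order terms per unit of L: 2 c2 from rounding a and b up, 9/4 c2^2 + 2
    \<delta> from 2 X, and 2 from 2 (L - lh). N is chosen so that the slack 2 N \<kappa> exceeds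
    them by 1.\<close>
  define M0 where "M0 = 2 * c2 + 9 / 4 * c2 ^ 2 + 2 * \<delta> + 2"
  define N where "N = (M0 + 1) / (2 * \<kappa>)"
  have M0: "M0 > 0" using c \<delta> zero_le_power2[of c2] unfolding M0_def by linarith
  have N: "N > 0" "2 * N * \<kappa> = M0 + 1" using M0 \<kappa> by (auto simp: N_def)
  define B0 where "B0 = nat \<lceil>N * c2\<rceil>"
  define Q where "Q = Max ((\<lambda>(a, b). q a b) ` ({..B0} \<times> {..B0}))"
  have Q: "q a b \<le> Q" if "a \<le> B0" "b \<le> B0" for a b
    unfolding Q_def using that by (intro Max_ge) (auto intro!: image_eqI[of _ _ "(a, b)"])
  have Q1: "Q \<ge> 1" using q[of 0 0] Q[of 0 0] by simp
  define L0 where "L0 = 2 * ln Q + 2 * N * (c2 ^ 2 + \<kappa>) * lh + lh + 1"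
  have tN: "2 * N * (c2 ^ 2 + \<kappa>) * lh \<ge> 0" using N \<kappa> lh by simp
  have lnQ: "ln Q \<ge> 0" using Q1 by simp
  show ?thesis
  proof (rule that[of L0 B0])
    show "L0 > 0" "L0 > lh" using tN lnQ lh unfolding L0_def by linarith+
    fix L \<D> \<U> assume L: "L \<ge> L0" and D: "c1 * L \<le> \<D>" "\<D> \<le> c2 * L" "c1 * L \<le> \<U>" "\<U> \<le> c2 * L"
    have Lpos: "L > 0" and Y: "L - lh > 0" "L - lh \<le> L" using L tN lnQ lh unfolding L0_def by linarith+
    define \<alpha> where "\<alpha> = \<D> / L"
    define \<beta> where "\<beta> = \<U> / L"
    define \<gamma> where "\<gamma> = \<alpha> * \<beta>"
    have ab: "c1 \<le> \<alpha>" "\<alpha> \<le> c2" "c1 \<le> \<beta>" "\<beta> \<le> c2" using D Lpos by (simp_all add: \<alpha>_def \<beta>_def pos_le_divide_eq pos_divide_le_eq)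
    have DU: "\<D> = \<alpha> * L" "\<U> = \<beta> * L" using Lpos by (auto simp: \<alpha>_def \<beta>_def)
    have \<gamma>: "c1 ^ 2 \<le> \<gamma>" "\<gamma> \<le> c2 ^ 2" unfolding \<gamma>_def power2_eq_square by (intro mult_mono; use ab c in linarith)+
    have \<gamma>0: "\<gamma> > 0" using \<gamma>(1) c by (meson less_le_trans zero_less_power)
    define a where "a = nat \<lceil>N * \<beta>\<rceil>"
    define b where "b = nat \<lceil>N * \<alpha>\<rceil>"
    have "N * \<beta> \<ge> 0" "N * \<alpha> \<ge> 0" using N ab c by auto
    hence ra: "N * \<beta> \<le> real a" "real a \<le> N * \<beta> + 1" "N * \<alpha> \<le> real b" "real b \<le> N * \<alpha> + 1"
      unfolding a_def b_def by linarith+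
    have "N * \<beta> \<le> N * c2" "N * \<alpha> \<le> N * c2" using ab N by simp_all
    note this[THEN ceiling_mono, THEN nat_mono]
    hence le: "a \<le> B0" "b \<le> B0" unfolding a_def b_def B0_def by blast+
    define n where "n = (a + 1) * (b + 1)"
    define X where "X = 9 / 8 * (\<D> * \<U> / L) + \<delta> * L"
    have X: "X = (9 / 8 * \<gamma> + \<delta>) * L" unfolding X_def DU \<gamma>_def using Lpos by (simp add: algebra_simps)
    have X0: "X > 0" unfolding X using \<gamma>0 \<delta> Lpos by simp
    have n1: "real n \<ge> 1" by (simp add: n_def)
    have nge: "N ^ 2 * \<gamma> \<le> real n"
    proof -
      have "N ^ 2 * \<gamma> = (N * \<beta>) * (N * \<alpha>)" by (simp add: \<gamma>_def power2_eq_square)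
      also have "\<dots> \<le> (real a + 1) * (real b + 1)" using ra \<open>N * \<beta> \<ge> 0\<close> \<open>N * \<alpha> \<ge> 0\<close> by (intro mult_mono) auto
      finally show ?thesis by (simp add: n_def algebra_simps)
    qed
    have aux: "a * (g ^ 2 + 8 / 9 * g * d) * (L * Y) = 8 / 9 * (a * g * ((9 / 8 * g + d) * L * Y))" for a g d Y :: real
      by (simp add: field_simps power2_eq_square)
    have aux2: "(3 / 2 * (N * g * Y)) ^ 2 = 9 / 4 * (N ^ 2 * g ^ 2 * Y ^ 2)" for g Y :: real by (simp add: power2_eq_square)
    have lin: "9 / 4 * t \<le> 2 * real n * X * Y" if "t \<le> 8 / 9 * (real n * (X * Y))" for t Y :: real using that by simp
    have sq: "4 / 3 * sqrt (2 * real n * X * (L - lh)) \<ge> 2 * N * (\<gamma> + \<kappa>) * (L - lh)"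
    proof -
      have "(\<gamma> + \<kappa>) ^ 2 \<le> \<gamma> ^ 2 + 8 / 9 * \<gamma> * \<delta>"
      proof -
        have "\<kappa> ^ 2 \<le> \<gamma> * \<kappa>" unfolding power2_eq_square using \<kappa> \<gamma> by (intro mult_right_mono) auto
        moreover have "\<gamma> * \<kappa> \<le> \<gamma> * (8 / 27 * \<delta>)" using \<kappa> \<gamma>0 by (intro mult_left_mono) auto
        ultimately show ?thesis by (simp add: power2_eq_square algebra_simps)
      qed
      hence "(N ^ 2 * (\<gamma> + \<kappa>) ^ 2) * (L - lh) ^ 2 \<le> (N ^ 2 * (\<gamma> ^ 2 + 8 / 9 * \<gamma> * \<delta>)) * (L * (L - lh))"
        unfolding power2_eq_square[of "L - lh"] using Y Lpos \<gamma>0 \<delta>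
        by (intro mult_mono[OF mult_left_mono mult_right_mono]) simp_all
      also have "\<dots> = 8 / 9 * ((N ^ 2 * \<gamma>) * (X * (L - lh)))" unfolding X by (rule aux)
      also have "\<dots> \<le> 8 / 9 * (real n * (X * (L - lh)))" 
      proof (rule mult_left_mono)
        show "N ^ 2 * \<gamma> * (X * (L - lh)) \<le> real n * (X * (L - lh))"
          by (rule mult_right_mono[OF nge]) (use X0 Y in simp)
      qed simp
      finally have "(3 / 2 * (N * (\<gamma> + \<kappa>) * (L - lh))) ^ 2 \<le> 2 * real n * X * (L - lh)"
        unfolding aux2 by (rule lin)
      hence "3 / 2 * (N * (\<gamma> + \<kappa>) * (L - lh)) \<le> sqrt (2 * real n * X * (L - lh))" by (rule real_le_rsqrt)
      hence "2 * (N * (\<gamma> + \<kappa>) * (L - lh)) \<le> 4 / 3 * sqrt (2 * real n * X * (L - lh))" by linarith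
      thus ?thesis by (simp only: mult.assoc)
    qed
    have gen: "p = 2 * a + 2 * b + 2 * y \<Longrightarrow> q = 2 * a' + 2 * b + 2 * L \<Longrightarrow> y \<le> L \<Longrightarrow> a \<le> a' \<Longrightarrow> p \<le> q"
      for p q a a' b y :: real by linarith
    have main: "2 * ln Q + (a * \<D> + b * \<U>) + 2 * (X + (L - lh)) < 4 / 3 * sqrt (2 * real n * X * (L - lh))"
    proof -
      have "a * \<D> \<le> (N * \<beta> + 1) * \<D>" "b * \<U> \<le> (N * \<alpha> + 1) * \<U>"
        unfolding DU by (rule mult_right_mono; use ra ab c Lpos in simp)+
      hence 1: "a * \<D> + b * \<U> \<le> 2 * N * \<gamma> * L + 2 * c2 * L"
        using D by (simp add: DU \<gamma>_def algebra_simps)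
      have "9 / 8 * \<gamma> * L \<le> 9 / 8 * c2 ^ 2 * L" using \<gamma> Lpos by simp
      hence 2: "2 * (X + (L - lh)) \<le> (9 / 4 * c2 ^ 2 + 2 * \<delta> + 2) * L"
      proof -
        have "2 * (X + (L - lh)) = 2 * (9 / 8 * \<gamma> * L) + 2 * (\<delta> * L) + 2 * (L - lh)" unfolding X by (simp add: field_simps)
        moreover have "(9 / 4 * c2 ^ 2 + 2 * \<delta> + 2) * L = 2 * (9 / 8 * c2 ^ 2 * L) + 2 * (\<delta> * L) + 2 * L" by (simp add: field_simps)
        ultimately show ?thesis using Y(2) \<open>9 / 8 * \<gamma> * L \<le> 9 / 8 * c2 ^ 2 * L\<close> by (rule gen)
      qed
      have 3: "2 * N * (\<gamma> + \<kappa>) * lh \<le> 2 * N * (c2 ^ 2 + \<kappa>) * lh" using \<gamma> N lh by (intro mult_right_mono mult_left_mono) auto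
      have "2 * N * (\<gamma> + \<kappa>) * (L - lh) = 2 * N * \<gamma> * L + (2 * N * \<kappa>) * L - 2 * N * (\<gamma> + \<kappa>) * lh" by (simp add: algebra_simps)
      also have "\<dots> = 2 * N * \<gamma> * L + M0 * L + L - 2 * N * (\<gamma> + \<kappa>) * lh" unfolding N(2) by (simp add: algebra_simps)
      finally have 4: "2 * N * (\<gamma> + \<kappa>) * (L - lh) = 2 * N * \<gamma> * L + M0 * L + L - 2 * N * (\<gamma> + \<kappa>) * lh" .
      have 5: "M0 * L = 2 * c2 * L + (9 / 4 * c2 ^ 2 + 2 * \<delta> + 2) * L" by (simp add: M0_def algebra_simps)
      show ?thesis using 1 2 3 4 5 sq L lh unfolding L0_def by linarith
    qed
    have "2 * ln (q a b) \<le> 2 * ln Q" using Q[OF le] q[of a b] Q1 by simp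
    also have "\<dots> \<le> real n * (2 * ln Q)" using mult_right_mono[OF n1, of "2 * ln Q"] lnQ by simp
    finally have "2 * ln (q a b) + real n * (a * \<D> + b * \<U>) + real n * (2 * (X + (L - lh))) 
       \<le> real n * (2 * ln Q + (a * \<D> + b * \<U>) + 2 * (X + (L - lh)))" by (simp add: algebra_simps)
    also have "\<dots> < real n * (4 / 3 * sqrt (2 * real n * X * (L - lh)))" using main n1 by (intro mult_strict_left_mono) auto
    finally have "2 * ln (q a b) + real n * (a * \<D> + b * \<U>)
        - 2 * (2 / 3 * real n * sqrt (2 * real n * X * (L - lh)) - real n * (X + (L - lh))) < 0"
      by (simp add: algebra_simps)
    thus "\<exists>a\<le>B0. \<exists>b\<le>B0. 2 * ln (q a b) + real ((a + 1) * (b + 1)) * (a * \<D> + b * \<U>)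
        - 2 * (2 / 3 * real ((a + 1) * (b + 1)) * sqrt (2 * real ((a + 1) * (b + 1)) * (9 / 8 * (\<D> * \<U> / L) + \<delta> * L) * (L - lh))
               - real ((a + 1) * (b + 1)) * ((9 / 8 * (\<D> * \<U> / L) + \<delta> * L) + (L - lh))) < 0"
      using le unfolding n_def X_def by blast
  qed
qed

section \<open>Short vectors for the strips\<close>

lemma harm_le: "n \<ge> 1 \<Longrightarrow> harm n \<le> 1 + ln (real n)"
proof -
  assume "n \<ge> 1"
  then obtain m where m: "n = Suc m" by (cases n) auto
  have "harm (Suc m) - ln (Suc m) \<le> harm (Suc 0) - ln (real (Suc 0))"
    using decseq_harm_diff_ln by (rule decseqD) simp
  thus ?thesis by (simp add: m harm_def)
qed

lemma sum_inverse_Suc_le: "(\<Sum>j\<le>n. 1 / (1 + real j)) \<le> 1 + ln (real (Suc n))"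
proof -
  have "(\<Sum>j\<le>n. 1 / (1 + real j)) = harm (Suc n)"
    unfolding harm_def by (rule sum.reindex_bij_witness[of _ "\<lambda>j. j - 1" Suc]) (auto simp: field_simps)
  thus ?thesis using harm_le[of "Suc n"] by simp
qed

text \<open>If m is z clamped to the range from 0 to n and rounded down, then |i - z| >= |i - m| -
  1, so the sum is comparable to a two-sided harmonic sum about m.\<close>

lemma sum_inverse_dist_le:
  fixes z :: real
  shows "(\<Sum>i\<le>n. 1 / max 1 \<bar>real i - z\<bar>) \<le> 6 * (1 + ln (real (Suc n)))"
proof -
  define m where "m = nat \<lfloor>max 0 (min z n)\<rfloor>"
  have m: "m \<le> n" unfolding m_def by linarith
  let ?f = "\<lambda>i. 1 / (1 + \<bar>real i - real m\<bar>)"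
  have "1 / max 1 \<bar>real i - z\<bar> \<le> 3 * ?f i" if "i \<le> n" for i
  proof -
    have "\<bar>real i - real m\<bar> - 1 \<le> \<bar>real i - z\<bar>" using that unfolding m_def by linarith
    hence "1 + \<bar>real i - real m\<bar> \<le> 3 * max 1 \<bar>real i - z\<bar>"
      using max.cobounded1[of 1 "\<bar>real i - z\<bar>"] max.cobounded2[of "\<bar>real i - z\<bar>" 1] by linarith
    thus ?thesis by (simp add: field_simps)
  qed
  hence "(\<Sum>i\<le>n. 1 / max 1 \<bar>real i - z\<bar>) \<le> (\<Sum>i\<le>n. 3 * ?f i)" by (intro sum_mono) auto
  also have "\<dots> = 3 * ((\<Sum>i\<le>m. ?f i) + (\<Sum>i\<in>{m<..n}. ?f i))"
  proof -
    have "{..n} = {..m} \<union> {m<..n}" using m by auto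
    moreover have "(\<Sum>i\<in>{..m} \<union> {m<..n}. ?f i) = (\<Sum>i\<le>m. ?f i) + (\<Sum>i\<in>{m<..n}. ?f i)"
      by (rule sum.union_disjoint) auto
    ultimately have "(\<Sum>i\<le>n. ?f i) = (\<Sum>i\<le>m. ?f i) + (\<Sum>i\<in>{m<..n}. ?f i)" by (simp only:)
    thus ?thesis by (simp only: sum_distrib_left[symmetric])
  qed
  also have "(\<Sum>i\<le>m. ?f i) = (\<Sum>j\<le>m. 1 / (1 + real j))"
    by (rule sum.reindex_bij_witness[of _ "\<lambda>j. m - j" "\<lambda>j. m - j"]) (auto simp: of_nat_diff)
  also have "\<dots> \<le> (\<Sum>j\<le>n. 1 / (1 + real j))" using m by (intro sum_mono2) auto
  also have "(\<Sum>i\<in>{m<..n}. ?f i) = (\<Sum>j\<in>{0<..n - m}. 1 / (1 + real j))"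
    by (rule sum.reindex_bij_witness[of _ "\<lambda>j. m + j" "\<lambda>j. j - m"]) (auto simp: of_nat_diff)
  also have "\<dots> \<le> (\<Sum>j\<le>n. 1 / (1 + real j))" using m by (intro sum_mono2) auto
  finally show ?thesis using sum_inverse_Suc_le[of n] by simp
qed

text \<open>With N about sqrt (Y0 / X0), Dirichlet's q <= N and |p - s q| < 1 / N bound the two
  gauges q / Y0 and |p - s q| / X0 by the same order 1 / sqrt (X0 Y0).\<close>

lemma ex_short_vector:
  fixes s X0 Y0 :: real
  assumes XY: "0 < X0" "X0 \<le> Y0" and N: "N = nat \<lfloor>sqrt (Y0 / X0)\<rfloor>"
  shows "\<exists>p q. coprime p q \<and> 0 < q \<and> q \<le> int N \<and> \<bar>of_int p - s * of_int q\<bar> \<le> 1 \<and>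
     max (\<bar>of_int p - s * of_int q\<bar> / X0) (of_int q / Y0) * sqrt (X0 * Y0) \<le> 2"
proof -
  define R where "R = sqrt (Y0 / X0)"
  have R1: "R \<ge> 1" using XY by (simp add: R_def)
  hence "N \<ge> 1" unfolding N R_def[symmetric] by (simp add: le_nat_floor)
  moreover have "real N \<le> R" "R \<le> real N + 1" unfolding N R_def[symmetric] using R1 by linarith+
  ultimately have R: "R \<ge> 1" "real N \<le> R" "R \<le> 2 * real N" "N \<ge> 1" using R1 by auto
  have e: "sqrt (X0 * Y0) = X0 * R" "sqrt (X0 * Y0) = Y0 / R"
    using XY by (simp_all add: R_def real_sqrt_mult real_sqrt_divide field_simps)
  obtain p q where pq: "coprime p q" "0 < q" "q \<le> int N" "\<bar>of_int q * s - of_int p\<bar> < 1 / N"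
    using Dirichlet_approx_coprime[of N s] R by auto
  have "\<bar>of_int p - s * of_int q\<bar> = \<bar>of_int q * s - of_int p\<bar>" by (simp add: abs_minus_commute mult.commute)
  hence b: "\<bar>of_int p - s * of_int q\<bar> \<le> 1 / N" using pq by simp
  have "\<bar>of_int p - s * of_int q\<bar> / X0 * sqrt (X0 * Y0) = \<bar>of_int p - s * of_int q\<bar> * R" using XY by (simp add: e(1))
  also have "\<dots> \<le> 1 / N * (2 * real N)" using b R by (intro mult_mono) auto
  also have "\<dots> = 2" using R by simp
  finally have 1: "\<bar>of_int p - s * of_int q\<bar> / X0 * sqrt (X0 * Y0) \<le> 2" .
  have "of_int q / Y0 * sqrt (X0 * Y0) = of_int q / R" using XY by (simp add: e(2))
  also have "\<dots> \<le> 2"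
  proof -
    have "real_of_int q \<le> real_of_int (int N)" using pq(3) by (simp only: of_int_le_iff)
    hence "of_int q \<le> R" using R by simp
    thus ?thesis using R by (simp add: field_simps)
  qed
  finally have 2: "of_int q / Y0 * sqrt (X0 * Y0) \<le> 2" .
  have "1 / real N \<le> 1" using R by simp
  with b have "\<bar>of_int p - s * of_int q\<bar> \<le> 1" by linarith
  with 1 2 pq show ?thesis by (intro exI[of _ p] exI[of _ q]) (auto simp: max_def)
qed

text \<open>A fraction p / q gives a small gauge only in strips whose slope s i is near p / q, so 1
  / \<rho> cannot be large too often. Summing over all q <= N and the O(D q / E + 1) numerators
  belonging to q gives a logarithm times D N + E log N, and D N is at most sqrt (2 D E /
  \<eta>).\<close>

lemma short_vectors_sum:
  fixes D E \<eta> :: real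
  defines "n \<equiv> nat \<lceil>3 / \<eta>\<rceil>"
  assumes pos: "D > 0" "E > 0" and \<eta>: "0 < \<eta>" "\<eta> \<le> 1"
  obtains \<rho> where
    "\<And>i. i \<le> n \<Longrightarrow> \<rho> i > 0 \<and> \<rho> i * sqrt ((D * \<eta>) * (2 * E)) \<le> 2 \<and>
      (\<exists>g1 g2. coprime g1 g2 \<and> \<bar>of_int g1 - D / (2 * E) * (1 + real i * \<eta>) * of_int g2\<bar> \<le> \<rho> i * (D * \<eta>) \<and>
        \<bar>of_int g2\<bar> \<le> \<rho> i * (2 * E) \<and>
        (\<bar>of_int g1 - D / (2 * E) * (1 + real i * \<eta>) * of_int g2\<bar> = \<rho> i * (D * \<eta>) \<or> \<bar>of_int g2\<bar> = \<rho> i * (2 * E)))"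
    "(\<Sum>i\<le>n. 1 / \<rho> i) \<le> 5 * D + 6 * (1 + ln (real (Suc n))) *
       (5 * sqrt (2 * D * E / \<eta>) + 6 * E * (1 + ln (1 + 2 * E / (D * \<eta>))))"
proof -
  define s where "s i = D / (2 * E) * (1 + real i * \<eta>)" for i :: nat
  define X0 where "X0 = D * \<eta>"
  define Y0 where "Y0 = 2 * E"
  have XY: "X0 > 0" "Y0 > 0" using pos \<eta> by (auto simp: X0_def Y0_def)
  have n\<eta>: "real n * \<eta> \<le> 3 + \<eta>"
  proof -
    have "real n \<le> 3 / \<eta> + 1" unfolding n_def using \<eta> by simp
    hence "real n * \<eta> \<le> (3 / \<eta> + 1) * \<eta>" using \<eta> by (intro mult_right_mono) auto
    also have "\<dots> = 3 + \<eta>" using \<eta> by (simp add: field_simps)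
    finally show ?thesis .
  qed
  define W where "W = 6 * (1 + ln (real (Suc n)))"
  have W: "W \<ge> 0" by (simp add: W_def)
  have lnY: "ln (1 + 2 * E / (D * \<eta>)) \<ge> 0" using pos \<eta> by simp
  have main: "\<exists>\<rho>. (\<forall>i\<le>n. \<rho> i > 0 \<and> \<rho> i * sqrt (X0 * Y0) \<le> 2 \<and>
      (\<exists>g1 g2. coprime g1 g2 \<and> \<bar>of_int g1 - s i * of_int g2\<bar> \<le> \<rho> i * X0 \<and> \<bar>of_int g2\<bar> \<le> \<rho> i * Y0 \<and>
        (\<bar>of_int g1 - s i * of_int g2\<bar> = \<rho> i * X0 \<or> \<bar>of_int g2\<bar> = \<rho> i * Y0))) \<and>
    (\<Sum>i\<le>n. 1 / \<rho> i) \<le> 5 * D + W * (5 * sqrt (2 * D * E / \<eta>) + 6 * E * (1 + ln (1 + 2 * E / (D * \<eta>))))"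
  proof (cases "X0 \<le> Y0")
    \<comment> \<open>If X0 > Y0, the vector (1, 0) with \<rho> = 1 / X0 serves every strip, and the
      n + 1 terms X0 = D \<eta> add up to at most 5 D.\<close>
    case False
    have R: "1 / X0 * sqrt (X0 * Y0) \<le> 2"
    proof -
      have "sqrt (X0 * Y0) \<le> sqrt (X0 ^ 2)" using False XY unfolding power2_eq_square by (intro real_sqrt_le_mono mult_left_mono) auto
      thus ?thesis using XY by (simp add: field_simps)
    qed
    have "(\<Sum>i\<le>n. 1 / (1 / X0)) = D * (real n * \<eta> + \<eta>)" by (simp add: X0_def algebra_simps)
    also have "\<dots> \<le> D * 5" using n\<eta> \<eta> pos by (intro mult_left_mono) auto
    also have "\<dots> \<le> 5 * D + W * (5 * sqrt (2 * D * E / \<eta>) + 6 * E * (1 + ln (1 + 2 * E / (D * \<eta>))))"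
      using W lnY pos \<eta> by simp
    finally have "(\<Sum>i\<le>n. 1 / (1 / X0)) \<le> 5 * D + W * (5 * sqrt (2 * D * E / \<eta>) + 6 * E * (1 + ln (1 + 2 * E / (D * \<eta>))))" .
    moreover have "\<exists>g1 g2. coprime g1 g2 \<and> \<bar>of_int g1 - s i * of_int g2\<bar> \<le> 1 / X0 * X0 \<and> \<bar>of_int g2\<bar> \<le> 1 / X0 * Y0 \<and>
        (\<bar>of_int g1 - s i * of_int g2\<bar> = 1 / X0 * X0 \<or> \<bar>of_int g2\<bar> = 1 / X0 * Y0)" for i
      by (rule exI[of _ 1], rule exI[of _ 0]) (use XY in auto)
    moreover have "1 / X0 > 0" using XY by simp
    ultimately show ?thesis using R by (intro exI[of _ "\<lambda>_. 1 / X0"] conjI allI impI)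
  next
    case True
    define N where "N = nat \<lfloor>sqrt (Y0 / X0)\<rfloor>"
    have N1: "N \<ge> 1" unfolding N_def using True XY by (simp add: le_nat_floor)
    have NR: "real N \<le> sqrt (Y0 / X0)" unfolding N_def using XY by simp
    have "\<forall>i. \<exists>pq. coprime (fst pq) (snd pq) \<and> 0 < snd pq \<and> snd pq \<le> int N \<and> \<bar>of_int (fst pq) - s i * of_int (snd pq)\<bar> \<le> 1 \<and>
       max (\<bar>of_int (fst pq) - s i * of_int (snd pq)\<bar> / X0) (of_int (snd pq) / Y0) * sqrt (X0 * Y0) \<le> 2"
      using ex_short_vector[OF XY(1) True N_def] by simp
    from choice[OF this] obtain g where g: "\<And>i. coprime (fst (g i)) (snd (g i)) \<and> 0 < snd (g i) \<and> snd (g i) \<le> int N \<and> \<bar>of_int (fst (g i)) - s i * of_int (snd (g i))\<bar> \<le> 1 \<and>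
       max (\<bar>of_int (fst (g i)) - s i * of_int (snd (g i))\<bar> / X0) (of_int (snd (g i)) / Y0) * sqrt (X0 * Y0) \<le> 2"
      by blast
    define \<rho> where "\<rho> i = max (\<bar>of_int (fst (g i)) - s i * of_int (snd (g i))\<bar> / X0) (of_int (snd (g i)) / Y0)" for i
    have \<rho>0: "\<rho> i > 0" for i
    proof -
      have "0 < of_int (snd (g i)) / Y0" using g[of i] XY by simp
      thus ?thesis unfolding \<rho>_def by linarith
    qed
    \<comment> \<open>The real index i at which s i equals p / q. The gauge of (p, q) in strip i is
      q / Y0 times the distance from i to this index, or q / Y0 if that distance is below 1.\<close>
    define z where "z p q = (2 * E * of_int p / (D * of_int q) - 1) / \<eta>" for p q :: int
    have \<rho>z: "1 / \<rho> i = Y0 / of_int (snd (g i)) * (1 / max 1 \<bar>real i - z (fst (g i)) (snd (g i))\<bar>)" for i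
    proof -
      obtain p q where pq: "g i = (p, q)" by force
      have q: "q > 0" using g[of i] pq by simp
      have "(of_int p - s i * of_int q) / X0 = of_int q / Y0 * (z p q - real i)"
        using q pos \<eta> by (simp add: s_def X0_def Y0_def z_def field_simps)
      hence "\<bar>(of_int p - s i * of_int q) / X0\<bar> = \<bar>of_int q / Y0 * (z p q - real i)\<bar>" by simp
      hence "\<bar>of_int p - s i * of_int q\<bar> / X0 = of_int q / Y0 * \<bar>real i - z p q\<bar>"
        using XY q by (simp add: abs_mult abs_minus_commute)
      hence "\<rho> i = max (of_int q / Y0 * \<bar>real i - z p q\<bar>) (of_int q / Y0 * 1)" by (simp add: \<rho>_def pq)
      also have "\<dots> = of_int q / Y0 * max 1 \<bar>real i - z p q\<bar>"
        using XY q by (simp add: max_mult_distrib_left max.commute)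
      finally show ?thesis by (simp add: pq)
    qed
    \<comment> \<open>All numerators that can occur with denominator q: s i lies between 0 and 5 D /
      (2 E), and |p - s i q| <= 1.\<close>
    define P where "P q = {-1..\<lfloor>5 / 2 * (D / E) * of_int q + 1\<rfloor>}" for q :: int
    define f where "f i p q = Y0 / of_int q * (1 / max 1 \<bar>real i - z p q\<bar>)" for i p q
    have f0: "f i p q \<ge> 0" if "q \<ge> 1" for i p q using that XY by (auto simp: f_def)
    have in_P: "fst (g i) \<in> P (snd (g i))" if "i \<le> n" for i
    proof -
      obtain p q where pq: "g i = (p, q)" by force
      have q: "q > 0" "\<bar>of_int p - s i * of_int q\<bar> \<le> 1" using g[of i] pq by auto
      have "real i * \<eta> \<le> real n * \<eta>" using that \<eta> by (intro mult_right_mono) auto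
      moreover have "0 \<le> real i * \<eta>" using \<eta> by simp
      ultimately have i4: "1 + real i * \<eta> \<le> 5" "0 \<le> 1 + real i * \<eta>" using n\<eta> \<eta> by linarith+
      have "s i \<le> D / (2 * E) * 5" unfolding s_def using i4 pos by (intro mult_left_mono) auto
      hence "s i * of_int q \<le> D / (2 * E) * 5 * of_int q" using q by (intro mult_right_mono) auto
      hence 1: "s i * of_int q \<le> 5 / 2 * (D / E) * of_int q" by simp
      have 2: "0 \<le> s i * of_int q" unfolding s_def using q pos i4 by simp
      have "of_int p \<le> 5 / 2 * (D / E) * of_int q + 1" "- 1 \<le> real_of_int p" using q(2) 1 2 by linarith+
      moreover from this(2) have "-1 \<le> p" by linarith
      ultimately show ?thesis unfolding P_def pq fst_conv snd_conv atLeastAtMost_iff le_floor_iff by blast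
    qed
    have cardP: "real (card {-1..\<lfloor>y + 1\<rfloor>}) \<le> y + 3" if "y \<ge> 0" for y :: real
      using that by (simp only: card_atLeastAtMost_int) linarith
    have sqD: "D * sqrt t = sqrt (D ^ 2 * t)" for t using pos by (simp add: real_sqrt_mult)
    have sqrt_le: "sqrt t \<le> t" if "t \<ge> 1" for t :: real using that by (intro real_le_lsqrt self_le_power) auto
    have "(\<Sum>i\<le>n. 1 / \<rho> i) \<le> (\<Sum>i\<le>n. \<Sum>q\<in>{1..int N}. \<Sum>p\<in>P q. f i p q)"
    proof (rule sum_mono)
      fix i assume "i \<in> {..n}"
      hence i: "i \<le> n" by simp
      have "1 / \<rho> i = f i (fst (g i)) (snd (g i))" by (simp only: \<rho>z f_def)
      also have "\<dots> \<le> (\<Sum>p\<in>P (snd (g i)). f i p (snd (g i)))"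
        using in_P[OF i] g[of i] by (intro member_le_sum f0) (auto simp: P_def)
      also have "\<dots> \<le> (\<Sum>q\<in>{1..int N}. \<Sum>p\<in>P q. f i p q)"
        using g[of i] by (intro member_le_sum[of "snd (g i)" _ "\<lambda>q. \<Sum>p\<in>P q. f i p q"] sum_nonneg f0) auto
      finally show "1 / \<rho> i \<le> (\<Sum>q\<in>{1..int N}. \<Sum>p\<in>P q. f i p q)" .
    qed
    also have "\<dots> = (\<Sum>q\<in>{1..int N}. \<Sum>p\<in>P q. \<Sum>i\<le>n. f i p q)"
      by (subst sum.swap) (rule sum.cong[OF refl], rule sum.swap)
    also have "\<dots> \<le> (\<Sum>q\<in>{1..int N}. W * (5 * D + 6 * E * (1 / of_int q)))"
    proof (rule sum_mono)
      fix q assume "q \<in> {1..int N}"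
      hence q: "q \<ge> 1" by simp
      have DEq: "5 / 2 * (D / E) * of_int q \<ge> 0" using pos q by simp
      have "(\<Sum>p\<in>P q. \<Sum>i\<le>n. f i p q) \<le> (\<Sum>p\<in>P q. Y0 / of_int q * W)"
      proof (rule sum_mono)
        fix p
        have "(\<Sum>i\<le>n. f i p q) = Y0 / of_int q * (\<Sum>i\<le>n. 1 / max 1 \<bar>real i - z p q\<bar>)" unfolding f_def sum_distrib_left ..
        also have "\<dots> \<le> Y0 / of_int q * W" unfolding W_def using XY q by (intro mult_left_mono sum_inverse_dist_le) auto
        finally show "(\<Sum>i\<le>n. f i p q) \<le> Y0 / of_int q * W" .
      qed
      also have "\<dots> = real (card (P q)) * (Y0 / of_int q * W)" by simp
      also have "\<dots> \<le> (5 / 2 * (D / E) * of_int q + 3) * (Y0 / of_int q * W)"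
      proof (rule mult_right_mono)
        show "real (card (P q)) \<le> 5 / 2 * (D / E) * of_int q + 3" unfolding P_def by (rule cardP[OF DEq])
      qed (use XY q W in auto)
      also have "\<dots> = W * (5 * D + 6 * E * (1 / of_int q))" using q pos by (simp add: Y0_def field_simps)
      finally show "(\<Sum>p\<in>P q. \<Sum>i\<le>n. f i p q) \<le> W * (5 * D + 6 * E * (1 / of_int q))" .
    qed
    also have "\<dots> = W * (5 * D * real N + 6 * E * (\<Sum>q\<in>{1..int N}. 1 / of_int q))"
      by (simp add: sum.distrib sum_distrib_left algebra_simps)
    also have "(\<Sum>q\<in>{1..int N}. 1 / real_of_int q) = harm N"
      unfolding harm_def by (rule sum.reindex_bij_witness[of _ int nat]) (auto simp: field_simps)
    also have "W * (5 * D * real N + 6 * E * harm N) \<le> W * (5 * sqrt (2 * D * E / \<eta>) + 6 * E * (1 + ln (1 + 2 * E / (D * \<eta>))))"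
    proof (intro mult_left_mono add_mono W)
      have "D * real N \<le> D * sqrt (Y0 / X0)" using NR pos by simp
      also have "\<dots> = sqrt (D ^ 2 * (Y0 / X0))" by (rule sqD)
      also have "D ^ 2 * (Y0 / X0) = 2 * D * E / \<eta>" using pos \<eta> by (simp add: X0_def Y0_def field_simps power2_eq_square)
      finally show "5 * D * real N \<le> 5 * sqrt (2 * D * E / \<eta>)" by simp
      have "real N \<le> 1 + Y0 / X0"
      proof -
        have "1 \<le> Y0 / X0" using True XY by simp
        from sqrt_le[OF this] show ?thesis using NR by linarith
      qed
      hence "ln (real N) \<le> ln (1 + 2 * E / (D * \<eta>))" using N1 unfolding X0_def Y0_def by simp
      thus "harm N \<le> 1 + ln (1 + 2 * E / (D * \<eta>))" using harm_le[OF N1] by simp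
    qed (use pos in auto)
    finally have "(\<Sum>i\<le>n. 1 / \<rho> i) \<le> 5 * D + W * (5 * sqrt (2 * D * E / \<eta>) + 6 * E * (1 + ln (1 + 2 * E / (D * \<eta>))))"
      using pos by simp
    moreover have "\<rho> i > 0 \<and> \<rho> i * sqrt (X0 * Y0) \<le> 2 \<and>
      (\<exists>g1 g2. coprime g1 g2 \<and> \<bar>of_int g1 - s i * of_int g2\<bar> \<le> \<rho> i * X0 \<and> \<bar>of_int g2\<bar> \<le> \<rho> i * Y0 \<and>
        (\<bar>of_int g1 - s i * of_int g2\<bar> = \<rho> i * X0 \<or> \<bar>of_int g2\<bar> = \<rho> i * Y0))" for i
    proof -
      obtain p q where pq: "g i = (p, q)" by force
      have q: "coprime p q" "q > 0" "\<rho> i * sqrt (X0 * Y0) \<le> 2" using g[of i] pq by (auto simp: \<rho>_def)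
      have r: "\<rho> i = max (\<bar>of_int p - s i * of_int q\<bar> / X0) (of_int q / Y0)" by (simp add: \<rho>_def pq)
      have "\<bar>of_int p - s i * of_int q\<bar> / X0 \<le> \<rho> i" "of_int q / Y0 \<le> \<rho> i"
        "\<rho> i = \<bar>of_int p - s i * of_int q\<bar> / X0 \<or> \<rho> i = of_int q / Y0"
        unfolding r by (auto simp: max_def)
      hence "\<bar>of_int p - s i * of_int q\<bar> \<le> \<rho> i * X0" "\<bar>of_int q\<bar> \<le> \<rho> i * Y0"
        "\<bar>of_int p - s i * of_int q\<bar> = \<rho> i * X0 \<or> \<bar>of_int q\<bar> = \<rho> i * Y0"
        using XY q by (auto simp: pos_divide_le_eq)
      thus ?thesis using q \<rho>0 by blast
    qed
    ultimately show ?thesis by blast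
  qed
  then obtain \<rho> where "\<forall>i\<le>n. \<rho> i > 0 \<and> \<rho> i * sqrt (X0 * Y0) \<le> 2 \<and>
      (\<exists>g1 g2. coprime g1 g2 \<and> \<bar>of_int g1 - s i * of_int g2\<bar> \<le> \<rho> i * X0 \<and> \<bar>of_int g2\<bar> \<le> \<rho> i * Y0 \<and>
        (\<bar>of_int g1 - s i * of_int g2\<bar> = \<rho> i * X0 \<or> \<bar>of_int g2\<bar> = \<rho> i * Y0))"
    "(\<Sum>i\<le>n. 1 / \<rho> i) \<le> 5 * D + W * (5 * sqrt (2 * D * E / \<eta>) + 6 * E * (1 + ln (1 + 2 * E / (D * \<eta>))))" by blast
  thus ?thesis using that[of \<rho>] unfolding X0_def Y0_def s_def W_def by blast
qed

section \<open>Summation over the strips\<close>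

text \<open>The ratio d / e lies between D / (2 E) and 2 D / E, so 2 E / D times it runs from 1 to
  4, and 3 / \<eta> steps of length \<eta> suffice. On one step d / e differs from s i by at most D
  \<eta> / (2 E), and e < 2 E turns this into the strip |d - s i e| <= D \<eta>.\<close>

lemma card_solutions_le_strips:
  fixes h H :: int and D E U V x c \<eta> K \<delta> :: real
  assumes k: "k \<ge> 1" and l: "l \<ge> 1" and h: "h \<noteq> 0" and pos: "D > 0" "E > 0" "U > 0" "V > 0"
    and H: "H \<ge> 1" "2 * D \<le> of_int H" "2 * E \<le> of_int H" "2 * U \<le> of_int H" "2 * V \<le> of_int H"
    and fib: "fibres_le K0 (solutions k l h D E U V) dd ee"
    and \<eta>: "0 < \<eta>" "\<eta> \<le> 1"
    and K: "\<And>a b. a \<le> B0 \<Longrightarrow> b \<le> B0 \<Longrightarrow> strip_count k l h K0 \<delta> a b K TYPE(nat \<times> nat \<times> nat \<times> nat)"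
    and form: "\<And>T s. T \<subseteq> solutions k l h D E U V \<Longrightarrow> s > 0 \<Longrightarrow> s \<le> 2 * D / E \<Longrightarrow>
      (\<And>P. P \<in> T \<Longrightarrow> s \<le> of_int (dd P) / of_int (ee P) \<and> of_int (dd P) / of_int (ee P) \<le> s * (1 + \<eta>)) \<Longrightarrow>
      \<exists>a\<le>B0. \<exists>b\<le>B0. on_form a b T dd ee uu vv"
  defines "n \<equiv> nat \<lceil>3 / \<eta>\<rceil>"
  shows "real (card (solutions k l h D E U V)) \<le> K * of_int H powr \<delta> *
     ((3 / \<eta> + 2) * (sqrt (2 * D * E * \<eta>) + 1) + 5 * D + 6 * (1 + ln (real (Suc n))) *
       (5 * sqrt (2 * D * E / \<eta>) + 6 * E * (1 + ln (1 + 2 * E / (D * \<eta>)))))"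
proof -
  let ?S = "solutions k l h D E U V"
  obtain \<rho> where \<rho>: "\<And>i. i \<le> n \<Longrightarrow> \<rho> i > 0 \<and> \<rho> i * sqrt ((D * \<eta>) * (2 * E)) \<le> 2 \<and>
      (\<exists>g1 g2. coprime g1 g2 \<and> \<bar>of_int g1 - D / (2 * E) * (1 + real i * \<eta>) * of_int g2\<bar> \<le> \<rho> i * (D * \<eta>) \<and>
        \<bar>of_int g2\<bar> \<le> \<rho> i * (2 * E) \<and>
        (\<bar>of_int g1 - D / (2 * E) * (1 + real i * \<eta>) * of_int g2\<bar> = \<rho> i * (D * \<eta>) \<or> \<bar>of_int g2\<bar> = \<rho> i * (2 * E)))"
    and \<rho>sum: "(\<Sum>i\<le>n. 1 / \<rho> i) \<le> 5 * D + 6 * (1 + ln (real (Suc n))) *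
       (5 * sqrt (2 * D * E / \<eta>) + 6 * E * (1 + ln (1 + 2 * E / (D * \<eta>))))"
    unfolding n_def using short_vectors_sum[OF pos(1,2) \<eta>] by blast
  define s where "s i = D / (2 * E) * (1 + real i * \<eta>)" for i :: nat
  have s0: "s i > 0" for i unfolding s_def using pos \<eta> by (intro mult_pos_pos add_pos_nonneg) auto
  define T where "T i = {P\<in>?S. s i \<le> of_int (dd P) / of_int (ee P) \<and> of_int (dd P) / of_int (ee P) \<le> s i + D / (2 * E) * \<eta>}" for i
  have K0: "K \<ge> 0" using K[of 0 0] by (simp add: strip_count_def)
  have cover: "?S \<subseteq> (\<Union>i\<in>{..n}. T i)"
  proof
    fix P assume P: "P \<in> ?S"
    note sP = solutionsD[OF P pos]
    define r where "r = real_of_int (dd P) / of_int (ee P)"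
    define w where "w = (2 * E / D * r - 1) / \<eta>"
    have e: "real_of_int (ee P) > 0" using sP(2) by simp
    have "D / (2 * E) < r"
      unfolding r_def using sP pos e by (intro frac_less) auto
    hence "2 * E / D * r > 1" using pos by (simp add: field_simps)
    hence w0: "w \<ge> 0" unfolding w_def using \<eta> by simp
    have "r < 2 * D / E"
      unfolding r_def using sP pos e by (intro frac_less) auto
    hence "2 * E / D * r \<le> 4" using pos by (simp add: field_simps)
    hence w3: "w \<le> 3 / \<eta>" unfolding w_def using \<eta> by (intro divide_right_mono) auto
    define i where "i = nat \<lfloor>w\<rfloor>"
    have i: "real i \<le> w" "w \<le> real i + 1" unfolding i_def using w0 by linarith+
    have "i \<le> n" unfolding i_def n_def using w3 by linarith
    have rw: "r = D / (2 * E) * (1 + w * \<eta>)" unfolding w_def using pos \<eta> by (simp add: field_simps)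
    have "s i \<le> r" unfolding rw s_def using i \<eta> pos by (intro mult_left_mono) auto
    moreover have "r \<le> D / (2 * E) * (1 + (real i + 1) * \<eta>)"
      unfolding rw using i \<eta> pos by (intro mult_left_mono add_left_mono mult_right_mono) auto
    moreover have "A * (1 + (real i + 1) * \<eta>) = A * (1 + real i * \<eta>) + A * \<eta>" for A :: real by (simp add: algebra_simps)
    ultimately have "s i \<le> r" "r \<le> s i + D / (2 * E) * \<eta>" unfolding s_def by simp_all
    hence "P \<in> T i" using P unfolding T_def r_def by blast
    thus "P \<in> (\<Union>i\<in>{..n}. T i)" using \<open>i \<le> n\<close> by blast
  qed
  define B where "B i = K * of_int H powr \<delta> * (sqrt ((D * \<eta>) * (2 * E)) + 1 + 1 / \<rho> i)" for i
  have each: "real (card (T i)) \<le> B i" if i: "i \<le> n" for i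
  proof (cases "T i = {}")
    case True
    have "1 / \<rho> i \<ge> 0" using \<rho>[OF i] by simp
    thus ?thesis unfolding B_def using True K0 pos \<eta> by simp
  next
    case False
    have TS: "T i \<subseteq> ?S" by (auto simp: T_def)
    note sol = solutionsD[OF subsetD[OF TS] pos]
    have s2: "s i \<le> 2 * D / E"
    proof -
      obtain P where P: "P \<in> T i" using False by blast
      have "real_of_int (dd P) / of_int (ee P) \<le> 2 * D / E" using sol[OF P] pos by (intro frac_le) auto
      thus ?thesis using P by (simp add: T_def)
    qed
    have "s i + D / (2 * E) * \<eta> \<le> s i * (1 + \<eta>)"
    proof -
      have "D / (2 * E) * 1 \<le> s i" unfolding s_def using pos \<eta> by (intro mult_left_mono) auto
      hence "D / (2 * E) * \<eta> \<le> s i * \<eta>" using \<eta> by (intro mult_right_mono) auto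
      thus ?thesis by (simp add: distrib_left)
    qed
    hence "\<And>P. P \<in> T i \<Longrightarrow> s i \<le> of_int (dd P) / of_int (ee P) \<and> of_int (dd P) / of_int (ee P) \<le> s i * (1 + \<eta>)"
      unfolding T_def by force
    from form[OF TS s0 s2 this] obtain a b where ab: "a \<le> B0" "b \<le> B0" "on_form a b (T i) dd ee uu vv" by blast
    have "in_strip k l h K0 H (s i) (D * \<eta>) (2 * E) (\<rho> i) (T i) dd ee uu vv"
      unfolding in_strip_def
    proof (intro conjI ballI)
      show "fibres_le K0 (T i) dd ee" using fib TS by (rule fibres_le_subset)
      fix P assume P: "P \<in> T i"
      note sP = sol[OF P]
      have le: "y \<le> H" if "real_of_int y < z" "z \<le> of_int H" for y z using that by linarith
      show "0 < dd P" "0 < ee P" "0 < uu P" "0 < vv P" using sP by simp_all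
      show "dd P \<le> H" "ee P \<le> H" "uu P \<le> H" "vv P \<le> H" using sP H by (blast intro: le)+
      show "ee P ^ k * vv P ^ l - dd P ^ k * uu P ^ l = h" by (rule sP(13))
      show "of_int (ee P) \<le> 2 * E" using sP by simp
      have e: "real_of_int (ee P) > 0" using sP(2) by simp
      have "0 \<le> of_int (dd P) / of_int (ee P) - s i" "of_int (dd P) / of_int (ee P) - s i \<le> D / (2 * E) * \<eta>"
        using P by (auto simp: T_def)
      hence "\<bar>of_int (dd P) / of_int (ee P) - s i\<bar> * of_int (ee P) \<le> D / (2 * E) * \<eta> * (2 * E)"
        using e sP by (intro mult_mono) auto
      also have "\<dots> = D * \<eta>" using pos by simp
      finally have "\<bar>(of_int (dd P) / of_int (ee P) - s i) * of_int (ee P)\<bar> \<le> D * \<eta>" using e by (simp add: abs_mult)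
      moreover have "(of_int (dd P) / of_int (ee P) - s i) * of_int (ee P) = of_int (dd P) - s i * of_int (ee P)"
        using e by (simp add: left_diff_distrib)
      ultimately show "\<bar>of_int (dd P) - s i * of_int (ee P)\<bar> \<le> D * \<eta>" by simp
    next
      have "D * \<eta> \<le> D * 1" using pos \<eta> by (intro mult_left_mono) auto
      thus "D * \<eta> \<le> of_int H" using H(2) pos by linarith
    qed (use H pos \<eta> \<rho>[OF i] in \<open>auto simp: s_def\<close>)
    thus ?thesis using K[OF ab(1,2)] ab(3) unfolding strip_count_def B_def by blast
  qed
  have "real (card ?S) \<le> real (card (\<Union>i\<in>{..n}. T i))"
    using cover finite_solutions by (intro of_nat_mono card_mono) (auto simp: T_def)
  also have "\<dots> \<le> real (\<Sum>i\<le>n. card (T i))" by (intro of_nat_mono card_UN_le) auto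
  also have "\<dots> \<le> (\<Sum>i\<le>n. B i)" unfolding of_nat_sum by (rule sum_mono) (use each in simp)
  also have "\<dots> = K * of_int H powr \<delta> * (real (Suc n) * (sqrt (2 * D * E * \<eta>) + 1) + (\<Sum>i\<le>n. 1 / \<rho> i))"
    unfolding B_def sum_distrib_left[symmetric] by (simp add: sum.distrib mult_ac)
  also have "\<dots> \<le> K * of_int H powr \<delta> * ((3 / \<eta> + 2) * (sqrt (2 * D * E * \<eta>) + 1) + (5 * D + 6 * (1 + ln (real (Suc n))) *
       (5 * sqrt (2 * D * E / \<eta>) + 6 * E * (1 + ln (1 + 2 * E / (D * \<eta>))))))"
  proof (intro mult_left_mono add_mono \<rho>sum mult_right_mono)
    have "3 / \<eta> > 0" using \<eta> by simp
    thus "real (Suc n) \<le> 3 / \<eta> + 2" unfolding n_def by linarith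
  qed (use K0 pos \<eta> in auto)
  finally show ?thesis by (simp only: add.assoc)
qed

text \<open>With \<eta> = exp (- X), where X is ln M + \<delta> ln x for the M of the theorem, the
  logarithm of the squared determinant bound in \<open>interval_on_form\<close> is exactly the
  expression that \<open>choose_bidegree\<close> makes negative. The degrees stay below a
  \<open>B0\<close> independent of x, so finitely many constants of \<open>strip_count\<close> are
  involved.\<close>

lemma small_interval_on_form:
  fixes h :: int and c1 c2 \<delta> :: real
  assumes k: "k \<ge> 1" and l: "l \<ge> 1" and h: "h \<noteq> 0" and c: "c1 > 0" "c2 > 0" and \<delta>: "\<delta> > 0"
  obtains B0 L0 where "L0 > 0"
   "\<And>x D E U V T s. L0 \<le> ln x \<Longrightarrow> x > 0 \<Longrightarrow> D > 0 \<Longrightarrow> E > 0 \<Longrightarrow> U > 0 \<Longrightarrow> V > 0 \<Longrightarrow>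
      D ^ k * U ^ l = x \<Longrightarrow> E ^ k * V ^ l = x \<Longrightarrow>
      c1 * ln x \<le> ln (D * E) \<Longrightarrow> ln (D * E) \<le> c2 * ln x \<Longrightarrow> c1 * ln x \<le> ln (U * V) \<Longrightarrow> ln (U * V) \<le> c2 * ln x \<Longrightarrow>
      T \<subseteq> solutions k l h D E U V \<Longrightarrow> s > 0 \<Longrightarrow> s \<le> 2 * D / E \<Longrightarrow>
      (\<And>P. P \<in> T \<Longrightarrow> s \<le> of_int (dd P) / of_int (ee P) \<and>
        of_int (dd P) / of_int (ee P) \<le> s * (1 + exp (- (9 / 8 * (ln (D * E) * ln (U * V) / ln x) + \<delta> * ln x)))) \<Longrightarrow>
      \<exists>a\<le>B0. \<exists>b\<le>B0. on_form a b T dd ee uu vv"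
proof -
  define q where "q a b = real (card ({..l * a + k * b} \<times> {..b})) ^ ((a + 1) * (b + 1)) * fact ((a + 1) * (b + 1)) *
        (2 ^ ((l * a + k * b) + b + a + b + a + k * b)) ^ ((a + 1) * (b + 1))" for a b
  define lh where "lh = ln \<bar>real_of_int h\<bar>"
  have h1: "\<bar>real_of_int h\<bar> \<ge> 1" using h by linarith
  have lh: "lh \<ge> 0" using h1 by (simp add: lh_def)
  have q1: "q a b \<ge> 1" for a b
  proof -
    have "1 * 1 * 1 \<le> q a b" unfolding q_def by (intro mult_mono one_le_power fact_ge_1) auto
    thus ?thesis by simp
  qed
  obtain B0 L0 where BL: "L0 > 0" "L0 > lh"
    "\<And>L \<D> \<U>. L \<ge> L0 \<Longrightarrow> c1 * L \<le> \<D> \<Longrightarrow> \<D> \<le> c2 * L \<Longrightarrow> c1 * L \<le> \<U> \<Longrightarrow> \<U> \<le> c2 * L \<Longrightarrow>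
      \<exists>a\<le>B0. \<exists>b\<le>B0. 2 * ln (q a b) + real ((a + 1) * (b + 1)) * (a * \<D> + b * \<U>)
        - 2 * (2 / 3 * real ((a + 1) * (b + 1)) * sqrt (2 * real ((a + 1) * (b + 1)) * (9 / 8 * (\<D> * \<U> / L) + \<delta> * L) * (L - lh))
               - real ((a + 1) * (b + 1)) * ((9 / 8 * (\<D> * \<U> / L) + \<delta> * L) + (L - lh))) < 0"
    by (rule choose_bidegree[where q = q, OF c \<delta> lh q1]) blast
  show ?thesis
  proof (rule that[OF BL(1), of B0])
    fix x D E U V s :: real and T
    assume x: "L0 \<le> ln x" "x > 0" and pos: "D > 0" "E > 0" "U > 0" "V > 0" and xe: "D ^ k * U ^ l = x" "E ^ k * V ^ l = x"
      and c12: "c1 * ln x \<le> ln (D * E)" "ln (D * E) \<le> c2 * ln x" "c1 * ln x \<le> ln (U * V)" "ln (U * V) \<le> c2 * ln x"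
      and T: "T \<subseteq> solutions k l h D E U V" and s: "s > 0" "s \<le> 2 * D / E"
      and Ts: "\<And>P. P \<in> T \<Longrightarrow> s \<le> of_int (dd P) / of_int (ee P) \<and>
        of_int (dd P) / of_int (ee P) \<le> s * (1 + exp (- (9 / 8 * (ln (D * E) * ln (U * V) / ln x) + \<delta> * ln x)))"
    define X where "X = 9 / 8 * (ln (D * E) * ln (U * V) / ln x) + \<delta> * ln x"
    have lx: "ln x > 0" using x(1) BL(1) by linarith
    have "c1 * ln x > 0" using c lx by simp
    hence "ln (D * E) > 0" "ln (U * V) > 0" using c12 by linarith+
    hence "X > 0" unfolding X_def using lx \<delta> by (intro add_pos_pos mult_pos_pos divide_pos_pos) auto
    have "ln \<bar>real_of_int h\<bar> < ln x" using x BL by (simp add: lh_def)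
    hence xh: "\<bar>real_of_int h\<bar> < x" using h1 x(2) by (subst (asm) ln_less_cancel_iff) auto
    obtain a b where ab: "a \<le> B0" "b \<le> B0" and neg: "2 * ln (q a b) + real ((a + 1) * (b + 1)) * (a * ln (D * E) + b * ln (U * V))
        - 2 * (2 / 3 * real ((a + 1) * (b + 1)) * sqrt (2 * real ((a + 1) * (b + 1)) * X * (ln x - lh))
               - real ((a + 1) * (b + 1)) * (X + (ln x - lh))) < 0"
      using BL(3)[OF x(1) c12] unfolding X_def by blast
    define n where "n = (a + 1) * (b + 1)"
    define G where "G = 2 * (2 / 3 * real n * sqrt (2 * real n * X * (ln x - lh)) - real n * (X + (ln x - lh)))"
    have qp: "q a b > 0" using q1[of a b] by simp
    have DE: "D * E > 0" "U * V > 0" using pos by auto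
    have "ln (q a b ^ 2 * ((D * E) ^ a * (U * V) ^ b) ^ n * exp (- G))
        = 2 * ln (q a b) + real n * (a * ln (D * E) + b * ln (U * V)) - G"
    proof -
      have "ln (((D * E) ^ a * (U * V) ^ b) ^ n) = real n * ln ((D * E) ^ a * (U * V) ^ b)" by (rule ln_realpow)
      also have "ln ((D * E) ^ a * (U * V) ^ b) = a * ln (D * E) + b * ln (U * V)"
        using DE by (subst ln_mult_pos) (auto simp only: ln_realpow zero_less_power)
      finally have 1: "ln (((D * E) ^ a * (U * V) ^ b) ^ n) = real n * (a * ln (D * E) + b * ln (U * V))" .
      have 2: "ln (q a b ^ 2) = 2 * ln (q a b)" by (simp only: ln_realpow of_nat_numeral)
      have p: "q a b ^ 2 > 0" "((D * E) ^ a * (U * V) ^ b) ^ n > 0" using qp DE by auto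
      have "ln (q a b ^ 2 * ((D * E) ^ a * (U * V) ^ b) ^ n * exp (- G))
        = ln (q a b ^ 2) + ln (((D * E) ^ a * (U * V) ^ b) ^ n) + ln (exp (- G))"
        using p by (simp only: ln_mult_pos mult_pos_pos exp_gt_zero)
      thus ?thesis unfolding 1 2 by simp
    qed
    also have "\<dots> < 0" using neg unfolding n_def G_def by simp
    finally have ln0: "ln (q a b ^ 2 * ((D * E) ^ a * (U * V) ^ b) ^ n * exp (- G)) < 0" .
    have "q a b ^ 2 * ((D * E) ^ a * (U * V) ^ b) ^ n * exp (- G) > 0" using qp DE by (simp only: mult_pos_pos zero_less_power exp_gt_zero)
    hence small: "q a b ^ 2 * ((D * E) ^ a * (U * V) ^ b) ^ n * exp (- G) < 1" using ln0 by (simp only: ln_less_zero_iff)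
    have lnhx: "- ln (\<bar>of_int h\<bar> / x) = ln x - lh" using h1 x(2) ln_divide_pos[of "\<bar>of_int h\<bar>" x] by (simp add: lh_def)
    have \<eta>: "0 < exp (- X)" "exp (- X) < 1" using \<open>X > 0\<close> by auto
    have GE: "- G = - 2 * (2 / 3 * real n * sqrt (2 * real n * (- ln (exp (- X))) * (- ln (\<bar>of_int h\<bar> / x)))
           - real n * (- ln (exp (- X)) - ln (\<bar>of_int h\<bar> / x)))"
    proof -
      have "- ln (exp (- X)) - ln (\<bar>of_int h\<bar> / x) = X + (ln x - lh)" using lnhx by simp
      thus ?thesis unfolding lnhx G_def by simp
    qed
    have "on_form a b T dd ee uu vv"
    proof (rule interval_on_form[OF k l pos xe xh h s \<eta> T])
      show "s \<le> of_int (dd P) / of_int (ee P) \<and> of_int (dd P) / of_int (ee P) \<le> s * (1 + exp (- X))" if "P \<in> T" for P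
        using Ts[OF that] by (simp only: X_def)
    qed (use small in \<open>unfold GE q_def n_def, blast\<close>)
    thus "\<exists>a\<le>B0. \<exists>b\<le>B0. on_form a b T dd ee uu vv" using ab by blast
  qed
qed

section \<open>Uniform constants and the total over all strips\<close>

lemma strip_count_mono:
  assumes "strip_count k l h K0 \<delta> a b K TYPE('p)" "K \<le> K'" "\<delta> > 0"
  shows "strip_count k l h K0 \<delta> a b K' TYPE('p)"
  unfolding strip_count_def
proof (intro conjI allI impI)
  show "K' \<ge> 0" using assms by (simp add: strip_count_def)
  fix S :: "'p set" and d e u v H s0 X0 Y0 \<rho>
  assume st: "in_strip k l h K0 H s0 X0 Y0 \<rho> S d e u v \<and> on_form a b S d e u v"
  define B where "B = of_int H powr \<delta> * (sqrt (X0 * Y0) + 1 + 1 / \<rho>)"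
  have "B \<ge> 1" using in_strip_bound_ge_1[OF conjunct1[OF st] assms(3)] by (simp add: B_def)
  have "real (card S) \<le> K * of_int H powr \<delta> * (sqrt (X0 * Y0) + 1 + 1 / \<rho>)"
    using assms(1) st unfolding strip_count_def by blast
  hence "real (card S) \<le> K * B" by (simp only: B_def mult.assoc)
  also have "\<dots> \<le> K' * B" using assms(2) \<open>B \<ge> 1\<close> by (intro mult_right_mono) auto
  finally show "real (card S) \<le> K' * of_int H powr \<delta> * (sqrt (X0 * Y0) + 1 + 1 / \<rho>)" by (simp only: B_def mult.assoc)
qed

lemma ex_uniform_strip_count:
  fixes h :: int and \<delta> :: real
  assumes "k > 0" "l > 0" "h \<noteq> 0" and \<delta>: "\<delta> > 0"
  shows "\<exists>K\<ge>0. \<forall>a\<le>B0. \<forall>b\<le>B0. strip_count k l h K0 \<delta> a b K TYPE('p)"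
proof -
  define f where "f a b = (SOME K. strip_count k l h K0 \<delta> a b K TYPE('p))" for a b
  have f: "strip_count k l h K0 \<delta> a b (f a b) TYPE('p)" for a b
    unfolding f_def by (rule someI_ex[OF ex_strip_count[OF assms]])
  have f0: "f a b \<ge> 0" for a b by (rule conjunct1[OF f[of a b, unfolded strip_count_def]])
  define K where "K = (\<Sum>a\<le>B0. \<Sum>b\<le>B0. f a b)"
  have "f a b \<le> K" if "a \<le> B0" "b \<le> B0" for a b
  proof -
    have "f a b \<le> (\<Sum>b\<le>B0. f a b)" by (rule member_le_sum) (use that f0 in auto)
    also have "\<dots> \<le> K" unfolding K_def 
      by (rule member_le_sum[of a _ "\<lambda>a. \<Sum>b\<le>B0. f a b"]) (use that in \<open>auto intro: sum_nonneg f0\<close>)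
    finally show ?thesis .
  qed
  hence "\<forall>a\<le>B0. \<forall>b\<le>B0. strip_count k l h K0 \<delta> a b K TYPE('p)" 
    by (intro allI impI strip_count_mono[OF f _ \<delta>])
  moreover have "K \<ge> 0" unfolding K_def by (intro sum_nonneg f0)
  ultimately show ?thesis by blast
qed

text \<open>There are about 1 / \<eta> = M y strips, each contributing sqrt (2 D E \<eta>), which
  makes sqrt (2 D E / \<eta>), of order sqrt (D E M y). The further term 1 per strip costs M y, and
  M <= sqrt (D E M) because M <= D E. G stands for the logarithms.\<close>

lemma strips_total_le:
  fixes D E M y \<eta> A B G :: real
  assumes pos: "D > 0" "E > 0" and M: "1 \<le> M" "M \<le> D * E" and y: "y \<ge> 1" and \<eta>: "\<eta> = 1 / (M * y)"
    and AB: "0 \<le> A" "A \<le> G" "0 \<le> B" "B \<le> G" and G: "G \<ge> 1"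
  shows "(3 / \<eta> + 2) * (sqrt (2 * D * E * \<eta>) + 1) + 5 * D + 6 * A * (5 * sqrt (2 * D * E / \<eta>) + 6 * E * B)
    \<le> 100 * G ^ 2 * y * (sqrt (D * E * M) + D + E)"
proof -
  define S where "S = sqrt (D * E * M)"
  have S: "S \<ge> 0" "S ^ 2 = D * E * M" using pos M by (auto simp: S_def)
  have My: "M * y \<ge> 1" using mult_mono[of 1 M 1 y] M y by simp
  have r1: "sqrt (2 * D * E / \<eta>) \<le> 3 / 2 * (S * y)"
  proof (rule real_le_lsqrt)
    have "D * E * M * (2 * y) \<le> D * E * M * (9 / 4 * y ^ 2)"
      using pos M y by (intro mult_left_mono) (auto simp: power2_eq_square)
    thus "2 * D * E / \<eta> \<le> (3 / 2 * (S * y)) ^ 2" by (simp add: \<eta> power_mult_distrib S power_divide)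
  qed (use S y in auto)
  have r2: "(3 / \<eta> + 2) * (sqrt (2 * D * E * \<eta>) + 1) \<le> 25 / 2 * (S * y)"
  proof -
    have "3 / \<eta> + 2 \<le> 5 * (M * y)" using My by (simp add: \<eta>)
    hence "(3 / \<eta> + 2) * (sqrt (2 * D * E * \<eta>) + 1) \<le> 5 * (M * y) * (sqrt (2 * D * E * \<eta>) + 1)"
      using pos My \<eta> by (intro mult_right_mono) auto
    also have "\<dots> = 5 * (M * y * sqrt (2 * D * E * \<eta>)) + 5 * (M * y)" by (simp add: algebra_simps)
    also have "M * y * sqrt (2 * D * E * \<eta>) = sqrt ((M * y) ^ 2 * (2 * D * E * \<eta>))"
      using M y by (simp only: real_sqrt_mult real_sqrt_abs) simp
    also have "(M * y) ^ 2 * (2 * D * E * \<eta>) = 2 * D * E / \<eta>" using M y by (simp add: \<eta> power2_eq_square)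
    also note r1
    also have "M * y \<le> S * y"
    proof (rule mult_right_mono)
      have "M * M \<le> D * E * M" using M by (intro mult_right_mono) auto
      thus "M \<le> S" unfolding S_def by (intro real_le_rsqrt) (simp add: power2_eq_square)
    qed (use y in auto)
    finally show ?thesis by (simp add: mult_ac)
  qed
  have G2: "G \<le> G ^ 2" "1 \<le> G ^ 2" using G by (auto simp: self_le_power)
  have Sy: "0 \<le> S * y" using S y by simp
  have "6 * A * (5 * sqrt (2 * D * E / \<eta>) + 6 * E * B) \<le> 6 * G * (15 / 2 * (S * y) + 6 * E * G)"
  proof (rule mult_mono)
    have "6 * E * B \<le> 6 * E * G" using AB pos by (intro mult_left_mono) auto
    thus "5 * sqrt (2 * D * E / \<eta>) + 6 * E * B \<le> 15 / 2 * (S * y) + 6 * E * G" using r1 by linarith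
    have "2 * D * E / \<eta> \<ge> 0" using pos M y by (simp add: \<eta>)
    thus "0 \<le> 5 * sqrt (2 * D * E / \<eta>) + 6 * E * B" using AB pos by simp
  qed (use AB in auto)
  also have "\<dots> = 45 * (G * (S * y)) + 36 * (G ^ 2 * E)" by (simp add: algebra_simps power2_eq_square)
  also have "G * (S * y) \<le> G ^ 2 * (S * y)" using G2(1) Sy by (rule mult_right_mono)
  finally have t3: "6 * A * (5 * sqrt (2 * D * E / \<eta>) + 6 * E * B) \<le> 45 * (G ^ 2 * (S * y)) + 36 * (G ^ 2 * E)" by simp
  have t1: "S * y \<le> G ^ 2 * (S * y)" using mult_right_mono[OF G2(2) Sy] by simp
  have Gy: "1 \<le> G ^ 2 * y" using mult_mono[of 1 "G ^ 2" 1 y] G2 y by simp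
  have t2: "D \<le> G ^ 2 * y * D" using mult_right_mono[OF Gy, of D] pos by simp
  have t4: "G ^ 2 * E \<le> G ^ 2 * y * E" using mult_left_mono[OF y, of "G ^ 2"] pos by (intro mult_right_mono) auto
  have "100 * G ^ 2 * y * (sqrt (D * E * M) + D + E) = 100 * (G ^ 2 * (S * y)) + 100 * (G ^ 2 * y * D) + 100 * (G ^ 2 * y * E)"
    unfolding S_def by (simp add: algebra_simps)
  moreover have "0 \<le> G ^ 2 * (S * y)" "0 \<le> G ^ 2 * y * D" "0 \<le> G ^ 2 * y * E" using Sy G2 y pos by auto
  ultimately show ?thesis using r2 t1 t2 t3 t4 by linarith
qed

lemma card_solutions_le_pairs:
  assumes pos: "D > 0" "E > 0" "U > 0" "V > 0"
    and K: "\<And>d0 e0. card {P\<in>solutions k l h D E U V. dd P = d0 \<and> ee P = e0} \<le> K"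
  shows "real (card (solutions k l h D E U V)) \<le> 4 * real K * (D * E)"
proof -
  let ?S = "solutions k l h D E U V" and ?f = "\<lambda>P. (dd P, ee P)"
  have "card {P\<in>?S. ?f P = y} \<le> K" for y using K[of "fst y" "snd y"] by (cases y) simp
  hence "card ?S \<le> K * card (?f ` ?S)" by (intro card_le_mult_card_image finite_solutions)
  moreover have "card (?f ` ?S) \<le> card ({1..\<lfloor>2 * D\<rfloor>} \<times> {1..\<lfloor>2 * E\<rfloor>})"
  proof (rule card_mono)
    show "?f ` ?S \<subseteq> {1..\<lfloor>2 * D\<rfloor>} \<times> {1..\<lfloor>2 * E\<rfloor>}"
    proof
      fix z assume "z \<in> ?f ` ?S"
      then obtain P where P: "P \<in> ?S" "z = ?f P" by blast
      note sP = solutionsD[OF P(1) pos]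
      show "z \<in> {1..\<lfloor>2 * D\<rfloor>} \<times> {1..\<lfloor>2 * E\<rfloor>}" using sP by (auto simp: P(2) le_floor_iff)
    qed
  qed auto
  moreover have "card ({1..\<lfloor>2 * D\<rfloor>} \<times> {1..\<lfloor>2 * E\<rfloor>}) = nat \<lfloor>2 * D\<rfloor> * nat \<lfloor>2 * E\<rfloor>" by (simp add: card_cartesian_product)
  ultimately have "card ?S \<le> K * (nat \<lfloor>2 * D\<rfloor> * nat \<lfloor>2 * E\<rfloor>)" by (metis le_trans mult_le_mono2)
  hence "real (card ?S) \<le> real (K * (nat \<lfloor>2 * D\<rfloor> * nat \<lfloor>2 * E\<rfloor>))" by (simp only: of_nat_le_iff)
  also have "\<dots> = real K * (real (nat \<lfloor>2 * D\<rfloor>) * real (nat \<lfloor>2 * E\<rfloor>))" by simp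
  also have "\<dots> \<le> real K * ((2 * D) * (2 * E))" using pos by (intro mult_left_mono mult_mono) auto
  finally show ?thesis by (simp add: mult_ac)
qed

text \<open>With y = x^(\<epsilon>/6) the factor G^2 y from logarithms and strips is of order y^3 =
  x^(\<epsilon>/2), and \<delta>1 is chosen so that the power of H costs another x^(\<epsilon>/2).
  All sizes are assumed above 1/2 rather than above 1, because U and V may be below 1 and the bound
  is applied to both orders of the pairs.\<close>

lemma card_solutions_bound:
  fixes h :: int and \<epsilon> c1 c2 c :: real
  assumes k: "k \<ge> 1" and l: "l \<ge> 1" and h: "h \<noteq> 0" and \<epsilon>: "\<epsilon> > 0" and c: "c1 > 0" "c2 > 0" "c > 0"
  obtains X C where "X > 1" "C > 0"
   "\<And>x D E U V M. X \<le> x \<Longrightarrow> D > 1 / 2 \<Longrightarrow> E > 1 / 2 \<Longrightarrow> U > 1 / 2 \<Longrightarrow> V > 1 / 2 \<Longrightarrow>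
      D ^ k * U ^ l = x \<Longrightarrow> E ^ k * V ^ l = x \<Longrightarrow> U * V \<le> c * x \<Longrightarrow>
      c1 * ln x \<le> ln (D * E) \<Longrightarrow> ln (D * E) \<le> c2 * ln x \<Longrightarrow> c1 * ln x \<le> ln (U * V) \<Longrightarrow> ln (U * V) \<le> c2 * ln x \<Longrightarrow>
      M > 1 \<Longrightarrow> ln M = 9 / 8 * (ln (D * E) * ln (U * V) / ln x) \<Longrightarrow>
      real (card (solutions k l h D E U V)) \<le> C * x powr \<epsilon> * (sqrt (D * E * M) + D + E)"
proof -
  define \<delta> where "\<delta> = \<epsilon> / 6"
  define \<delta>1 where "\<delta>1 = min 1 (\<epsilon> / (2 * c2))"
  have \<delta>: "\<delta> > 0" and \<delta>1: "\<delta>1 > 0" "\<delta>1 \<le> 1" "c2 * \<delta>1 \<le> \<epsilon> / 2"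
    using \<epsilon> c by (auto simp: \<delta>_def \<delta>1_def min_def field_simps)
  show ?thesis
  proof (rule small_interval_on_form[OF k l h c(1,2) \<delta>])
    fix B0 L0
    assume L0: "L0 > 0" and form: "\<And>x D E U V T s. L0 \<le> ln x \<Longrightarrow> x > 0 \<Longrightarrow> D > 0 \<Longrightarrow> E > 0 \<Longrightarrow> U > 0 \<Longrightarrow> V > 0 \<Longrightarrow>
        D ^ k * U ^ l = x \<Longrightarrow> E ^ k * V ^ l = x \<Longrightarrow>
        c1 * ln x \<le> ln (D * E) \<Longrightarrow> ln (D * E) \<le> c2 * ln x \<Longrightarrow> c1 * ln x \<le> ln (U * V) \<Longrightarrow> ln (U * V) \<le> c2 * ln x \<Longrightarrow>
        T \<subseteq> solutions k l h D E U V \<Longrightarrow> s > 0 \<Longrightarrow> s \<le> 2 * D / E \<Longrightarrow>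
        (\<And>P. P \<in> T \<Longrightarrow> s \<le> of_int (dd P) / of_int (ee P) \<and>
          of_int (dd P) / of_int (ee P) \<le> s * (1 + exp (- (9 / 8 * (ln (D * E) * ln (U * V) / ln x) + \<delta> * ln x)))) \<Longrightarrow>
        \<exists>a\<le>B0. \<exists>b\<le>B0. on_form a b T dd ee uu vv"
    define K2 where "K2 = nat \<lfloor>(2 * (\<bar>of_int h\<bar> * 2 ^ l * c) + 1) * (2 * \<bar>of_int h\<bar> + 1)\<rfloor>"
    have "k > 0" "l > 0" using k l by auto
    from ex_uniform_strip_count[where 'p = "nat \<times> nat \<times> nat \<times> nat", OF this h \<delta>1(1), of B0 "K2 * nat \<bar>h\<bar>"]
    obtain K where K: "K \<ge> 0" "\<And>a b. a \<le> B0 \<Longrightarrow> b \<le> B0 \<Longrightarrow>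
        strip_count k l h (K2 * nat \<bar>h\<bar>) \<delta>1 a b K TYPE(nat \<times> nat \<times> nat \<times> nat)"
      by blast
    define c4 where "c4 = 9 / 8 * c2 ^ 2 + \<delta>"
    \<comment> \<open>G = G0 x^\<delta> has to exceed 9 + (c2 + c4) ln x, and ln x <= x^\<delta> /
      \<delta>. The 9 is 1 + 8 with ln 9 <= 8, from the bound for B.\<close>
    define G0 where "G0 = 9 + (c2 + c4) / \<delta>"
    have c4: "c4 > 0" using \<delta> by (simp add: c4_def add_nonneg_pos)
    have G0: "G0 \<ge> 1" using c4 c \<delta> by (simp add: G0_def)
    define C where "C = 500 * K * G0 ^ 2 + 4 * real K2 + 1"
    have C: "C > 0" "500 * K * G0 ^ 2 \<le> C" "4 * real K2 \<le> C" using K(1) by (auto simp: C_def add_nonneg_pos)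
    show thesis
    proof (rule that[of "exp L0" C])
      show "exp L0 > 1" using L0 by simp
      fix x D E U V M :: real
      assume x: "exp L0 \<le> x" and half: "D > 1 / 2" "E > 1 / 2" "U > 1 / 2" "V > 1 / 2"
        and xe: "D ^ k * U ^ l = x" "E ^ k * V ^ l = x" and UV: "U * V \<le> c * x"
        and c12: "c1 * ln x \<le> ln (D * E)" "ln (D * E) \<le> c2 * ln x" "c1 * ln x \<le> ln (U * V)" "ln (U * V) \<le> c2 * ln x"
        and M: "M > 1" "ln M = 9 / 8 * (ln (D * E) * ln (U * V) / ln x)"
      have pos: "D > 0" "E > 0" "U > 0" "V > 0" using half by auto
      have x1: "x > 1" using x L0 by (meson less_le_trans one_less_exp_iff)
      have Lx: "L0 \<le> ln x" using x x1 by (simp add: ln_ge_iff)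
      have lx: "ln x > 0" using x1 by simp
      note fib = fibres_le_solutions[OF k l h pos xe(2) UV c(3), folded K2_def]
      define Z where "Z = sqrt (D * E * M) + D + E"
      have Z: "Z \<ge> 0" using pos M by (simp add: Z_def)
      have DE0: "D * E > 0" "U * V > 0" using pos by auto
      show "real (card (solutions k l h D E U V)) \<le> C * x powr \<epsilon> * (sqrt (D * E * M) + D + E)"
      proof (cases "D * E \<le> M")
        \<comment> \<open>If M >= D E, then D E <= sqrt (D E M), and counting pairs (d, e) is
          enough.\<close>
        case True
        have "D * E = sqrt ((D * E) * (D * E))" using pos by simp
        also have "\<dots> \<le> sqrt (D * E * M)" using True DE0 by (intro real_sqrt_le_mono mult_left_mono) auto
        finally have DEZ: "D * E \<le> Z" using pos by (simp add: Z_def)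
        have "real (card (solutions k l h D E U V)) \<le> 4 * real K2 * (D * E)" by (rule card_solutions_le_pairs[OF pos fib(2)])
        also have "\<dots> \<le> C * Z" using C DEZ DE0 by (intro mult_mono) auto
        also have "\<dots> \<le> C * x powr \<epsilon> * Z"
          using C Z x1 \<epsilon> by (intro mult_right_mono) (auto intro: ge_one_powr_ge_zero)
        finally show ?thesis by (simp only: Z_def)
      next
        case False
        define y where "y = x powr \<delta>"
        have y1: "y \<ge> 1" unfolding y_def using x1 \<delta> by (intro ge_one_powr_ge_zero) auto
        have lny: "ln y = \<delta> * ln x" using x1 by (simp add: y_def ln_powr)
        define \<eta> where "\<eta> = 1 / (M * y)"
        have My: "M * y > 1" using mult_less_le_imp_less[of 1 M 1 y] M y1 by simp
        have \<eta>: "0 < \<eta>" "\<eta> \<le> 1" using My by (auto simp: \<eta>_def)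
        have lnMy: "ln (M * y) = 9 / 8 * (ln (D * E) * ln (U * V) / ln x) + \<delta> * ln x"
          using M(1) y1 ln_mult_pos[of M y] by (simp add: M(2) lny)
        have \<eta>exp: "\<eta> = exp (- (9 / 8 * (ln (D * E) * ln (U * V) / ln x) + \<delta> * ln x))"
          unfolding lnMy[symmetric] exp_minus using My by (simp add: \<eta>_def inverse_eq_divide)
        have c1x: "c1 * ln x > 0" using c lx by simp
        have lnDE: "ln (D * E) > 0" "ln (U * V) > 0" using c12 c1x by linarith+
        have lnMy_le: "ln (M * y) \<le> c4 * ln x"
        proof -
          have "ln (D * E) * ln (U * V) \<le> (c2 * ln x) * (c2 * ln x)" using c12 lnDE by (intro mult_mono) auto
          hence "ln (D * E) * ln (U * V) / ln x \<le> c2 ^ 2 * ln x" using lx by (simp add: pos_divide_le_eq power2_eq_square mult_ac)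
          thus ?thesis unfolding lnMy c4_def by (simp add: distrib_right)
        qed
        have DE1: "D * E > 1" using lnDE(1) DE0 by simp
        define G where "G = G0 * y"
        have Gge: "9 + (c2 + c4) * ln x \<le> G"
        proof -
          have "ln x \<le> y / \<delta>" unfolding y_def using x1 \<delta> by (intro ln_powr_bound) auto
          hence "(c2 + c4) * ln x \<le> (c2 + c4) * (y / \<delta>)" using c c4 by (intro mult_left_mono) auto
          thus ?thesis unfolding G_def G0_def using y1 by (simp add: distrib_right)
        qed
        have G1: "G \<ge> 1" using Gge c c4 lx mult_nonneg_nonneg[of "c2 + c4" "ln x"] by linarith
        define A where "A = 1 + ln (real (Suc (nat \<lceil>3 / \<eta>\<rceil>)))"
        define B where "B = 1 + ln (1 + 2 * E / (D * \<eta>))"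
        have A: "0 \<le> A" "A \<le> G"
        proof -
          show "0 \<le> A" by (simp add: A_def)
          have "real (Suc (nat \<lceil>3 / \<eta>\<rceil>)) \<le> 5 * (M * y)" using My unfolding \<eta>_def by simp linarith
          hence "ln (real (Suc (nat \<lceil>3 / \<eta>\<rceil>))) \<le> ln (5 * (M * y))" by (subst ln_le_cancel_iff) (use My in auto)
          also have "\<dots> = ln 5 + ln (M * y)" using My by (intro ln_mult_pos) auto
          also have "ln 5 \<le> (4 :: real)" using ln_le_minus_one[of "5 :: real"] by simp
          finally have "A \<le> 5 + c4 * ln x" using lnMy_le by (simp add: A_def)
          thus "A \<le> G" using Gge mult_pos_pos[OF c(2) lx] by (simp add: distrib_right)
        qed
        have B: "0 \<le> B" "B \<le> G"
        proof -
          have "M * y > 0" using My by linarith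
          with DE0(1) have p: "M * y > 0" "D * E * (M * y) > 0" by (blast intro: mult_pos_pos)+
          have q: "0 \<le> 2 * E / (D * \<eta>)" using pos \<eta> by simp
          thus "0 \<le> B" by (simp add: B_def)
          \<comment> \<open>D > 1/2 trades the quotient E / D for a multiple of D E, whose logarithm
            is controlled.\<close>
          have "1 / D \<le> 4 * D"
          proof -
            have "1 / D \<le> 2" using half by (simp add: pos_divide_le_eq)
            thus ?thesis using half by linarith
          qed
          hence "2 * E * (M * y) * (1 / D) \<le> 2 * E * (M * y) * (4 * D)" using pos My by (intro mult_left_mono) auto
          hence "2 * E / (D * \<eta>) \<le> 8 * (D * E * (M * y))" by (simp add: \<eta>_def mult_ac)
          moreover have "1 * 1 \<le> D * E * (M * y)" using DE1 My by (intro mult_mono) auto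
          ultimately have "1 + 2 * E / (D * \<eta>) \<le> 9 * (D * E * (M * y))" by linarith
          hence "ln (1 + 2 * E / (D * \<eta>)) \<le> ln (9 * (D * E * (M * y)))" by (subst ln_le_cancel_iff) (use q My DE0 in auto)
          also have "\<dots> = ln 9 + ln (D * E * (M * y))" by (rule ln_mult_pos[OF _ p(2)]) simp
          also have "ln (D * E * (M * y)) = ln (D * E) + ln (M * y)" by (rule ln_mult_pos[OF DE0(1) p(1)])
          also have "ln 9 \<le> (8 :: real)" using ln_le_minus_one[of "9 :: real"] by simp
          finally have "B \<le> 9 + c2 * ln x + c4 * ln x" using lnMy_le c12(2) by (simp add: B_def)
          thus "B \<le> G" using Gge by (simp add: distrib_right)
        qed
        define H where "H = \<lceil>4 * x powr c2\<rceil>"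
        have xc2: "x powr c2 \<ge> 1" using x1 c by (intro ge_one_powr_ge_zero) auto
        have H: "H \<ge> 1" "4 * x powr c2 \<le> of_int H" "of_int H \<le> 5 * x powr c2" using xc2 unfolding H_def by linarith+
        have le_pow: "p * q \<le> x powr c2" if "ln (p * q) \<le> c2 * ln x" "p * q > 0" for p q :: real
        proof -
          have "p * q = exp (ln (p * q))" using that(2) by simp
          also have "\<dots> \<le> exp (c2 * ln x)" using that(1) by (simp only: exp_le_cancel_iff)
          also have "\<dots> = x powr c2" using x1 by (simp add: powr_def)
          finally show ?thesis .
        qed
        have le4: "2 * p \<le> of_int H" if "p > 0" "q > 1 / 2" "p * q \<le> x powr c2" for p q :: real
        proof -
          have "p * (1 / 2) \<le> p * q" using that by (intro mult_left_mono) auto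
          thus ?thesis using that(3) H(2) by linarith
        qed
        have DEx: "D * E \<le> x powr c2" "U * V \<le> x powr c2" using le_pow c12 DE0 by auto
        have Hs: "2 * D \<le> of_int H" "2 * E \<le> of_int H" "2 * U \<le> of_int H" "2 * V \<le> of_int H"
          using le4[of D E] le4[of E D] le4[of U V] le4[of V U] DEx half pos by (auto simp: mult.commute)
        have card1: "real (card (solutions k l h D E U V)) \<le> K * of_int H powr \<delta>1 *
          ((3 / \<eta> + 2) * (sqrt (2 * D * E * \<eta>) + 1) + 5 * D + 6 * (1 + ln (real (Suc (nat \<lceil>3 / \<eta>\<rceil>)))) *
           (5 * sqrt (2 * D * E / \<eta>) + 6 * E * (1 + ln (1 + 2 * E / (D * \<eta>)))))"
        proof (rule card_solutions_le_strips[OF k l h pos H(1) Hs fib(1) \<eta> K(2)])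
          fix T s assume "T \<subseteq> solutions k l h D E U V" "s > 0" "s \<le> 2 * D / E"
            "\<And>P. P \<in> T \<Longrightarrow> s \<le> of_int (dd P) / of_int (ee P) \<and> of_int (dd P) / of_int (ee P) \<le> s * (1 + \<eta>)"
          thus "\<exists>a\<le>B0. \<exists>b\<le>B0. on_form a b T dd ee uu vv"
            unfolding \<eta>exp using x1 by (intro form[OF Lx _ pos xe c12]) auto
        qed
        have "real (card (solutions k l h D E U V)) \<le> K * of_int H powr \<delta>1 * (100 * G ^ 2 * y * Z)"
          using card1 strips_total_le[OF pos(1,2) _ _ y1 \<eta>_def A B G1] M(1) False K(1) unfolding Z_def A_def B_def
          by (elim order_trans) (intro mult_left_mono; simp)
        also have "\<dots> \<le> K * (5 * x powr (\<epsilon> / 2)) * (100 * G ^ 2 * y * Z)"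
        proof (intro mult_right_mono mult_left_mono K(1))
          have "of_int H powr \<delta>1 \<le> (5 * x powr c2) powr \<delta>1" using H \<delta>1 by (intro powr_mono2) auto
          also have "\<dots> = 5 powr \<delta>1 * x powr (c2 * \<delta>1)" by (simp add: powr_mult powr_powr)
          also have "\<dots> \<le> 5 powr 1 * x powr (\<epsilon> / 2)" using \<delta>1 x1 by (intro mult_mono powr_mono) auto
          finally show "of_int H powr \<delta>1 \<le> 5 * x powr (\<epsilon> / 2)" by simp
        qed (use G1 y1 Z in auto)
        also have "\<dots> = 500 * K * G0 ^ 2 * (x powr (\<epsilon> / 2) * (y * y * y)) * Z"
          by (simp add: G_def power_mult_distrib power2_eq_square mult_ac)
        also have "x powr (\<epsilon> / 2) * (y * y * y) = x powr \<epsilon>" by (simp add: y_def powr_add[symmetric] \<delta>_def)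
        also have "500 * K * G0 ^ 2 * x powr \<epsilon> * Z \<le> C * x powr \<epsilon> * Z" using C Z by (intro mult_right_mono) auto
        finally show ?thesis by (simp only: Z_def)
      qed
    qed (use C in auto)
  qed
qed

section \<open>The sizes U and V, the exchange of the two pairs, and the final bound\<close>

lemma cofactor_size_pos: "x > 0 \<Longrightarrow> D > 0 \<Longrightarrow> cofactor_size k l x D > 0"
  by (simp add: cofactor_size_def)

lemma power_mult_cofactor_size:
  assumes "l \<ge> 1" "x > 0" "D > 0"
  shows "D ^ k * cofactor_size k l x D ^ l = x"
proof -
  have "(x powr (1 / real l)) ^ l = x" using assms by (simp add: powr_power)
  moreover have "(D powr (real k / real l)) ^ l = D ^ k" using assms by (simp add: powr_power powr_realpow)
  ultimately have "cofactor_size k l x D ^ l = x / D ^ k" by (simp only: cofactor_size_def power_divide)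
  thus ?thesis using assms by simp
qed

lemma solution_set_eq_solutions:
  assumes "x > 0" "D > 0" "E > 0"
  shows "solution_set k l h x D E = solutions k l h D E (cofactor_size k l x D) (cofactor_size k l x E)"
proof -
  have ge1: "n \<ge> 1" if "Y < real n" "Y > 0" for Y :: real and n :: nat using that by (cases n) auto
  show ?thesis
    unfolding solution_set_def solutions_def dyadic_def
    using ge1[of D] ge1[of E] ge1[OF _ cofactor_size_pos[OF assms(1,2)]] ge1[OF _ cofactor_size_pos[OF assms(1,3)]] assms
    by auto
qed

lemma card_solutions_swap: "card (solutions k l h D E U V) = card (solutions l k h U V D E)"
proof (rule bij_betw_same_card)
  show "bij_betw (\<lambda>(d, e, u, v). (u, v, d, e)) (solutions k l h D E U V) (solutions l k h U V D E)"
    by (rule bij_betw_byWitness[where f' = "\<lambda>(d, e, u, v). (u, v, d, e)"]) (auto simp: solutions_def mult.commute)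
qed

text \<open>An open interval from Y to 2 Y with 0 < Y <= 1/2 contains no integer; this disposes of
  the sizes excluded in \<open>card_solutions_bound\<close>.\<close>

lemma solutions_empty: "U \<le> 1 / 2 \<or> V \<le> 1 / 2 \<Longrightarrow> U > 0 \<Longrightarrow> V > 0 \<Longrightarrow> solutions k l h D E U V = {}"
proof -
  assume *: "U \<le> 1 / 2 \<or> V \<le> 1 / 2" "U > 0" "V > 0"
  have "\<not> (Y < real n \<and> real n < 2 * Y)" if "Y \<le> 1 / 2" "Y > 0" for Y :: real and n :: nat
    using that by (cases n) auto
  thus ?thesis using * unfolding solutions_def by blast
qed

text \<open>Applied to (D E)^k (U V)^l = x^2 it bounds D E by x, and U V by x when l >= 2. For l = 1
  a bound for U V has to come from condition (2).\<close>

lemma le_of_power_mult_eq_square: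
  fixes A B x :: real
  assumes "A \<ge> 1" "B \<ge> 1" "k \<ge> 2" "A ^ k * B ^ l = x ^ 2" "x > 0"
  shows "A \<le> x"
proof -
  have "A ^ 2 * 1 \<le> A ^ k * B ^ l" using assms by (intro mult_mono power_increasing one_le_power) auto
  thus ?thesis using assms by (intro power2_le_imp_le[of A x]) auto
qed

theorem theorem1:
  fixes \<epsilon> c1 c2 :: real and c3 :: "nat \<Rightarrow> nat \<Rightarrow> int \<Rightarrow> real"
  assumes "\<epsilon> > 0" and "c1 > 0" and "c2 > 0" and "\<And>k l h. c3 k l h > 0"
  shows "\<exists>x0 :: real. \<forall>(k :: nat) (l :: nat) (h :: int).
           1 \<le> l \<and> l < k \<and> h \<noteq> 0 \<longrightarrow>
           (\<exists>C > 0. \<forall>(x :: real) (D :: real) (E :: real) (U :: real) (V :: real) (M :: real).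
              x > 1 \<and> D > 1 \<and> E > 1 \<and> x \<ge> x0 \<and>
              U = cofactor_size k l x D \<and> V = cofactor_size k l x E \<and>
              M > 1 \<and> ln M = 9 / 8 * (ln (D * E) * ln (U * V) / ln x) \<and>
              c1 * ln x \<le> ln (D * E) \<and> ln (D * E) \<le> c2 * ln x \<and>
              c1 * ln x \<le> ln (U * V) \<and> ln (U * V) \<le> c2 * ln x \<and>
              (l \<ge> 2 \<or> D * E \<ge> c3 k l h * x powr (1 / real k)) \<longrightarrow>
              real (solution_count k l h x D E)
                \<le> C * x powr \<epsilon> * min (sqrt (D * E * M) + D + E) (sqrt (U * V * M) + U + V))"
proof (rule exI[of _ 1], intro allI impI)
  fix k l :: nat and h :: int
  assume klh: "1 \<le> l \<and> l < k \<and> h \<noteq> 0"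
  hence l: "l \<ge> 1" and k: "k \<ge> 1" "k \<ge> 2" and h: "h \<noteq> 0" by auto
  \<comment> \<open>The constant in U V <= c x. For l >= 2 the value 1 works; for l = 1 condition
    (2) gives (D E)^k >= c3^k x, and (D E)^k U V = x^2.\<close>
  define c where "c = max 1 (1 / c3 k l h ^ k)"
  have c: "c > 0" "c \<ge> 1" "c \<ge> 1 / c3 k l h ^ k" by (auto simp: c_def)
  \<comment> \<open>Stated for arbitrary positive exponents, so that it applies to (k, l) and, after
    the exchange of the pairs, to (l, k).\<close>
  have "\<exists>X C. X > 1 \<and> C > 0 \<and> (\<forall>x D E U V M. X \<le> x \<and> D > 1 / 2 \<and> E > 1 / 2 \<and> U > 1 / 2 \<and> V > 1 / 2 \<and>
      D ^ k * U ^ l = x \<and> E ^ k * V ^ l = x \<and> U * V \<le> c * x \<and>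
      c1 * ln x \<le> ln (D * E) \<and> ln (D * E) \<le> c2 * ln x \<and> c1 * ln x \<le> ln (U * V) \<and> ln (U * V) \<le> c2 * ln x \<and>
      M > 1 \<and> ln M = 9 / 8 * (ln (D * E) * ln (U * V) / ln x) \<longrightarrow>
      real (card (solutions k l h D E U V)) \<le> C * x powr \<epsilon> * (sqrt (D * E * M) + D + E))" if "k \<ge> 1" "l \<ge> 1" for k l
  proof (rule card_solutions_bound[OF that h assms(1-3) c(1)], goal_cases)
    case (1 X C)
    show ?case by (intro exI[of _ X] exI[of _ C] conjI 1(1,2) allI impI, elim conjE, rule 1(3))
  qed
  note bound = this
  obtain X1 C1 where B1: "X1 > 1" "C1 > 0" "\<And>x D E U V M. X1 \<le> x \<and> D > 1 / 2 \<and> E > 1 / 2 \<and> U > 1 / 2 \<and> V > 1 / 2 \<and>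
      D ^ k * U ^ l = x \<and> E ^ k * V ^ l = x \<and> U * V \<le> c * x \<and>
      c1 * ln x \<le> ln (D * E) \<and> ln (D * E) \<le> c2 * ln x \<and> c1 * ln x \<le> ln (U * V) \<and> ln (U * V) \<le> c2 * ln x \<and>
      M > 1 \<and> ln M = 9 / 8 * (ln (D * E) * ln (U * V) / ln x) \<Longrightarrow>
      real (card (solutions k l h D E U V)) \<le> C1 * x powr \<epsilon> * (sqrt (D * E * M) + D + E)"
    using bound[OF k(1) l] by blast
  obtain X2 C2 where B2: "X2 > 1" "C2 > 0" "\<And>x D E U V M. X2 \<le> x \<and> D > 1 / 2 \<and> E > 1 / 2 \<and> U > 1 / 2 \<and> V > 1 / 2 \<and>
      D ^ l * U ^ k = x \<and> E ^ l * V ^ k = x \<and> U * V \<le> c * x \<and>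
      c1 * ln x \<le> ln (D * E) \<and> ln (D * E) \<le> c2 * ln x \<and> c1 * ln x \<le> ln (U * V) \<and> ln (U * V) \<le> c2 * ln x \<and>
      M > 1 \<and> ln M = 9 / 8 * (ln (D * E) * ln (U * V) / ln x) \<Longrightarrow>
      real (card (solutions l k h D E U V)) \<le> C2 * x powr \<epsilon> * (sqrt (D * E * M) + D + E)"
    using bound[OF l k(1)] by blast
  define K where "K = nat \<lfloor>(2 * (\<bar>of_int h\<bar> * 2 ^ l * c) + 1) * (2 * \<bar>of_int h\<bar> + 1)\<rfloor>"
  define X where "X = max X1 X2"
  \<comment> \<open>The last term covers x < X: there D E <= x < X, and the trivial count is at most
    4 K X. This is why the threshold x0 = 1 works.\<close>
  define C where "C = C1 + C2 + 4 * real K * X"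
  have X: "X > 1" "X1 \<le> X" "X2 \<le> X" using B1(1) by (auto simp: X_def)
  have "4 * real K * X \<ge> 0" using X(1) by simp
  hence C: "C > 0" "C1 \<le> C" "C2 \<le> C" "4 * real K * X \<le> C" using B1(2) B2(2) unfolding C_def by linarith+
  show "\<exists>C > 0. \<forall>(x :: real) (D :: real) (E :: real) (U :: real) (V :: real) (M :: real).
              x > 1 \<and> D > 1 \<and> E > 1 \<and> x \<ge> 1 \<and>
              U = cofactor_size k l x D \<and> V = cofactor_size k l x E \<and>
              M > 1 \<and> ln M = 9 / 8 * (ln (D * E) * ln (U * V) / ln x) \<and>
              c1 * ln x \<le> ln (D * E) \<and> ln (D * E) \<le> c2 * ln x \<and>
              c1 * ln x \<le> ln (U * V) \<and> ln (U * V) \<le> c2 * ln x \<and>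
              (l \<ge> 2 \<or> D * E \<ge> c3 k l h * x powr (1 / real k)) \<longrightarrow>
              real (solution_count k l h x D E)
                \<le> C * x powr \<epsilon> * min (sqrt (D * E * M) + D + E) (sqrt (U * V * M) + U + V)"
  proof (intro exI[of _ C] conjI allI impI C(1))
    fix x D E U V M :: real
    assume hyp: "x > 1 \<and> D > 1 \<and> E > 1 \<and> x \<ge> 1 \<and>
              U = cofactor_size k l x D \<and> V = cofactor_size k l x E \<and>
              M > 1 \<and> ln M = 9 / 8 * (ln (D * E) * ln (U * V) / ln x) \<and>
              c1 * ln x \<le> ln (D * E) \<and> ln (D * E) \<le> c2 * ln x \<and>
              c1 * ln x \<le> ln (U * V) \<and> ln (U * V) \<le> c2 * ln x \<and>
              (l \<ge> 2 \<or> D * E \<ge> c3 k l h * x powr (1 / real k))"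
    hence x1: "x > 1" and DE: "D > 1" "E > 1" and UV: "U = cofactor_size k l x D" "V = cofactor_size k l x E"
      and M: "M > 1" "ln M = 9 / 8 * (ln (D * E) * ln (U * V) / ln x)"
      and c12: "c1 * ln x \<le> ln (D * E)" "ln (D * E) \<le> c2 * ln x" "c1 * ln x \<le> ln (U * V)" "ln (U * V) \<le> c2 * ln x"
      and cond: "l \<ge> 2 \<or> D * E \<ge> c3 k l h * x powr (1 / real k)" by blast+
    have pos: "D > 0" "E > 0" "U > 0" "V > 0" using DE UV x1 cofactor_size_pos by auto
    have xe: "D ^ k * U ^ l = x" "E ^ k * V ^ l = x" unfolding UV using power_mult_cofactor_size l x1 pos by auto
    have count: "solution_count k l h x D E = card (solutions k l h D E U V)"
      unfolding solution_count_def UV using x1 pos by (subst solution_set_eq_solutions) auto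
    have "c1 * ln x > 0" using assms(2) x1 by simp
    hence "ln (D * E) > 0" "ln (U * V) > 0" using c12 by linarith+
    moreover have p2: "D * E > 0" "U * V > 0" using pos by auto
    ultimately have ge1: "D * E > 1" "U * V > 1" by simp_all
    have prod: "(D * E) ^ k * (U * V) ^ l = x ^ 2"
    proof -
      have "(D * E) ^ k * (U * V) ^ l = (D ^ k * U ^ l) * (E ^ k * V ^ l)" by (simp only: power_mult_distrib mult_ac)
      thus ?thesis unfolding xe by (simp only: power2_eq_square)
    qed
    have DEx: "D * E \<le> x" by (rule le_of_power_mult_eq_square[OF _ _ k(2) prod]) (use ge1 x1 in linarith)+
    have UVx: "U * V \<le> c * x"
    proof (cases "l \<ge> 2")
      case True
      have e: "(U * V) ^ l * (D * E) ^ k = x ^ 2" using prod by (simp only: mult.commute)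
      have "U * V \<le> x" by (rule le_of_power_mult_eq_square[OF _ _ True e]) (use ge1 x1 in linarith)+
      also have "\<dots> \<le> c * x" using c x1 by simp
      finally show ?thesis .
    next
      case False
      hence l1: "l = 1" using l by simp
      define z where "z = c3 k l h"
      have z: "z > 0" using assms(4) by (simp add: z_def)
      have "z * x powr (1 / real k) \<le> D * E" using cond False by (simp add: z_def)
      hence "(z * x powr (1 / real k)) ^ k \<le> (D * E) ^ k" using z by (intro power_mono) auto
      moreover have "(z * x powr (1 / real k)) ^ k = z ^ k * x" using x1 k by (simp add: power_mult_distrib powr_power)
      ultimately have "z ^ k * x * (U * V) \<le> (D * E) ^ k * (U * V)" using p2 by (intro mult_right_mono) auto
      hence "z ^ k * x * (U * V) \<le> x * x" using prod l1 by (simp add: power2_eq_square)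
      hence "z ^ k * (U * V) \<le> x" using x1 by (simp add: mult_ac)
      hence "U * V \<le> 1 / z ^ k * x" using z by (simp add: field_simps)
      also have "\<dots> \<le> c * x" using c(3) x1 unfolding z_def by (intro mult_right_mono) auto
      finally show ?thesis .
    qed
    define m1 where "m1 = sqrt (D * E * M) + D + E"
    define m2 where "m2 = sqrt (U * V * M) + U + V"
    have m: "m1 \<ge> 1" "m2 \<ge> 1"
    proof -
      have "1 * 1 \<le> D * E * M" "1 * 1 \<le> U * V * M" using ge1 M by (intro mult_mono; simp)+
      hence "sqrt (D * E * M) \<ge> 1" "sqrt (U * V * M) \<ge> 1" by simp_all
      thus "m1 \<ge> 1" "m2 \<ge> 1" using pos unfolding m1_def m2_def by linarith+
    qed
    have xp: "x powr \<epsilon> \<ge> 1" using x1 assms(1) by (intro ge_one_powr_ge_zero) auto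
    have "real (card (solutions k l h D E U V)) \<le> C * x powr \<epsilon> * min m1 m2"
    proof (cases "U \<le> 1 / 2 \<or> V \<le> 1 / 2")
      case True
      have "0 \<le> C * x powr \<epsilon> * min m1 m2" using C m xp by simp
      thus ?thesis using solutions_empty[OF True pos(3,4)] by simp
    next
      case False
      hence half: "U > 1 / 2" "V > 1 / 2" by auto
      have xe': "U ^ l * D ^ k = x" "V ^ l * E ^ k = x" using xe by (simp_all only: mult.commute)
      have lnM: "ln M = 9 / 8 * (ln (U * V) * ln (D * E) / ln x)" using M(2) by (simp only: mult.commute)
      show ?thesis
      proof (cases "X \<le> x")
        case True
        have 1: "real (card (solutions k l h D E U V)) \<le> C1 * x powr \<epsilon> * m1"
          unfolding m1_def using half True X DE xe UVx c12 M by (intro B1(3) conjI; (assumption | linarith))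
        have "D * E \<le> c * x"
        proof -
          have "1 * x \<le> c * x" using c(2) x1 by (intro mult_right_mono) auto
          thus ?thesis using DEx by simp
        qed
        hence "real (card (solutions l k h U V D E)) \<le> C2 * x powr \<epsilon> * m2"
          unfolding m2_def using half True X DE xe' c12 M(1) lnM by (intro B2(3) conjI; (assumption | linarith))
        hence 2: "real (card (solutions k l h D E U V)) \<le> C2 * x powr \<epsilon> * m2" by (simp only: card_solutions_swap[of k l])
        have "C1 * x powr \<epsilon> * m1 \<le> C * x powr \<epsilon> * m1" "C2 * x powr \<epsilon> * m2 \<le> C * x powr \<epsilon> * m2"
          using C m xp by (intro mult_right_mono; simp)+
        with 1 2 show ?thesis by (simp add: min_def)
      next
        case small: False
        have "real (card (solutions k l h D E U V)) \<le> 4 * real K * (D * E)"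
          unfolding K_def by (rule card_solutions_le_pairs[OF pos fibres_le_solutions(2)[OF k(1) l h pos xe(2) UVx c(1)]])
        also have "\<dots> \<le> 4 * real K * X" using DEx small by (intro mult_left_mono) auto
        also have "\<dots> \<le> C * 1 * 1" using C by simp
        also have "\<dots> \<le> C * x powr \<epsilon> * min m1 m2" using C m xp by (intro mult_mono) auto
        finally show ?thesis .
      qed
    qed
    thus "real (solution_count k l h x D E) \<le> C * x powr \<epsilon> * min (sqrt (D * E * M) + D + E) (sqrt (U * V * M) + U + V)"
      unfolding count m1_def m2_def .
  qed
qed

end
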